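(* (a) Let $\eta>0$ be such that $\sqrt[3]{c\eta}>1000\max(\nu^{-1/2},1)$, and let $k_2=\bigl\lfloor\frac1{10}\sqrt[3]{c\eta\pi/2}\bigr\rfloor$. Then the solution $(\theta,G)$ of the wave perturbation system at $y$-frequency $\eta$ with initial data $\theta_l(0)=\delta_{lk_2}$, $G_l(0)=0$ satisfies, for all $t>2\eta$, \[ \exp\bigl(\sqrt[3]{c\eta}\bigr)\|\theta(0)\|_X\le\|\theta(t)\|_X\le\|\theta(t)\|_X+\|G(t)\|_X\le\exp\bigl(50\sqrt[3]{c\eta}\bigr)\|\theta(0)\|_X, \] and $\theta(t)$ converges in $X$ as $t\to\infty$. (b) For every $\sigma\in\mathbb R$ there exist $C'>0$ and a measurable family of initial data $(\theta_0(\eta))_{\eta\in\mathbb R}\subset X$, with $G_0(\eta)=0$ for all $\eta$, such that $\int_{\mathbb R}\exp(C'|\eta|^{1/3})\|\theta_0(\eta)\|_X^2d\eta<\infty$ and such that the corresponding solutions $\theta(t,\eta)$ (solving for each $\eta$ the wave perturbation system at $y$-frequency $\eta$) converge in $H^sX$ as $t\to\infty$ for every $s<\sigma$, while $\|\theta(t)\|_{H^sX}\to\infty$ as $t\to\infty$ for every $s>\sigma$.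
   Context: Standing assumptions: fix $\nu>0$, $0<c<0.001$, and a continuous $f:[0,\infty)\to\mathbb R$ with $|f(t)|\le \frac{2c}{1+t^2}$. For a real parameter $\eta$ (the frequency in $y$), $l\in\mathbb Z$ and $t\ge0$ put, when $l\pm1\neq0$, \[ c_l^{\pm}(t)=\frac{c\eta}{(l\pm1)^3}\frac{1}{\bigl(1+(\frac{\eta}{l\pm1}-t)^2\bigr)^2},\qquad d_l^{\pm}(t)=\frac{c\eta}{(l\pm1)^3}\frac{1}{1+(\frac{\eta}{l\pm1}-t)^2}, \] and $c_l^\pm=d_l^\pm=0$ if $l\pm1=0$. The wave perturbation system at $y$-frequency $\eta$ is the linear system for complex sequences $(\theta_l(t))_{l\in\mathbb Z\setminus\{0\}}$, $(G_l(t))_{l\in\mathbb Z\setminus\{0\}}$ (with $\theta_0\equiv G_0\equiv0$): \[ \dot\theta_l=c_l^+\theta_{l+1}+c_l^-\theta_{l-1}+d_l^+G_{l+1}+d_l^-G_{l-1}, \] \[ \dot G_l=-\nu\bigl(l^2+(\eta-lt)^2\bigr)G_l+\frac{f(t)}{2c}\,i l\bigl(d_l^+G_{l+1}+d_l^-G_{l-1}+c_l^+\theta_{l+1}+c_l^-\theta_{l-1}\bigr)+\frac{2(\frac{\eta}{l}-t)}{(1+(\frac{\eta}{l}-t)^2)^2}\theta_l+\frac{c_l^+\theta_{l+1}+c_l^-\theta_{l-1}+d_l^+G_{l+1}+d_l^-G_{l-1}}{1+(\frac{\eta}{l}-t)^2}. \] (This is the Fourier representation, in coordinates $(x-ty,y)$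 and at $x$-frequency $l$, $y$-frequency $\eta$, of the Boussinesq equations without thermal diffusion linearized around the wave $\omega_*=-1+f(t)\cos(x-ty)$, $\theta_*=2c\nu\sin(x-ty)$.) The space $X$: fix a weight $\lambda:\mathbb Z\to(0,\infty)$ with $\sup_{l}\lambda(l\pm1)/\lambda(l)<2$; $X$ is the Hilbert space of sequences $u=(u_l)$ with $\|u\|_X^2=\sum_l\lambda(l)^2|u_l|^2<\infty$. For a family $u=(u(\eta))_{\eta\in\mathbb R}\subset X$, $\|u\|_{H^sX}^2=\int_{\mathbb R}(1+|\eta|^2)^s\|u(\eta)\|_X^2\,d\eta$. *)

theory Defs
  imports "HOL-Analysis.Analysis"
begin

text \<open>Coefficients c_l^{+-}(t), d_l^{+-}(t); the argument m stands for l+1 or l-1.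
  They vanish when m = 0.\<close>

definition ccoef :: "real \<Rightarrow> real \<Rightarrow> int \<Rightarrow> real \<Rightarrow> real" where
  "ccoef c eta m t = (if m = 0 then 0 else
     c * eta / (real_of_int m) ^ 3 / (1 + (eta / real_of_int m - t)\<^sup>2)\<^sup>2)"

definition dcoef :: "real \<Rightarrow> real \<Rightarrow> int \<Rightarrow> real \<Rightarrow> real" where
  "dcoef c eta m t = (if m = 0 then 0 else
     c * eta / (real_of_int m) ^ 3 / (1 + (eta / real_of_int m - t)\<^sup>2))"

definition coupling :: "real \<Rightarrow> real \<Rightarrow> (int \<Rightarrow> complex) \<Rightarrow> (int \<Rightarrow> complex) \<Rightarrow> int \<Rightarrow> real \<Rightarrow> complex" where
  "coupling c eta th G l t =
     of_real (ccoef c eta (l + 1) t) * th (l + 1) + of_real (ccoef c eta (l - 1) t) * th (l - 1)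
   + of_real (dcoef c eta (l + 1) t) * G (l + 1) + of_real (dcoef c eta (l - 1) t) * G (l - 1)"

definition G_rhs :: "real \<Rightarrow> real \<Rightarrow> (real \<Rightarrow> real) \<Rightarrow> real \<Rightarrow> (int \<Rightarrow> complex) \<Rightarrow> (int \<Rightarrow> complex) \<Rightarrow> int \<Rightarrow> real \<Rightarrow> complex" where
  "G_rhs nu c f eta th G l t =
     - of_real (nu * ((real_of_int l)\<^sup>2 + (eta - real_of_int l * t)\<^sup>2)) * G l
   + of_real (f t / (2 * c)) * \<i> * of_int l * coupling c eta th G l t
   + of_real (2 * (eta / real_of_int l - t) / (1 + (eta / real_of_int l - t)\<^sup>2)\<^sup>2) * th l
   + coupling c eta th G l t / of_real (1 + (eta / real_of_int l - t)\<^sup>2)"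

definition in_X :: "(int \<Rightarrow> real) \<Rightarrow> (int \<Rightarrow> complex) \<Rightarrow> bool" where
  "in_X lam u \<longleftrightarrow> (\<lambda>l. (lam l * cmod (u l))\<^sup>2) summable_on UNIV"

definition Xnorm :: "(int \<Rightarrow> real) \<Rightarrow> (int \<Rightarrow> complex) \<Rightarrow> real" where
  "Xnorm lam u = sqrt (\<Sum>\<^sub>\<infinity>l. (lam l * cmod (u l))\<^sup>2)"

definition wave_ivp ::
  "real \<Rightarrow> real \<Rightarrow> (real \<Rightarrow> real) \<Rightarrow> (int \<Rightarrow> real) \<Rightarrow> real \<Rightarrow>
   (int \<Rightarrow> complex) \<Rightarrow> (int \<Rightarrow> complex) \<Rightarrow>
   (real \<Rightarrow> int \<Rightarrow> complex) \<Rightarrow> (real \<Rightarrow> int \<Rightarrow> complex) \<Rightarrow> bool" where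
  "wave_ivp nu c f lam eta th0 G0 th G \<longleftrightarrow>
     th 0 = th0 \<and> G 0 = G0 \<and>
     (\<forall>t\<ge>0. th t 0 = 0 \<and> G t 0 = 0 \<and> in_X lam (th t) \<and> in_X lam (G t)) \<and>
     (\<forall>s\<ge>0. ((\<lambda>t. Xnorm lam (\<lambda>l. th t l - th s l)) \<longlongrightarrow> 0) (at s within {0..}) \<and>
            ((\<lambda>t. Xnorm lam (\<lambda>l. G t l - G s l)) \<longlongrightarrow> 0) (at s within {0..})) \<and>
     (\<forall>l. l \<noteq> 0 \<longrightarrow> (\<forall>t\<ge>0.
        ((\<lambda>s. th s l) has_vector_derivative coupling c eta (th t) (G t) l t) (at t within {0..}) \<and>
        ((\<lambda>s. G s l) has_vector_derivative G_rhs nu c f eta (th t) (G t) l t) (at t within {0..})))"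

definition X_convergent :: "(int \<Rightarrow> real) \<Rightarrow> (real \<Rightarrow> int \<Rightarrow> complex) \<Rightarrow> bool" where
  "X_convergent lam u \<longleftrightarrow>
     (\<exists>L. in_X lam L \<and> ((\<lambda>t. Xnorm lam (\<lambda>l. u t l - L l)) \<longlongrightarrow> 0) at_top)"

definition HsX_sq :: "(int \<Rightarrow> real) \<Rightarrow> real \<Rightarrow> (real \<Rightarrow> int \<Rightarrow> complex) \<Rightarrow> ennreal" where
  "HsX_sq lam s u = (\<integral>\<^sup>+ eta. ennreal ((1 + eta\<^sup>2) powr s * (Xnorm lam (u eta))\<^sup>2) \<partial>lborel)"

definition HsX_convergent :: "(int \<Rightarrow> real) \<Rightarrow> real \<Rightarrow> (real \<Rightarrow> real \<Rightarrow> int \<Rightarrow> complex) \<Rightarrow> bool" where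
  "HsX_convergent lam s u \<longleftrightarrow>
     (\<exists>L. (\<forall>l. (\<lambda>eta. L eta l) \<in> borel_measurable lborel) \<and> (\<forall>eta. in_X lam (L eta)) \<and>
          HsX_sq lam s L < \<infinity> \<and>
          ((\<lambda>t. HsX_sq lam s (\<lambda>eta l. u t eta l - L eta l)) \<longlongrightarrow> 0) at_top)"

end

theory Submission
  imports Defs "HOL-Real_Asymp.Real_Asymp"
begin

text \<open>Put \<open>w\<^sub>l = 1 / (1 + (\<eta> / l - t)\<^sup>2)\<close> and \<open>H\<^sub>l = G\<^sub>l - w\<^sub>l \<theta>\<^sub>l\<close>. The coupling of mode \<open>l\<close> to its
  neighbours is then concentrated near the resonant time \<open>t = \<eta> / l\<close>, where \<open>H\<^sub>l\<close> can cancel only part of the action of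
  \<open>\<theta>\<^sub>l\<close>. Starting from mode \<open>k\<^sub>2\<close>, the resonances at \<open>\<eta> / k\<close> for \<open>k = k\<^sub>2, k\<^sub>2 - 1, \<dots>, 1\<close> are met one after the
  other, and each of them hands mode \<open>k\<close> over to mode \<open>k - 1\<close> with an amplification between \<open>5/4\<close> and \<open>160\<close> times
  \<open>c \<eta> / k\<^sup>3\<close>, while all other modes stay below a geometrically decaying majorant. By Stirling the product of these
  factors is exponential in \<open>(c \<eta>)\<^sup>1\<^sup>/\<^sup>3\<close>. After the last resonance mode 2 carries a fixed portion of the norm of \<open>\<theta>(t)\<close> and
  of its limit, so dividing the initial data by the limit amplitude and multiplying by \<open>(1 + \<eta>\<^sup>2)\<^bsup>-\<sigma>/2 - 1/4\<^esup>\<close> gives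
  data in a Gevrey class whose limit lies exactly on the borderline of \<open>H\<^sup>\<sigma>\<close>.\<close>

text \<open>Where the constants come from: \<open>K\<close> is about one tenth of the cube root of c
  eta pi / 2, so \<open>b K\<close> = c eta / K^3 is close to 2000 / pi = 636.6, and
  \<open>b k\<close> is at least 636 for every k up to K. Each passage therefore multiplies the
  leading mode by at least 5/4 * 636 = 795, and this gain pays for all losses, so that the same
  smallness conditions hold again at the next resonance. Three obstacles shape the estimates. A
  resonance feeds mode k + 1 exactly as it feeds k - 1, so mode k + 1 has to be controlled through
  the difference of the two. The damping can be arbitrarily weak or strong, so \<open>H\<close> is
  only ever estimated through the identity D w = nu l^2. Before the first useful resonance the
  infinitely many modes l > K pass theirs, some with strength in the hundreds, and the majorant must
  let each of them grow only after its own resonance is over. Sequences decay by the ratio 4 per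
  mode, which leaves a factor 2 to spare against the weight of X; the same reserve explains the
  powers 2^K in the numerical bounds.\<close>

section \<open>Comparison principles for derivatives\<close>

lemma deriv_comparison:
  fixes g :: "real \<Rightarrow> 'a::real_normed_vector"
  assumes ab: "a \<le> b"
    and g: "\<And>x. a \<le> x \<Longrightarrow> x \<le> b \<Longrightarrow> (g has_vector_derivative g' x) (at x within {a..b})"
    and p: "\<And>x. a \<le> x \<Longrightarrow> x \<le> b \<Longrightarrow> (p has_real_derivative p' x) (at x within {a..b})"
    and le: "\<And>x. a \<le> x \<Longrightarrow> x \<le> b \<Longrightarrow> norm (g' x) \<le> p' x"
  shows "norm (g b - g a) \<le> p b - p a"
proof (cases "a = b")
  case False
  then have "a < b" using ab by simp
  then show ?thesis
  proof (rule differentiable_bound_general[where f' = g' and \<phi>' = p'])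
    show "continuous_on {a..b} g"
      using g has_vector_derivative_continuous by (fastforce simp: continuous_on_eq_continuous_within)
    show "continuous_on {a..b} p"
      by (rule DERIV_continuous_on[where D = p']) (use p in auto)
  next
    fix x assume x: "a < x" "x < b"
    then have at: "at x within {a..b} = at x" by (intro at_within_interior) simp
    show "(g has_vector_derivative g' x) (at x)" using g[of x] x unfolding at by simp
    show "(p has_vector_derivative p' x) (at x)" using p[of x] x unfolding at
      by (simp add: has_real_derivative_iff_has_vector_derivative)
    show "norm (g' x) \<le> p' x" using le x by simp
  qed
qed simp

lemma deriv_nonneg_le:
  fixes p :: "real \<Rightarrow> real"
  assumes "a \<le> b" and "\<And>x. a \<le> x \<Longrightarrow> x \<le> b \<Longrightarrow> (p has_real_derivative p' x) (at x within {a..b})"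
    and "\<And>x. a \<le> x \<Longrightarrow> x \<le> b \<Longrightarrow> 0 \<le> p' x"
  shows "p a \<le> p b"
proof -
  have "norm ((\<lambda>_. 0::real) b - (\<lambda>_. 0) a) \<le> p b - p a"
    by (rule deriv_comparison[where g' = "\<lambda>_. 0" and p' = p']) (use assms in auto)
  then show ?thesis by simp
qed

text \<open>With the integrating factor exp(E), the function exp(E) (|y a| + M + p - p a) grows at
  least as fast as exp(E) y. A source of size D M thus costs only M, whatever the size of D; this
  makes the later bounds on \<open>H\<close> independent of nu.\<close>

lemma damped_bound:
  fixes y :: "real \<Rightarrow> 'a::real_normed_vector"
  assumes ab: "a \<le> b"
    and y: "\<And>x. a \<le> x \<Longrightarrow> x \<le> b \<Longrightarrow> (y has_vector_derivative (g x - D x *\<^sub>R y x)) (at x within {a..b})"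
    and E: "\<And>x. a \<le> x \<Longrightarrow> x \<le> b \<Longrightarrow> (E has_real_derivative D x) (at x within {a..b})"
    and D: "\<And>x. a \<le> x \<Longrightarrow> x \<le> b \<Longrightarrow> 0 \<le> D x"
    and p: "\<And>x. a \<le> x \<Longrightarrow> x \<le> b \<Longrightarrow> (p has_real_derivative p' x) (at x within {a..b})"
    and p0: "\<And>x. a \<le> x \<Longrightarrow> x \<le> b \<Longrightarrow> 0 \<le> p' x"
    and g: "\<And>x. a \<le> x \<Longrightarrow> x \<le> b \<Longrightarrow> norm (g x) \<le> D x * M + p' x"
    and M: "0 \<le> M"
  shows "norm (y b) \<le> norm (y a) + M + (p b - p a)"
proof -
  define z where "z = (\<lambda>x. exp (E x) *\<^sub>R y x)"
  define q where "q = (\<lambda>x. exp (E x) * (norm (y a) + M + (p x - p a)))"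
  have pm: "p a \<le> p x" if "a \<le> x" "x \<le> b" for x
    by (rule deriv_nonneg_le[where p = p and p' = p'])
      (use that p0 in \<open>auto intro!: has_field_derivative_subset[OF p]\<close>)
  have "norm (z b - z a) \<le> q b - q a"
  proof (rule deriv_comparison[OF ab])
    fix x assume x: "a \<le> x" "x \<le> b"
    have e: "((\<lambda>x. exp (E x)) has_real_derivative exp (E x) * D x) (at x within {a..b})"
      by (rule derivative_eq_intros E[OF x] refl | simp)+
    show "(z has_vector_derivative exp (E x) *\<^sub>R g x) (at x within {a..b})"
      unfolding z_def
      by (rule has_vector_derivative_eq_rhs[OF has_vector_derivative_scaleR[OF e y[OF x]]])
         (simp add: algebra_simps)
    show "(q has_real_derivative exp (E x) * D x * (norm (y a) + M + (p x - p a)) + exp (E x) * p' x)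
      (at x within {a..b})"
      unfolding q_def by (rule derivative_eq_intros e p[OF x] refl | simp)+
    have "norm (g x) \<le> D x * M + p' x" by (rule g[OF x])
    also have "\<dots> \<le> D x * (norm (y a) + M + (p x - p a)) + p' x"
      using D[OF x] pm[OF x] by (intro add_right_mono mult_left_mono) auto
    finally have "exp (E x) * norm (g x) \<le> exp (E x) * (D x * (norm (y a) + M + (p x - p a)) + p' x)"
      by (rule mult_left_mono) simp
    then show "norm (exp (E x) *\<^sub>R g x) \<le> exp (E x) * D x * (norm (y a) + M + (p x - p a)) + exp (E x) * p' x"
      by (simp only: norm_scaleR abs_exp_cancel distrib_left mult.assoc)
  qed
  then have "norm (z b) \<le> norm (z a) + (q b - q a)"
    by (smt (verit) norm_triangle_sub)
  also have "\<dots> \<le> q b" unfolding z_def q_def using M by simp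
  finally have "exp (E b) * norm (y b) \<le> exp (E b) * (norm (y a) + M + (p b - p a))"
    unfolding z_def q_def by simp
  then show ?thesis by simp
qed

lemma has_vector_derivative_series:
  fixes f :: "nat \<Rightarrow> real \<Rightarrow> complex"
  assumes f: "\<And>n x. x \<in> {a..b} \<Longrightarrow> (f n has_vector_derivative f' n x) (at x within {a..b})"
    and B: "\<And>n x. x \<in> {a..b} \<Longrightarrow> norm (f' n x) \<le> B n" "summable B"
    and s: "\<And>x. x \<in> {a..b} \<Longrightarrow> summable (\<lambda>n. f n x)"
    and x: "x \<in> {a..b}"
  shows "((\<lambda>x. \<Sum>n. f n x) has_vector_derivative (\<Sum>n. f' n x)) (at x within {a..b})"
proof -
  have ul: "uniform_limit {a..b} (\<lambda>n x. \<Sum>i<n. f' i x) (\<lambda>x. \<Sum>i. f' i x) sequentially"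
    by (rule Weierstrass_m_test[OF B])
  have "\<exists>g. \<forall>x\<in>{a..b}. (\<lambda>n. f n x) sums (g x) \<and> (g has_derivative (\<lambda>h. h *\<^sub>R (\<Sum>n. f' n x))) (at x within {a..b})"
  proof (rule has_derivative_series[where f' = "\<lambda>n x h. h *\<^sub>R f' n x"])
    show "\<And>n x. x \<in> {a..b} \<Longrightarrow> (f n has_derivative (\<lambda>h. h *\<^sub>R f' n x)) (at x within {a..b})"
      using f by (simp add: has_vector_derivative_def)
    show "x \<in> {a..b}" "(\<lambda>n. f n x) sums (\<Sum>n. f n x)" using x s by auto
    fix e :: real assume "e > 0"
    with ul have "\<forall>\<^sub>F n in sequentially. \<forall>x\<in>{a..b}. norm ((\<Sum>i<n. f' i x) - (\<Sum>i. f' i x)) < e"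
      by (simp add: uniform_limit_iff dist_norm)
    then show "\<forall>\<^sub>F n in sequentially. \<forall>x\<in>{a..b}. \<forall>h. norm ((\<Sum>i<n. h *\<^sub>R f' i x) - h *\<^sub>R (\<Sum>n. f' n x)) \<le> e * norm h"
    proof eventually_elim
      case (elim n)
      show ?case
      proof (intro ballI allI)
        fix x h assume "x \<in> {a..b}"
        have "norm ((\<Sum>i<n. h *\<^sub>R f' i x) - h *\<^sub>R (\<Sum>n. f' n x)) = \<bar>h\<bar> * norm ((\<Sum>i<n. f' i x) - (\<Sum>i. f' i x))"
          by (simp add: scaleR_sum_right[symmetric] scaleR_diff_right[symmetric])
        also have "\<dots> \<le> \<bar>h\<bar> * e" using elim[rule_format, OF \<open>x \<in> _\<close>] by (intro mult_left_mono) auto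
        finally show "norm ((\<Sum>i<n. h *\<^sub>R f' i x) - h *\<^sub>R (\<Sum>n. f' n x)) \<le> e * norm h" by (simp add: mult.commute)
      qed
    qed
  qed auto
  then obtain g where g: "\<And>x. x\<in>{a..b} \<Longrightarrow> (\<lambda>n. f n x) sums (g x)"
    "\<And>x. x\<in>{a..b} \<Longrightarrow> (g has_vector_derivative (\<Sum>n. f' n x)) (at x within {a..b})"
    unfolding has_vector_derivative_def by blast
  show ?thesis
    by (rule has_vector_derivative_transform[OF x _ g(2)[OF x]]) (metis g(1) sums_unique)
qed

section \<open>Countable linear systems with diagonal damping\<close>

text \<open>The damping may be unbounded in the index, so it is kept out of the matrix and enters
  only through its antiderivative \<open>E\<close>. Continuity is required jointly in the parameter
  and in time because the superposition over frequencies needs solutions that are measurable in the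
  parameter.\<close>

locale lin_sys =
  fixes N :: "'i \<Rightarrow> 'i set" and M :: "'i \<Rightarrow> 'i \<Rightarrow> real \<Rightarrow> real \<Rightarrow> complex"
    and D E :: "'i \<Rightarrow> real \<Rightarrow> real \<Rightarrow> real"
  assumes fin: "finite (N i)"
    and contM: "continuous_on (UNIV \<times> {0..}) (\<lambda>(\<eta>, t). M i j \<eta> t)"
    and contE: "continuous_on (UNIV \<times> {0..}) (\<lambda>(\<eta>, t). E i \<eta> t)"
    and derE: "t \<ge> 0 \<Longrightarrow> (E i \<eta> has_real_derivative D i \<eta> t) (at t within {0..})"
    and D_nonneg: "0 \<le> D i \<eta> t"
begin

definition rhs :: "real \<Rightarrow> ('i \<Rightarrow> complex) \<Rightarrow> 'i \<Rightarrow> real \<Rightarrow> complex" where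
  "rhs \<eta> y i t = (\<Sum>j\<in>N i. M i j \<eta> t * y j)"

definition solution :: "real \<Rightarrow> ('i \<Rightarrow> real \<Rightarrow> complex) \<Rightarrow> bool" where
  "solution \<eta> y \<longleftrightarrow> (\<forall>i. \<forall>t\<ge>0.
     (y i has_vector_derivative (rhs \<eta> (\<lambda>j. y j t) i t - D i \<eta> t *\<^sub>R y i t)) (at t within {0..}))"

text \<open>Boundedness of the matrix by kappa in the sup norm with weight \<open>W\<close>. The
  weight is left open: geometric weights give existence with fast decay in l, and 1 / lam gives
  uniqueness in X.\<close>

definition row_bound :: "real \<Rightarrow> ('i \<Rightarrow> real) \<Rightarrow> real \<Rightarrow> bool" where
  "row_bound \<eta> W \<kappa> \<longleftrightarrow> 0 \<le> \<kappa> \<and> (\<forall>i. 0 \<le> W i) \<and>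
     (\<forall>i. \<forall>t\<ge>0. (\<Sum>j\<in>N i. cmod (M i j \<eta> t) * W j) \<le> \<kappa> * W i)"

lemma rhs_bound:
  assumes "row_bound \<eta> W \<kappa>" "t \<ge> 0" "\<And>j. cmod (y j) \<le> C * W j" "0 \<le> C"
  shows "cmod (rhs \<eta> y i t) \<le> C * \<kappa> * W i"
proof -
  have "cmod (rhs \<eta> y i t) \<le> (\<Sum>j\<in>N i. cmod (M i j \<eta> t) * (C * W j))"
    unfolding rhs_def by (intro order.trans[OF norm_sum] sum_mono) (use assms in \<open>auto simp: norm_mult intro!: mult_left_mono\<close>)
  also have "\<dots> = C * (\<Sum>j\<in>N i. cmod (M i j \<eta> t) * W j)" by (simp add: sum_distrib_left mult_ac)
  also have "\<dots> \<le> C * (\<kappa> * W i)" using assms by (auto simp: row_bound_def intro!: mult_left_mono)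
  finally show ?thesis by (simp add: mult_ac)
qed

text \<open>One Picard step integrates the majorant once and so gains the factor kappa t / (n + 1);
  nonnegative damping does no harm.\<close>

lemma damped_iterate:
  assumes rb: "row_bound \<eta> W \<kappa>" and T: "t \<ge> 0" and C: "C \<ge> 0"
    and y: "\<And>s. 0 \<le> s \<Longrightarrow> s \<le> t \<Longrightarrow> (y has_vector_derivative (rhs \<eta> (\<lambda>j. z j s) i s - D i \<eta> s *\<^sub>R y s)) (at s within {0..})"
    and z: "\<And>j s. 0 \<le> s \<Longrightarrow> s \<le> t \<Longrightarrow> cmod (z j s) \<le> C * (\<kappa> * s) ^ n / fact n * W j"
    and y0: "y 0 = 0"
  shows "cmod (y t) \<le> C * (\<kappa> * t) ^ Suc n / fact (Suc n) * W i"
proof -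
  have "cmod (y t) \<le> cmod (y 0) + 0 + (C * (\<kappa> * t) ^ Suc n / fact (Suc n) * W i - C * (\<kappa> * 0) ^ Suc n / fact (Suc n) * W i)"
  proof (rule damped_bound[OF T, where D = "D i \<eta>" and E = "E i \<eta>" and g = "\<lambda>s. rhs \<eta> (\<lambda>j. z j s) i s"
      and p' = "\<lambda>s. C * (\<kappa> * s) ^ n / fact n * \<kappa> * W i"])
    fix s assume s: "0 \<le> s" "s \<le> t"
    show "(y has_vector_derivative rhs \<eta> (\<lambda>j. z j s) i s - D i \<eta> s *\<^sub>R y s) (at s within {0..t})"
      by (rule has_vector_derivative_within_subset[OF y[OF s]]) auto
    show "(E i \<eta> has_real_derivative D i \<eta> s) (at s within {0..t})"
      by (rule has_field_derivative_subset[OF derE[OF s(1)]]) auto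
    show "((\<lambda>s. C * (\<kappa> * s) ^ Suc n / fact (Suc n) * W i) has_real_derivative C * (\<kappa> * s) ^ n / fact n * \<kappa> * W i) (at s within {0..t})"
      by (rule derivative_eq_intros refl | simp add: divide_simps del: power_Suc)+
    have nn: "0 \<le> C * (\<kappa> * s) ^ n / fact n" using rb C s by (auto simp: row_bound_def)
    show "0 \<le> C * (\<kappa> * s) ^ n / fact n * \<kappa> * W i" using nn rb by (intro mult_nonneg_nonneg) (auto simp: row_bound_def)
    show "cmod (rhs \<eta> (\<lambda>j. z j s) i s) \<le> D i \<eta> s * 0 + C * (\<kappa> * s) ^ n / fact n * \<kappa> * W i"
      using rhs_bound[OF rb s(1), of "\<lambda>j. z j s" "C * (\<kappa> * s) ^ n / fact n" i] z[OF s] nn by simp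
  qed (use D_nonneg in auto)
  then show ?thesis using y0 by simp
qed

text \<open>Inserting a solution into its own equation n times bounds it by (kappa t)^n / n!, which
  tends to 0.\<close>

lemma solution_zero:
  assumes rb: "row_bound \<eta> W \<kappa>" and sol: "solution \<eta> y" and y0: "\<And>i. y i 0 = 0"
    and bd: "\<And>i t. 0 \<le> t \<Longrightarrow> t \<le> T \<Longrightarrow> cmod (y i t) \<le> C * W i" and t: "0 \<le> t" "t \<le> T"
  shows "y i t = 0"
proof -
  have C: "cmod (y i t) \<le> max C 0 * W i" if "0 \<le> t" "t \<le> T" for i t
    by (rule order.trans[OF bd[OF that]], rule mult_right_mono) (use rb in \<open>auto simp: row_bound_def\<close>)
  have "cmod (y i t) \<le> max C 0 * (\<kappa> * t) ^ n / fact n * W i" if "0 \<le> t" "t \<le> T" for i t n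
    using that
  proof (induction n arbitrary: i t)
    case (Suc n)
    show ?case
      by (rule damped_iterate[OF rb, where z = y]) (use Suc sol y0 in \<open>auto simp: solution_def\<close>)
  qed (use C in auto)
  note bound = this[OF t]
  have "(\<lambda>n. max C 0 * W i * ((\<kappa> * t) ^ n / fact n)) \<longlonglongrightarrow> max C 0 * W i * 0"
    using summable_LIMSEQ_zero[OF summable_exp[of "\<kappa> * t"]]
    by (intro tendsto_mult_left) (simp add: field_simps)
  moreover have "cmod (y i t) \<le> max C 0 * W i * ((\<kappa> * t) ^ n / fact n)" for n using bound[of i n] by (simp add: mult_ac)
  ultimately have "cmod (y i t) \<le> max C 0 * W i * 0" by (intro LIMSEQ_le_const) auto
  then show ?thesis by simp
qed

text \<open>Increments of the Duhamel iteration: iterate 0 is the damped free evolution, and the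
  solution is the sum of all iterates. The integral over [0, t] is rescaled to the fixed interval
  [0, 1], so that continuity of parameter integrals yields joint continuity in (eta, t) by
  induction.\<close>

primrec pic :: "('i \<Rightarrow> complex) \<Rightarrow> nat \<Rightarrow> 'i \<Rightarrow> real \<Rightarrow> real \<Rightarrow> complex" where
  "pic y0 0 i \<eta> t = exp (E i \<eta> 0 - E i \<eta> t) *\<^sub>R y0 i"
| "pic y0 (Suc n) i \<eta> t = exp (- E i \<eta> t) *\<^sub>R
     (t *\<^sub>R integral (cbox 0 1) (\<lambda>u. exp (E i \<eta> (t * u)) *\<^sub>R rhs \<eta> (\<lambda>j. pic y0 n j \<eta> (t * u)) i (t * u)))"

lemma continuous_comp2:
  fixes p q :: "'c::topological_space \<Rightarrow> real" and g :: "real \<Rightarrow> real \<Rightarrow> 'b::topological_space"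
  assumes "continuous_on (UNIV \<times> {0..}) (\<lambda>(\<eta>, t). g \<eta> t)" "continuous_on S p" "continuous_on S q"
    "\<And>x. x \<in> S \<Longrightarrow> q x \<ge> 0"
  shows "continuous_on S (\<lambda>x. g (p x) (q x))"
  using continuous_on_compose2[OF assms(1), of S "\<lambda>x. (p x, q x)"] assms(2-)
  by (auto intro!: continuous_intros)

lemma continuous_pic: "continuous_on (UNIV \<times> {0..}) (\<lambda>(\<eta>, t). pic y0 n i \<eta> t)"
proof (induction n arbitrary: i)
  case 0
  show ?case unfolding pic.simps split_beta
    by (intro continuous_intros continuous_comp2[OF contE]) auto
next
  case (Suc n)
  have "continuous_on ((UNIV \<times> {0..}) \<times> cbox 0 1) (\<lambda>(x, u). exp (E i (fst x) (snd x * u)) *\<^sub>R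
      rhs (fst x) (\<lambda>j. pic y0 n j (fst x) (snd x * u)) i (snd x * u))"
    unfolding split_beta rhs_def
    by (intro continuous_intros continuous_comp2[OF contE] continuous_comp2[OF contM] continuous_comp2[OF Suc])
       (auto intro!: mult_nonneg_nonneg)
  from integral_continuous_on_param[OF this] show ?case
    unfolding pic.simps split_beta
    by (intro continuous_intros continuous_comp2[OF contE]) auto
qed

lemma continuous_rhs_pic: "continuous_on {0..} (\<lambda>s. exp (E i \<eta> s) *\<^sub>R rhs \<eta> (\<lambda>j. pic y0 n j \<eta> s) i s)"
  unfolding rhs_def
  by (intro continuous_intros continuous_comp2[OF contE] continuous_comp2[OF contM] continuous_comp2[OF continuous_pic]) auto

lemma pic_Suc_integral:
  assumes "t \<ge> 0"
  shows "pic y0 (Suc n) i \<eta> t = exp (- E i \<eta> t) *\<^sub>R integral {0..t} (\<lambda>s. exp (E i \<eta> s) *\<^sub>R rhs \<eta> (\<lambda>j. pic y0 n j \<eta> s) i s)"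
proof -
  let ?g = "\<lambda>s. exp (E i \<eta> s) *\<^sub>R rhs \<eta> (\<lambda>j. pic y0 n j \<eta> s) i s"
  have "((\<lambda>u. t *\<^sub>R ?g (t * u)) has_integral (integral {t * 0..t * 1} ?g)) {0..1}"
  proof (rule has_integral_substitution[where c = 0 and d = t])
    show "continuous_on {0..t} ?g" by (rule continuous_on_subset[OF continuous_rhs_pic]) auto
    show "((*) t has_real_derivative t) (at x within {0..1})" for x
      by (rule derivative_eq_intros refl | simp)+
  qed (use assms in \<open>auto simp: mult_left_le\<close>)
  then have "integral {0..t} ?g = t *\<^sub>R integral {0..1} (\<lambda>u. ?g (t * u))"
    by (simp only: mult_zero_right mult_1_right integral_unique[symmetric] integral_cmul[symmetric])
  then show ?thesis by simp
qed

lemma deriv_pic_int: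
  assumes "0 \<le> t" "t \<le> T"
  shows "((\<lambda>t. exp (E i \<eta> t) *\<^sub>R pic y0 (Suc n) i \<eta> t) has_vector_derivative exp (E i \<eta> t) *\<^sub>R rhs \<eta> (\<lambda>j. pic y0 n j \<eta> t) i t) (at t within {0..T})"
proof -
  let ?g = "\<lambda>s. exp (E i \<eta> s) *\<^sub>R rhs \<eta> (\<lambda>j. pic y0 n j \<eta> s) i s"
  have "((\<lambda>u. integral {0..u} ?g) has_vector_derivative ?g t) (at t within {0..T})"
    by (rule integral_has_vector_derivative) (use assms in \<open>auto intro: continuous_on_subset[OF continuous_rhs_pic]\<close>)
  then show ?thesis
  proof (rule has_vector_derivative_transform[rotated 2])
    show "t \<in> {0..T}" using assms by auto
    fix x assume "x \<in> {0..T}"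
    then show "exp (E i \<eta> x) *\<^sub>R pic y0 (Suc n) i \<eta> x = integral {0..x} ?g"
      using pic_Suc_integral[of x y0 n i \<eta>] by (simp add: exp_minus del: pic.simps)
  qed
qed

lemma within_atMost_iff:
  fixes y :: "real \<Rightarrow> 'b::real_normed_vector"
  assumes "0 \<le> t" "t < T" "(y has_vector_derivative d) (at t within {0..T})"
  shows "(y has_vector_derivative d) (at t within {0..})"
proof -
  have "at t within {0..T} = at t within {0..}"
    by (rule at_within_nhd[where S = "{..<T}"]) (use assms in auto)
  then show ?thesis using assms by simp
qed

lemma deriv_undamp:
  fixes y :: "real \<Rightarrow> complex"
  assumes t: "0 \<le> t" "t < T" and z: "((\<lambda>t. exp (E i \<eta> t) *\<^sub>R y t) has_vector_derivative exp (E i \<eta> t) *\<^sub>R r) (at t within {0..T})"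
  shows "(y has_vector_derivative r - D i \<eta> t *\<^sub>R y t) (at t within {0..})"
proof -
  have E: "(E i \<eta> has_real_derivative D i \<eta> t) (at t within {0..T})"
    by (rule has_field_derivative_subset[OF derE[OF t(1)]]) auto
  have e: "((\<lambda>t. exp (- E i \<eta> t)) has_real_derivative - exp (- E i \<eta> t) * D i \<eta> t) (at t within {0..T})"
    by (rule derivative_eq_intros E refl | simp)+
  have "((\<lambda>t. exp (- E i \<eta> t) *\<^sub>R (exp (E i \<eta> t) *\<^sub>R y t)) has_vector_derivative r - D i \<eta> t *\<^sub>R y t) (at t within {0..T})"
    by (rule has_vector_derivative_eq_rhs[OF has_vector_derivative_scaleR[OF e z]])
       (simp add: exp_minus algebra_simps)
  then have "(y has_vector_derivative r - D i \<eta> t *\<^sub>R y t) (at t within {0..T})"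
    by (simp add: exp_minus)
  then show ?thesis by (rule within_atMost_iff[OF t])
qed

lemma deriv_pic_Suc:
  assumes t: "0 \<le> t"
  shows "(pic y0 (Suc n) i \<eta> has_vector_derivative rhs \<eta> (\<lambda>j. pic y0 n j \<eta> t) i t - D i \<eta> t *\<^sub>R pic y0 (Suc n) i \<eta> t) (at t within {0..})"
  by (rule deriv_undamp[where T = "t + 1"]) (use t deriv_pic_int[of t "t + 1"] in auto)

lemma E_mono: assumes "0 \<le> s" "s \<le> t" shows "E i \<eta> s \<le> E i \<eta> t"
  by (rule deriv_nonneg_le[where p = "E i \<eta>" and p' = "D i \<eta>"]) (use assms D_nonneg in \<open>auto intro: has_field_derivative_subset[OF derE]\<close>)

lemma pic_bound:
  assumes rb: "row_bound \<eta> W \<kappa>" and y0: "\<And>i. cmod (y0 i) \<le> C * W i" and C: "C \<ge> 0" and t: "0 \<le> t"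
  shows "cmod (pic y0 n i \<eta> t) \<le> C * (\<kappa> * t) ^ n / fact n * W i"
  using t
proof (induction n arbitrary: i t)
  case 0
  have "exp (E i \<eta> 0 - E i \<eta> t) \<le> 1" using E_mono[of 0 t i \<eta>] 0 by simp
  then have "exp (E i \<eta> 0 - E i \<eta> t) * cmod (y0 i) \<le> 1 * cmod (y0 i)" by (intro mult_right_mono) auto
  then show ?case using y0[of i] by simp
next
  case (Suc n)
  show ?case
    by (rule damped_iterate[OF rb, where z = "\<lambda>j. pic y0 n j \<eta>"]) (use Suc C deriv_pic_Suc in \<open>auto simp del: pic.simps(2) simp: pic_Suc_integral\<close>)
qed

definition sol :: "('i \<Rightarrow> complex) \<Rightarrow> 'i \<Rightarrow> real \<Rightarrow> real \<Rightarrow> complex" where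
  "sol y0 i \<eta> t = (\<Sum>n. pic y0 n i \<eta> t)"

lemma summable_pic_bound: "summable (\<lambda>n. C * (x::real) ^ n / fact n * W)"
  using summable_mult[OF summable_exp[of x], of "C * W"] by (simp add: field_simps)

lemma measurable_sol: "t \<ge> 0 \<Longrightarrow> (\<lambda>\<eta>. sol y0 i \<eta> t) \<in> borel_measurable lborel"
  unfolding sol_def
  by (intro borel_measurable_suminf) (auto intro!: borel_measurable_continuous_onI continuous_comp2[OF continuous_pic] continuous_intros)

context
  fixes \<eta> W \<kappa> y0 C
  assumes rb: "row_bound \<eta> W \<kappa>" and y0: "\<And>i. cmod (y0 i) \<le> C * W i" and C: "C \<ge> 0"
begin

lemma summable_pic: "0 \<le> t \<Longrightarrow> summable (\<lambda>n. pic y0 n i \<eta> t)"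
  by (rule summable_comparison_test'[OF summable_pic_bound pic_bound[OF rb y0 C]])

lemma sol_bound: assumes "0 \<le> t" shows "cmod (sol y0 i \<eta> t) \<le> C * exp (\<kappa> * t) * W i"
proof -
  have "cmod (sol y0 i \<eta> t) \<le> (\<Sum>n. C * (\<kappa> * t) ^ n / fact n * W i)"
    unfolding sol_def by (rule norm_suminf_le[OF pic_bound[OF rb y0 C assms] summable_pic_bound])
  also have "\<dots> = (\<Sum>n. (C * W i) * ((\<kappa> * t) ^ n /\<^sub>R fact n))" by (simp add: field_simps)
  also have "\<dots> = (C * W i) * exp (\<kappa> * t)"
    unfolding exp_def by (rule suminf_mult) (rule summable_exp_generic)
  finally show ?thesis by (simp add: mult_ac)
qed

lemma sol_initial: "sol y0 i \<eta> 0 = y0 i"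
proof -
  have "(\<lambda>n. pic y0 n i \<eta> 0) = (\<lambda>n. if n = 0 then y0 i else 0)"
  proof
    fix n show "pic y0 n i \<eta> 0 = (if n = 0 then y0 i else 0)" by (cases n) auto
  qed
  then show ?thesis using sums_If_finite_set[of "{0}" "\<lambda>_. y0 i"] by (simp add: sol_def sums_iff)
qed

lemma solution_sol: "solution \<eta> (\<lambda>i. sol y0 i \<eta>)"
  unfolding solution_def
proof (intro allI impI)
  fix i and t :: real assume t: "0 \<le> t"
  define T where "T = t + 1"
  let ?e = "\<lambda>x. exp (E i \<eta> x)"
  \<comment> \<open>Multiplication by exp(E) removes the damping from each summand: iterate 0
    becomes constant, which explains the derivative 0 there, and the derivative of iterate m + 1 is
    given by iterate m. The factorials then make the differentiated series uniformly
    convergent.\<close>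
  have "((\<lambda>x. \<Sum>n. ?e x *\<^sub>R pic y0 n i \<eta> x) has_vector_derivative
     (\<Sum>n. ?e t *\<^sub>R (case n of 0 \<Rightarrow> 0 | Suc m \<Rightarrow> rhs \<eta> (\<lambda>j. pic y0 m j \<eta> t) i t))) (at t within {0..T})"
  proof (rule has_vector_derivative_series[where B = "\<lambda>n. case n of 0 \<Rightarrow> 0 | Suc m \<Rightarrow> C * (\<kappa> * T) ^ m / fact m * (?e T * \<kappa> * W i)"])
    fix n x assume x: "x \<in> {0..T}"
    show "((\<lambda>x. ?e x *\<^sub>R pic y0 n i \<eta> x) has_vector_derivative ?e x *\<^sub>R (case n of 0 \<Rightarrow> 0 | Suc m \<Rightarrow> rhs \<eta> (\<lambda>j. pic y0 m j \<eta> x) i x)) (at x within {0..T})"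
    proof (cases n)
      case 0
      then show ?thesis by (simp add: exp_diff)
    next
      case (Suc m)
      then show ?thesis using deriv_pic_int[of x T i \<eta> y0 m] x by (simp del: pic.simps)
    qed
    show "norm (?e x *\<^sub>R (case n of 0 \<Rightarrow> 0 | Suc m \<Rightarrow> rhs \<eta> (\<lambda>j. pic y0 m j \<eta> x) i x)) \<le>
       (case n of 0 \<Rightarrow> 0 | Suc m \<Rightarrow> C * (\<kappa> * T) ^ m / fact m * (?e T * \<kappa> * W i))"
    proof (cases n)
      case (Suc m)
      have xT: "0 \<le> x" "x \<le> T" using x by auto
      have nn: "0 \<le> C * (\<kappa> * x) ^ m / fact m" using C rb xT by (auto simp: row_bound_def)
      have pw: "C * (\<kappa> * x) ^ m / fact m \<le> C * (\<kappa> * T) ^ m / fact m"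
        using C rb xT by (intro divide_right_mono mult_left_mono power_mono) (auto simp: row_bound_def)
      have "cmod (rhs \<eta> (\<lambda>j. pic y0 m j \<eta> x) i x) \<le> C * (\<kappa> * x) ^ m / fact m * \<kappa> * W i"
        by (rule rhs_bound[OF rb xT(1) _ nn]) (use pic_bound[OF rb y0 C xT(1)] in auto)
      also have "\<dots> \<le> C * (\<kappa> * T) ^ m / fact m * \<kappa> * W i"
        using pw rb by (intro mult_right_mono) (auto simp: row_bound_def)
      finally have "?e x * cmod (rhs \<eta> (\<lambda>j. pic y0 m j \<eta> x) i x) \<le> ?e T * (C * (\<kappa> * T) ^ m / fact m * \<kappa> * W i)"
        using E_mono[OF xT, of i \<eta>] by (intro mult_mono) auto
      then show ?thesis using Suc by (simp add: mult_ac)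
    qed simp
  next
    show "summable (\<lambda>n. case n of 0 \<Rightarrow> 0 | Suc m \<Rightarrow> C * (\<kappa> * T) ^ m / fact m * (?e T * \<kappa> * W i))"
      using summable_pic_bound[of C "\<kappa> * T" "?e T * \<kappa> * W i"] by (subst summable_Suc_iff[symmetric]) simp
  qed (use t summable_pic in \<open>auto simp: T_def intro!: summable_scaleR_right\<close>)
  moreover have "(\<Sum>n. ?e t *\<^sub>R (case n of 0 \<Rightarrow> 0 | Suc m \<Rightarrow> rhs \<eta> (\<lambda>j. pic y0 m j \<eta> t) i t)) = ?e t *\<^sub>R rhs \<eta> (\<lambda>j. sol y0 j \<eta> t) i t"
  proof -
    have s: "(\<lambda>m. rhs \<eta> (\<lambda>j. pic y0 m j \<eta> t) i t) sums rhs \<eta> (\<lambda>j. sol y0 j \<eta> t) i t"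
      unfolding rhs_def sol_def by (intro sums_sum sums_mult summable_sums summable_pic t)
    then have "(\<lambda>n. case n of 0 \<Rightarrow> 0 | Suc m \<Rightarrow> rhs \<eta> (\<lambda>j. pic y0 m j \<eta> t) i t) sums rhs \<eta> (\<lambda>j. sol y0 j \<eta> t) i t"
      by (subst (asm) sums_Suc_iff[where f = "\<lambda>n. case n of 0 \<Rightarrow> 0 | Suc m \<Rightarrow> rhs \<eta> (\<lambda>j. pic y0 m j \<eta> t) i t", simplified]) 
    from sums_scaleR_right[OF this, of "?e t"] show ?thesis by (simp add: sums_iff)
  qed
  ultimately have z: "((\<lambda>x. \<Sum>n. ?e x *\<^sub>R pic y0 n i \<eta> x) has_vector_derivative ?e t *\<^sub>R rhs \<eta> (\<lambda>j. sol y0 j \<eta> t) i t) (at t within {0..T})" by simp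
  have "((\<lambda>x. ?e x *\<^sub>R sol y0 i \<eta> x) has_vector_derivative ?e t *\<^sub>R rhs \<eta> (\<lambda>j. sol y0 j \<eta> t) i t) (at t within {0..T})"
    by (rule has_vector_derivative_transform[OF _ _ z]) (use t summable_pic in \<open>auto simp: T_def sol_def suminf_scaleR_right\<close>)
  then show "(sol y0 i \<eta> has_vector_derivative rhs \<eta> (\<lambda>j. sol y0 j \<eta> t) i t - D i \<eta> t *\<^sub>R sol y0 i \<eta> t) (at t within {0..})"
    by (intro deriv_undamp[where T = T]) (use t in \<open>auto simp: T_def\<close>)
qed

end

end

section \<open>Upper bounds for integrals via antiderivatives\<close>

text \<open>The integral of g over [s, t] is at most B, witnessed by a function whose derivative
  dominates g. In this form no integrability of g has to be shown, and bounds are added by adding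
  the witnesses.\<close>

definition accum :: "(real \<Rightarrow> real) \<Rightarrow> real \<Rightarrow> real \<Rightarrow> real \<Rightarrow> bool" where
  "accum g s t B \<longleftrightarrow> (\<exists>p p'. (\<forall>x. s \<le> x \<and> x \<le> t \<longrightarrow>
     (p has_real_derivative p' x) (at x within {s..t}) \<and> g x \<le> p' x) \<and> p t - p s \<le> B)"

lemma accumI:
  assumes "\<And>x. s \<le> x \<Longrightarrow> x \<le> t \<Longrightarrow> (p has_real_derivative p' x) (at x within {s..t})"
    "\<And>x. s \<le> x \<Longrightarrow> x \<le> t \<Longrightarrow> g x \<le> p' x" "p t - p s \<le> B"
  shows "accum g s t B"
  unfolding accum_def by (rule exI[of _ p], rule exI[of _ p']) (use assms in blast)

lemma accumE:
  assumes "accum g s t B"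
  obtains p p' where "\<And>x. s \<le> x \<Longrightarrow> x \<le> t \<Longrightarrow> (p has_real_derivative p' x) (at x within {s..t})"
    "\<And>x. s \<le> x \<Longrightarrow> x \<le> t \<Longrightarrow> g x \<le> p' x" "p t - p s \<le> B"
  using assms unfolding accum_def by blast

lemma accum_le:
  assumes "accum g s t A" "\<And>x. s \<le> x \<Longrightarrow> x \<le> t \<Longrightarrow> h x \<le> g x" "A \<le> B"
  shows "accum h s t B"
  using assms(1)
proof (rule accumE)
  fix p p' assume *: "\<And>x. s \<le> x \<Longrightarrow> x \<le> t \<Longrightarrow> (p has_real_derivative p' x) (at x within {s..t})"
    "\<And>x. s \<le> x \<Longrightarrow> x \<le> t \<Longrightarrow> g x \<le> p' x" "p t - p s \<le> A"
  show ?thesis by (rule accumI[of _ _ p p']) (use * assms(2,3) in \<open>auto intro: order.trans\<close>)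
qed

lemma accum_add:
  assumes "accum g s t A" "accum h s t B"
  shows "accum (\<lambda>x. g x + h x) s t (A + B)"
proof -
  obtain p p' where p: "\<And>x. s \<le> x \<Longrightarrow> x \<le> t \<Longrightarrow> (p has_real_derivative p' x) (at x within {s..t})"
    "\<And>x. s \<le> x \<Longrightarrow> x \<le> t \<Longrightarrow> g x \<le> p' x" "p t - p s \<le> A" using accumE[OF assms(1)] by metis
  obtain q q' where q: "\<And>x. s \<le> x \<Longrightarrow> x \<le> t \<Longrightarrow> (q has_real_derivative q' x) (at x within {s..t})"
    "\<And>x. s \<le> x \<Longrightarrow> x \<le> t \<Longrightarrow> h x \<le> q' x" "q t - q s \<le> B" using accumE[OF assms(2)] by metis
  show ?thesis
  proof (rule accumI[of _ _ "\<lambda>x. p x + q x" "\<lambda>x. p' x + q' x"])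
    fix x assume x: "s \<le> x" "x \<le> t"
    show "((\<lambda>x. p x + q x) has_real_derivative p' x + q' x) (at x within {s..t})"
      by (intro DERIV_add p q x)
    show "g x + h x \<le> p' x + q' x" by (intro add_mono p q x)
  qed (use p(3) q(3) in linarith)
qed

lemma accum_cmult:
  assumes "accum g s t A" "0 \<le> k"
  shows "accum (\<lambda>x. k * g x) s t (k * A)"
proof -
  obtain p p' where p: "\<And>x. s \<le> x \<Longrightarrow> x \<le> t \<Longrightarrow> (p has_real_derivative p' x) (at x within {s..t})"
    "\<And>x. s \<le> x \<Longrightarrow> x \<le> t \<Longrightarrow> g x \<le> p' x" "p t - p s \<le> A" using accumE[OF assms(1)] by metis
  show ?thesis
    by (rule accumI[of _ _ "\<lambda>x. k * p x" "\<lambda>x. k * p' x"])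
       (use p assms in \<open>auto intro!: DERIV_cmult mult_left_mono simp: right_diff_distrib[symmetric]\<close>)
qed

lemma accum_zero: "accum (\<lambda>_. 0) s t 0"
  by (rule accumI[of _ _ "\<lambda>_. 0" "\<lambda>_. 0"]) auto

lemma accum_deriv_bound:
  fixes g :: "real \<Rightarrow> 'a::real_normed_vector"
  assumes "s \<le> t" "\<And>x. s \<le> x \<Longrightarrow> x \<le> t \<Longrightarrow> (g has_vector_derivative g' x) (at x within {s..t})"
    "accum h s t B" "\<And>x. s \<le> x \<Longrightarrow> x \<le> t \<Longrightarrow> norm (g' x) \<le> h x"
  shows "norm (g t - g s) \<le> B"
proof -
  obtain p p' where p: "\<And>x. s \<le> x \<Longrightarrow> x \<le> t \<Longrightarrow> (p has_real_derivative p' x) (at x within {s..t})"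
    "\<And>x. s \<le> x \<Longrightarrow> x \<le> t \<Longrightarrow> h x \<le> p' x" "p t - p s \<le> B" using accumE[OF assms(3)] by metis
  have "norm (g t - g s) \<le> p t - p s"
    by (rule deriv_comparison[OF assms(1,2) p(1)]) (use assms(4) p(2) in \<open>auto intro: order.trans\<close>)
  then show ?thesis using p(3) by simp
qed

lemma deriv_arctan_shift:
  "((\<lambda>t. arctan (t - x)) has_real_derivative 1 / (1 + (t - x)\<^sup>2)) (at t within S)"
proof -
  have "1 + (t - x)\<^sup>2 \<noteq> 0" by (smt (verit) zero_le_power2)
  then show ?thesis by (auto intro!: derivative_eq_intros simp: field_simps)
qed

lemma accum_lorentz: "accum (\<lambda>t. 1 / (1 + (t - x)\<^sup>2)) s t pi"
  by (rule accumI[OF deriv_arctan_shift]) (use arctan_bounded[of "s - x"] arctan_bounded[of "t - x"] in auto)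

lemma accum_lorentz_pos:
  assumes "0 \<le> s" shows "accum (\<lambda>t. 1 / (1 + t\<^sup>2)) s t (pi / 2)"
  by (rule accumI[OF deriv_arctan_shift[of 0, simplified]])
     (use arctan_bounded[of t] zero_le_arctan_iff[of s] assms in \<open>auto simp del: zero_le_arctan_iff\<close>)

lemma arctan_ge: assumes "0 < d" shows "pi / 2 - 1 / d \<le> arctan d"
  using arctan_inverse[of d] arctan_le_self[of "1 / d"] assms by (auto simp: inverse_eq_divide)

text \<open>The tail of the Lorentzian beyond distance d has mass at most pi/2 - arctan d, which is
  at most 1 / d.\<close>

lemma accum_lorentz_right:
  assumes "0 < d" "d \<le> s - x"
  shows "accum (\<lambda>t. 1 / (1 + (t - x)\<^sup>2)) s t (1 / d)"
  using arctan_ge[OF assms(1)] arctan_monotone'[OF assms(2)] arctan_bounded[of "t - x"]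
  by (intro accumI[OF deriv_arctan_shift]) auto

lemma accum_lorentz_left:
  assumes "0 < d" "d \<le> x - t"
  shows "accum (\<lambda>t. 1 / (1 + (t - x)\<^sup>2)) s t (1 / d)"
proof -
  have "arctan d \<le> arctan (x - t)" by (rule arctan_monotone'[OF assms(2)])
  also have "\<dots> = - arctan (t - x)" using arctan_minus[of "t - x"] by simp
  finally have "arctan (t - x) \<le> - arctan d" by simp
  then show ?thesis
    using arctan_ge[OF assms(1)] arctan_bounded[of "s - x"] by (intro accumI[OF deriv_arctan_shift]) auto
qed

section \<open>The system for the modified unknown\<close>

text \<open>Replacing \<open>G\<^sub>l\<close> by \<open>H\<^sub>l = G\<^sub>l - w\<^sub>l \<theta>\<^sub>l\<close> turns all forcing terms of \<open>G\<^sub>l\<close> except the one with \<open>f\<close> into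
  \<open>- \<nu> l\<^sup>2 \<theta>\<^sub>l\<close>, which the damping \<open>\<nu> l\<^sup>2 / w\<^sub>l\<close> balances exactly at \<open>H\<^sub>l = - w\<^sub>l \<theta>\<^sub>l\<close>, uniformly in \<open>\<nu>\<close>.
  Mode 0 drops out because \<open>b 0 = 0\<close> by division by zero.\<close>

locale modes =
  fixes nu c eta :: real and f :: "real \<Rightarrow> real"
  assumes nu_pos: "0 < nu" and c_pos: "0 < c" and c_small: "c < 1 / 1000" and eta_pos: "0 < eta"
    and f_bound: "\<And>t. 0 \<le> t \<Longrightarrow> \<bar>f t\<bar> \<le> 2 * c / (1 + t\<^sup>2)"
begin

definition b :: "nat \<Rightarrow> real" where "b m = c * eta / real m ^ 3"
definition w :: "nat \<Rightarrow> real \<Rightarrow> real" where "w m t = 1 / (1 + (t - eta / real m)\<^sup>2)"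
definition D :: "nat \<Rightarrow> real \<Rightarrow> real" where "D l t = nu * (real l)\<^sup>2 * (1 + (t - eta / real l)\<^sup>2)"
definition Ed :: "nat \<Rightarrow> real \<Rightarrow> real" where
  "Ed l t = nu * (real l)\<^sup>2 * ((t - eta / real l) + (t - eta / real l) ^ 3 / 3)"
text \<open>What mode m sends to each of its two neighbours. Substituting G = H + w th into c th + d
  G, where c = b w^2 and d = b w, produces the factor 2.\<close>

definition inflow :: "(nat \<Rightarrow> complex) \<Rightarrow> (nat \<Rightarrow> complex) \<Rightarrow> nat \<Rightarrow> real \<Rightarrow> complex" where
  "inflow th H m t = b m *\<^sub>R ((2 * (w m t)\<^sup>2) *\<^sub>R th m + w m t *\<^sub>R H m)"
definition cpl :: "(nat \<Rightarrow> complex) \<Rightarrow> (nat \<Rightarrow> complex) \<Rightarrow> nat \<Rightarrow> real \<Rightarrow> complex" where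
  "cpl th H l t = inflow th H (l + 1) t + inflow th H (l - 1) t"
definition Hrhs :: "(nat \<Rightarrow> complex) \<Rightarrow> (nat \<Rightarrow> complex) \<Rightarrow> nat \<Rightarrow> real \<Rightarrow> complex" where
  "Hrhs th H l t = of_real (f t / (2 * c)) * \<i> * of_nat l * cpl th H l t - (nu * (real l)\<^sup>2) *\<^sub>R th l"
definition flux :: "(nat \<Rightarrow> real \<Rightarrow> real) \<Rightarrow> (nat \<Rightarrow> real \<Rightarrow> real) \<Rightarrow> nat \<Rightarrow> real \<Rightarrow> real" where
  "flux Q P m t = b m * (2 * (w m t)\<^sup>2 * Q m t + w m t * P m t)"
text \<open>This is eta / (k + 1/2), a switching time between the resonant times eta / (k + 1) and
  eta / k; the window from \<open>tau k\<close> to \<open>tau (k - 1)\<close> contains the single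
  resonance eta / k.\<close>

definition tau :: "nat \<Rightarrow> real" where "tau k = 2 * eta / (2 * real k + 1)"

lemma b_nonneg: "0 \<le> b m" using c_pos eta_pos by (simp add: b_def)
lemma b_0 [simp]: "b 0 = 0" by (simp add: b_def)
lemma w_pos: "0 < w m t" unfolding w_def by (smt (verit) zero_le_power2 divide_pos_pos)
lemma w_le_1: "w m t \<le> 1" unfolding w_def by (simp add: add_pos_nonneg)
lemma D_nonneg: "0 \<le> D l t" using nu_pos by (simp add: D_def)
lemma D_w: "D l t * w l t = nu * (real l)\<^sup>2"
proof -
  have "1 + (t - eta / real l)\<^sup>2 \<noteq> 0" by (smt (verit) zero_le_power2)
  then show ?thesis unfolding D_def w_def by simp
qed
lemma deriv_Ed: "(Ed l has_real_derivative D l t) (at t within S)"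
proof -
  have "((\<lambda>t. nu * (real l)\<^sup>2 * ((t - x) + (t - x) ^ 3 / 3)) has_real_derivative nu * (real l)\<^sup>2 * (1 + (t - x)\<^sup>2)) (at t within S)" for x
    by (rule derivative_eq_intros refl | simp)+
  then show ?thesis unfolding Ed_def[abs_def] D_def .
qed
lemma w_le_dist: assumes "0 < d" "d \<le> \<bar>t - eta / real m\<bar>" shows "w m t \<le> 1 / d\<^sup>2"
proof -
  have "d\<^sup>2 \<le> (t - eta / real m)\<^sup>2" using assms by (metis abs_le_square_iff abs_of_pos)
  then show ?thesis using assms unfolding w_def by (intro divide_left_mono mult_pos_pos) (auto simp: add_pos_nonneg)
qed
lemma tau_pos: "0 < tau k" using eta_pos by (simp add: tau_def)

lemma inflow_bound:
  assumes "m \<ge> 1 \<Longrightarrow> cmod (th m) \<le> N * Q m t" "m \<ge> 1 \<Longrightarrow> cmod (H m) \<le> N * P m t"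
  shows "cmod (inflow th H m t) \<le> N * flux Q P m t"
proof (cases "m = 0")
  case False
  have "cmod (inflow th H m t) \<le> b m * (2 * (w m t)\<^sup>2 * cmod (th m) + w m t * cmod (H m))"
    unfolding inflow_def using b_nonneg[of m] w_pos[of m t]
    by (simp add: mult_left_mono norm_triangle_le)
  also have "\<dots> \<le> b m * (2 * (w m t)\<^sup>2 * (N * Q m t) + w m t * (N * P m t))"
    using b_nonneg[of m] w_pos[of m t] assms False by (intro mult_left_mono add_mono) auto
  also have "\<dots> = N * flux Q P m t" by (simp add: flux_def algebra_simps)
  finally show ?thesis .
qed (simp add: inflow_def flux_def)

lemma cpl_bound:
  assumes "\<And>m. m \<ge> 1 \<Longrightarrow> cmod (th m) \<le> N * Q m t" "\<And>m. m \<ge> 1 \<Longrightarrow> cmod (H m) \<le> N * P m t"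
  shows "cmod (cpl th H l t) \<le> N * (flux Q P (l + 1) t + flux Q P (l - 1) t)"
  unfolding cpl_def distrib_left
  by (intro norm_triangle_mono inflow_bound assms)

lemma f_term_bound:
  assumes "0 \<le> t"
  shows "cmod (of_real (f t / (2 * c)) * \<i> * of_nat l * z) \<le> real l / (1 + t\<^sup>2) * cmod z"
proof -
  have "\<bar>f t / (2 * c)\<bar> \<le> 1 / (1 + t\<^sup>2)" using f_bound[OF assms] c_pos by (simp add: field_simps)
  then have "\<bar>f t / (2 * c)\<bar> * (real l * cmod z) \<le> 1 / (1 + t\<^sup>2) * (real l * cmod z)" by (intro mult_right_mono) auto
  moreover have "cmod (of_real (f t / (2 * c)) * \<i> * of_nat l * z) = \<bar>f t / (2 * c)\<bar> * (real l * cmod z)"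
    by (simp only: norm_mult norm_of_real norm_ii norm_of_nat mult_1_right mult.assoc)
  ultimately show ?thesis by simp
qed

end

section \<open>Integrated forms of the equations\<close>

locale modes_sol = modes +
  fixes th H :: "real \<Rightarrow> nat \<Rightarrow> complex"
  assumes th_deriv: "\<And>l t. 1 \<le> l \<Longrightarrow> 0 \<le> t \<Longrightarrow>
      ((\<lambda>s. th s l) has_vector_derivative cpl (th t) (H t) l t) (at t within {0..})"
    and H_deriv: "\<And>l t. 1 \<le> l \<Longrightarrow> 0 \<le> t \<Longrightarrow>
      ((\<lambda>s. H s l) has_vector_derivative (Hrhs (th t) (H t) l t - D l t *\<^sub>R H t l)) (at t within {0..})"
begin

lemma th_deriv': "1 \<le> l \<Longrightarrow> 0 \<le> t0 \<Longrightarrow> t0 \<le> t \<Longrightarrow>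
      ((\<lambda>s. th s l) has_vector_derivative cpl (th t) (H t) l t) (at t within {t0..t1})"
  by (rule has_vector_derivative_within_subset[OF th_deriv]) auto

lemma H_deriv': "1 \<le> l \<Longrightarrow> 0 \<le> t0 \<Longrightarrow> t0 \<le> t \<Longrightarrow>
      ((\<lambda>s. H s l) has_vector_derivative (Hrhs (th t) (H t) l t - D l t *\<^sub>R H t l)) (at t within {t0..t1})"
  by (rule has_vector_derivative_within_subset[OF H_deriv]) auto

lemma th_increment:
  assumes "1 \<le> l" "0 \<le> t0" "t0 \<le> t" "\<And>m s. m \<ge> 1 \<Longrightarrow> t0 \<le> s \<Longrightarrow> s \<le> t \<Longrightarrow> cmod (th s m) \<le> N * Q m s"
    "\<And>m s. m \<ge> 1 \<Longrightarrow> t0 \<le> s \<Longrightarrow> s \<le> t \<Longrightarrow> cmod (H s m) \<le> N * P m s" "0 \<le> N"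
    "accum (\<lambda>s. flux Q P (l + 1) s + flux Q P (l - 1) s) t0 t B"
  shows "cmod (th t l - th t0 l) \<le> N * B"
  by (rule accum_deriv_bound[OF assms(3) th_deriv' accum_cmult[OF assms(7,6)] cpl_bound]) (use assms in auto)

text \<open>\<open>Y\<close> solves the equation of \<open>H\<close> with \<open>th\<close> frozen
  at \<open>z\<close> and without the term in f. The difference is driven only by \<open>th\<close>
  - \<open>z\<close> and by the coupling. The choice \<open>Y\<close> = 0, \<open>z\<close> = 0
  gives the plain size bound for \<open>H\<close>, and the resonance profile gives the sharp
  one.\<close>

lemma H_increment:
  assumes l: "1 \<le> l" "0 \<le> t0" "t0 \<le> t"
    and Q: "\<And>m s. m \<ge> 1 \<Longrightarrow> t0 \<le> s \<Longrightarrow> s \<le> t \<Longrightarrow> cmod (th s m) \<le> N * Q m s"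
    and P: "\<And>m s. m \<ge> 1 \<Longrightarrow> t0 \<le> s \<Longrightarrow> s \<le> t \<Longrightarrow> cmod (H s m) \<le> N * P m s"
    and N: "0 \<le> N" and nn: "\<And>m s. m \<ge> 1 \<Longrightarrow> t0 \<le> s \<Longrightarrow> s \<le> t \<Longrightarrow> 0 \<le> Q m s \<and> 0 \<le> P m s"
    and ac: "accum (\<lambda>s. real l / (1 + s\<^sup>2) * (flux Q P (l + 1) s + flux Q P (l - 1) s)) t0 t B"
    and dY: "\<And>s. t0 \<le> s \<Longrightarrow> s \<le> t \<Longrightarrow> (Y has_vector_derivative - (nu * (real l)\<^sup>2) *\<^sub>R z - D l s *\<^sub>R Y s) (at s within {t0..t})"
    and W: "\<And>s. t0 \<le> s \<Longrightarrow> s \<le> t \<Longrightarrow> w l s * cmod (th s l - z) \<le> M"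
  shows "cmod (H t l - Y t) \<le> cmod (H t0 l - Y t0) + M + N * B"
proof -
  obtain p p' where p: "\<And>x. t0 \<le> x \<Longrightarrow> x \<le> t \<Longrightarrow> (p has_real_derivative p' x) (at x within {t0..t})"
    "\<And>x. t0 \<le> x \<Longrightarrow> x \<le> t \<Longrightarrow> real l / (1 + x\<^sup>2) * (flux Q P (l + 1) x + flux Q P (l - 1) x) \<le> p' x" "p t - p t0 \<le> B"
    using accumE[OF ac] by metis
  have fl: "0 \<le> flux Q P m s" if "t0 \<le> s" "s \<le> t" for m s
    using nn[of m s] that b_nonneg[of m] w_pos[of m s] by (cases "m = 0") (auto simp: flux_def)
  have M: "0 \<le> M" using W[of t0] w_pos[of l t0] l by (meson less_imp_le mult_nonneg_nonneg norm_ge_zero order.trans order.refl)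
  have "cmod ((\<lambda>s. H s l - Y s) t) \<le> cmod ((\<lambda>s. H s l - Y s) t0) + M + ((\<lambda>s. N * p s) t - (\<lambda>s. N * p s) t0)"
  proof (rule damped_bound[OF l(3), where D = "D l" and E = "Ed l" and p' = "\<lambda>s. N * p' s"
      and g = "\<lambda>s. Hrhs (th s) (H s) l s + (nu * (real l)\<^sup>2) *\<^sub>R z"])
    fix s assume s: "t0 \<le> s" "s \<le> t"
    show "((\<lambda>s. H s l - Y s) has_vector_derivative Hrhs (th s) (H s) l s + (nu * (real l)\<^sup>2) *\<^sub>R z - D l s *\<^sub>R (H s l - Y s)) (at s within {t0..t})"
      by (rule has_vector_derivative_eq_rhs[OF has_vector_derivative_diff[OF H_deriv' dY]]) (use l s in \<open>auto simp: algebra_simps\<close>)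
    have "0 \<le> real l / (1 + s\<^sup>2) * (flux Q P (l + 1) s + flux Q P (l - 1) s)"
      using fl[OF s] by (intro mult_nonneg_nonneg) auto
    then show p'0: "0 \<le> N * p' s" using p(2)[OF s] N by auto
    show "((\<lambda>s. N * p s) has_real_derivative N * p' s) (at s within {t0..t})" by (intro DERIV_cmult p(1) s)
    have "Hrhs (th s) (H s) l s + (nu * (real l)\<^sup>2) *\<^sub>R z =
       of_real (f s / (2 * c)) * \<i> * of_nat l * cpl (th s) (H s) l s - (nu * (real l)\<^sup>2) *\<^sub>R (th s l - z)"
      by (simp add: Hrhs_def algebra_simps)
    then have "cmod (Hrhs (th s) (H s) l s + (nu * (real l)\<^sup>2) *\<^sub>R z) \<le>
       cmod (of_real (f s / (2 * c)) * \<i> * of_nat l * cpl (th s) (H s) l s) + (nu * (real l)\<^sup>2) * cmod (th s l - z)"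
      using norm_triangle_ineq4[of "of_real (f s / (2 * c)) * \<i> * of_nat l * cpl (th s) (H s) l s" "(nu * (real l)\<^sup>2) *\<^sub>R (th s l - z)"] nu_pos
      by simp
    also have "\<dots> \<le> real l / (1 + s\<^sup>2) * (N * (flux Q P (l + 1) s + flux Q P (l - 1) s)) + D l s * M"
    proof (rule add_mono)
      \<comment> \<open>The identity D w = nu l^2 rewrites this source as damping times w |th - z|,
        the form that costs only M in \<open>damped_bound\<close>.\<close>
      show "nu * (real l)\<^sup>2 * cmod (th s l - z) \<le> D l s * M"
        unfolding D_w[symmetric, of l s] mult.assoc using W[OF s] D_nonneg by (intro mult_left_mono)
      have "cmod (cpl (th s) (H s) l s) \<le> N * (flux Q P (l + 1) s + flux Q P (l - 1) s)"
        by (rule cpl_bound) (use Q P s in auto)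
      then have "real l / (1 + s\<^sup>2) * cmod (cpl (th s) (H s) l s) \<le> real l / (1 + s\<^sup>2) * (N * (flux Q P (l + 1) s + flux Q P (l - 1) s))"
        by (rule mult_left_mono) simp
      then show "cmod (of_real (f s / (2 * c)) * \<i> * of_nat l * cpl (th s) (H s) l s)
         \<le> real l / (1 + s\<^sup>2) * (N * (flux Q P (l + 1) s + flux Q P (l - 1) s))"
        using f_term_bound[of s l "cpl (th s) (H s) l s"] s l by linarith
    qed
    also have "\<dots> \<le> D l s * M + N * p' s"
      using mult_left_mono[OF p(2)[OF s] N] by (simp add: mult_ac)
    finally show "cmod (Hrhs (th s) (H s) l s + (nu * (real l)\<^sup>2) *\<^sub>R z) \<le> D l s * M + N * p' s" .
  qed (use D_nonneg deriv_Ed M in auto)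
  also have "(\<lambda>s. N * p s) t - (\<lambda>s. N * p s) t0 \<le> N * B" using mult_left_mono[OF p(3) N] by (simp add: right_diff_distrib)
  finally show ?thesis by simp
qed

text \<open>A supersolution with some slack in its initial values absorbs any finite a priori bound:
  the hypotheses improve a bound by \<open>N\<close> times the majorant to \<open>(1 + N) / 2\<close> times it.\<close>

lemma absorb:
  assumes t0: "0 \<le> t0"
    and pos: "\<And>l t. 1 \<le> l \<Longrightarrow> t0 \<le> t \<Longrightarrow> t \<le> t1 \<Longrightarrow> 0 \<le> Q l t \<and> 0 \<le> P l t"
    and apriori: "\<And>l t. 1 \<le> l \<Longrightarrow> t0 \<le> t \<Longrightarrow> t \<le> t1 \<Longrightarrow> cmod (th t l) \<le> N * Q l t \<and> cmod (H t l) \<le> N * P l t"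
    and init: "\<And>l t. 1 \<le> l \<Longrightarrow> t0 \<le> t \<Longrightarrow> t \<le> t1 \<Longrightarrow> cmod (th t0 l) \<le> Q l t / 2 \<and> cmod (H t0 l) \<le> P l t / 2"
    and throw: "\<And>l t. 1 \<le> l \<Longrightarrow> t0 \<le> t \<Longrightarrow> t \<le> t1 \<Longrightarrow>
        accum (\<lambda>s. flux Q P (l + 1) s + flux Q P (l - 1) s) t0 t (Q l t / 2)"
    and Hrow1: "\<And>l s t. 1 \<le> l \<Longrightarrow> t0 \<le> s \<Longrightarrow> s \<le> t \<Longrightarrow> t \<le> t1 \<Longrightarrow> w l s * Q l s \<le> P l t / 4"
    and Hrow2: "\<And>l t. 1 \<le> l \<Longrightarrow> t0 \<le> t \<Longrightarrow> t \<le> t1 \<Longrightarrow>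
        accum (\<lambda>s. real l / (1 + s\<^sup>2) * (flux Q P (l + 1) s + flux Q P (l - 1) s)) t0 t (P l t / 4)"
    and l: "1 \<le> l" "t0 \<le> t" "t \<le> t1"
  shows "cmod (th t l) \<le> Q l t" "cmod (H t l) \<le> P l t"
proof -
  define M where "M = max N 1"
  have step: "cmod (th t l) \<le> (1 + (M - 1) / 2 ^ n) * Q l t \<and> cmod (H t l) \<le> (1 + (M - 1) / 2 ^ n) * P l t"
    if "1 \<le> l" "t0 \<le> t" "t \<le> t1" for n l t
    using that
  proof (induction n arbitrary: l t)
    case 0
    have "N * Q l t \<le> M * Q l t" "N * P l t \<le> M * P l t"
      using pos[OF 0] by (auto simp: M_def intro!: mult_right_mono)
    then show ?case using apriori[OF 0] by auto
  next
    case (Suc n)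
    define K where "K = 1 + (M - 1) / 2 ^ n"
    have K: "0 \<le> K" "1 + (M - 1) / 2 ^ Suc n = (1 + K) / 2" unfolding K_def M_def by (auto simp: add_divide_distrib intro!: add_nonneg_nonneg) (simp add: field_simps)?
    have Q: "cmod (th s m) \<le> K * Q m s" and P: "cmod (H s m) \<le> K * P m s" if "m \<ge> 1" "t0 \<le> s" "s \<le> t" for m s
      using Suc that by (auto simp: K_def)
    have "cmod (th t l - th t0 l) \<le> K * (Q l t / 2)"
      by (rule th_increment[OF _ _ _ Q P _ throw]) (use Suc t0 K in auto)
    moreover have "cmod (H t l - 0) \<le> cmod (H t0 l - 0) + K * (P l t / 4) + K * (P l t / 4)"
    proof (rule H_increment[where Y = "\<lambda>_. 0" and z = 0, OF _ _ _ Q P _ _ Hrow2])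
      fix s assume s: "t0 \<le> s" "s \<le> t"
      have "w l s * cmod (th s l - 0) \<le> w l s * (K * Q l s)"
        using Q[of l s] s Suc w_pos[of l s] by (intro mult_left_mono) auto
      also have "\<dots> = K * (w l s * Q l s)" by simp
      also have "\<dots> \<le> K * (P l t / 4)" using Hrow1[of l s t] Suc s K by (intro mult_left_mono) auto
      finally show "w l s * cmod (th s l - 0) \<le> K * (P l t / 4)" .
    qed (use Suc t0 K pos in auto)
    ultimately have "cmod (th t l) \<le> Q l t / 2 + K * (Q l t / 2)" "cmod (H t l) \<le> P l t / 2 + K * (P l t / 2)"
      using init[OF Suc.prems] norm_triangle_sub[of "th t l" "th t0 l"] by auto
    then show ?case unfolding K(2) by (simp add: algebra_simps add_divide_distrib)
  qed
  have lim: "(\<lambda>n. (1 + (M - 1) / 2 ^ n) * X) \<longlonglongrightarrow> (1 + 0) * X" for X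
    by (intro tendsto_intros LIMSEQ_divide_realpow_zero) auto
  show "cmod (th t l) \<le> Q l t"
    using LIMSEQ_le_const[OF lim[of "Q l t"]] step[OF l] by auto
  show "cmod (H t l) \<le> P l t"
    using LIMSEQ_le_const[OF lim[of "P l t"]] step[OF l] by auto
qed

end

section \<open>Interaction integrals away from resonance\<close>

context modes begin

text \<open>For a resonance already passed, the mass of the tail is at most 1 over the distance from
  eta / m to \<open>tau k\<close>. In m b_m times this bound eta cancels and c (2k + 1) / (m (2m -
  2k - 1)) remains. So non-resonant interactions cost only a multiple of c at every frequency; the
  factor m is carried along to pay for the factor l in the term with f.\<close>

lemma accum_w_right:
  assumes "1 \<le> k" "k < m"
  shows "accum (\<lambda>t. real m * b m * w m t) (tau k) T (3 * c)"
proof -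
  define d where "d = eta * (2 * real m - 2 * real k - 1) / (real m * (2 * real k + 1))"
  have m: "real m \<ge> real k + 1" "real k \<ge> 1" using assms by auto
  have d: "0 < d" unfolding d_def using m eta_pos by auto
  have "tau k - eta / real m = d" unfolding d_def tau_def using m by (simp add: field_simps)
  then have ac: "accum (\<lambda>t. 1 / (1 + (t - eta / real m)\<^sup>2)) (tau k) T (1 / d)"
    by (intro accum_lorentz_right d) simp
  have "2 * real k + 1 \<le> 3 * (real m * (2 * real m - 2 * real k - 1))"
  proof -
    have "1 * (real k + 1) \<le> (2 * real m - 2 * real k - 1) * real m" using m by (intro mult_mono) auto
    then show ?thesis using m by (simp add: mult.commute)
  qed
  then have "c * (2 * real k + 1) \<le> c * (3 * (real m * (2 * real m - 2 * real k - 1)))"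
    using c_pos by (intro mult_left_mono) auto
  then have "real m * b m * (1 / d) \<le> 3 * c"
    unfolding b_def d_def using m eta_pos by (simp add: divide_simps power3_eq_cube)
  then show ?thesis
    unfolding w_def by (intro accum_le[OF accum_cmult[OF ac, of "real m * b m"]]) (auto simp: b_nonneg)
qed

text \<open>The mirror image for resonances still to come, where the distance is eta / m -
  \<open>tau k\<close>. The case m = k is included, since up to \<open>tau k\<close> that resonance
  has not been reached either.\<close>

lemma accum_w_left:
  assumes "1 \<le> m" "m \<le> k" "T \<le> tau k"
  shows "accum (\<lambda>t. real m * b m * w m t) s T (3 * c)"
proof -
  define d where "d = eta * (2 * real k + 1 - 2 * real m) / (real m * (2 * real k + 1))"
  have m: "real m \<le> real k" "real m \<ge> 1" using assms by auto
  have d: "0 < d" unfolding d_def using m eta_pos by auto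
  have "eta / real m - tau k = d" unfolding d_def tau_def using m by (simp add: field_simps)
  then have ac: "accum (\<lambda>t. 1 / (1 + (t - eta / real m)\<^sup>2)) s T (1 / d)"
    using assms by (intro accum_lorentz_left d) simp
  have "2 * real k + 1 \<le> 3 * (real m * (2 * real k + 1 - 2 * real m))"
  proof -
    have "0 \<le> (2 * real m - 1) * (real k - real m)" using m by (intro mult_nonneg_nonneg) auto
    then show ?thesis using m by (simp add: algebra_simps)
  qed
  then have "c * (2 * real k + 1) \<le> c * (3 * (real m * (2 * real k + 1 - 2 * real m)))"
    using c_pos by (intro mult_left_mono) auto
  then have "real m * b m * (1 / d) \<le> 3 * c"
    unfolding b_def d_def using m eta_pos by (simp add: divide_simps power3_eq_cube)
  then show ?thesis
    unfolding w_def by (intro accum_le[OF accum_cmult[OF ac, of "real m * b m"]]) (auto simp: b_nonneg)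
qed

lemma w_right_le:
  assumes "1 \<le> k" "k < m" "tau k \<le> t"
  shows "w m t \<le> ((real k + 1) * (2 * real k + 1) / eta)\<^sup>2"
proof -
  define d where "d = eta / ((real k + 1) * (2 * real k + 1))"
  have m: "real m \<ge> real k + 1" "real k \<ge> 1" using assms by auto
  have d: "0 < d" unfolding d_def using m eta_pos by auto
  have "eta / real m \<le> eta / (real k + 1)" using m eta_pos by (intro divide_left_mono) auto
  moreover have "tau k - eta / (real k + 1) = d" unfolding d_def tau_def using m by (simp add: field_simps)
  ultimately have "d \<le> \<bar>t - eta / real m\<bar>" using assms(3) by linarith
  from w_le_dist[OF d this] show ?thesis unfolding d_def by (simp add: power_divide)
qed

lemma w_left_le:
  assumes "1 \<le> m" "m \<le> k" "t \<le> tau k"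
  shows "w m t \<le> (real k * (2 * real k + 1) / eta)\<^sup>2"
proof -
  define d where "d = eta / (real k * (2 * real k + 1))"
  have m: "real m \<le> real k" "real m \<ge> 1" using assms by auto
  have d: "0 < d" unfolding d_def using m eta_pos by auto
  have "eta / real k \<le> eta / real m" using m eta_pos by (intro divide_left_mono) auto
  moreover have "eta / real k - tau k = d" unfolding d_def tau_def using m by (simp add: field_simps)
  ultimately have "d \<le> \<bar>t - eta / real m\<bar>" using assms(3) by linarith
  from w_le_dist[OF d this] show ?thesis unfolding d_def by (simp add: power_divide)
qed

end

section \<open>The resonance profile\<close>

lemma antiderivative_real:
  fixes h :: "real \<Rightarrow> real"
  assumes "continuous_on UNIV h"
  shows "\<exists>g. \<forall>x. (g has_real_derivative h x) (at x)"
proof (intro exI allI)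
  fix x :: real
  define a b where "a = min 0 x - 1" and "b = max 0 x + 1"
  have "((\<lambda>u. LBINT y=ereal 0..ereal u. h y) has_vector_derivative h x) (at x within {a..b})"
    by (rule interval_integral_FTC2) (use assms in \<open>auto simp: a_def b_def intro: continuous_on_subset\<close>)
  moreover have "at x within {a..b} = at x"
    by (rule at_within_interior) (auto simp: a_def b_def)
  ultimately show "((\<lambda>u. LBINT y=ereal 0..ereal u. h y) has_real_derivative h x) (at x)"
    by (simp add: has_real_derivative_iff_has_vector_derivative)
qed

text \<open>The differential inequality says that exp(E) y is nondecreasing.\<close>

lemma damped_nonneg:
  fixes y :: "real \<Rightarrow> real"
  assumes "a \<le> b" and y: "\<And>x. a \<le> x \<Longrightarrow> x \<le> b \<Longrightarrow> (y has_real_derivative y' x) (at x)"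
    and E: "\<And>x. (E has_real_derivative D x) (at x)"
    and ge: "\<And>x. a \<le> x \<Longrightarrow> x \<le> b \<Longrightarrow> 0 \<le> y' x + D x * y x" and "0 \<le> y a"
  shows "0 \<le> y b"
proof -
  have "exp (E a) * y a \<le> exp (E b) * y b"
  proof (rule deriv_nonneg_le[OF assms(1), where p' = "\<lambda>x. exp (E x) * (y' x + D x * y x)"])
    fix x assume x: "a \<le> x" "x \<le> b"
    show "((\<lambda>x. exp (E x) * y x) has_real_derivative exp (E x) * (y' x + D x * y x)) (at x within {a..b})"
      by (rule has_field_derivative_at_within) (rule derivative_eq_intros E y[OF x] refl | simp add: algebra_simps)+
  qed (use ge in auto)
  moreover have "0 \<le> exp (E a) * y a" using assms by simp
  ultimately show ?thesis by (smt (verit) exp_gt_zero mult_pos_neg)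
qed

text \<open>With \<open>\<theta>\<^sub>k\<close> frozen, \<open>H\<^sub>k = - r \<theta>\<^sub>k\<close> near the resonance. Since \<open>r\<close> lags behind \<open>1 / (1 + s\<^sup>2)\<close>, it is larger
  at \<open>s\<close> than at \<open>-s\<close>, and testing the equation of \<open>r\<close> against \<open>1 / (1 + s\<^sup>2)\<^sup>2\<close> shows that
  the contribution of \<open>H\<^sub>k\<close> can cancel at most half of the one of \<open>\<theta>\<^sub>k\<close>, whatever \<open>\<mu>\<close> is.\<close>

lemma resonance_profile:
  fixes mu S :: real
  assumes mu: "0 < mu" and S: "100 \<le> S"
  obtains r Z where "\<And>s. (r has_real_derivative mu - mu * (1 + s\<^sup>2) * r s) (at s)" "r (- S) = 0"
    "\<And>s. (Z has_real_derivative 2 / (1 + s\<^sup>2)\<^sup>2 - r s / (1 + s\<^sup>2)) (at s)" "Z (- S) = 0"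
    "\<And>s. S \<le> s \<Longrightarrow> 3 / 2 \<le> Z s"
proof -
  define E where "E = (\<lambda>s::real. mu * (s + s ^ 3 / 3))"
  define w where "w = (\<lambda>s::real. 1 / (1 + s\<^sup>2))"
  have nz: "1 + s\<^sup>2 \<noteq> 0" "1 + s\<^sup>2 > 0" for s :: real by (auto simp: add_pos_nonneg add_nonneg_eq_0_iff)
  have wpos: "0 < w s" for s using nz unfolding w_def by simp
  have wD: "(1 + s\<^sup>2) * w s = 1" for s using nz[of s] unfolding w_def by simp
  have weven: "w (- s) = w s" for s by (simp add: w_def)
  have E: "(E has_real_derivative mu * (1 + s\<^sup>2)) (at s)" for s
    unfolding E_def by (rule derivative_eq_intros refl | simp)+
  have w: "(w has_real_derivative - 2 * s * (w s)\<^sup>2) (at s)" for s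
    unfolding w_def using nz[of s] by (auto intro!: derivative_eq_intros simp: power2_eq_square)
  have "continuous_on UNIV (\<lambda>s. exp (E s))" unfolding E_def by (intro continuous_intros) auto
  then obtain g0 where g0: "\<And>s. (g0 has_real_derivative exp (E s)) (at s)" using antiderivative_real by blast
  \<comment> \<open>Variation of constants with initial value 0 at -S.\<close>
  define r where "r = (\<lambda>s. mu * exp (- E s) * (g0 s - g0 (- S)))"
  have r: "(r has_real_derivative mu - mu * (1 + s\<^sup>2) * r s) (at s)" for s
    unfolding r_def by (rule derivative_eq_intros E g0 refl | simp)+ (simp add: algebra_simps exp_minus)
  have r0: "r (- S) = 0" by (simp add: r_def)
  have r_neg: "((\<lambda>s. r (- s)) has_real_derivative - (mu - mu * (1 + s\<^sup>2) * r (- s))) (at s)" for s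
    using r[of "- s"] unfolding DERIV_mirror by simp
  have r_nonneg: "0 \<le> r s" if "- S \<le> s" for s
    by (rule damped_nonneg[where a = "- S", OF that r E]) (use r0 mu in auto)
  have r_le_1: "r s \<le> 1" if "- S \<le> s" for s
  proof -
    have "0 \<le> (\<lambda>s. 1 - r s) s"
      by (rule damped_nonneg[where a = "- S" and y' = "\<lambda>s. - (mu - mu * (1 + s\<^sup>2) * r s)", OF that _ E])
         (auto intro!: derivative_eq_intros r simp: r0 mu less_imp_le algebra_simps)
    then show ?thesis by simp
  qed
  \<comment> \<open>Up to time 0 the quasi-equilibrium w increases, so it is a supersolution there
    and r stays below it.\<close>
  have r_le_w: "r s \<le> w s" if "- S \<le> s" "s \<le> 0" for s
  proof -
    have "0 \<le> (\<lambda>s. w s - r s) s"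
    proof (rule damped_nonneg[where a = "- S" and y' = "\<lambda>s. - 2 * s * (w s)\<^sup>2 - (mu - mu * (1 + s\<^sup>2) * r s)", OF that(1) _ E])
      fix x assume x: "- S \<le> x" "x \<le> s"
      have "- 2 * x * (w x)\<^sup>2 - (mu - mu * (1 + x\<^sup>2) * r x) + mu * (1 + x\<^sup>2) * (w x - r x) = (- 2 * x) * (w x)\<^sup>2 + mu * ((1 + x\<^sup>2) * w x - 1)"
        by (simp add: algebra_simps)
      also have "\<dots> \<ge> 0" unfolding wD using x that by (auto intro!: mult_nonpos_nonneg)
      finally show "0 \<le> - 2 * x * (w x)\<^sup>2 - (mu - mu * (1 + x\<^sup>2) * r x) + mu * (1 + x\<^sup>2) * (w x - r x)" .
    qed (use w r wpos in \<open>auto intro!: derivative_eq_intros simp: r0 less_imp_le\<close>)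
    then show ?thesis by simp
  qed
  \<comment> \<open>The difference r(s) - r(-s) has the source 2 mu (1 - (1 + s^2) r(-s)), which is
    nonnegative because r is below w at negative times.\<close>
  have p_nonneg: "0 \<le> r s - r (- s)" if "0 \<le> s" "s \<le> S" for s
  proof -
    have "0 \<le> (\<lambda>s. r s - r (- s)) s"
    proof (rule damped_nonneg[where a = 0 and y' = "\<lambda>s. mu - mu * (1 + s\<^sup>2) * r s + (mu - mu * (1 + s\<^sup>2) * r (- s))", OF that(1) _ E])
      fix x assume x: "0 \<le> x" "x \<le> s"
      show "((\<lambda>s. r s - r (- s)) has_real_derivative mu - mu * (1 + x\<^sup>2) * r x + (mu - mu * (1 + x\<^sup>2) * r (- x))) (at x)"
        by (rule derivative_eq_intros r r_neg refl | simp)+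
      have "r (- x) \<le> w x" using r_le_w[of "- x"] x that by (simp add: weven)
      then have "(1 + x\<^sup>2) * r (- x) \<le> 1" using mult_left_mono[of "r (- x)" "w x" "1 + x\<^sup>2"] nz[of x] wD[of x] by simp
      then have "mu * ((1 + x\<^sup>2) * r (- x)) \<le> mu * 1" using mu by (intro mult_left_mono) auto
      then show "0 \<le> mu - mu * (1 + x\<^sup>2) * r x + (mu - mu * (1 + x\<^sup>2) * r (- x)) + mu * (1 + x\<^sup>2) * (r x - r (- x))"
        by (simp add: algebra_simps)
    qed auto
    then show ?thesis by simp
  qed
  have "continuous_on UNIV r" using r by (rule DERIV_continuous_on)
  then have "continuous_on UNIV (\<lambda>s. (w s)\<^sup>2 - r s * w s)"
    unfolding w_def by (intro continuous_intros) (use nz in auto)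
  then obtain Y where Y: "\<And>s. (Y has_real_derivative (w s)\<^sup>2 - r s * w s) (at s)" using antiderivative_real by blast
  have Y_neg: "((\<lambda>s. Y (- s)) has_real_derivative - ((w s)\<^sup>2 - r (- s) * w s)) (at s)" for s
    using Y[of "- s"] unfolding DERIV_mirror by (simp add: weven)
  \<comment> \<open>The equation of r gives w^2 - r w = w^2 r' / mu. Integrating by parts over
    [-s, s] leaves the boundary term subtracted here, and the remaining integrand 4 s w^3 (r(s) -
    r(-s)) / mu is nonnegative. Hence w^2 - r w has nonnegative integral over [-S, S].\<close>
  define X where "X = (\<lambda>s. Y s - Y (- s) - (r s - r (- s)) * (w s)\<^sup>2 / mu)"
  have "X 0 \<le> X S"
  proof (rule deriv_nonneg_le[where p = X and p' = "\<lambda>s. (r s - r (- s)) * (4 * s * w s ^ 3) / mu"])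
    fix s assume s: "0 \<le> s" "s \<le> S"
    have w2: "((\<lambda>s. (w s)\<^sup>2) has_real_derivative - 4 * s * w s ^ 3) (at s)"
      by (rule derivative_eq_intros w refl | simp add: power2_eq_square power3_eq_cube)+
    have "(X has_real_derivative ((w s)\<^sup>2 - r s * w s) - - ((w s)\<^sup>2 - r (- s) * w s) -
        ((mu - mu * (1 + s\<^sup>2) * r s - - (mu - mu * (1 + s\<^sup>2) * r (- s))) * (w s)\<^sup>2 + (- 4 * s * w s ^ 3) * (r s - r (- s))) / mu) (at s)"
      unfolding X_def by (intro DERIV_diff Y Y_neg DERIV_cdivide DERIV_mult r r_neg w2)
    moreover have "((w s)\<^sup>2 - r s * w s) - - ((w s)\<^sup>2 - r (- s) * w s) -
        ((mu - mu * (1 + s\<^sup>2) * r s - - (mu - mu * (1 + s\<^sup>2) * r (- s))) * (w s)\<^sup>2 + (- 4 * s * w s ^ 3) * (r s - r (- s))) / mu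
        = (r s - r (- s)) * (4 * s * w s ^ 3) / mu"
    proof -
      have "(mu - mu * A * r1 - - (mu - mu * A * r2)) * W\<^sup>2 = mu * (2 * W\<^sup>2 - r1 * W - r2 * W)" if "A * W = 1" for A W r1 r2 :: real
      proof -
        have "(mu - mu * A * r1 - - (mu - mu * A * r2)) * W\<^sup>2 = mu * (2 * W\<^sup>2 - r1 * W * (A * W) - r2 * W * (A * W))"
          by (simp add: algebra_simps power2_eq_square)
        then show ?thesis using that by simp
      qed
      from this[OF wD[of s]] have eq: "(mu - mu * (1 + s\<^sup>2) * r s - - (mu - mu * (1 + s\<^sup>2) * r (- s))) * (w s)\<^sup>2
          = mu * (2 * (w s)\<^sup>2 - r s * w s - r (- s) * w s)" .
      show ?thesis unfolding eq using mu by (simp add: field_simps)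
    qed
    ultimately show "(X has_real_derivative (r s - r (- s)) * (4 * s * w s ^ 3) / mu) (at s within {0..S})"
      by (simp add: has_field_derivative_at_within)
    show "0 \<le> (r s - r (- s)) * (4 * s * w s ^ 3) / mu"
      using p_nonneg[OF s] s mu wpos[of s] by (intro divide_nonneg_nonneg mult_nonneg_nonneg) auto
  qed (use S in auto)
  moreover have "0 \<le> (r S - r (- S)) * (w S)\<^sup>2 / mu" using p_nonneg[of S] S mu by auto
  ultimately have YS: "0 \<le> Y S - Y (- S)" unfolding X_def by simp
  \<comment> \<open>An antiderivative of w^2; it carries the half of 2 w^2 that r cannot
    cancel.\<close>
  define V where "V = (\<lambda>s. (arctan s + s * w s) / 2)"
  have V: "(V has_real_derivative (w s)\<^sup>2) (at s)" for s
  proof -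
    have "(V has_real_derivative (w s + (1 * w s + (- 2 * s * (w s)\<^sup>2) * s)) / 2) (at s)"
      unfolding V_def using deriv_arctan_shift[of 0 s UNIV]
      by (intro DERIV_cdivide DERIV_add DERIV_mult w DERIV_ident) (simp add: w_def)
    moreover have "(W + (1 * W + (- 2 * s * W\<^sup>2) * s)) / 2 = W\<^sup>2" if "(1 + s\<^sup>2) * W = 1" for W
    proof -
      have "(W + (1 * W + (- 2 * s * W\<^sup>2) * s)) / 2 = W * (1 + W - (1 + s\<^sup>2) * W)" by (simp add: field_simps power2_eq_square)
      then show ?thesis using that by (simp add: power2_eq_square)
    qed
    ultimately show ?thesis using wD by simp
  qed
  define Z where "Z = (\<lambda>s. Y s - Y (- S) + (V s - V (- S)))"
  have Z: "(Z has_real_derivative 2 * (w s)\<^sup>2 - r s * w s) (at s)" for s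
    unfolding Z_def by (rule derivative_eq_intros Y V refl | simp)+
  have ZS: "arctan S \<le> Z S"
  proof -
    have "Z S = Y S - Y (- S) + (arctan S + S * w S)" unfolding Z_def V_def by (simp add: arctan_minus weven field_simps)
    moreover have "0 \<le> S * w S" using S wpos[of S] by (intro mult_nonneg_nonneg) auto
    ultimately show ?thesis using YS by linarith
  qed
  \<comment> \<open>Beyond S only r <= 1 is used, so at most the arctan tail is lost. This leaves 2
    arctan S - pi/2 >= pi/2 - 2/S, and S >= 100 makes it exceed 3/2.\<close>
  have "3 / 2 \<le> Z s" if "S \<le> s" for s
  proof -
    have "Z S + arctan S \<le> Z s + arctan s"
    proof (rule deriv_nonneg_le[OF that, where p = "\<lambda>s. Z s + arctan s" and p' = "\<lambda>s. 2 * (w s)\<^sup>2 - r s * w s + w s"])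
      fix x assume x: "S \<le> x" "x \<le> s"
      have "((\<lambda>s. Z s + arctan s) has_real_derivative 2 * (w x)\<^sup>2 - r x * w x + w x) (at x)"
        using Z deriv_arctan_shift[of 0 x UNIV] unfolding w_def by (intro DERIV_add) auto
      then show "((\<lambda>s. Z s + arctan s) has_real_derivative 2 * (w x)\<^sup>2 - r x * w x + w x) (at x within {S..s})"
        by (rule has_field_derivative_at_within)
      have "r x * w x \<le> 1 * w x" using r_le_1[of x] x S wpos[of x] by (intro mult_right_mono) auto
      then show "0 \<le> 2 * (w x)\<^sup>2 - r x * w x + w x" by (smt (verit) zero_le_power2)
    qed
    moreover have "1 / S \<le> 1 / 100" using S by (intro divide_left_mono) auto
    moreover have "pi / 2 - 1 / S \<le> arctan S" using arctan_ge[of S] S by auto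
    moreover have "arctan s < pi / 2" using arctan_bounded[of s] by auto
    moreover note ZS
    moreover have "pi \<ge> 157 / 50" using pi_approx by simp
    ultimately show ?thesis by linarith
  qed
  moreover have "2 * (w s)\<^sup>2 - r s * w s = 2 / (1 + s\<^sup>2)\<^sup>2 - r s / (1 + s\<^sup>2)" for s by (simp add: w_def power_divide)
  ultimately show thesis using that[of r Z] r r0 Z by (simp add: Z_def)
qed

section \<open>Passing one resonance\<close>

text \<open>Four to the power of minus the distance of k and l; the sum of the two truncated
  differences is the distance.\<close>

definition dq :: "nat \<Rightarrow> nat \<Rightarrow> real" where "dq k l = 1 / 4 ^ ((l - k) + (k - l))"

lemma dq_pos: "0 < dq k l" and dq_le_1: "dq k l \<le> 1" by (simp_all add: dq_def)
lemma dq_self [simp]: "dq k k = 1" by (simp add: dq_def)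
lemma dq_Suc [simp]: "dq k (Suc k) = 1 / 4" "dq (Suc k) k = 1 / 4" by (simp_all add: dq_def)
lemma dq_le: assumes "(l' - k') + (k' - l') + j \<ge> (l - k) + (k - l)" shows "dq k' l' \<le> 4 ^ j * dq k l"
proof -
  have "(4::real) ^ ((l - k) + (k - l)) \<le> 4 ^ ((l' - k') + (k' - l') + j)" using assms by (intro power_increasing) auto
  then show ?thesis by (simp add: dq_def divide_simps power_add mult_ac)
qed
lemma dq_nbr: "dq k (l + 1) \<le> 4 * dq k l" "dq k (l - 1) \<le> 4 * dq k l" "dq (k - 1) l \<le> 4 * dq k l" "dq k l \<le> 4 * dq (k - 1) l"
  by (rule dq_le[where j = 1, simplified], arith)+

context modes begin

text \<open>Majorants during the passage of resonance k, for |th_k| = p at its start. The values 40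
  and 160 leave room for \<open>absorb\<close>: 40 is twice the entry bound 20, and 160 b_k is more
  than four times the mass 12 pi b_k sent to a neighbour. In \<open>stepP\<close> the value 8 at l =
  k is four times the bound 2 on th_k, as the row w Q <= P / 4 demands.\<close>

definition stepQ :: "nat \<Rightarrow> real \<Rightarrow> nat \<Rightarrow> real \<Rightarrow> real" where
  "stepQ k p l t = p * (if l = k then 2 else if l = k + 1 \<or> l + 1 = k then 160 * b k else 40 * dq k l)"
definition stepP :: "nat \<Rightarrow> real \<Rightarrow> nat \<Rightarrow> real \<Rightarrow> real" where
  "stepP k p l t = p * (if l = k then 8 else dq k l)"

text \<open>A resonance of strength 636 with c below 1/1000 forces eta to be huge compared with k^3,
  so corrections of relative order k / eta are negligible.\<close>

lemma eta_large:
  assumes "1 \<le> k" "636 \<le> b k"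
  shows "636000 * real k ^ 3 \<le> eta"
proof -
  have "636 * real k ^ 3 \<le> c * eta" using assms unfolding b_def by (simp add: field_simps)
  moreover have "c * eta \<le> 1 / 1000 * eta" using c_small eta_pos by (intro mult_right_mono) auto
  ultimately show ?thesis by linarith
qed

text \<open>The neighbours k + 1 and k - 1 may grow to 160 b_k p, but off resonance
  \<open>th\<close> acts through w^2, and there w is of order k^4 / eta^2. The product with b_k is
  of order c k / eta.\<close>

lemma off_resonance_small:
  assumes "1 \<le> k" "636 \<le> b k"
  shows "320 * b k * ((real k + 1) * (2 * real k + 1) / eta)\<^sup>2 \<le> 1 / 1000"
proof -
  have k: "1 \<le> real k" using assms by simp
  have k3: "real k ^ 3 \<ge> real k" using power_increasing[of 1 3 "real k"] k by simp
  have "(real k + 1) * (2 * real k + 1) \<le> (2 * real k) * (3 * real k)" using k by (intro mult_mono) auto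
  then have "((real k + 1) * (2 * real k + 1))\<^sup>2 \<le> (6 * (real k)\<^sup>2)\<^sup>2" by (intro power_mono) (auto simp: power2_eq_square)
  then have "320 * b k * ((real k + 1) * (2 * real k + 1) / eta)\<^sup>2 \<le> 320 * b k * ((6 * (real k)\<^sup>2)\<^sup>2 / eta\<^sup>2)"
    unfolding power_divide using b_nonneg by (intro mult_left_mono divide_right_mono) auto
  also have "\<dots> = c * (11520 * real k / eta)"
    unfolding b_def using k eta_pos by (simp add: field_simps power2_eq_square power3_eq_cube)
  also have "\<dots> \<le> 1 / 1000 * 1"
  proof (rule mult_mono)
    have "11520 * real k \<le> eta" using eta_large[OF assms] k3 k by linarith
    then show "11520 * real k / eta \<le> 1" using eta_pos by simp
  qed (use c_small c_pos k eta_pos in auto)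
  finally show ?thesis by simp
qed

lemma c_aux:
  assumes "0 \<le> X"
  shows "11 / 10 * X * (3 * c) \<le> X / 250 \<and> 22 / 10 * X * (3 * c) \<le> X / 125"
proof -
  have "X * c \<le> X * (1 / 1000)" using assms c_small by (intro mult_left_mono) auto
  then show ?thesis using assms by linarith
qed

text \<open>One bound for resonances passed and resonances to come. The window has a right end only
  for k >= 2; after the resonance of mode 1 none is left.\<close>

lemma w_off_resonance:
  assumes "1 \<le> k" "1 \<le> m" "m \<noteq> k" "tau k \<le> t" "2 \<le> k \<Longrightarrow> t \<le> tau (k - 1)"
  shows "w m t \<le> ((real k + 1) * (2 * real k + 1) / eta)\<^sup>2"
proof (cases "k < m")
  case False
  then have m: "m \<le> k - 1" "2 \<le> k" using assms by auto
  have "w m t \<le> (real (k - 1) * (2 * real (k - 1) + 1) / eta)\<^sup>2" by (rule w_left_le) (use assms m in auto)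
  also have "\<dots> \<le> ((real k + 1) * (2 * real k + 1) / eta)\<^sup>2"
    using eta_pos by (intro power_mono divide_right_mono mult_mono divide_nonneg_nonneg) auto
  finally show ?thesis .
qed (use w_right_le assms in auto)

lemma accum_off_resonance:
  assumes "1 \<le> k" "1 \<le> m" "m \<noteq> k" "2 \<le> k \<Longrightarrow> t \<le> tau (k - 1)"
  shows "accum (\<lambda>s. real m * b m * w m s) (tau k) t (3 * c)"
proof (cases "k < m")
  case False
  then show ?thesis using assms by (intro accum_w_left[of m "k - 1"]) auto
qed (use accum_w_right assms in auto)

context
  fixes k :: nat and p T :: real
  assumes k: "1 \<le> k" "636 \<le> b k" "0 \<le> p" "2 \<le> k \<Longrightarrow> T \<le> tau (k - 1)"
begin

lemma step_flux_off:
  assumes "1 \<le> m" "m \<noteq> k" "tau k \<le> s" "s \<le> T"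
  shows "flux (stepQ k p) (stepP k p) m s \<le> 11 / 10 * dq k m * p * (b m * w m s)"
proof -
  define d where "d = ((real k + 1) * (2 * real k + 1) / eta)\<^sup>2"
  have d: "320 * b k * d \<le> 1 / 1000" unfolding d_def by (rule off_resonance_small[OF k(1,2)])
  have d0: "0 \<le> d" unfolding d_def by simp
  have "320 * 636 * d \<le> 320 * b k * d" using k(2) d0 by (intro mult_right_mono) auto
  then have d2: "80 * d \<le> 1 / 1000" using d d0 by linarith
  have w: "w m s \<le> d" unfolding d_def using assms k by (intro w_off_resonance) auto
  have "2 * w m s * stepQ k p m s \<le> 2 * d * stepQ k p m s"
    using w b_nonneg[of k] k(3) dq_pos[of k m] by (intro mult_right_mono) (auto simp: stepQ_def)
  also have "\<dots> \<le> 1 / 10 * dq k m * p"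
  proof (cases "m = k + 1 \<or> m + 1 = k")
    case True
    then have e: "dq k m = 1 / 4" by auto
    have q: "2 * d * stepQ k p m s = 320 * b k * d * p" using True by (auto simp: stepQ_def)
    show ?thesis unfolding q e using mult_right_mono[OF d k(3)] k(3) by linarith
  next
    case False
    then have "2 * d * stepQ k p m s = 80 * d * (dq k m * p)" using assms by (auto simp: stepQ_def)
    also have "\<dots> \<le> 1 / 10 * (dq k m * p)" using d2 dq_pos[of k m] k(3) by (intro mult_right_mono) auto
    finally show ?thesis by simp
  qed
  finally have "2 * w m s * stepQ k p m s + stepP k p m s \<le> 11 / 10 * dq k m * p"
    using assms by (simp add: stepP_def algebra_simps)
  then have "b m * w m s * (2 * w m s * stepQ k p m s + stepP k p m s) \<le> b m * w m s * (11 / 10 * dq k m * p)"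
    using b_nonneg[of m] w_pos[of m s] by (intro mult_left_mono mult_nonneg_nonneg) auto
  then show ?thesis by (simp add: flux_def algebra_simps power2_eq_square)
qed

text \<open>Up to the factor 11/10 the flux is b_m w_m times the bound on \<open>H\<close>, so the
  mass 3 c of \<open>accum_off_resonance\<close> gives 3.3 c and, with l <= 2 m, 6.6 c.\<close>

lemma accum_step_flux_off:
  assumes "m \<noteq> k" "t \<le> T"
  shows "accum (flux (stepQ k p) (stepP k p) m) (tau k) t (dq k m * p / 250)"
    and "l \<le> m + 1 \<Longrightarrow> accum (\<lambda>s. real l / (1 + s\<^sup>2) * flux (stepQ k p) (stepP k p) m s) (tau k) t (dq k m * p / 125)"
proof -
  have dp: "0 \<le> dq k m * p" using dq_pos[of k m] k(3) by simp
  have "accum (flux (stepQ k p) (stepP k p) m) (tau k) t (dq k m * p / 250) \<and>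
    (l \<le> m + 1 \<longrightarrow> accum (\<lambda>s. real l / (1 + s\<^sup>2) * flux (stepQ k p) (stepP k p) m s) (tau k) t (dq k m * p / 125))"
  proof (cases "m = 0")
    case True
    then show ?thesis using accum_le[OF accum_zero, of _ _ "\<lambda>_. 0"] dp by (auto simp: flux_def[abs_def])
  next
    case False
    then have m: "1 \<le> m" by simp
    have ac: "accum (\<lambda>s. real m * b m * w m s) (tau k) t (3 * c)"
      using k assms m by (intro accum_off_resonance) auto
    have c3: "3 * c \<le> 3 / 1000" using c_small by simp
    have fl: "flux (stepQ k p) (stepP k p) m s \<le> 11 / 10 * (dq k m * p) * (b m * w m s)" if "tau k \<le> s" "s \<le> t" for s
      using step_flux_off[of m s] that assms m by (simp add: mult_ac)
    have bw: "0 \<le> b m * w m s" for s using b_nonneg[of m] w_pos[of m s] by simp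
    have 1: "accum (flux (stepQ k p) (stepP k p) m) (tau k) t (dq k m * p / 250)"
    proof (rule accum_le[OF accum_cmult[OF ac, of "11 / 10 * (dq k m * p)"]])
      fix s assume s: "tau k \<le> s" "s \<le> t"
      have "1 * (b m * w m s) \<le> real m * (b m * w m s)" using m bw by (intro mult_right_mono) auto
      then have "11 / 10 * (dq k m * p) * (b m * w m s) \<le> 11 / 10 * (dq k m * p) * (real m * b m * w m s)"
        using dp by (intro mult_left_mono) (auto simp: mult_ac)
      then show "flux (stepQ k p) (stepP k p) m s \<le> 11 / 10 * (dq k m * p) * (real m * b m * w m s)"
        using fl[OF s] by linarith
    next
      show "11 / 10 * (dq k m * p) * (3 * c) \<le> dq k m * p / 250"
        using c_aux[OF dp] by simp
    qed (use dp in simp)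
    have 2: "accum (\<lambda>s. real l / (1 + s\<^sup>2) * flux (stepQ k p) (stepP k p) m s) (tau k) t (dq k m * p / 125)" if "l \<le> m + 1"
    proof (rule accum_le[OF accum_cmult[OF ac, of "22 / 10 * (dq k m * p)"]])
      fix s assume s: "tau k \<le> s" "s \<le> t"
      have "real l / (1 + s\<^sup>2) \<le> real l / 1" by (intro divide_left_mono) (auto simp: add_pos_nonneg)
      also have "\<dots> \<le> 2 * real m" using that m by simp
      finally have lm: "real l / (1 + s\<^sup>2) \<le> 2 * real m" .
      have "real l / (1 + s\<^sup>2) * flux (stepQ k p) (stepP k p) m s \<le> real l / (1 + s\<^sup>2) * (11 / 10 * (dq k m * p) * (b m * w m s))"
        using fl[OF s] by (intro mult_left_mono) auto
      also have "\<dots> \<le> 2 * real m * (11 / 10 * (dq k m * p) * (b m * w m s))"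
        using lm mult_nonneg_nonneg[OF dp bw[of s]] by (intro mult_right_mono) (auto simp: mult_ac)
      finally show "real l / (1 + s\<^sup>2) * flux (stepQ k p) (stepP k p) m s \<le> 22 / 10 * (dq k m * p) * (real m * b m * w m s)"
        by (simp add: mult_ac)
    next
      show "22 / 10 * (dq k m * p) * (3 * c) \<le> dq k m * p / 125"
        using c_aux[OF dp] by simp
    qed (use dp in simp)
    show ?thesis using 1 2 by blast
  qed
  then show "accum (flux (stepQ k p) (stepP k p) m) (tau k) t (dq k m * p / 250)"
    and "l \<le> m + 1 \<Longrightarrow> accum (\<lambda>s. real l / (1 + s\<^sup>2) * flux (stepQ k p) (stepP k p) m s) (tau k) t (dq k m * p / 125)"
    by auto
qed

lemma step_flux_res: "flux (stepQ k p) (stepP k p) k s \<le> 12 * (b k * p) * w k s"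
proof -
  have "(w k s)\<^sup>2 \<le> w k s" using w_pos[of k s] w_le_1[of k s] by (simp add: power2_eq_square mult_left_le)
  then have "b k * p * (4 * (w k s)\<^sup>2 + 8 * w k s) \<le> b k * p * (12 * w k s)"
    using b_nonneg[of k] k(3) by (intro mult_left_mono) auto
  then show ?thesis by (simp add: flux_def stepQ_def stepP_def algebra_simps)
qed

text \<open>The resonant flux has mass at most 12 pi b_k p. In the term with f it is multiplied by l
  / (1 + s^2) at times of order eta / k, so only a contribution of order c / eta survives although
  b_k is large.\<close>

lemma accum_step_flux_res:
  shows "accum (flux (stepQ k p) (stepP k p) k) (tau k) t (38 * b k * p)"
    and "l \<le> k + 1 \<Longrightarrow> accum (\<lambda>s. real l / (1 + s\<^sup>2) * flux (stepQ k p) (stepP k p) k s) (tau k) t (p / 1000)"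
proof -
  have bp: "0 \<le> b k * p" using b_nonneg[of k] k(3) by simp
  have ac: "accum (w k) (tau k) t pi" using accum_lorentz[of "eta / real k"] by (simp add: w_def[abs_def])
  have pi: "pi \<le> 38 / 12" using pi_approx by simp
  show "accum (flux (stepQ k p) (stepP k p) k) (tau k) t (38 * b k * p)"
  proof (rule accum_le[OF accum_cmult[OF ac, of "12 * (b k * p)"]])
    show "12 * (b k * p) * pi \<le> 38 * b k * p" using mult_left_mono[OF pi bp] by (simp add: mult_ac)
  qed (use step_flux_res bp in auto)
  assume l: "l \<le> k + 1"
  have kk: "1 \<le> real k" using k by simp
  define A where "A = 9 * (real k)\<^sup>2 / (4 * eta\<^sup>2)"
  have tk: "1 / (tau k)\<^sup>2 \<le> A"
  proof -
    have "2 * eta / (3 * real k) \<le> tau k" unfolding tau_def using kk eta_pos by (intro divide_left_mono) auto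
    then have "(2 * eta / (3 * real k))\<^sup>2 \<le> (tau k)\<^sup>2" using kk eta_pos by (intro power_mono) auto
    then have "1 / (tau k)\<^sup>2 \<le> 1 / (2 * eta / (3 * real k))\<^sup>2" using kk eta_pos tau_pos[of k] by (intro divide_left_mono) auto
    then show ?thesis by (simp add: A_def power_divide power_mult_distrib)
  qed
  have A0: "0 \<le> A" by (simp add: A_def)
  show "accum (\<lambda>s. real l / (1 + s\<^sup>2) * flux (stepQ k p) (stepP k p) k s) (tau k) t (p / 1000)"
  proof (rule accum_le[OF accum_cmult[OF ac, of "(2 * real k * A) * (12 * (b k * p))"]])
    fix s assume s: "tau k \<le> s" "s \<le> t"
    have "(tau k)\<^sup>2 \<le> s\<^sup>2" using s tau_pos[of k] by (intro power_mono) auto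
    then have "1 / (1 + s\<^sup>2) \<le> 1 / (tau k)\<^sup>2" using tau_pos[of k] by (intro divide_left_mono) (auto simp: add_pos_nonneg)
    then have "1 / (1 + s\<^sup>2) \<le> A" using tk by linarith
    then have "real l * (1 / (1 + s\<^sup>2)) \<le> (2 * real k) * A" using l k by (intro mult_mono) auto
    then show "real l / (1 + s\<^sup>2) * flux (stepQ k p) (stepP k p) k s \<le> 2 * real k * A * (12 * (b k * p)) * w k s"
      using mult_mono[of "real l / (1 + s\<^sup>2)" "2 * real k * A" "flux (stepQ k p) (stepP k p) k s" "12 * (b k * p) * w k s"]
        step_flux_res[of s] A0 kk b_nonneg[of k] w_pos[of k s] k(3)
      by (auto simp: mult.assoc flux_def stepQ_def stepP_def)
  next
    have "2 * real k * A * (12 * (b k * p)) * pi \<le> 2 * real k * A * (12 * (b k * p)) * 4"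
      using A0 kk b_nonneg k(3) pi by (intro mult_left_mono mult_nonneg_nonneg) auto
    also have "\<dots> = c * p * (216 / eta)" unfolding A_def b_def using kk eta_pos by (simp add: field_simps power2_eq_square power3_eq_cube)
    also have "\<dots> \<le> 1 / 1000 * p * 1"
    proof (intro mult_mono)
      have "1 \<le> real k ^ 3" using kk by simp
      then have "216 \<le> eta" using eta_large[OF k(1,2)] by linarith
      then show "216 / eta \<le> 1" using eta_pos by simp
    qed (use c_small c_pos k eta_pos in auto)
    finally show "2 * real k * A * (12 * (b k * p)) * pi \<le> p / 1000" by simp
  qed (use A0 bp kk in auto)
qed

end

end

text \<open>A qualitative bound with unspecified constant, from which \<open>absorb\<close> starts.
  It is asked for every ratio \<open>R\<close> because the majorants of the different phases decay
  at different rates.\<close>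

locale modes_sol_ap = modes_sol +
  assumes apriori: "\<And>R T. 1 \<le> R \<Longrightarrow> \<exists>C. \<forall>l\<ge>1. \<forall>t. 0 \<le> t \<longrightarrow> t \<le> T \<longrightarrow>
     cmod (th t l) \<le> C / R ^ l \<and> cmod (H t l) \<le> C / R ^ l"
begin

text \<open>Mode k dominates when its resonance window opens. The constants 20 and 1/20 reproduce
  themselves from one window to the next.\<close>

definition ready :: "nat \<Rightarrow> bool" where
  "ready k \<longleftrightarrow> 0 < cmod (th (tau k) k) \<and> (\<forall>l\<ge>1. cmod (th (tau k) l) \<le> 20 * dq k l * cmod (th (tau k) k) \<and>
     cmod (H (tau k) l) \<le> dq k l * cmod (th (tau k) k) / 20)"

context
  fixes k :: nat and T p :: real
  assumes k: "1 \<le> k" "636 \<le> b k" "2 \<le> k \<Longrightarrow> T \<le> tau (k - 1)"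
    and rdy: "ready k" and p: "p = cmod (th (tau k) k)"
begin

lemma p_pos: "0 < p" using rdy p by (simp add: ready_def)

lemma step_majorant:
  assumes "1 \<le> l" "tau k \<le> t" "t \<le> T"
  shows "cmod (th t l) \<le> stepQ k p l t" "cmod (H t l) \<le> stepP k p l t"
proof -
  let ?Q = "stepQ k p" and ?P = "stepP k p"
  have p0: "0 \<le> p" using p_pos by simp
  note off = accum_step_flux_off[OF k(1,2) p0 k(3)]
  note res = accum_step_flux_res[OF k(1,2) p0 k(3)]
  \<comment> \<open>The ratio 4 matches the decay of \<open>dq\<close>, so this bound is a finite
    multiple of the majorant.\<close>
  obtain C where C: "\<And>l t. 1 \<le> l \<Longrightarrow> 0 \<le> t \<Longrightarrow> t \<le> T \<Longrightarrow> cmod (th t l) \<le> C / 4 ^ l \<and> cmod (H t l) \<le> C / 4 ^ l"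
    using apriori[of 4 T] by auto
  have dq4: "1 / 4 ^ l \<le> 4 ^ k * dq k l" for l
    using power_increasing[of "(l - k) + (k - l)" "l + k" "4::real"] by (simp add: dq_def divide_simps power_add mult_ac)
  have dp: "0 < dq k l * p" for l using dq_pos[of k l] p_pos by simp
  have Qd: "dq k l * p \<le> ?Q l t" and Pd: "dq k l * p \<le> ?P l t" for l t
    using dq_le_1[of k l] dq_pos[of k l] p_pos k(2) by (auto simp: stepQ_def stepP_def mult_ac)
  have init: "cmod (th (tau k) l) \<le> 20 * dq k l * p" "cmod (H (tau k) l) \<le> dq k l * p / 20" if "1 \<le> l" for l
    using rdy that p by (auto simp: ready_def)
  have nb: "dq k (l + 1) * p \<le> 4 * (dq k l * p)" "dq k (l - 1) * p \<le> 4 * (dq k l * p)" for l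
    using mult_right_mono[OF dq_nbr(1)[of k l] p0] mult_right_mono[OF dq_nbr(2)[of k l] p0] by (simp_all add: mult_ac)
  have bp: "636 * p \<le> b k * p" using k(2) p0 by (intro mult_right_mono) auto
  have t0: "0 \<le> tau k" using tau_pos[of k] by simp
  have pos: "0 \<le> ?Q l t \<and> 0 \<le> ?P l t" for l t using Qd[of l t] Pd[of l t] dp[of l] by auto
  have ap: "cmod (th t l) \<le> max C 0 * 4 ^ k / p * ?Q l t \<and> cmod (H t l) \<le> max C 0 * 4 ^ k / p * ?P l t"
    if l: "1 \<le> l" and t: "tau k \<le> t" "t \<le> T" for l t
  proof -
    have "C / 4 ^ l \<le> max C 0 * (4 ^ k * dq k l)"
      using mult_mono[of C "max C 0" "1 / 4 ^ l" "4 ^ k * dq k l"] dq4[of l] by simp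
    also have "\<dots> = max C 0 * 4 ^ k / p * (dq k l * p)" using p_pos by simp
    finally have c: "C / 4 ^ l \<le> max C 0 * 4 ^ k / p * (dq k l * p)" .
    have n: "0 \<le> max C 0 * 4 ^ k / p" using p_pos by simp
    show ?thesis
      using C[OF l, of t] t tau_pos[of k] c mult_left_mono[OF Qd[of l t] n] mult_left_mono[OF Pd[of l t] n] by auto
  qed
  have ini: "cmod (th (tau k) l) \<le> ?Q l t / 2 \<and> cmod (H (tau k) l) \<le> ?P l t / 2" if l: "1 \<le> l" for l t
  proof -
    consider "l = k" | "l = k + 1 \<or> l + 1 = k" | "l \<noteq> k" "l \<noteq> k + 1" "l + 1 \<noteq> k" by blast
    then show ?thesis
    proof cases
      case 1
      then show ?thesis using init[OF l] p_pos by (simp add: stepQ_def stepP_def p[symmetric])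
    next
      case 2
      then have e: "dq k l = 1 / 4" by auto
      have "cmod (th (tau k) l) \<le> 5 * p" "cmod (H (tau k) l) \<le> p / 80" using init[OF l, unfolded e] by auto
      moreover have "?Q l t / 2 = 80 * (b k * p)" "?P l t / 2 = p / 8" using 2 by (auto simp: stepQ_def stepP_def)
      ultimately show ?thesis using bp p_pos by linarith
    next
      case 3
      then have "?Q l t / 2 = 20 * dq k l * p" "?P l t / 2 = dq k l * p / 2" by (auto simp: stepQ_def stepP_def)
      then show ?thesis using init[OF l] dp[of l] by linarith
    qed
  qed
  have rows: "accum (\<lambda>s. flux ?Q ?P (l + 1) s + flux ?Q ?P (l - 1) s) (tau k) t (?Q l t / 2) \<and>
      accum (\<lambda>s. real l / (1 + s\<^sup>2) * (flux ?Q ?P (l + 1) s + flux ?Q ?P (l - 1) s)) (tau k) t (?P l t / 4)"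
    if l: "1 \<le> l" and t: "tau k \<le> t" "t \<le> T" for l t
  proof -
    let ?f = "\<lambda>m s. real l / (1 + s\<^sup>2) * flux ?Q ?P m s"
    have comb: "accum (\<lambda>s. flux ?Q ?P (l + 1) s + flux ?Q ?P (l - 1) s) (tau k) t (?Q l t / 2) \<and>
       accum (\<lambda>s. ?f (l + 1) s + ?f (l - 1) s) (tau k) t (?P l t / 4)"
      if "accum (flux ?Q ?P (l + 1)) (tau k) t B1" "accum (flux ?Q ?P (l - 1)) (tau k) t B2"
        "accum (?f (l + 1)) (tau k) t C1" "accum (?f (l - 1)) (tau k) t C2"
        "B1 + B2 \<le> ?Q l t / 2" "C1 + C2 \<le> ?P l t / 4" for B1 B2 C1 C2
      by (intro conjI accum_le[OF accum_add[OF that(1,2)] order.refl that(5)] accum_le[OF accum_add[OF that(3,4)] order.refl that(6)])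
    have d1: "dq k m * p \<le> p" for m using mult_right_mono[OF dq_le_1[of k m] p0] by simp
    \<comment> \<open>Only the modes next to k receive the resonant flux; mode k itself and the
      distant modes are fed by off-resonant ones.\<close>
    consider "l = k" | "l = k + 1" | "l + 1 = k" | "l \<noteq> k" "l \<noteq> k + 1" "l + 1 \<noteq> k" by blast
    then have "accum (\<lambda>s. flux ?Q ?P (l + 1) s + flux ?Q ?P (l - 1) s) (tau k) t (?Q l t / 2) \<and>
       accum (\<lambda>s. ?f (l + 1) s + ?f (l - 1) s) (tau k) t (?P l t / 4)"
    proof cases
      case 1
      then have "?Q l t / 2 = p" "?P l t / 4 = 2 * p" by (auto simp: stepQ_def stepP_def)
      then show ?thesis using d1[of "l + 1"] d1[of "l - 1"] p_pos 1 l t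
        by (intro comb[OF off(1) off(1) off(2) off(2)]) (linarith | arith | simp)+
    next
      case 2
      then have "?Q l t / 2 = 80 * b k * p" "?P l t / 4 = p / 16" by (auto simp: stepQ_def stepP_def)
      moreover have "accum (flux ?Q ?P (l - 1)) (tau k) t (38 * b k * p)" "accum (?f (l - 1)) (tau k) t (p / 1000)"
        using res(1)[of t] res(2)[of l] 2 by auto
      moreover have "dq k (l + 1) * p \<le> p / 16" using 2 by (simp add: dq_def)
      ultimately show ?thesis using d1[of "l + 1"] bp p_pos 2 l t
        by (intro comb[OF off(1) _ off(2)]) (linarith | arith | simp)+
    next
      case 3
      then have "?Q l t / 2 = 80 * b k * p" "?P l t / 4 = p / 16" by (auto simp: stepQ_def stepP_def)
      moreover have "accum (flux ?Q ?P (l + 1)) (tau k) t (38 * b k * p)" "accum (?f (l + 1)) (tau k) t (p / 1000)"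
        using res(1)[of t] res(2)[of l] 3 by auto
      ultimately show ?thesis using d1[of "l - 1"] bp p_pos 3 l t
        by (intro comb[OF _ off(1) _ off(2)]) (linarith | arith | simp)+
    next
      case 4
      then have "?Q l t / 2 = 20 * (dq k l * p)" "?P l t / 4 = dq k l * p / 4" by (auto simp: stepQ_def stepP_def)
      moreover have "l - 1 \<noteq> k" using 4 l by auto
      ultimately show ?thesis using 4 nb[of l] dp[of l] l t
        by (intro comb[OF off(1) off(1) off(2) off(2)]) (linarith | arith | simp)+
    qed
    then show ?thesis by (auto simp: distrib_left)
  qed
  have row1: "w l s * ?Q l s \<le> ?P l t / 4" if l: "1 \<le> l" and s: "tau k \<le> s" "s \<le> t" "t \<le> T" for l s t
    proof (cases "l = k")
      case True
      then show ?thesis using mult_right_mono[OF w_le_1[of l s] p0] by (simp add: stepQ_def stepP_def mult.commute)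
    next
      case False
      define d where "d = ((real k + 1) * (2 * real k + 1) / eta)\<^sup>2"
      have d: "320 * b k * d \<le> 1 / 1000" unfolding d_def by (rule off_resonance_small[OF k(1,2)])
      have d0: "0 \<le> d" unfolding d_def by simp
      have "320 * 636 * d \<le> 320 * b k * d" using k(2) d0 by (intro mult_right_mono) auto
      then have d2: "40 * d \<le> 1 / 4" using d d0 by linarith
      have wd: "w l s \<le> d" unfolding d_def using False l s k by (intro w_off_resonance) auto
      have "w l s * ?Q l s \<le> d * ?Q l s" using wd dp[of l] Qd[of l s] by (intro mult_right_mono) auto
      also have "\<dots> \<le> ?P l t / 4"
      proof (cases "l = k + 1 \<or> l + 1 = k")
        case True
        then have e: "dq k l = 1 / 4" by auto
        have "d * ?Q l s = 160 * b k * d * p" using True by (auto simp: stepQ_def)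
        also have "\<dots> \<le> 1 / 16 * p" using d p0 by (intro mult_right_mono) auto
        finally show ?thesis using False by (simp add: stepP_def e)
      next
        case f: False
        then have "d * ?Q l s = 40 * d * (dq k l * p)" using False by (auto simp: stepQ_def)
        also have "\<dots> \<le> 1 / 4 * (dq k l * p)" using d2 dp[of l] by (intro mult_right_mono) auto
        finally show ?thesis using False by (simp add: stepP_def mult.commute)
      qed
      finally show ?thesis .
    qed
  show "cmod (th t l) \<le> ?Q l t" "cmod (H t l) \<le> ?P l t"
    using absorb[OF t0 pos ap ini _ row1 _ assms] rows by blast+
qed

end

end

section \<open>Amplification by a single resonance\<close>

context modes_sol_ap begin

context
  fixes k :: nat and T p :: real
  assumes k: "1 \<le> k" "636 \<le> b k" "2 \<le> k \<Longrightarrow> T \<le> tau (k - 1)"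
    and rdy: "ready k" and p: "p = cmod (th (tau k) k)"
begin

text \<open>The resonant mode is fed only by its two off-resonant neighbours, so it may be treated
  as frozen; each of them contributes p / 1000.\<close>

lemma step_th_k:
  assumes "tau k \<le> t" "t \<le> T"
  shows "cmod (th t k - th (tau k) k) \<le> p / 500"
proof -
  have p0: "0 \<le> p" using p_pos[OF k rdy p] by simp
  note off = accum_step_flux_off[OF k(1,2) p0 k(3)]
  have "accum (\<lambda>s. flux (stepQ k p) (stepP k p) (k + 1) s + flux (stepQ k p) (stepP k p) (k - 1) s) (tau k) t
      (dq k (k + 1) * p / 250 + dq k (k - 1) * p / 250)"
    by (intro accum_add off(1)) (use k assms in auto)
  then have "cmod (th t k - th (tau k) k) \<le> 1 * (dq k (k + 1) * p / 250 + dq k (k - 1) * p / 250)"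
    by (rule th_increment[rotated -1]) (use step_majorant[OF k rdy p] k assms tau_pos[of k] in auto)
  moreover have e: "dq k (k - 1) = 1 / 4" using k(1) by (cases k) auto
  ultimately show ?thesis unfolding e by simp
qed

lemma step_H_k:
  assumes "tau k \<le> t" "t \<le> T"
    and r: "\<And>s. (r has_real_derivative nu * (real k)\<^sup>2 - nu * (real k)\<^sup>2 * (1 + s\<^sup>2) * r s) (at s)" "r (tau k - eta / real k) = 0"
  shows "cmod (H t k + r (t - eta / real k) *\<^sub>R th (tau k) k) \<le> 3 / 50 * p"
proof -
  have p0: "0 \<le> p" using p_pos[OF k rdy p] by simp
  note off = accum_step_flux_off[OF k(1,2) p0 k(3)]
  define z where "z = th (tau k) k"
  define Y where "Y = (\<lambda>t. - r (t - eta / real k) *\<^sub>R z)"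
  have e: "dq k (k - 1) = 1 / 4" using k(1) by (cases k) auto
  have "accum (\<lambda>s. real k / (1 + s\<^sup>2) * (flux (stepQ k p) (stepP k p) (k + 1) s + flux (stepQ k p) (stepP k p) (k - 1) s)) (tau k) t
      (dq k (k + 1) * p / 125 + dq k (k - 1) * p / 125)"
    unfolding distrib_left by (intro accum_add off(2)) (use k assms in auto)
  then have "cmod (H t k - Y t) \<le> cmod (H (tau k) k - Y (tau k)) + p / 500 + 1 * (dq k (k + 1) * p / 125 + dq k (k - 1) * p / 125)"
  proof (rule H_increment[where z = z, rotated 7])
    fix s assume s: "tau k \<le> s" "s \<le> t"
    have "((\<lambda>t. r (t - eta / real k)) has_real_derivative nu * (real k)\<^sup>2 - nu * (real k)\<^sup>2 * (1 + (s - eta / real k)\<^sup>2) * r (s - eta / real k)) (at s)"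
      using r(1)[of "s + - (eta / real k)"] unfolding DERIV_shift by (simp only: add_uminus_conv_diff)
    then have "((\<lambda>t. - r (t - eta / real k)) has_real_derivative - (nu * (real k)\<^sup>2 - nu * (real k)\<^sup>2 * (1 + (s - eta / real k)\<^sup>2) * r (s - eta / real k))) (at s within {tau k..t})"
      by (rule has_field_derivative_at_within[OF DERIV_minus])
    from has_vector_derivative_scaleR[OF this has_vector_derivative_const[of z]]
    show "(Y has_vector_derivative - (nu * (real k)\<^sup>2) *\<^sub>R z - D k s *\<^sub>R Y s) (at s within {tau k..t})"
      unfolding Y_def D_def by (rule has_vector_derivative_eq_rhs) (simp add: algebra_simps)
    have "w k s * cmod (th s k - z) \<le> 1 * cmod (th s k - z)" using w_le_1[of k s] by (intro mult_right_mono) auto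
    also have "\<dots> \<le> p / 500" using step_th_k[of s] s assms unfolding z_def by auto
    finally show "w k s * cmod (th s k - z) \<le> p / 500" .
  next
    show "0 \<le> stepQ k p m s \<and> 0 \<le> stepP k p m s" for m s
      using p0 b_nonneg[of k] dq_pos[of k m] by (auto simp: stepQ_def stepP_def)
  qed (use step_majorant[OF k rdy p] k assms tau_pos[of k] in auto)
  moreover have "Y (tau k) = 0" using r(2) by (simp add: Y_def)
  moreover have "cmod (H (tau k) k) \<le> p / 20" using rdy p k(1) by (auto simp: ready_def)
  moreover have "H t k - Y t = H t k + r (t - eta / real k) *\<^sub>R th (tau k) k" by (simp add: Y_def z_def)
  ultimately show ?thesis using p0 unfolding e by simp
qed

text \<open>With th_k frozen at z and H_k close to -r z, the resonance contributes b_k Z z to each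
  neighbour, and the profile gives Z >= 3/2. The first admissible time is the mirror image of
  \<open>tau k\<close> about eta / k, where the symmetric window of the profile ends.\<close>

lemma step_growth:
  assumes t: "eta / real k + eta / (real k * (2 * real k + 1)) \<le> t" "t \<le> T" and l: "l = k + 1 \<or> (l + 1 = k \<and> 1 \<le> l)"
  shows "5 / 4 * b k * p \<le> cmod (th t l)"
proof -
  have p0: "0 \<le> p" using p_pos[OF k rdy p] by simp
  note off = accum_step_flux_off[OF k(1,2) p0 k(3)]
  define z S where "z = th (tau k) k" and "S = eta / (real k * (2 * real k + 1))"
  have kk: "1 \<le> real k" using k by simp
  have "0 < nu * (real k)\<^sup>2" using nu_pos kk by simp
  moreover have S100: "100 \<le> S"
  proof -
    have "real k * (2 * real k + 1) \<le> real k * (3 * real k)" using kk by (intro mult_left_mono) auto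
    also have "\<dots> = 3 * (real k ^ 2)" by (simp add: power2_eq_square)
    also have "\<dots> \<le> 3 * real k ^ 3" using kk by (intro mult_left_mono power_increasing) auto
    finally have "100 * (real k * (2 * real k + 1)) \<le> eta" using eta_large[OF k(1,2)] kk zero_le_power[of "real k" 3] by linarith
    then show ?thesis unfolding S_def using kk by (simp add: pos_le_divide_eq)
  qed
  ultimately obtain r Z where r: "\<And>s. (r has_real_derivative nu * (real k)\<^sup>2 - nu * (real k)\<^sup>2 * (1 + s\<^sup>2) * r s) (at s)" "r (- S) = 0"
    and Z: "\<And>s. (Z has_real_derivative 2 / (1 + s\<^sup>2)\<^sup>2 - r s / (1 + s\<^sup>2)) (at s)" "Z (- S) = 0"
    "\<And>s. S \<le> s \<Longrightarrow> 3 / 2 \<le> Z s" using resonance_profile by blast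
  have tS: "tau k - eta / real k = - S" unfolding tau_def S_def using kk by (simp add: field_simps)
  have tk: "tau k \<le> t" using t tS S100 unfolding S_def by linarith
  \<comment> \<open>The other neighbour of l. For k = 2 and l = 1 it is mode 0, which contributes
    nothing since \<open>b 0\<close> = 0.\<close>
  define m where "m = (if l = k + 1 then k + 2 else k - 2)"
  have m: "m \<noteq> k" using l by (auto simp: m_def)
  define X where "X = (\<lambda>t. th t l - (b k * Z (t - eta / real k)) *\<^sub>R z)"
  have bp: "636 * p \<le> b k * p" "0 \<le> b k * p" using k(2) p0 by (auto intro: mult_right_mono)
  have "cmod (X t - X (tau k)) \<le> dq k m * p / 250 + 8 / 125 * (b k * p) * pi"
  proof (rule accum_deriv_bound[where g = X, OF tk])
    have "accum (w k) (tau k) t pi" using accum_lorentz[of "eta / real k"] by (simp add: w_def[abs_def])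
    then show "accum (\<lambda>s. flux (stepQ k p) (stepP k p) m s + 8 / 125 * (b k * p) * w k s) (tau k) t (dq k m * p / 250 + 8 / 125 * (b k * p) * pi)"
      by (intro accum_add off(1) accum_cmult) (use t m bp in auto)
    fix s assume s: "tau k \<le> s" "s \<le> t"
    let ?s = "s - eta / real k"
    have "((\<lambda>t. Z (t - eta / real k)) has_real_derivative 2 * (w k s)\<^sup>2 - r ?s * w k s) (at s)"
      using Z(1)[of "s + - (eta / real k)"] unfolding DERIV_shift by (simp add: w_def power_divide)
    then have "((\<lambda>t. b k * Z (t - eta / real k)) has_real_derivative b k * (2 * (w k s)\<^sup>2 - r ?s * w k s)) (at s within {tau k..t})"
      by (rule has_field_derivative_at_within[OF DERIV_cmult])
    from has_vector_derivative_scaleR[OF this has_vector_derivative_const[of z]]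
    have "((\<lambda>t. (b k * Z (t - eta / real k)) *\<^sub>R z) has_vector_derivative (b k * (2 * (w k s)\<^sup>2 - r ?s * w k s)) *\<^sub>R z) (at s within {tau k..t})"
      by simp
    moreover have "((\<lambda>s. th s l) has_vector_derivative cpl (th s) (H s) l s) (at s within {tau k..t})"
      using th_deriv'[of l "tau k" s] l s tau_pos[of k] by auto
    ultimately show "(X has_vector_derivative cpl (th s) (H s) l s - (b k * (2 * (w k s)\<^sup>2 - r ?s * w k s)) *\<^sub>R z) (at s within {tau k..t})"
      unfolding X_def by (rule has_vector_derivative_diff[rotated])
    have "cpl (th s) (H s) l s = inflow (th s) (H s) m s + inflow (th s) (H s) k s"
      using l by (auto simp: cpl_def m_def)
    then have "cpl (th s) (H s) l s - (b k * (2 * (w k s)\<^sup>2 - r ?s * w k s)) *\<^sub>R z =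
       inflow (th s) (H s) m s + b k *\<^sub>R ((2 * (w k s)\<^sup>2) *\<^sub>R (th s k - z) + w k s *\<^sub>R (H s k + r ?s *\<^sub>R z))"
      by (simp add: inflow_def algebra_simps)
    also have "cmod \<dots> \<le> 1 * flux (stepQ k p) (stepP k p) m s + b k * ((2 * (w k s)\<^sup>2) * cmod (th s k - z) + w k s * cmod (H s k + r ?s *\<^sub>R z))"
    proof (rule norm_triangle_mono)
      show "cmod (inflow (th s) (H s) m s) \<le> 1 * flux (stepQ k p) (stepP k p) m s"
        by (rule inflow_bound) (use step_majorant[OF k rdy p, of m s] s t in auto)
      show "cmod (b k *\<^sub>R ((2 * (w k s)\<^sup>2) *\<^sub>R (th s k - z) + w k s *\<^sub>R (H s k + r ?s *\<^sub>R z))) \<le>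
        b k * ((2 * (w k s)\<^sup>2) * cmod (th s k - z) + w k s * cmod (H s k + r ?s *\<^sub>R z))"
        unfolding norm_scaleR using b_nonneg[of k] w_pos[of k s]
        by (auto intro!: mult_left_mono norm_triangle_le)
    qed
    \<comment> \<open>The two deviations add up to 2/500 + 3/50 = 8/125.\<close>
    also have "\<dots> \<le> 1 * flux (stepQ k p) (stepP k p) m s + b k * ((2 * w k s) * (p / 500) + w k s * (3 / 50 * p))"
    proof (intro add_left_mono mult_left_mono add_mono mult_mono)
      show "(w k s)\<^sup>2 \<le> w k s" using w_pos[of k s] w_le_1[of k s] by (simp add: power2_eq_square mult_left_le)
      show "cmod (th s k - z) \<le> p / 500" using step_th_k[of s] s t by (auto simp: z_def)
      show "cmod (H s k + r ?s *\<^sub>R z) \<le> 3 / 50 * p" unfolding z_def by (rule step_H_k) (use s t r tS in auto)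
    qed (use b_nonneg w_pos[of k s] in auto)
    also have "\<dots> = flux (stepQ k p) (stepP k p) m s + 8 / 125 * (b k * p) * w k s" by simp
    finally show "cmod (cpl (th s) (H s) l s - (b k * (2 * (w k s)\<^sup>2 - r ?s * w k s)) *\<^sub>R z) \<le> flux (stepQ k p) (stepP k p) m s + 8 / 125 * (b k * p) * w k s" .
  qed
  also have "\<dots> \<le> p / 250 + 8 / 125 * (b k * p) * (22 / 7)"
    using mult_right_mono[OF dq_le_1[of k m] p0] pi_approx bp by (intro add_mono divide_right_mono mult_left_mono) auto
  finally have dX: "cmod (X t - X (tau k)) \<le> p / 250 + 176 / 875 * (b k * p)" by simp
  have Xt: "X (tau k) = th (tau k) l" using Z(2) tS by (simp add: X_def)
  moreover have "cmod (th (tau k) l) \<le> 5 * p"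
  proof -
    have "dq k l = 1 / 4" using l by auto
    then have "20 * dq k l * p = 5 * p" by simp
    then show ?thesis using rdy p l unfolding ready_def by (metis le_add2)
  qed
  ultimately have "cmod (X t) \<le> 5 * p + (p / 250 + 176 / 875 * (b k * p))"
    using norm_triangle_sub[of "X t" "X (tau k)"] dX unfolding Xt by linarith
  moreover have "cmod ((b k * Z (t - eta / real k)) *\<^sub>R z) \<le> cmod (th t l) + cmod (X t)"
    using norm_triangle_ineq4[of "th t l" "X t"] by (simp add: X_def)
  moreover have "3 / 2 * (b k * p) \<le> cmod ((b k * Z (t - eta / real k)) *\<^sub>R z)"
  proof -
    have "S \<le> t - eta / real k" using t unfolding S_def by linarith
    then have "3 / 2 \<le> Z (t - eta / real k)" by (rule Z(3))
    then have "3 / 2 * (b k * p) \<le> Z (t - eta / real k) * (b k * p)" using bp by (intro mult_right_mono) auto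
    moreover have "cmod z = p" using p by (simp add: z_def)
    ultimately show ?thesis using b_nonneg[of k] \<open>3 / 2 \<le> Z _\<close> by (simp add: abs_mult mult_ac)
  qed
  \<comment> \<open>From 3/2 the error 176/875 and the starting terms of about 5 p <= (5/636) b_k p
    are subtracted; more than 5/4 is left.\<close>
  ultimately show ?thesis using bp p0 by simp
qed

text \<open>The resonant inflow from k is the same for both neighbours and cancels in their
  difference. This is the control of mode k + 1 that the next window needs: there it may be at most
  20/16 of the new leading mode, which the separate bounds 160 b_k p and 5/4 b_k p cannot
  give.\<close>

lemma step_difference:
  assumes "2 \<le> k" "tau k \<le> t" "t \<le> T"
  shows "cmod (th t (k + 1) - th t (k - 1)) \<le> 11 * p"
proof -
  have p0: "0 \<le> p" using p_pos[OF k rdy p] by simp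
  note off = accum_step_flux_off[OF k(1,2) p0 k(3)]
  have "cmod ((th t (k + 1) - th t (k - 1)) - (th (tau k) (k + 1) - th (tau k) (k - 1))) \<le> dq k (k + 2) * p / 250 + dq k (k - 2) * p / 250"
  proof (rule accum_deriv_bound[where g = "\<lambda>s. th s (k + 1) - th s (k - 1)", OF assms(2)])
    show "accum (\<lambda>s. flux (stepQ k p) (stepP k p) (k + 2) s + flux (stepQ k p) (stepP k p) (k - 2) s) (tau k) t (dq k (k + 2) * p / 250 + dq k (k - 2) * p / 250)"
      by (intro accum_add off(1)) (use assms in auto)
    fix s assume s: "tau k \<le> s" "s \<le> t"
    show "((\<lambda>s. th s (k + 1) - th s (k - 1)) has_vector_derivative (cpl (th s) (H s) (k + 1) s - cpl (th s) (H s) (k - 1) s)) (at s within {tau k..t})"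
      by (intro has_vector_derivative_diff th_deriv') (use assms s tau_pos[of k] in auto)
    have "cpl (th s) (H s) (k + 1) s - cpl (th s) (H s) (k - 1) s = inflow (th s) (H s) (k + 2) s - inflow (th s) (H s) (k - 2) s"
      using assms by (simp add: cpl_def numeral_2_eq_2)
    also have "cmod \<dots> \<le> cmod (inflow (th s) (H s) (k + 2) s) + cmod (inflow (th s) (H s) (k - 2) s)" by (rule norm_triangle_ineq4)
    also have "\<dots> \<le> 1 * flux (stepQ k p) (stepP k p) (k + 2) s + 1 * flux (stepQ k p) (stepP k p) (k - 2) s"
      by (intro add_mono inflow_bound) (use step_majorant[OF k rdy p] s assms in auto)
    finally show "cmod (cpl (th s) (H s) (k + 1) s - cpl (th s) (H s) (k - 1) s) \<le> flux (stepQ k p) (stepP k p) (k + 2) s + flux (stepQ k p) (stepP k p) (k - 2) s" by simp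
  qed
  moreover have "dq k m * p \<le> p" for m using mult_right_mono[OF dq_le_1[of k m] p0] by simp
  note this[of "k + 2"] this[of "k - 2"]
  moreover have a: "cmod (th (tau k) l) \<le> 5 * p" if "l = k + 1 \<or> l + 1 = k" "1 \<le> l" for l
  proof -
    have "dq k l = 1 / 4" using that by auto
    then have "20 * dq k l * p = 5 * p" by simp
    then show ?thesis using rdy p that unfolding ready_def by metis
  qed
  have "cmod (th (tau k) (k + 1)) \<le> 5 * p" "cmod (th (tau k) (k - 1)) \<le> 5 * p"
    by (rule a; use assms in auto)+
  moreover have "cmod (th (tau k) (k + 1) - th (tau k) (k - 1)) \<le> cmod (th (tau k) (k + 1)) + cmod (th (tau k) (k - 1))" by (rule norm_triangle_ineq4)
  moreover have "cmod (th t (k + 1) - th t (k - 1)) \<le> cmod ((th t (k + 1) - th t (k - 1)) - (th (tau k) (k + 1) - th (tau k) (k - 1))) + cmod (th (tau k) (k + 1) - th (tau k) (k - 1))"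
    by (metis norm_triangle_sub add.commute)
  ultimately show ?thesis using p0 by linarith
qed

end

text \<open>The new leading mode is k - 1 with size q >= 795 p. Everything bounded by a multiple of
  p alone becomes small relative to q, and mode k + 1 is within 11 p of q.\<close>

lemma ready_step:
  assumes "2 \<le> k" "636 \<le> b k" and rdy: "ready k"
  shows "ready (k - 1)" "5 / 4 * b k * cmod (th (tau k) k) \<le> cmod (th (tau (k - 1)) (k - 1))"
    "cmod (th (tau (k - 1)) (k - 1)) \<le> 160 * b k * cmod (th (tau k) k)"
proof -
  define p T where "p = cmod (th (tau k) k)" and "T = tau (k - 1)"
  have k: "1 \<le> k" "636 \<le> b k" "2 \<le> k \<Longrightarrow> T \<le> tau (k - 1)" using assms by (auto simp: T_def)
  have pp: "0 < p" by (rule p_pos[OF k rdy p_def])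
  define q where "q = cmod (th T (k - 1))"
  have kk: "2 \<le> real k" using assms by simp
  \<comment> \<open>The window reaches beyond the mirror image of its left end, since the gap eta /
    (k (2k - 1)) on the right exceeds the gap on the left.\<close>
  have tT: "eta / real k + eta / (real k * (2 * real k + 1)) \<le> T"
  proof -
    have "T - eta / real k = eta / (real k * (2 * real k - 1))" unfolding T_def tau_def using kk by (simp add: of_nat_diff field_simps)
    moreover have "eta / (real k * (2 * real k + 1)) \<le> eta / (real k * (2 * real k - 1))"
      using kk eta_pos by (intro divide_left_mono mult_left_mono mult_pos_pos) auto
    ultimately show ?thesis by linarith
  qed
  have tk: "tau k \<le> T" unfolding T_def tau_def using kk eta_pos by (intro divide_left_mono mult_pos_pos) (auto simp: of_nat_diff)
  show ge: "5 / 4 * b k * cmod (th (tau k) k) \<le> cmod (th (tau (k - 1)) (k - 1))"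
  proof -
    have "k - 1 = k + 1 \<or> (k - 1 + 1 = k \<and> 1 \<le> k - 1)" using assms by auto
    from step_growth[OF k rdy p_def tT order.refl this] show ?thesis unfolding p_def T_def .
  qed
  show "cmod (th (tau (k - 1)) (k - 1)) \<le> 160 * b k * cmod (th (tau k) k)"
  proof -
    have "1 \<le> k - 1" "k - 1 \<noteq> k" "k - 1 + 1 = k" using assms by auto
    then show ?thesis using step_majorant(1)[OF k rdy p_def _ tk order.refl, of "k - 1"]
      by (simp add: stepQ_def p_def T_def mult_ac)
  qed
  have "636 * p \<le> b k * p" using k(2) pp by (intro mult_right_mono) auto
  then have q: "795 * p \<le> q" using ge unfolding q_def p_def T_def by simp
  have maj: "cmod (th T l) \<le> stepQ k p l T" "cmod (H T l) \<le> stepP k p l T" if "1 \<le> l" for l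
    using step_majorant[OF k rdy p_def _ tk order.refl, of l] that by auto
  have dqk: "dq (k - 1) k = 1 / 4" using assms dq_Suc(1)[of "k - 1"] by simp
  have dqk1: "dq (k - 1) (k + 1) = 1 / 16" using assms by (simp add: dq_def)
  show "ready (k - 1)"
    unfolding ready_def
  proof (intro conjI allI impI)
    show "0 < cmod (th (tau (k - 1)) (k - 1))" using q pp unfolding q_def T_def by linarith
    fix l :: nat assume l: "1 \<le> l"
    have dl: "dq k l * p \<le> 4 * (dq (k - 1) l * p)" using mult_right_mono[OF dq_nbr(4)[of k l], of p] pp by simp
    have dl0: "0 < dq (k - 1) l" by (rule dq_pos)
    have dpq: "dq (k - 1) l * (795 * p) \<le> dq (k - 1) l * q" using q dl0 by (intro mult_left_mono) auto
    have "cmod (th T l) \<le> 20 * dq (k - 1) l * q"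
    proof -
      consider "l = k - 1" | "l = k" | "l = k + 1" | "l \<noteq> k" "l \<noteq> k + 1" "l + 1 \<noteq> k" by arith
      then show ?thesis
      proof cases
        case 2
        have "cmod (th T l) \<le> 2 * p" using maj(1)[OF l] 2 by (simp add: stepQ_def)
        then show ?thesis using q pp unfolding 2 dqk by simp
      next
        case 3
        \<comment> \<open>The allowance is 20/16 q, so q + 11 p fits because q is at least 795
          p.\<close>
        have "cmod (th T (k + 1)) \<le> cmod (th T (k - 1)) + cmod (th T (k + 1) - th T (k - 1))"
          using norm_triangle_sub by blast
        then have "cmod (th T l) \<le> q + 11 * p"
          using step_difference[OF k rdy p_def assms(1) tk order.refl] 3 unfolding q_def by simp
        then show ?thesis using q pp unfolding 3 dqk1 by simp
      next
        case 4
        have "cmod (th T l) \<le> 40 * (dq k l * p)" using maj(1)[OF l] 4 by (simp add: stepQ_def mult_ac)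
        then show ?thesis using dl dpq mult_pos_pos[OF dl0 pp] by simp
      qed (use dq_self q_def in auto)
    qed
    then show "cmod (th (tau (k - 1)) l) \<le> 20 * dq (k - 1) l * cmod (th (tau (k - 1)) (k - 1))" by (simp add: T_def q_def)
    have "cmod (H T l) \<le> dq (k - 1) l * q / 20"
    proof (cases "l = k")
      case True
      \<comment> \<open>The tightest use of the gain: 8 p <= q / 80 needs q >= 640 p.\<close>
      have "cmod (H T l) \<le> 8 * p" using maj(2)[OF l] True by (simp add: stepP_def)
      then show ?thesis using q pp unfolding True dqk by simp
    next
      case False
      then have "cmod (H T l) \<le> dq k l * p" using maj(2)[OF l] by (simp add: stepP_def mult_ac)
      then show ?thesis using dl dpq mult_pos_pos[OF dl0 pp] by simp
    qed
    then show "cmod (H (tau (k - 1)) l) \<le> dq (k - 1) l * cmod (th (tau (k - 1)) (k - 1)) / 20" by (simp add: T_def q_def)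
  qed
qed

end

section \<open>The phase before the first resonance\<close>

context modes begin

text \<open>Before the first useful resonance, mode l > K must be smaller than mode l - 1 by the
  strength b_l, since its own resonance sends about b_l times its size back to l - 1. The value 4800
  is 12 * 10 * 40: flux constant, bound of \<open>Fp\<close>, and the share 1/40 granted in
  \<open>accum_down\<close>.\<close>

definition Rr :: "nat \<Rightarrow> real" where "Rr l = 4 + 4800 * b l"
definition qq :: "nat \<Rightarrow> nat \<Rightarrow> real" where
  "qq K l = (if l < K then 2 / 4 ^ (K - l) else 2 / (\<Prod>j\<in>{K<..l}. Rr j))"
text \<open>A nondecreasing majorant of w and the shape of the bound on \<open>H\<close>: weak
  damping may keep H_l from relaxing after the resonance, so from then on only 1 is claimed.\<close>

definition Fh :: "nat \<Rightarrow> real \<Rightarrow> real" where "Fh l t = (if t \<le> eta / real l then w l t else 1)"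
text \<open>Its derivative 2 (pi/2 + arctan) w dominates w \<open>Fh\<close>, so it is an explicit
  majorant of the flux accumulated through the resonance of mode m. It is quadratically small before
  that resonance and at most 10 afterwards.\<close>

definition Fp :: "nat \<Rightarrow> real \<Rightarrow> real" where "Fp m t = (pi / 2 + arctan (t - eta / real m))\<^sup>2"
text \<open>Mode l may grow through the resonance of mode l - 1, which comes later than its own. The
  factor 48 is 4 * 12: the flux constant against the share 1/4 in \<open>accum_up\<close>.\<close>

definition iL :: "nat \<Rightarrow> nat \<Rightarrow> real" where "iL K l = (if l = K then 0 else 48 * b (l - 1) * Rr l)"
text \<open>Four times the bound (3 K^2 / eta)^2 on w_m for the modes m <= K, whose resonances lie
  after \<open>tau K\<close>.\<close>

definition hp :: "nat \<Rightarrow> real" where "hp K = 36 * real K ^ 4 / eta\<^sup>2"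
definition iQ :: "nat \<Rightarrow> nat \<Rightarrow> real \<Rightarrow> real" where
  "iQ K l t = (if l < K then qq K l else qq K l * (1 + iL K l * Fp (l - 1) t))"
definition iP :: "nat \<Rightarrow> nat \<Rightarrow> real \<Rightarrow> real" where
  "iP K l t = (if l < K then hp K * qq K l else 8 * qq K l * Fh l t)"

lemma Rr_ge: "4 \<le> Rr l" "4800 * b l \<le> Rr l" using b_nonneg[of l] by (auto simp: Rr_def)
lemma Rr_pos: "0 < Rr l" using Rr_ge[of l] by linarith
lemma qq_pos: "0 < qq K l" by (auto simp: qq_def intro!: divide_pos_pos prod_pos Rr_pos)
lemma qq_self [simp]: "qq K K = 2" by (simp add: qq_def)
lemma qq_Suc: assumes "K \<le> l" shows "qq K l = Rr (Suc l) * qq K (Suc l)"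
proof -
  have "{K<..Suc l} = insert (Suc l) {K<..l}" using assms by auto
  then show ?thesis using assms Rr_pos[of "Suc l"] by (simp add: qq_def)
qed
lemma qq_below: assumes "l < K" shows "qq K (Suc l) = 4 * qq K l"
proof -
  have "K - l = Suc (K - Suc l)" using assms by simp
  then show ?thesis using assms by (cases "Suc l < K") (auto simp: qq_def)
qed
lemma qq_le: "qq K l \<le> 2 * dq K l"
proof (cases "l < K")
  case False
  have "(4::real) ^ card {K<..l} \<le> (\<Prod>j\<in>{K<..l}. Rr j)"
    using prod_mono[of "{K<..l}" "\<lambda>_. 4" Rr] Rr_ge by auto
  then have "2 / (\<Prod>j\<in>{K<..l}. Rr j) \<le> 2 / 4 ^ (l - K)" by (intro divide_left_mono) (auto intro!: mult_pos_pos prod_pos Rr_pos)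
  then show ?thesis using False by (simp add: qq_def dq_def)
qed (simp add: qq_def dq_def)

lemma w_le_Fh: "w l t \<le> Fh l t" and Fh_le_1: "Fh l t \<le> 1" using w_le_1[of l t] by (auto simp: Fh_def)
lemma Fh_pos: "0 < Fh l t" using w_pos[of l t] by (simp add: Fh_def)
lemma w_mono: assumes "s \<le> t" "t \<le> eta / real l" shows "w l s \<le> w l t"
proof -
  have "(eta / real l - t)\<^sup>2 \<le> (eta / real l - s)\<^sup>2" using assms by (intro power_mono) auto
  then have "(t - eta / real l)\<^sup>2 \<le> (s - eta / real l)\<^sup>2" by (simp add: power2_commute)
  then show ?thesis unfolding w_def by (intro divide_left_mono) (auto simp: add_pos_nonneg)
qed
lemma Fh_mono: assumes "s \<le> t" shows "Fh l s \<le> Fh l t"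
  using assms w_mono[of s t l] w_le_1[of l s] by (auto simp: Fh_def)
lemma Fh_prev: assumes "1 \<le> m" shows "Fh m t \<le> Fh (Suc m) t" "w m t \<le> Fh (Suc m) t"
proof -
  have e: "eta / real (Suc m) \<le> eta / real m" using assms eta_pos by (intro divide_left_mono) auto
  show 1: "Fh m t \<le> Fh (Suc m) t"
  proof (cases "t \<le> eta / real (Suc m)")
    case True
    have "(eta / real (Suc m) - t)\<^sup>2 \<le> (eta / real m - t)\<^sup>2" using True e by (intro power_mono) auto
    then have "(t - eta / real (Suc m))\<^sup>2 \<le> (t - eta / real m)\<^sup>2" by (simp add: power2_commute)
    then have "w m t \<le> w (Suc m) t" unfolding w_def by (intro divide_left_mono) (auto simp: add_pos_nonneg)
    then show ?thesis using True e by (simp add: Fh_def)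
  next
    case False
    then have "Fh (Suc m) t = 1" by (simp add: Fh_def)
    then show ?thesis using Fh_le_1[of m t] by simp
  qed
  show "w m t \<le> Fh (Suc m) t" using 1 w_le_Fh[of m t] by linarith
qed

text \<open>The difference of the two sides is nondecreasing, its derivative being 2 (1 + s + s^2) /
  (1 + s^2)^2, and it vanishes at minus infinity.\<close>

lemma lorentz_le_arctan: "1 / (1 + s\<^sup>2) \<le> 2 * (pi / 2 + arctan s)"
proof -
  define g where "g = (\<lambda>s. 2 * (pi / 2 + arctan s) - 1 / (1 + s\<^sup>2))"
  have nz: "1 + x\<^sup>2 \<noteq> 0" "1 + x\<^sup>2 > 0" for x :: real by (auto simp: add_pos_nonneg add_nonneg_eq_0_iff)
  have mono: "g r \<le> g s" if "r \<le> s" for r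
  proof (rule deriv_nonneg_le[OF that, where p = g and p' = "\<lambda>x. 2 * (1 + x + x\<^sup>2) / (1 + x\<^sup>2)\<^sup>2"])
    fix x
    have "((\<lambda>x. 1 / (1 + x\<^sup>2)) has_real_derivative - (2 * x) / (1 + x\<^sup>2)\<^sup>2) (at x within {r..s})"
      using nz[of x] by (auto intro!: derivative_eq_intros simp: power2_eq_square)
    then have "(g has_real_derivative 2 * (1 / (1 + x\<^sup>2)) - - (2 * x) / (1 + x\<^sup>2)\<^sup>2) (at x within {r..s})"
      unfolding g_def using deriv_arctan_shift[of 0 x "{r..s}"]
      by (intro DERIV_diff DERIV_cmult) (auto intro!: derivative_eq_intros simp: inverse_eq_divide)
    moreover have "2 * (1 / (1 + x\<^sup>2)) - - (2 * x) / (1 + x\<^sup>2)\<^sup>2 = 2 * (1 + x + x\<^sup>2) / (1 + x\<^sup>2)\<^sup>2"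
      using nz[of x] by (simp add: divide_simps power2_eq_square)
    ultimately show "(g has_real_derivative 2 * (1 + x + x\<^sup>2) / (1 + x\<^sup>2)\<^sup>2) (at x within {r..s})" by simp
    have "1 + x + x\<^sup>2 = (x + 1 / 2)\<^sup>2 + 3 / 4" by (simp add: power2_eq_square algebra_simps)
    then have "0 \<le> 1 + x + x\<^sup>2" by (smt (verit) zero_le_power2 divide_nonneg_nonneg)
    then show "0 \<le> 2 * (1 + x + x\<^sup>2) / (1 + x\<^sup>2)\<^sup>2" by simp
  qed
  have "0 \<le> g s"
  proof (rule ccontr)
    assume "\<not> 0 \<le> g s"
    \<comment> \<open>So far to the left that 1 / (1 + r^2) is at most -g(s); here r <= -1 gives r^2
      >= -r.\<close>
    define r where "r = min s (min (-1) (1 / g s))"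
    have gs: "g s < 0" using \<open>\<not> 0 \<le> g s\<close> by simp
    have r: "r \<le> s" "r \<le> -1" "r \<le> 1 / g s" by (auto simp: r_def)
    have "- (1 / (1 + r\<^sup>2)) < g r" unfolding g_def using arctan_bounded[of r] by simp
    moreover have "- r \<le> r\<^sup>2" using mult_left_mono_neg[of r "-1" r] r by (simp add: power2_eq_square)
    then have "1 + r\<^sup>2 \<ge> - (1 / g s)" using r by linarith
    then have "1 / (1 + r\<^sup>2) \<le> 1 / (- (1 / g s))" using gs nz(2)[of r] by (intro divide_left_mono mult_pos_pos) (auto simp: divide_neg_neg divide_pos_neg)
    then have "1 / (1 + r\<^sup>2) \<le> - g s" by simp
    ultimately show False using mono[OF r(1)] by linarith
  qed
  then show ?thesis by (simp add: g_def)
qed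

lemma w_Fh_le: "w m t * Fh m t \<le> 2 * (pi / 2 + arctan (t - eta / real m)) * w m t"
proof -
  have "Fh m t \<le> 2 * (pi / 2 + arctan (t - eta / real m))"
  proof (cases "t \<le> eta / real m")
    case True
    then show ?thesis using lorentz_le_arctan[of "t - eta / real m"] by (simp add: Fh_def w_def)
  next
    case False
    then show ?thesis using pi_gt3 zero_le_arctan_iff[of "t - eta / real m"] by (simp add: Fh_def del: zero_le_arctan_iff)
  qed
  then show ?thesis using w_pos[of m t] by (simp add: mult.commute mult_right_mono)
qed

lemma deriv_Fp: "(Fp m has_real_derivative 2 * (pi / 2 + arctan (t - eta / real m)) * w m t) (at t within S)"
proof -
  have "((\<lambda>t. (pi / 2 + arctan (t - x))\<^sup>2) has_real_derivative 2 * (pi / 2 + arctan (t - x)) * (1 / (1 + (t - x)\<^sup>2))) (at t within S)" for x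
    by (rule derivative_eq_intros deriv_arctan_shift refl | simp)+
  then show ?thesis unfolding Fp_def[abs_def] w_def .
qed

lemma Fp_nonneg: "0 \<le> Fp m t" by (simp add: Fp_def)
lemma Fp_le: "Fp m t \<le> 10"
proof -
  have "Fp m t \<le> (79 / 25)\<^sup>2" unfolding Fp_def using arctan_bounded[of "t - eta / real m"] pi_approx by (intro power_mono) auto
  then show ?thesis by (simp add: power2_eq_square)
qed
lemma Fp_left: assumes "0 < x" "x \<le> eta / real m - t" shows "Fp m t \<le> 1 / x\<^sup>2"
proof -
  have "arctan x \<le> - arctan (t - eta / real m)" using arctan_monotone'[OF assms(2)] arctan_minus[of "t - eta / real m"] by simp
  then have "pi / 2 + arctan (t - eta / real m) \<le> 1 / x" using arctan_ge[OF assms(1)] by linarith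
  then have "Fp m t \<le> (1 / x)\<^sup>2" unfolding Fp_def using arctan_bounded[of "t - eta / real m"] by (intro power_mono) auto
  then show ?thesis by (simp add: power_divide)
qed

lemma accum_w_Fh: "accum (\<lambda>s. w m s * Fh m s) s t (Fp m t)"
  by (rule accumI[OF deriv_Fp w_Fh_le]) (use Fp_nonneg in auto)

text \<open>Two Lorentzians with centres 0 and eta / m: at every time one of them is at distance at
  least eta / (2m) from its centre and hence small.\<close>

lemma w_over_le:
  assumes "1 \<le> m" "0 \<le> s"
  shows "w m s / (1 + s\<^sup>2) \<le> 4 * (real m)\<^sup>2 / eta\<^sup>2 * (w m s + 1 / (1 + s\<^sup>2))"
proof -
  have e: "0 < eta / (2 * real m)" using assms eta_pos by simp
  have inv: "1 / (eta / (2 * real m))\<^sup>2 = 4 * (real m)\<^sup>2 / eta\<^sup>2" by (simp add: power_divide power_mult_distrib)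
  have p: "0 < w m s" "0 \<le> 1 / (1 + s\<^sup>2)" using w_pos by auto
  have nn: "0 \<le> 4 * (real m)\<^sup>2 / eta\<^sup>2" by simp
  show ?thesis
  proof (cases "eta / (2 * real m) \<le> s")
    case True
    then have "(eta / (2 * real m))\<^sup>2 \<le> s\<^sup>2" using e by (intro power_mono) auto
    then have "1 / (1 + s\<^sup>2) \<le> 1 / (eta / (2 * real m))\<^sup>2"
      using e by (intro divide_left_mono mult_pos_pos zero_less_power) (auto simp: add_pos_nonneg)
    then have "w m s * (1 / (1 + s\<^sup>2)) \<le> w m s * (4 * (real m)\<^sup>2 / eta\<^sup>2)" unfolding inv using p by (intro mult_left_mono) auto
    also have "\<dots> = 4 * (real m)\<^sup>2 / eta\<^sup>2 * w m s" by simp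
    also have "\<dots> \<le> 4 * (real m)\<^sup>2 / eta\<^sup>2 * (w m s + 1 / (1 + s\<^sup>2))" using nn p by (intro mult_left_mono) auto
    finally show ?thesis by simp
  next
    case False
    have "eta / (2 * real m) \<le> \<bar>s - eta / real m\<bar>" using False e by (simp add: field_simps)
    from w_le_dist[OF e this] have "w m s * (1 / (1 + s\<^sup>2)) \<le> 4 * (real m)\<^sup>2 / eta\<^sup>2 * (1 / (1 + s\<^sup>2))"
      unfolding inv using p by (intro mult_right_mono) auto
    also have "\<dots> \<le> 4 * (real m)\<^sup>2 / eta\<^sup>2 * (w m s + 1 / (1 + s\<^sup>2))" using nn p by (intro mult_left_mono) auto
    finally show ?thesis by simp
  qed
qed

lemma accum_w_over:
  assumes "1 \<le> m"
  shows "accum (\<lambda>s. w m s / (1 + s\<^sup>2)) 0 t (20 * (real m)\<^sup>2 / eta\<^sup>2)"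
proof -
  have ac: "accum (w m) 0 t pi" using accum_lorentz[of "eta / real m"] by (simp add: w_def[abs_def])
  show ?thesis
  proof (rule accum_le[OF accum_cmult[OF accum_add[OF ac accum_lorentz_pos[of 0 t]], of "4 * (real m)\<^sup>2 / eta\<^sup>2"]])
    have "pi + pi / 2 \<le> 5" using pi_approx by simp
    from mult_left_mono[OF this, of "4 * (real m)\<^sup>2 / eta\<^sup>2"]
    show "4 * (real m)\<^sup>2 / eta\<^sup>2 * (pi + pi / 2) \<le> 20 * (real m)\<^sup>2 / eta\<^sup>2" by simp
  qed (use w_over_le assms in auto)
qed

text \<open>The same splitting, except that \<open>Fh\<close> does not decay after the resonance:
  from half of E = eta / m on, 1 / (1 + s^2) is replaced by a Lorentzian of width E, of mass at most
  8 / E.\<close>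

lemma accum_Fh_over:
  assumes "1 \<le> m"
  shows "accum (\<lambda>s. Fh m s / (1 + s\<^sup>2)) 0 t (8 * (real m)\<^sup>2 / eta\<^sup>2 + 8 * real m / eta)"
proof -
  define E where "E = eta / real m"
  have E: "0 < E" using assms eta_pos by (simp add: E_def)
  have dA: "((\<lambda>s. 5 / E * arctan (s / E)) has_real_derivative 5 / (s\<^sup>2 + E\<^sup>2)) (at s within {0..t})" for s
  proof -
    have "((\<lambda>s. arctan (s / E)) has_real_derivative 1 / E * (1 / (1 + (s / E)\<^sup>2))) (at s within {0..t})"
      using E by (auto intro!: derivative_eq_intros simp: inverse_eq_divide)
    from DERIV_cmult[OF this, of "5 / E"] show ?thesis
      using E by (simp add: power_divide field_simps power2_eq_square)
  qed
  have acA: "accum (\<lambda>s. 5 / (s\<^sup>2 + E\<^sup>2)) 0 t (8 / E)"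
  proof (rule accumI[OF dA order.refl])
    have "arctan (t / E) \<le> 8 / 5" using arctan_bounded[of "t / E"] pi_approx by simp
    from mult_left_mono[OF this, of "5 / E"] show "5 / E * arctan (t / E) - 5 / E * arctan (0 / E) \<le> 8 / E" using E by simp
  qed
  have k: "0 \<le> 4 * (real m)\<^sup>2 / eta\<^sup>2" by simp
  show ?thesis
  proof (rule accum_le[OF accum_add[OF accum_cmult[OF accum_lorentz_pos[of 0 t] k] acA]])
    fix s assume s: "0 \<le> s" "s \<le> t"
    show "Fh m s / (1 + s\<^sup>2) \<le> 4 * (real m)\<^sup>2 / eta\<^sup>2 * (1 / (1 + s\<^sup>2)) + 5 / (s\<^sup>2 + E\<^sup>2)"
    proof (cases "E / 2 \<le> s")
      case True
      have "(E / 2)\<^sup>2 \<le> s\<^sup>2" using True E by (intro power_mono) auto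
      then have "s\<^sup>2 + E\<^sup>2 \<le> 5 * (1 + s\<^sup>2)" by (simp add: power_divide)
      then have "1 / (1 + s\<^sup>2) \<le> 5 / (s\<^sup>2 + E\<^sup>2)" using E by (simp add: divide_simps add_pos_nonneg add_nonneg_pos)
      moreover have "Fh m s / (1 + s\<^sup>2) \<le> 1 / (1 + s\<^sup>2)" using Fh_le_1[of m s] by (intro divide_right_mono) auto
      ultimately show ?thesis by (smt (verit) k divide_nonneg_nonneg mult_nonneg_nonneg zero_le_power2)
    next
      case False
      then have "E / 2 \<le> \<bar>s - eta / real m\<bar>" "s \<le> eta / real m" using E by (auto simp: E_def)
      then have "Fh m s \<le> 1 / (E / 2)\<^sup>2" using w_le_dist[of "E / 2" s m] E by (simp add: Fh_def)
      also have "\<dots> = 4 * (real m)\<^sup>2 / eta\<^sup>2" by (simp add: E_def power_divide)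
      finally have "Fh m s * (1 / (1 + s\<^sup>2)) \<le> 4 * (real m)\<^sup>2 / eta\<^sup>2 * (1 / (1 + s\<^sup>2))" by (intro mult_right_mono) auto
      moreover have "0 \<le> 5 / (s\<^sup>2 + E\<^sup>2)" by simp
      moreover have "Fh m s / (1 + s\<^sup>2) = Fh m s * (1 / (1 + s\<^sup>2))" by simp
      ultimately show ?thesis by linarith
    qed
  next
    have "pi / 2 \<le> 2" using pi_approx by simp
    from mult_left_mono[OF this k] show "4 * (real m)\<^sup>2 / eta\<^sup>2 * (pi / 2) + 8 / E \<le> 8 * (real m)\<^sup>2 / eta\<^sup>2 + 8 * real m / eta"
      by (simp add: E_def)
  qed simp
qed

text \<open>The bound on H_l carries the factor \<open>Fh l\<close>, which is still tiny when mode l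
  + 1 resonates. Comparing Lorentzians at distance D extracts this factor at the price of D^2 w, and
  that price is paid by the decay of f.\<close>

lemma w_le_Fh_next:
  assumes "1 \<le> l"
  shows "w (Suc l) s \<le> Fh l s * (2 + 2 * (eta / (real l * real (Suc l)))\<^sup>2 * w (Suc l) s)"
proof -
  define u D where "u = s - eta / real (Suc l)" and "D = eta / (real l * real (Suc l))"
  have D: "eta / real l - eta / real (Suc l) = D" unfolding D_def using assms by (simp add: field_simps)
  have D0: "0 < D" unfolding D_def using assms eta_pos by simp
  have nz: "0 < 1 + u\<^sup>2" "0 < 1 + (u - D)\<^sup>2" by (auto simp: add_pos_nonneg)
  have wS: "w (Suc l) s = 1 / (1 + u\<^sup>2)" by (simp add: w_def u_def)
  have wl: "w l s = 1 / (1 + (u - D)\<^sup>2)" using D by (simp add: w_def u_def algebra_simps)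
  have "(u - D)\<^sup>2 \<le> 2 * u\<^sup>2 + 2 * D\<^sup>2" using zero_le_power2[of "u + D"] by (simp add: power2_eq_square algebra_simps)
  then have "1 + (u - D)\<^sup>2 \<le> 2 * (1 + u\<^sup>2) + 2 * D\<^sup>2" by simp
  then have "1 * (1 / (1 + u\<^sup>2)) \<le> (2 * (1 + u\<^sup>2) + 2 * D\<^sup>2) / (1 + (u - D)\<^sup>2) * (1 / (1 + u\<^sup>2))"
    using nz by (intro mult_right_mono) auto
  also have "\<dots> = w l s * (2 + 2 * D\<^sup>2 * w (Suc l) s)" unfolding wS wl using nz by (simp add: field_simps)
  finally have "w (Suc l) s \<le> w l s * (2 + 2 * D\<^sup>2 * w (Suc l) s)" by (simp add: wS)
  also have "\<dots> \<le> Fh l s * (2 + 2 * D\<^sup>2 * w (Suc l) s)"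
    using w_le_Fh[of l s] w_pos[of "Suc l" s] by (intro mult_right_mono) auto
  finally show ?thesis by (simp add: D_def)
qed

lemma b_mono: assumes "1 \<le> m" "m \<le> l" shows "b l \<le> b m"
  unfolding b_def using assms c_pos eta_pos by (intro divide_left_mono power_mono) auto

end

section \<open>Interactions before the first useful resonance\<close>

context modes begin

context
  fixes K :: nat
  assumes K: "116 \<le> K" "636 \<le> b K" "b K \<le> 655"
begin

lemma K_real: "116 \<le> real K" using K(1) by simp

lemma etaK: "636000 * real K ^ 3 \<le> eta" "900000000000 \<le> eta"
proof -
  show 1: "636000 * real K ^ 3 \<le> eta" using eta_large[of K] K by auto
  have "(116::real) ^ 3 \<le> real K ^ 3" using K_real by (intro power_mono) auto
  then show "900000000000 \<le> eta" using 1 by simp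
qed

lemma hp_pos: "0 < hp K" using K_real eta_pos by (simp add: hp_def)

lemma K_hp_small: "real K * hp K \<le> 1 / 10000000"
proof -
  have "(636000 * real K ^ 3)\<^sup>2 \<le> eta\<^sup>2" using etaK by (intro power_mono) auto
  then have "real K * hp K \<le> real K * (36 * real K ^ 4 / (636000 * real K ^ 3)\<^sup>2)"
    unfolding hp_def using K_real eta_pos by (intro mult_left_mono divide_left_mono mult_pos_pos) auto
  also have "\<dots> = 36 / 636000\<^sup>2 * (1 / real K)" using K_real by (simp add: field_simps power2_eq_square power3_eq_cube power4_eq_xxxx)
  also have "\<dots> \<le> 36 / 636000\<^sup>2 * 1" using K_real by (intro mult_left_mono) auto
  finally show ?thesis by simp
qed

lemma hp_small: "hp K \<le> 1 / 10000000"
proof -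
  have "1 * hp K \<le> real K * hp K" using K_real hp_pos by (intro mult_right_mono) auto
  then show ?thesis using K_hp_small by simp
qed

lemma hp_w: assumes "1 \<le> m" "m \<le> K" "t \<le> tau K" shows "w m t \<le> hp K / 4"
proof -
  have "w m t \<le> (real K * (2 * real K + 1) / eta)\<^sup>2" by (rule w_left_le[OF assms])
  also have "\<dots> \<le> (real K * (3 * real K) / eta)\<^sup>2" using K_real eta_pos by (intro power_mono divide_right_mono mult_left_mono) auto
  also have "\<dots> = hp K / 4" by (simp add: hp_def power_divide power2_eq_square power3_eq_cube power4_eq_xxxx)
  finally show ?thesis .
qed

lemma tau_le: "tau K \<le> eta / real K"
  unfolding tau_def using K_real eta_pos by (simp add: field_simps)

text \<open>The growth allowed to mode l takes place only when its own resonance no longer acts.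
  Near eta / l the function \<open>Fp\<close> of mode l - 1 is still small because eta / (l - 1) is
  far away, and once \<open>Fp\<close> is of order 1 the factor w_l is small. For very small b_(l-1)
  the product \<open>iL\<close> \<open>Fp\<close> is below 1 anyway.\<close>

lemma iL_ok:
  assumes l: "K < l"
  shows "iL K l * Fp (l - 1) t * w l t \<le> Fh l t"
proof -
  define n where "n = l - 1"
  have n: "l = Suc n" "K \<le> n" "1 \<le> n" using l K by (auto simp: n_def)
  have bn: "0 \<le> b n" "b l \<le> b n" using b_nonneg b_mono[of n l] n by auto
  have L: "iL K l = 48 * b n * Rr l" using l by (simp add: iL_def n_def)
  have L0: "0 \<le> iL K l" unfolding L using bn Rr_pos[of l] by simp
  show ?thesis
  proof (cases "b n \<le> 1 / 10000")
    case True
    have "iL K l \<le> 48 * (1 / 10000) * 5" unfolding L Rr_def using True bn b_nonneg[of l] by (intro mult_mono) auto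
    then have "iL K l * Fp n t \<le> 48 * (1 / 10000) * 5 * 10" using Fp_le[of n t] Fp_nonneg[of n t] L0 by (intro mult_mono) auto
    then have "iL K l * Fp n t * w l t \<le> 1 * w l t" using w_pos[of l t] by (intro mult_right_mono) auto
    then show ?thesis using w_le_Fh[of l t] by (simp add: n_def)
  next
    case False
    define D where "D = eta / (real n * real l)"
    have nr: "116 \<le> real n" "real l = real n + 1" using n K by auto
    have D0: "0 < D" unfolding D_def using nr eta_pos by simp
    have Deq: "eta / real n - eta / real l = D" unfolding D_def using nr by (simp add: field_simps)
    have LD: "iL K l * (40 / D\<^sup>2) \<le> 1"
    proof -
      have "real n ^ 3 < 10000 * (c * eta)" using False nr unfolding b_def by (simp add: field_simps)
      moreover have "10000 * (c * eta) \<le> 10 * eta" using c_small eta_pos mult_right_mono[of c "1/1000" eta] by simp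
      moreover have "(116::real)\<^sup>2 * real n \<le> real n ^ 3"
        using mult_right_mono[of "(116::real)\<^sup>2" "(real n)\<^sup>2" "real n"] nr power_mono[of 116 "real n" 2] by (simp add: power2_eq_square power3_eq_cube)
      ultimately have nle: "real n \<le> eta / 1000" by simp
      have "iL K l * (40 / D\<^sup>2) = 1920 * b n * (4 + 4800 * b l) * (real n * real l)\<^sup>2 / eta\<^sup>2"
        unfolding L D_def Rr_def by (simp add: power_divide)
      also have "\<dots> = 7680 * (c * ((real l)\<^sup>2 / (real n * eta))) + 9216000 * ((c * c) * (1 / (real n * real l)))"
      proof -
        have "1920 * (c * eta / N ^ 3) * (4 + 4800 * (c * eta / L ^ 3)) * (N * L)\<^sup>2 / eta\<^sup>2
          = 7680 * (c * (L\<^sup>2 / (N * eta))) + 9216000 * ((c * c) * (1 / (N * L)))" if "0 < N" "0 < L" for N L :: real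
          using that eta_pos by (simp add: field_simps power2_eq_square power3_eq_cube)
        from this[of "real n" "real l"] show ?thesis unfolding b_def using nr by simp
      qed
      also have "\<dots> \<le> 7680 * (1 / 1000 * (1 / 250)) + 9216000 * ((1 / 1000 * (1 / 1000)) * (1 / 13456))"
      proof (intro add_mono mult_left_mono mult_mono)
        have "(real l)\<^sup>2 \<le> (2 * real n) * (2 * real n)" unfolding power2_eq_square using nr by (intro mult_mono) auto
        also have "\<dots> = 4 * real n * real n" by simp
        also have "\<dots> \<le> 4 * real n * (eta / 1000)" using nle nr by (intro mult_left_mono) auto
        finally show "(real l)\<^sup>2 / (real n * eta) \<le> 1 / 250" using nr eta_pos by (simp add: field_simps)
        have "116 * 116 \<le> real n * real l" using nr by (intro mult_mono) auto
        then show "1 / (real n * real l) \<le> 1 / 13456" using nr by (intro divide_left_mono) auto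
      qed (use c_pos c_small nr eta_pos in auto)
      finally show ?thesis by simp
    qed
    have "Fp n t * w l t \<le> 40 / D\<^sup>2 * Fh l t"
    proof (cases "t - eta / real l \<le> D / 2")
      case True
      have "D / 2 \<le> eta / real n - t" using True Deq by linarith
      then have "Fp n t \<le> 1 / (D / 2)\<^sup>2" using D0 by (intro Fp_left) auto
      also have "\<dots> \<le> 40 / D\<^sup>2" using D0 by (simp add: power_divide divide_right_mono)
      finally show ?thesis using w_le_Fh[of l t] w_pos[of l t] Fp_nonneg[of n t] by (intro mult_mono) auto
    next
      case False
      then have "Fh l t = 1" using D0 by (simp add: Fh_def)
      moreover have "w l t \<le> 1 / (D / 2)\<^sup>2" using False D0 by (intro w_le_dist) auto
      then have "Fp n t * w l t \<le> 10 * (1 / (D / 2)\<^sup>2)" using Fp_le[of n t] w_pos[of l t] by (intro mult_mono) auto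
      ultimately show ?thesis by (simp add: power_divide)
    qed
    then have "iL K l * (Fp n t * w l t) \<le> iL K l * (40 / D\<^sup>2 * Fh l t)" using L0 by (intro mult_left_mono) auto
    also have "\<dots> = iL K l * (40 / D\<^sup>2) * Fh l t" by (simp only: mult.assoc)
    also have "\<dots> \<le> 1 * Fh l t" using LD Fh_pos[of l t] by (intro mult_right_mono) auto
    finally show ?thesis by (simp add: n_def mult.assoc)
  qed
qed

lemma iL_nonneg: "0 \<le> iL K l" using b_nonneg Rr_pos[of l] by (simp add: iL_def)

lemma iQ_pos: "0 < iQ K l t"
  using qq_pos[of K l] iL_nonneg[of l] Fp_nonneg[of "l - 1" t] by (auto simp: iQ_def intro!: mult_pos_pos add_pos_nonneg)
lemma iP_pos: "0 < iP K l t"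
  using qq_pos[of K l] hp_pos Fh_pos[of l t] by (auto simp: iP_def)

lemma w_iQ: assumes "K \<le> l" shows "w l t * iQ K l t \<le> 2 * qq K l * Fh l t"
proof -
  have "iL K l * Fp (l - 1) t * w l t \<le> Fh l t"
    using iL_ok[of l t] assms Fh_pos[of l t] by (cases "l = K") (auto simp: iL_def)
  then have "w l t * (1 + iL K l * Fp (l - 1) t) \<le> 2 * Fh l t" using w_le_Fh[of l t] by (simp add: algebra_simps)
  from mult_left_mono[OF this, of "qq K l"] show ?thesis using qq_pos[of K l] assms by (simp add: iQ_def mult_ac)
qed

text \<open>12 = 4 + 8: twice w times the majorant of \<open>th\<close>, with the growth term
  absorbed by \<open>iL_ok\<close>, plus the majorant of \<open>H\<close>.\<close>

lemma flux_above:
  assumes "K \<le> m"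
  shows "flux (iQ K) (iP K) m t \<le> 12 * b m * qq K m * (w m t * Fh m t)"
proof -
  have "2 * (w m t * iQ K m t) + iP K m t \<le> 12 * qq K m * Fh m t" using w_iQ[OF assms, of t] assms by (simp add: iP_def mult_ac)
  then have "b m * w m t * (2 * (w m t * iQ K m t) + iP K m t) \<le> b m * w m t * (12 * qq K m * Fh m t)"
    using b_nonneg[of m] w_pos[of m t] by (intro mult_left_mono) auto
  then show ?thesis by (simp add: flux_def power2_eq_square algebra_simps)
qed

text \<open>All resonances of these modes lie ahead, so both parts of the flux carry an extra factor
  of size \<open>hp K\<close>.\<close>

lemma flux_below:
  assumes "m \<le> K" "t \<le> tau K"
  shows "flux (iQ K) (iP K) m t \<le> 3 * hp K * qq K m * (b m * w m t)"
proof (cases "m = 0")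
  case False
  then have w: "w m t \<le> hp K / 4" using hp_w[of m t] assms by simp
  have bw: "0 \<le> b m * w m t" using b_nonneg[of m] w_pos[of m t] by simp
  show ?thesis
  proof (cases "m = K")
    case True
    have "Fh m t = w m t" using True assms tau_le by (simp add: Fh_def)
    then have "flux (iQ K) (iP K) m t \<le> (b m * w m t * qq K m) * (12 * w m t)" using flux_above[of m t] True by (simp add: mult_ac)
    also have "\<dots> \<le> (b m * w m t * qq K m) * (3 * hp K)" using w bw qq_pos[of K m] by (intro mult_left_mono) auto
    finally show ?thesis by (simp add: mult_ac)
  next
    case f: False
    have "flux (iQ K) (iP K) m t = (b m * w m t * qq K m) * (2 * w m t + hp K)"
      using f assms by (simp add: flux_def iQ_def iP_def power2_eq_square algebra_simps)
    also have "\<dots> \<le> (b m * w m t * qq K m) * (3 * hp K)" using w hp_pos bw qq_pos[of K m] by (intro mult_left_mono) auto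
    finally show ?thesis by (simp add: mult_ac)
  qed
qed (simp add: flux_def)

lemma qq_nbr_below: assumes "l < K" shows "qq K (Suc l) \<le> 4 * qq K l" "qq K (l - 1) \<le> 4 * qq K l"
proof -
  show "qq K (Suc l) \<le> 4 * qq K l" using qq_below[OF assms] by simp
  show "qq K (l - 1) \<le> 4 * qq K l" using qq_below[of "l - 1" K] assms qq_pos[of K l] by (cases l) auto
qed

text \<open>This inflow is exactly what the growth term of \<open>iQ\<close> in mode m + 1 was made
  for.\<close>

lemma accum_up:
  assumes "K \<le> m"
  shows "accum (flux (iQ K) (iP K) m) 0 t (iQ K (Suc m) t / 4)"
proof (rule accum_le[OF accum_cmult[OF accum_w_Fh[of m 0 t], of "12 * b m * qq K m"]])
  have "12 * b m * qq K m * Fp m t = qq K (Suc m) * (iL K (Suc m) * Fp m t) / 4"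
    using qq_Suc[OF assms] assms by (simp add: iL_def)
  also have "\<dots> \<le> iQ K (Suc m) t / 4" using qq_pos[of K "Suc m"] assms by (simp add: iQ_def)
  finally show "12 * b m * qq K m * Fp m t \<le> iQ K (Suc m) t / 4" .
qed (use flux_above[OF assms] b_nonneg qq_pos[of K m] in auto)

text \<open>Feedback to the lower mode is bounded by the full mass of the resonance; the ratio
  \<open>Rr\<close> of consecutive sizes compensates b_(l+1).\<close>

lemma accum_down:
  assumes "K \<le> l"
  shows "accum (flux (iQ K) (iP K) (Suc l)) 0 t (qq K l / 40)"
proof (rule accum_le[OF accum_cmult[OF accum_w_Fh[of "Suc l" 0 t], of "12 * b (Suc l) * qq K (Suc l)"]])
  have "12 * b (Suc l) * qq K (Suc l) * Fp (Suc l) t \<le> 12 * b (Suc l) * qq K (Suc l) * 10"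
    using Fp_le b_nonneg[of "Suc l"] qq_pos[of K "Suc l"] by (intro mult_left_mono) auto
  also have "\<dots> = (4800 * b (Suc l)) * qq K (Suc l) / 40" by simp
  also have "\<dots> \<le> Rr (Suc l) * qq K (Suc l) / 40" using Rr_ge(2)[of "Suc l"] qq_pos[of K "Suc l"] by (intro divide_right_mono mult_right_mono) auto
  finally show "12 * b (Suc l) * qq K (Suc l) * Fp (Suc l) t \<le> qq K l / 40" using qq_Suc[OF assms] by simp
qed (use flux_above[of "Suc l"] assms b_nonneg qq_pos[of K "Suc l"] in auto)

lemma accum_low:
  assumes "m \<le> K" "t \<le> tau K"
  shows "accum (flux (iQ K) (iP K) m) 0 t (qq K m / 1000)"
proof (cases "m = 0")
  case True
  then show ?thesis using accum_le[OF accum_zero, of _ _ "\<lambda>_. 0"] qq_pos[of K m] by (auto simp: flux_def[abs_def])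
next
  case False
  then have ac: "accum (\<lambda>s. real m * b m * w m s) 0 t (3 * c)" using assms by (intro accum_w_left) auto
  show ?thesis
  proof (rule accum_le[OF accum_cmult[OF ac, of "3 * hp K * qq K m"]])
    fix s assume s: "0 \<le> s" "s \<le> t"
    have "1 * (b m * w m s) \<le> real m * (b m * w m s)" using False b_nonneg[of m] w_pos[of m s] by (intro mult_right_mono) auto
    then have "3 * hp K * qq K m * (b m * w m s) \<le> 3 * hp K * qq K m * (real m * b m * w m s)"
      using hp_pos qq_pos[of K m] by (intro mult_left_mono) (auto simp: mult_ac)
    then show "flux (iQ K) (iP K) m s \<le> 3 * hp K * qq K m * (real m * b m * w m s)"
      using flux_below[of m s] assms s by linarith
  next
    have "hp K * c \<le> 1 / 10000000 * 1" using hp_small hp_pos c_small c_pos by (intro mult_mono) auto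
    then have "qq K m * (9 * (hp K * c)) \<le> qq K m * (1 / 1000)" using qq_pos[of K m] by (intro mult_left_mono) auto
    then show "3 * hp K * qq K m * (3 * c) \<le> qq K m / 1000" by (simp add: mult_ac)
  qed (use hp_pos qq_pos[of K m] in auto)
qed

lemma initial_throw:
  assumes "1 \<le> l" "0 \<le> t" "t \<le> tau K"
  shows "accum (\<lambda>s. flux (iQ K) (iP K) (l + 1) s + flux (iQ K) (iP K) (l - 1) s) 0 t (iQ K l t / 2)"
proof -
  consider "l < K" | "l = K" | "K < l" by linarith
  then show ?thesis
  proof cases
    case 1
    have "accum (\<lambda>s. flux (iQ K) (iP K) (l + 1) s + flux (iQ K) (iP K) (l - 1) s) 0 t (qq K (l + 1) / 1000 + qq K (l - 1) / 1000)"
      by (intro accum_add accum_low) (use 1 assms in auto)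
    then show ?thesis using qq_nbr_below[OF 1] 1 qq_pos[of K l] by (elim accum_le[OF _ order.refl]) (auto simp: iQ_def)
  next
    case 2
    have "accum (\<lambda>s. flux (iQ K) (iP K) (l + 1) s + flux (iQ K) (iP K) (l - 1) s) 0 t (qq K l / 40 + qq K (l - 1) / 1000)"
      by (rule accum_add) (use 2 assms accum_down[of l t] accum_low[of "l - 1" t] in auto)
    moreover have "qq K (l - 1) \<le> 1" using qq_below[of "l - 1" K] 2 assms by (cases l) auto
    moreover have "iQ K l t = 2" using 2 by (simp add: iQ_def iL_def)
    ultimately show ?thesis using 2 by (elim accum_le[OF _ order.refl]) auto
  next
    case 3
    have "accum (\<lambda>s. flux (iQ K) (iP K) (l + 1) s + flux (iQ K) (iP K) (l - 1) s) 0 t (qq K l / 40 + iQ K l t / 4)"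
      by (rule accum_add) (use 3 assms accum_down[of l t] accum_up[of "l - 1" t] in auto)
    moreover have "qq K l \<le> iQ K l t" using 3 qq_pos[of K l] iL_nonneg[of l] Fp_nonneg[of "l - 1" t] by (simp add: iQ_def)
    ultimately show ?thesis using qq_pos[of K l] by (elim accum_le[OF _ order.refl]) auto
  qed
qed

lemma initial_row1:
  assumes "1 \<le> l" "s \<le> t" "t \<le> tau K"
  shows "w l s * iQ K l s \<le> iP K l t / 4"
proof (cases "l < K")
  case True
  have "w l s * qq K l \<le> hp K / 4 * qq K l" using hp_w[of l s] True assms qq_pos[of K l] by (intro mult_right_mono) auto
  then show ?thesis using True by (simp add: iQ_def iP_def)
next
  case False
  then have "w l s * iQ K l s \<le> 2 * qq K l * Fh l s" using w_iQ[of l s] by simp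
  also have "\<dots> \<le> 2 * qq K l * Fh l t" using Fh_mono[OF assms(2), of l] qq_pos[of K l] by (intro mult_left_mono) auto
  finally show ?thesis using False by (simp add: iP_def mult_ac)
qed

end

end

section \<open>The term with f before the first useful resonance\<close>

context modes begin

context
  fixes K :: nat
  assumes K: "116 \<le> K" "636 \<le> b K" "b K \<le> 655"
begin

lemmas KK = K_real[OF K] etaK[OF K] hp_pos[OF K] hp_small[OF K] K_hp_small[OF K]

lemma c_over_eta: "c / eta \<le> 1 / 900000000000000"
proof -
  have "c / eta \<le> (1 / 1000) / 900000000000" using KK c_small c_pos by (intro frac_le) auto
  then show ?thesis by simp
qed

text \<open>Against the mass 20 m^2 / eta^2 from \<open>accum_w_over\<close> this leaves 40 c / eta,
  so the factor l in the term with f is harmless.\<close>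

lemma lb_le: assumes "1 \<le> m" "l \<le> 2 * m" shows "real l * b m * (real m)\<^sup>2 \<le> 2 * (c * eta)"
proof -
  have "real l * b m * (real m)\<^sup>2 = c * eta * (real l / real m)" unfolding b_def using assms by (simp add: field_simps power2_eq_square power3_eq_cube)
  also have "real l / real m \<le> 2" using assms by (simp add: field_simps)
  finally show ?thesis using c_pos eta_pos by (simp add: mult_left_mono)
qed

lemma accum_lbw:
  assumes "1 \<le> m" "l \<le> 2 * m"
  shows "accum (\<lambda>s. real l * b m * (w m s / (1 + s\<^sup>2))) 0 t (1 / 20000000000000)"
proof (rule accum_le[OF accum_cmult[OF accum_w_over[OF assms(1)], of "real l * b m"]])
  have "real l * b m * (20 * (real m)\<^sup>2 / eta\<^sup>2) = 20 * (real l * b m * (real m)\<^sup>2) / eta\<^sup>2" by simp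
  also have "\<dots> \<le> 20 * (2 * (c * eta)) / eta\<^sup>2" using lb_le[OF assms] by (intro divide_right_mono) auto
  also have "\<dots> = 40 * (c / eta)" using eta_pos by (simp add: power2_eq_square)
  finally show "real l * b m * (20 * (real m)\<^sup>2 / eta\<^sup>2) \<le> 1 / 20000000000000" using c_over_eta by simp
qed (use b_nonneg in auto)

lemma f_flux_below:
  assumes "m \<le> K" "l \<le> m + 1" "t \<le> tau K"
  shows "accum (\<lambda>s. real l / (1 + s\<^sup>2) * flux (iQ K) (iP K) m s) 0 t (hp K * qq K m / 1000)"
proof (cases "m = 0")
  case True
  then show ?thesis using accum_le[OF accum_zero, of _ _ "\<lambda>_. 0"] qq_pos[of K m] KK by (auto simp: flux_def[abs_def])
next
  case False
  then have m: "1 \<le> m" "l \<le> 2 * m" using assms by auto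
  have hq: "0 \<le> 3 * hp K * qq K m" using KK qq_pos[of K m] by simp
  show ?thesis
  proof (rule accum_le[OF accum_cmult[OF accum_lbw[OF m] hq]])
    fix s assume s: "0 \<le> s" "s \<le> t"
    have "real l / (1 + s\<^sup>2) * flux (iQ K) (iP K) m s \<le> real l / (1 + s\<^sup>2) * (3 * hp K * qq K m * (b m * w m s))"
      using flux_below[OF K assms(1), of s] s assms by (intro mult_left_mono) auto
    then show "real l / (1 + s\<^sup>2) * flux (iQ K) (iP K) m s \<le> 3 * hp K * qq K m * (real l * b m * (w m s / (1 + s\<^sup>2)))"
      by (simp add: mult_ac)
  next
    have "0 \<le> hp K * qq K m" using hq by simp
    then show "3 * hp K * qq K m * (1 / 20000000000000) \<le> hp K * qq K m / 1000" by simp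
  qed
qed

text \<open>The target bound contains \<open>Fh K t\<close>, possibly tiny. Mode K - 1 resonates
  later than K, so its w is below \<open>Fh K\<close>, and the time integral uses only 1 / (1 +
  s^2); K \<open>hp K\<close> <= 10^-7 beats b_(K-1) <= 8 * 655.\<close>

lemma f_flux_K:
  assumes "0 \<le> t" "t \<le> tau K"
  shows "accum (\<lambda>s. real K / (1 + s\<^sup>2) * flux (iQ K) (iP K) (K - 1) s) 0 t (qq K K * Fh K t)"
proof -
  have K1: "Suc (K - 1) = K" "1 \<le> K - 1" using K by auto
  have q1: "qq K (K - 1) = 1 / 2" using qq_below[of "K - 1" K] K1 by simp
  have bK: "b (K - 1) \<le> 8 * b K"
  proof -
    have "real K \<le> 2 * real (K - 1)" using K by simp
    then have "real K ^ 3 \<le> (2 * real (K - 1)) ^ 3" by (intro power_mono) auto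
    then have "real K ^ 3 \<le> 8 * real (K - 1) ^ 3" by (simp add: power_mult_distrib)
    then have "c * eta * real K ^ 3 \<le> c * eta * (8 * real (K - 1) ^ 3)" using c_pos eta_pos by (intro mult_left_mono) auto
    then show ?thesis unfolding b_def using K KK by (simp add: field_simps)
  qed
  define X where "X = 3 / 2 * (real K * hp K) * b (K - 1) * Fh K t"
  have X: "0 \<le> X" using KK b_nonneg[of "K - 1"] Fh_pos[of K t] by (simp add: X_def)
  show ?thesis
  proof (rule accum_le[OF accum_cmult[OF accum_lorentz_pos[of 0 t] X]])
    fix s assume s: "0 \<le> s" "s \<le> t"
    have "w (K - 1) s \<le> Fh K s" using Fh_prev(2)[of "K - 1" s] K1 by simp
    then have w: "w (K - 1) s \<le> Fh K t" using Fh_mono[OF s(2), of K] by linarith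
    have "flux (iQ K) (iP K) (K - 1) s \<le> 3 * hp K * qq K (K - 1) * (b (K - 1) * w (K - 1) s)"
      using flux_below[OF K, of "K - 1" s] s assms by auto
    also have "\<dots> \<le> 3 * hp K * qq K (K - 1) * (b (K - 1) * Fh K t)"
      using w KK qq_pos[of K "K - 1"] b_nonneg[of "K - 1"] by (intro mult_left_mono) auto
    finally have "real K / (1 + s\<^sup>2) * flux (iQ K) (iP K) (K - 1) s \<le> real K / (1 + s\<^sup>2) * (3 / 2 * hp K * b (K - 1) * Fh K t)"
      unfolding q1 by (intro mult_left_mono) auto
    then show "real K / (1 + s\<^sup>2) * flux (iQ K) (iP K) (K - 1) s \<le> X * (1 / (1 + s\<^sup>2))"
      unfolding X_def by (simp add: mult_ac)
  next
    have "X * (pi / 2) \<le> X * 2" using pi_approx X by (intro mult_left_mono) auto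
    also have "X * 2 = 3 * ((real K * hp K) * b (K - 1)) * Fh K t" by (simp add: X_def)
    also have "\<dots> \<le> 3 * (1 / 10000000 * 5240) * Fh K t"
      using KK bK K b_nonneg[of "K - 1"] Fh_pos[of K t] by (intro mult_right_mono mult_left_mono mult_mono) auto
    also have "\<dots> \<le> 2 * Fh K t" using Fh_pos[of K t] by simp
    finally show "X * (pi / 2) \<le> qq K K * Fh K t" by simp
  qed simp
qed

lemma f_flux_up:
  assumes "K \<le> m" "0 \<le> t"
  shows "accum (\<lambda>s. real (Suc m) / (1 + s\<^sup>2) * flux (iQ K) (iP K) m s) 0 t (qq K (Suc m) * Fh (Suc m) t)"
proof -
  define l where "l = Suc m"
  have m: "1 \<le> m" "l \<le> 2 * m" using assms K by (auto simp: l_def)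
  define X where "X = 12 * Rr l * (qq K l * Fh l t)"
  have X: "0 \<le> X" using Rr_pos[of l] qq_pos[of K l] Fh_pos[of l t] by (simp add: X_def)
  have "accum (\<lambda>s. real l / (1 + s\<^sup>2) * flux (iQ K) (iP K) m s) 0 t (qq K l * Fh l t)"
  proof (rule accum_le[OF accum_cmult[OF accum_lbw[OF m] X]])
    fix s assume s: "0 \<le> s" "s \<le> t"
    have F: "Fh m s \<le> Fh l t" using Fh_prev(1)[OF m(1), of s] Fh_mono[OF s(2), of l] by (simp add: l_def)
    have "flux (iQ K) (iP K) m s \<le> 12 * b m * qq K m * (w m s * Fh m s)" by (rule flux_above[OF K assms(1)])
    also have "\<dots> \<le> 12 * b m * qq K m * (w m s * Fh l t)"
      using F b_nonneg[of m] qq_pos[of K m] w_pos[of m s] by (intro mult_left_mono) auto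
    also have "\<dots> = X * (b m * w m s)" unfolding X_def qq_Suc[OF assms(1)] l_def by simp
    finally have "real l / (1 + s\<^sup>2) * flux (iQ K) (iP K) m s \<le> real l / (1 + s\<^sup>2) * (X * (b m * w m s))" by (intro mult_left_mono) auto
    then show "real l / (1 + s\<^sup>2) * flux (iQ K) (iP K) m s \<le> X * (real l * b m * (w m s / (1 + s\<^sup>2)))" by (simp add: mult_ac)
  next
    have "b l \<le> 655" using b_mono[of K l] K assms by (simp add: l_def)
    then have "Rr l \<le> 4000000" by (simp add: Rr_def)
    then have "X \<le> 12 * 4000000 * (qq K l * Fh l t)" unfolding X_def using qq_pos[of K l] Fh_pos[of l t] by (intro mult_right_mono) auto
    moreover have "0 \<le> qq K l * Fh l t" using qq_pos[of K l] Fh_pos[of l t] by simp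
    ultimately show "X * (1 / 20000000000000) \<le> qq K l * Fh l t" by simp
  qed
  then show ?thesis by (simp add: l_def)
qed

text \<open>The source resonates before the target, so \<open>Fh l t\<close> is extracted with
  \<open>w_le_Fh_next\<close>. The factor D^2 meets m^2 / eta^2 from the decay of f near eta / m,
  and 1 / l^2 remains.\<close>

lemma f_flux_down:
  assumes "K \<le> l" "0 \<le> t"
  shows "accum (\<lambda>s. real l / (1 + s\<^sup>2) * flux (iQ K) (iP K) (Suc l) s) 0 t (qq K l * Fh l t)"
proof -
  define m where "m = Suc l"
  have l1: "1 \<le> l" "1 \<le> m" using assms K by (auto simp: m_def)
  define D where "D = eta / (real l * real m)"
  define g where "g = b m / Rr m"
  have Rm: "0 < Rr m" by (rule Rr_pos)
  have g: "0 \<le> g" "g \<le> b m / 4" "g \<le> 1 / 4800"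
    using Rr_ge(2)[of m] b_nonneg[of m] Rm divide_left_mono[OF Rr_ge(1)[of m] b_nonneg[of m]] by (auto simp: g_def field_simps)
  define Y where "Y = qq K l * Fh l t"
  have Y: "0 < Y" using qq_pos[of K l] Fh_pos[of l t] by (simp add: Y_def)
  have A1: "0 \<le> Y * (24 * real l * g)" and A2: "0 \<le> Y * (24 * real l * g * D\<^sup>2)" using Y g by auto
  have "accum (\<lambda>s. real l / (1 + s\<^sup>2) * flux (iQ K) (iP K) m s) 0 t Y"
  proof (rule accum_le[OF accum_add[OF accum_cmult[OF accum_Fh_over[OF l1(2)] A1] accum_cmult[OF accum_w_over[OF l1(2)] A2]]])
    fix s assume s: "0 \<le> s" "s \<le> t"
    have "qq K m = qq K l / Rr m" using qq_Suc[OF assms(1)] Rm by (simp add: m_def)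
    then have "12 * b m * qq K m * (w m s * Fh m s) = 12 * g * qq K l * Fh m s * w m s" by (simp add: g_def)
    also have "\<dots> \<le> 12 * g * qq K l * Fh m s * (Fh l s * (2 + 2 * D\<^sup>2 * w m s))"
      using w_le_Fh_next[OF l1(1), of s] g qq_pos[of K l] Fh_pos[of m s] unfolding m_def D_def by (intro mult_left_mono mult_nonneg_nonneg) auto
    also have "\<dots> \<le> 12 * g * qq K l * Fh m s * (Fh l t * (2 + 2 * D\<^sup>2 * w m s))"
      using Fh_mono[OF s(2), of l] g qq_pos[of K l] Fh_pos[of m s] w_pos[of m s]
      by (intro mult_left_mono mult_right_mono mult_nonneg_nonneg) auto
    also have "\<dots> = Y * (24 * g) * Fh m s + Y * (24 * g * D\<^sup>2) * (Fh m s * w m s)" by (simp add: Y_def algebra_simps)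
    also have "\<dots> \<le> Y * (24 * g) * Fh m s + Y * (24 * g * D\<^sup>2) * w m s"
      using Fh_le_1[of m s] w_pos[of m s] Y g by (intro add_left_mono mult_left_mono) (auto simp: mult_left_le_one_le Fh_pos less_imp_le)
    finally have "flux (iQ K) (iP K) m s \<le> Y * (24 * g) * Fh m s + Y * (24 * g * D\<^sup>2) * w m s"
      using flux_above[OF K, of m s] assms by (simp add: m_def)
    then have "real l / (1 + s\<^sup>2) * flux (iQ K) (iP K) m s \<le> real l / (1 + s\<^sup>2) * (Y * (24 * g) * Fh m s + Y * (24 * g * D\<^sup>2) * w m s)"
      by (intro mult_left_mono) auto
    also have "\<dots> = Y * (24 * real l * g) * (Fh m s / (1 + s\<^sup>2)) + Y * (24 * real l * g * D\<^sup>2) * (w m s / (1 + s\<^sup>2))"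
      by (simp add: distrib_left add_divide_distrib mult_ac)
    finally show "real l / (1 + s\<^sup>2) * flux (iQ K) (iP K) m s \<le> Y * (24 * real l * g) * (Fh m s / (1 + s\<^sup>2)) + Y * (24 * real l * g * D\<^sup>2) * (w m s / (1 + s\<^sup>2))" .
  next
    have lr: "116 \<le> real l" "real m = real l + 1" using assms KK by (auto simp: m_def)
    have p1: "24 * real l * g * (8 * (real m)\<^sup>2 / eta\<^sup>2 + 8 * real m / eta) \<le> 1 / 2"
    proof -
      have "24 * real l * g * (8 * (real m)\<^sup>2 / eta\<^sup>2 + 8 * real m / eta) \<le> 24 * real m * (b m / 4) * (8 * (real m)\<^sup>2 / eta\<^sup>2 + 8 * real m / eta)"
        using g lr eta_pos by (intro mult_right_mono mult_mono add_nonneg_nonneg) auto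
      also have "\<dots> = 48 * (c / eta) + 48 * c * (1 / real m)"
      proof -
        have "24 * x * (c * eta / x ^ 3 / 4) * (8 * x\<^sup>2 / eta\<^sup>2 + 8 * x / eta) = 48 * (c / eta) + 48 * c * (1 / x)" if "0 < x" for x
          using that eta_pos by (simp add: field_simps power2_eq_square power3_eq_cube)
        from this[of "real m"] show ?thesis unfolding b_def using l1 by simp
      qed
      also have "\<dots> \<le> 48 * (1 / 900000000000000) + 48 * (1 / 1000) * 1"
        using c_over_eta c_small c_pos eta_pos lr by (intro add_mono mult_mono) auto
      finally show ?thesis by simp
    qed
    have p2: "24 * real l * g * D\<^sup>2 * (20 * (real m)\<^sup>2 / eta\<^sup>2) \<le> 1 / 2"
    proof -
      have "24 * real l * g * D\<^sup>2 * (20 * (real m)\<^sup>2 / eta\<^sup>2) = 480 * g * (1 / real l)"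
      proof -
        have "24 * x * g * (eta / (x * y))\<^sup>2 * (20 * y\<^sup>2 / eta\<^sup>2) = 480 * g * (1 / x)" if "0 < x" "0 < y" for x y :: real
          using that eta_pos by (simp add: field_simps power2_eq_square)
        from this[of "real l" "real m"] show ?thesis unfolding D_def using l1 by simp
      qed
      also have "\<dots> \<le> 480 * (1 / 4800) * 1" using g lr by (intro mult_mono) auto
      finally show ?thesis by simp
    qed
    have "Y * (24 * real l * g * (8 * (real m)\<^sup>2 / eta\<^sup>2 + 8 * real m / eta) + 24 * real l * g * D\<^sup>2 * (20 * (real m)\<^sup>2 / eta\<^sup>2)) \<le> Y * 1"
      using p1 p2 Y by (intro mult_left_mono) auto
    then show "Y * (24 * real l * g) * (8 * (real m)\<^sup>2 / eta\<^sup>2 + 8 * real m / eta) + Y * (24 * real l * g * D\<^sup>2) * (20 * (real m)\<^sup>2 / eta\<^sup>2) \<le> Y"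
      by (simp only: mult.assoc distrib_left mult_1_right)
  qed
  then show ?thesis by (simp add: m_def Y_def)
qed

lemma initial_row2:
  assumes "1 \<le> l" "0 \<le> t" "t \<le> tau K"
  shows "accum (\<lambda>s. real l / (1 + s\<^sup>2) * (flux (iQ K) (iP K) (l + 1) s + flux (iQ K) (iP K) (l - 1) s)) 0 t (iP K l t / 4)"
proof (cases "l < K")
  case True
  have "accum (\<lambda>s. real l / (1 + s\<^sup>2) * (flux (iQ K) (iP K) (l + 1) s + flux (iQ K) (iP K) (l - 1) s)) 0 t (hp K * qq K (l + 1) / 1000 + hp K * qq K (l - 1) / 1000)"
    unfolding distrib_left by (intro accum_add f_flux_below) (use True assms in auto)
  then show ?thesis
  proof (rule accum_le[OF _ order.refl])
    have "hp K * qq K (l + 1) \<le> hp K * (4 * qq K l)" "hp K * qq K (l - 1) \<le> hp K * (4 * qq K l)"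
      using qq_nbr_below[OF K True] KK by (auto intro!: mult_left_mono)
    moreover have "0 < hp K * qq K l" using KK qq_pos[of K l] by simp
    ultimately show "hp K * qq K (l + 1) / 1000 + hp K * qq K (l - 1) / 1000 \<le> iP K l t / 4" using True by (simp add: iP_def)
  qed
next
  case False
  have "accum (\<lambda>s. real l / (1 + s\<^sup>2) * flux (iQ K) (iP K) (l - 1) s) 0 t (qq K l * Fh l t)"
    using f_flux_K[of t] f_flux_up[of "l - 1" t] False assms by (cases "l = K") auto
  moreover have "accum (\<lambda>s. real l / (1 + s\<^sup>2) * flux (iQ K) (iP K) (l + 1) s) 0 t (qq K l * Fh l t)"
    using f_flux_down[of l t] False assms by simp
  ultimately have "accum (\<lambda>s. real l / (1 + s\<^sup>2) * (flux (iQ K) (iP K) (l + 1) s + flux (iQ K) (iP K) (l - 1) s)) 0 t (qq K l * Fh l t + qq K l * Fh l t)"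
    unfolding distrib_left by (intro accum_add)
  then show ?thesis using False by (simp add: iP_def)
qed

end

end

section \<open>The state at the first switching time\<close>

context modes_sol_ap begin

context
  fixes K :: nat
  assumes K: "116 \<le> K" "636 \<le> b K" "b K \<le> 655"
    and init: "\<And>l. 1 \<le> l \<Longrightarrow> th 0 l = (if l = K then 1 else 0)"
      "\<And>l. 1 \<le> l \<Longrightarrow> H 0 l = (if l = K then - of_real (w K 0) else 0)"
begin

text \<open>The majorant decays like the product of the \<open>Rr\<close>, so the a priori bound is
  taken with the ratio 4 + 4800 \<open>b 1\<close>, which dominates every factor.\<close>

lemma initial_majorant:
  assumes "1 \<le> l" "0 \<le> t" "t \<le> tau K"
  shows "cmod (th t l) \<le> iQ K l t" "cmod (H t l) \<le> iP K l t"
proof -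
  define R where "R = 4 + 4800 * b 1"
  have R: "1 \<le> R" using b_nonneg[of 1] by (simp add: R_def)
  obtain C where C: "\<And>l t. 1 \<le> l \<Longrightarrow> 0 \<le> t \<Longrightarrow> t \<le> tau K \<Longrightarrow> cmod (th t l) \<le> C / R ^ l \<and> cmod (H t l) \<le> C / R ^ l"
    using apriori[OF R, of "tau K"] by auto
  define C' where "C' = max C 0"
  have qR: "1 / R ^ l \<le> 4 ^ K * qq K l" if "1 \<le> l" for l
  proof (cases "l < K")
    case True
    have "1 / R ^ l \<le> 1" using R by simp
    moreover have "(4::real) ^ (K - l) \<le> 4 ^ K" by (intro power_increasing) auto
    then have "4 ^ (K - l) \<le> 2 * (4::real) ^ K" using zero_le_power[of "4::real" K] by linarith
    then have "1 \<le> 4 ^ K * (2 / 4 ^ (K - l) :: real)" by (simp add: field_simps)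
    moreover have "qq K l = 2 / 4 ^ (K - l)" using True by (simp add: qq_def)
    ultimately show ?thesis by (simp only:)
  next
    case False
    have "(\<Prod>j\<in>{K<..l}. Rr j) \<le> R ^ card {K<..l}"
      unfolding prod_constant[symmetric]
      by (intro prod_mono) (auto simp: Rr_def R_def b_nonneg intro!: b_mono add_nonneg_nonneg)
    also have "\<dots> \<le> R ^ l" using R by (intro power_increasing) auto
    finally have "1 / R ^ l \<le> 1 / (\<Prod>j\<in>{K<..l}. Rr j)" using R by (intro divide_left_mono mult_pos_pos prod_pos Rr_pos) auto
    also have "\<dots> \<le> qq K l" using False by (simp add: qq_def divide_right_mono prod_nonneg Rr_pos less_imp_le)
    also have "\<dots> \<le> 4 ^ K * qq K l" using qq_pos[of K l] by simp
    finally show ?thesis .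
  qed
  \<comment> \<open>A common lower bound that ties both majorants to \<open>qq\<close>; 1 / (1 +
    eta^2) bounds w_l at time 0 from below for every l >= 1.\<close>
  define d where "d = min (hp K) (min 1 (1 / (1 + eta\<^sup>2)))"
  have d: "0 < d" using hp_pos[OF K] by (simp add: d_def add_pos_nonneg)
  have dQ: "d * qq K l \<le> iQ K l t" for l t
  proof -
    have "d * qq K l \<le> 1 * qq K l" using qq_pos[of K l] by (intro mult_right_mono) (auto simp: d_def)
    also have "\<dots> \<le> iQ K l t" using qq_pos[of K l] iL_nonneg[OF K, of l] Fp_nonneg[of "l - 1" t] by (auto simp: iQ_def)
    finally show ?thesis .
  qed
  have dP: "d * qq K l \<le> iP K l t" if "1 \<le> l" "0 \<le> t" for l t
  proof (cases "l < K")
    case False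
    have "1 / (1 + eta\<^sup>2) \<le> w l 0" using that(1) eta_pos unfolding w_def
      by (intro divide_left_mono) (auto simp: add_pos_nonneg power_divide divide_le_eq mult_le_cancel_left1)
    also have "\<dots> \<le> Fh l 0" by (rule w_le_Fh)
    also have "\<dots> \<le> Fh l t" by (rule Fh_mono[OF that(2)])
    finally have "d \<le> 8 * Fh l t" using Fh_pos[of l t] by (auto simp: d_def)
    then have "d * qq K l \<le> 8 * Fh l t * qq K l" using qq_pos[of K l] by (intro mult_right_mono) auto
    then show ?thesis using False by (simp add: iP_def mult_ac)
  qed (use qq_pos[of K l] in \<open>auto simp: iP_def d_def intro!: mult_right_mono\<close>)
  have C'0: "0 \<le> C'" by (simp add: C'_def)
  have ap: "cmod (th t l) \<le> C' * 4 ^ K / d * iQ K l t \<and> cmod (H t l) \<le> C' * 4 ^ K / d * iP K l t"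
    if l: "1 \<le> l" and t: "0 \<le> t" "t \<le> tau K" for l t
  proof -
    have "C / R ^ l \<le> C' * (4 ^ K * qq K l)" using mult_mono[of C C' "1 / R ^ l" "4 ^ K * qq K l"] qR[OF l] R by (simp add: C'_def)
    also have "\<dots> = C' * 4 ^ K / d * (d * qq K l)" using d by simp
    finally have c: "C / R ^ l \<le> C' * 4 ^ K / d * (d * qq K l)" .
    have "0 \<le> C' * 4 ^ K / d" using C'0 d by simp
    from mult_left_mono[OF dQ[of l t] this] mult_left_mono[OF dP[OF l t(1)] this]
    show ?thesis using C[OF l t] c by auto
  qed
  have ini: "cmod (th 0 l) \<le> iQ K l t / 2 \<and> cmod (H 0 l) \<le> iP K l t / 2" if l: "1 \<le> l" "0 \<le> t" for l t
  proof (cases "l = K")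
    case True
    have "w K 0 \<le> Fh K t" using w_le_Fh[of K 0] Fh_mono[OF that(2), of K] by linarith
    then show ?thesis using True init[OF l(1)] w_pos[of K 0] Fh_pos[of K t] by (simp add: iQ_def iL_def iP_def)
  qed (use init[OF l(1)] iQ_pos[OF K, of l t] iP_pos[OF K, of l t] in auto)
  show "cmod (th t l) \<le> iQ K l t" "cmod (H t l) \<le> iP K l t"
    using absorb[OF order.refl _ ap ini initial_throw[OF K] initial_row1[OF K] initial_row2[OF K] assms]
      iQ_pos[OF K] iP_pos[OF K] by (auto simp: less_imp_le)
qed

text \<open>For l = K + 1 the growth term is still tiny, because eta / K lies after
  \<open>tau K\<close>. For l >= K + 2 it is at most a tenth of \<open>qq\<close> two modes below,
  that is 16/5 times \<open>dq\<close>.\<close>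

lemma iQ_le_dq:
  assumes "1 \<le> l" "t \<le> tau K"
  shows "iQ K l t \<le> 6 * dq K l"
proof -
  note Kr = K_real[OF K]
  consider "l \<le> K" | "l = K + 1" | "K + 2 \<le> l" by linarith
  then show ?thesis
  proof cases
    case 1
    then show ?thesis using qq_le[of K l] dq_pos[of K l] by (auto simp: iQ_def iL_def)
  next
    case 2
    define S where "S = eta / (real K * (2 * real K + 1))"
    have S: "0 < S" using Kr eta_pos by (simp add: S_def)
    have "S = eta / real K - tau K" unfolding S_def tau_def using Kr by (simp add: field_simps)
    then have "Fp K t \<le> 1 / S\<^sup>2" using assms by (intro Fp_left S) auto
    also have "\<dots> = (real K * (2 * real K + 1) / eta)\<^sup>2" by (simp add: S_def power_divide)
    also have "\<dots> \<le> (real K * (3 * real K) / eta)\<^sup>2" using Kr eta_pos by (intro power_mono divide_right_mono mult_left_mono) auto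
    also have "\<dots> = hp K / 4" by (simp add: hp_def power_divide power2_eq_square power3_eq_cube power4_eq_xxxx)
    finally have "Fp K t \<le> 1 / 40000000" using hp_small[OF K] by simp
    then have f1: "96 * b K * Fp K t \<le> 96 * 655 * (1 / 40000000)" using K b_nonneg[of K] Fp_nonneg[of K t] by (intro mult_mono) auto
    have f2: "Rr (Suc K) * qq K (Suc K) = 2" using qq_Suc[of K K] by simp
    have "iQ K l t = qq K l + 48 * b K * Fp K t * (Rr (Suc K) * qq K (Suc K))" using 2 by (simp add: iQ_def iL_def algebra_simps)
    then have f3: "iQ K l t = qq K l + 96 * b K * Fp K t" unfolding f2 by simp
    have "dq K l = 1 / 4" using 2 by simp
    then show ?thesis using f1 f3 qq_le[of K l] by linarith
  next
    case 3
    define n where "n = l - 2"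
    have n: "l = Suc (Suc n)" "K \<le> n" using 3 by (auto simp: n_def)
    have q1: "qq K n = Rr (Suc n) * qq K (Suc n)" "qq K (Suc n) = Rr l * qq K l" using qq_Suc[of K n] qq_Suc[of K "Suc n"] n by auto
    have "iQ K l t = qq K l + 48 * b (Suc n) * Fp (Suc n) t * (Rr l * qq K l)" using n by (simp add: iQ_def iL_def algebra_simps)
    also have "\<dots> = qq K l + 48 * b (Suc n) * Fp (Suc n) t * qq K (Suc n)" using q1 by simp
    also have "\<dots> \<le> qq K l + 48 * b (Suc n) * 10 * qq K (Suc n)"
      using Fp_le b_nonneg[of "Suc n"] qq_pos[of K "Suc n"] by (intro add_left_mono mult_right_mono mult_left_mono) auto
    also have "\<dots> = qq K l + 4800 * b (Suc n) * qq K (Suc n) / 10" by simp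
    also have "\<dots> \<le> qq K l + Rr (Suc n) * qq K (Suc n) / 10"
      using Rr_ge(2)[of "Suc n"] qq_pos[of K "Suc n"] by (intro add_left_mono divide_right_mono mult_right_mono) auto
    also have "\<dots> = qq K l + qq K n / 10" using q1 by simp
    also have "\<dots> \<le> 2 * dq K l + 2 * dq K n / 10" using qq_le[of K l] qq_le[of K n] by simp
    also have "dq K n = 16 * dq K l"
    proof -
      have "l - K = n - K + 2" using n by simp
      then show ?thesis using n by (simp add: dq_def power_add)
    qed
    finally show ?thesis using dq_pos[of K l] by simp
  qed
qed

lemma initial_bound:
  assumes "1 \<le> l" "0 \<le> t" "t \<le> tau K" shows "cmod (th t l) \<le> 6 * dq K l"
  using initial_majorant(1)[OF assms] iQ_le_dq[OF assms(1,3)] by linarith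

text \<open>Mode K has moved by at most 1/10. For \<open>H\<close> the bound \<open>dq\<close> / 25
  fits under 9/10 * \<open>dq\<close> / 20.\<close>

lemma initial_ready: "9 / 10 \<le> cmod (th (tau K) K)" "cmod (th (tau K) K) \<le> 2" "ready K"
proof -
  have K1: "1 \<le> K" "0 \<le> tau K" using K tau_pos[of K] by auto
  have maj: "cmod (th t l) \<le> 1 * iQ K l t" "cmod (H t l) \<le> 1 * iP K l t" if "1 \<le> l" "0 \<le> t" "t \<le> tau K" for l t
    using initial_majorant[OF that] by auto
  have "accum (\<lambda>s. flux (iQ K) (iP K) (K + 1) s + flux (iQ K) (iP K) (K - 1) s) 0 (tau K) (qq K K / 40 + qq K (K - 1) / 1000)"
    by (rule accum_add) (use accum_down[OF K, of K] accum_low[OF K, of "K - 1" "tau K"] in auto)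
  then have "cmod (th (tau K) K - th 0 K) \<le> 1 * (qq K K / 40 + qq K (K - 1) / 1000)"
    by (rule th_increment[rotated -1]) (use K1 maj in auto)
  moreover have "qq K (K - 1) = 1 / 2" using qq_below[of "K - 1" K] K by simp
  ultimately have dev: "cmod (th (tau K) K - 1) \<le> 1 / 10" using init(1)[OF K1(1)] by simp
  have "1 \<le> cmod (th (tau K) K) + cmod (th (tau K) K - 1)"
    using norm_triangle_ineq4[of "th (tau K) K" "th (tau K) K - 1"] by simp
  then show p: "9 / 10 \<le> cmod (th (tau K) K)" using dev by linarith
  show "cmod (th (tau K) K) \<le> 2" using initial_majorant(1)[OF K1(1,2) order.refl] by (simp add: iQ_def iL_def)
  define p where "p = cmod (th (tau K) K)"
  have "cmod (th (tau K) l) \<le> 20 * dq K l * p \<and> cmod (H (tau K) l) \<le> dq K l * p / 20" if l: "1 \<le> l" for l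
  proof
    have dp: "dq K l * (9 / 10) \<le> dq K l * p" using p dq_pos[of K l] unfolding p_def by (intro mult_left_mono) auto
    show "cmod (th (tau K) l) \<le> 20 * dq K l * p"
      using initial_bound[OF l K1(2) order.refl] dp dq_pos[of K l] by (simp only: mult.assoc)
    have "iP K l (tau K) \<le> dq K l / 25"
    proof -
      consider "l < K" | "l = K" | "K < l" by linarith
      then show ?thesis
      proof cases
        case 1
        have "hp K * qq K l \<le> 1 / 10000000 * (2 * dq K l)" using qq_le[of K l] hp_small[OF K] hp_pos[OF K] qq_pos[of K l] by (intro mult_mono) auto
        then show ?thesis using 1 dq_pos[of K l] by (simp add: iP_def)
      next
        case 2
        have "Fh K (tau K) \<le> hp K / 4" using hp_w[OF K K1(1) order.refl order.refl] tau_le[OF K] by (simp add: Fh_def)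
        then show ?thesis using 2 hp_small[OF K] by (simp add: iP_def)
      next
        case 3
        have "real (Suc K) ^ 3 \<le> (2 * real K) ^ 3" using K by (intro power_mono) auto
        then have "real (Suc K) ^ 3 \<le> 8 * real K ^ 3" by (simp add: power_mult_distrib)
        then have "c * eta / (8 * real K ^ 3) \<le> b (Suc K)" unfolding b_def using c_pos eta_pos K by (intro divide_left_mono) auto
        then have "b K / 8 \<le> b (Suc K)" by (simp add: b_def)
        \<comment> \<open>One large ratio right above K makes \<open>qq\<close>, and with it
          \<open>H\<close>, small for all higher modes.\<close>
        then have R: "100000 \<le> Rr (Suc K)" using K by (simp add: Rr_def)
        have "(4::real) ^ (l - Suc K) \<le> (\<Prod>j\<in>{Suc K<..l}. Rr j)"
          using prod_mono[of "{Suc K<..l}" "\<lambda>_. 4" Rr] Rr_ge by auto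
        then have "100000 * (4::real) ^ (l - Suc K) \<le> Rr (Suc K) * (\<Prod>j\<in>{Suc K<..l}. Rr j)" using R by (intro mult_mono) auto
        moreover have "{K<..l} = insert (Suc K) {Suc K<..l}" using 3 by auto
        ultimately have "100000 * (4::real) ^ (l - Suc K) \<le> (\<Prod>j\<in>{K<..l}. Rr j)" by simp
        then have "2 / (\<Prod>j\<in>{K<..l}. Rr j) \<le> 2 / (100000 * 4 ^ (l - Suc K))"
          by (intro divide_left_mono mult_pos_pos prod_pos Rr_pos) auto
        moreover have "qq K l = 2 / (\<Prod>j\<in>{K<..l}. Rr j)" using 3 by (simp add: qq_def)
        ultimately have "qq K l \<le> 2 / (100000 * 4 ^ (l - Suc K))" by (simp only:)
        also have "\<dots> = 8 / 100000 * dq K l"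
        proof -
          have "l - K = Suc (l - Suc K)" using 3 by simp
          then show ?thesis using 3 by (simp add: dq_def)
        qed
        finally have "qq K l \<le> 8 / 100000 * dq K l" .
        moreover have "qq K l * Fh l (tau K) \<le> qq K l * 1" using Fh_le_1[of l "tau K"] qq_pos[of K l] by (intro mult_left_mono) auto
        ultimately show ?thesis using 3 dq_pos[of K l] by (simp add: iP_def)
      qed
    qed
    then show "cmod (H (tau K) l) \<le> dq K l * p / 20"
      using initial_majorant(2)[OF l K1(2) order.refl] dp dq_pos[of K l] by linarith
  qed
  then show "ready K" using p unfolding ready_def p_def by auto
qed

end

end

section \<open>The cascade of resonances\<close>

context modes_sol_ap begin

text \<open>After time eta all resonances are over, and the Lorentzian tails beyond s have mass at
  most 1 / (s - eta); with bounds uniform in time this is a Cauchy criterion.\<close>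

lemma th_convergent_of_bound:
  assumes s0: "eta < s0" and l: "1 \<le> l"
    and bd: "\<And>m s. 1 \<le> m \<Longrightarrow> s0 \<le> s \<Longrightarrow> cmod (th s m) \<le> A m \<and> cmod (H s m) \<le> A m"
  shows "\<exists>L. ((\<lambda>t. th t l) \<longlongrightarrow> L) at_top"
proof -
  have A0: "0 \<le> A m" if "1 \<le> m" for m using bd[OF that order.refl] norm_ge_zero order.trans by blast
  define B where "B = 3 * b (l + 1) * A (l + 1) + 3 * b (l - 1) * A (l - 1)"
  have inc: "cmod (th t l - th s l) \<le> B / (s - eta)" if "s0 \<le> s" "s \<le> t" for s t
  proof -
    have d: "0 < s - eta" using that s0 by simp
    have fl: "accum (flux (\<lambda>m _. A m) (\<lambda>m _. A m) m) s t (3 * b m * A m * (1 / (s - eta)))" for m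
    proof (cases "m = 0")
      case True
      then show ?thesis using accum_zero by (simp add: flux_def[abs_def])
    next
      case False
      then have m: "1 \<le> m" by simp
      have "eta / real m \<le> eta / 1" using m eta_pos by (intro divide_left_mono) auto
      then have "accum (w m) s t (1 / (s - eta))" unfolding w_def[abs_def] using d by (intro accum_lorentz_right) auto
      then show ?thesis
      proof (rule accum_le[OF accum_cmult])
        fix x
        have "(w m x)\<^sup>2 \<le> w m x" using w_pos[of m x] w_le_1[of m x] by (simp add: power2_eq_square mult_left_le)
        then have "b m * A m * (2 * (w m x)\<^sup>2 + w m x) \<le> b m * A m * (3 * w m x)"
          using b_nonneg[of m] A0[OF m] by (intro mult_left_mono) auto
        then show "flux (\<lambda>m _. A m) (\<lambda>m _. A m) m x \<le> 3 * b m * A m * w m x" by (simp add: flux_def algebra_simps)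
      qed (use b_nonneg A0[OF m] in auto)
    qed
    have "cmod (th t l - th s l) \<le> 1 * (3 * b (l + 1) * A (l + 1) * (1 / (s - eta)) + 3 * b (l - 1) * A (l - 1) * (1 / (s - eta)))"
      by (rule th_increment[OF l _ that(2) _ _ _ accum_add[OF fl fl]]) (use bd that s0 eta_pos in auto)
    then show ?thesis by (simp add: B_def add_divide_distrib)
  qed
  have lim0: "((\<lambda>s. B / (s - eta)) \<longlongrightarrow> 0) at_top" by real_asymp
  have "Cauchy (\<lambda>n. th (s0 + real n) l)"
  proof (rule metric_CauchyI)
    fix e :: real assume e: "0 < e"
    have fl: "filterlim (\<lambda>n. s0 + real n) at_top sequentially" by real_asymp
    have "\<forall>\<^sub>F n in sequentially. dist (B / (s0 + real n - eta)) 0 < e / 2"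
      by (rule tendstoD[OF filterlim_compose[OF lim0 fl]]) (use e in simp)
    then obtain N where N: "\<And>n. n \<ge> N \<Longrightarrow> dist (B / (s0 + real n - eta)) 0 < e / 2" unfolding eventually_sequentially by auto
    show "\<exists>M. \<forall>m\<ge>M. \<forall>n\<ge>M. dist (th (s0 + real m) l) (th (s0 + real n) l) < e"
    proof (intro exI allI impI)
      fix m n assume mn: "N \<le> m" "N \<le> n"
      have "cmod (th (s0 + real m) l - th (s0 + real N) l) < e / 2" "cmod (th (s0 + real n) l - th (s0 + real N) l) < e / 2"
        using inc[of "s0 + real N" "s0 + real m"] inc[of "s0 + real N" "s0 + real n"] N[of N, unfolded dist_real_def diff_0_right] mn
          abs_ge_self[of "B / (s0 + real N - eta)"] by linarith+
      then show "dist (th (s0 + real m) l) (th (s0 + real n) l) < e"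
        unfolding dist_norm using norm_triangle_ineq4[of "th (s0 + real m) l - th (s0 + real N) l" "th (s0 + real n) l - th (s0 + real N) l"] by simp
    qed
  qed
  then obtain L where L: "(\<lambda>n. th (s0 + real n) l) \<longlonglongrightarrow> L" using Cauchy_convergent_iff convergent_def by blast
  have "cmod (th s l - L) \<le> B / (s - eta)" if "s0 \<le> s" for s
  proof (rule tendsto_upperbound)
    show "(\<lambda>n. cmod (th s l - th (s0 + real n) l)) \<longlonglongrightarrow> cmod (th s l - L)" by (intro tendsto_intros L)
    obtain N :: nat where N: "s - s0 \<le> real N" using real_arch_simple by blast
    show "\<forall>\<^sub>F n in sequentially. cmod (th s l - th (s0 + real n) l) \<le> B / (s - eta)"
      using eventually_ge_at_top[of N]
    proof eventually_elim
      case (elim n)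
      then have "s \<le> s0 + real n" using N by (smt (verit) of_nat_le_iff)
      then show ?case using inc[OF that, of "s0 + real n"] by (simp add: norm_minus_commute)
    qed
  qed simp
  then have "\<forall>\<^sub>F s in at_top. norm (th s l - L) \<le> B / (s - eta)" by (intro eventually_mono[OF eventually_ge_at_top[of s0]])
  then have "((\<lambda>s. th s l - L) \<longlongrightarrow> 0) at_top" by (rule Lim_null_comparison[OF _ lim0])
  then show ?thesis using LIM_zero_iff by blast
qed

context
  fixes K :: nat
  assumes K: "116 \<le> K" "636 \<le> b K" "b K \<le> 655"
    and init: "\<And>l. 1 \<le> l \<Longrightarrow> th 0 l = (if l = K then 1 else 0)"
      "\<And>l. 1 \<le> l \<Longrightarrow> H 0 l = (if l = K then - of_real (w K 0) else 0)"
begin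

lemma b_large: assumes "1 \<le> k" "k \<le> K" shows "636 \<le> b k"
  using b_mono[OF assms] K by linarith

text \<open>Up to the constants 5/4 and 160, the size of the modes next to k after resonance
  k.\<close>

definition amp :: "nat \<Rightarrow> real" where "amp k = b k * cmod (th (tau k) k)"

text \<open>Downward induction from K; each window multiplies by 5/4 b_k to 160 b_k. The factors
  9/10 and 2 bound mode K at \<open>tau K\<close>.\<close>

lemma cascade:
  assumes "1 \<le> k" "k \<le> K"
  shows "ready k \<and> 9 / 10 * (\<Prod>j\<in>{k..K}. 5 / 4 * b j) \<le> 5 / 4 * amp k \<and> amp k \<le> 2 * (\<Prod>j\<in>{k..K}. 160 * b j)"
  using assms(2,1)
proof (induction rule: inc_induct)
  case base
  have "0 \<le> b K" using K by simp
  from mult_left_mono[OF initial_ready(1)[OF K init] this] mult_left_mono[OF initial_ready(2)[OF K init] this]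
  show ?case using initial_ready(3)[OF K init] \<open>0 \<le> b K\<close> by (simp add: amp_def)
next
  case (step k)
  have k: "1 \<le> k" "k < K" using step by auto
  have IH: "ready (Suc k)" "9 / 10 * (\<Prod>j\<in>{Suc k..K}. 5 / 4 * b j) \<le> 5 / 4 * amp (Suc k)" "amp (Suc k) \<le> 2 * (\<Prod>j\<in>{Suc k..K}. 160 * b j)"
    using step.IH by auto
  have "2 \<le> Suc k" "636 \<le> b (Suc k)" using k b_large[of "Suc k"] by auto
  note st = ready_step[OF this IH(1)]
  have bk: "0 \<le> b k" by (rule b_nonneg)
  have "b k * (5 / 4 * amp (Suc k)) \<le> amp k" "amp k \<le> b k * (160 * amp (Suc k))"
    using mult_left_mono[OF st(2) bk] mult_left_mono[OF st(3) bk] by (auto simp: amp_def mult_ac)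
  moreover have "b k * (9 / 10 * (\<Prod>j\<in>{Suc k..K}. 5 / 4 * b j)) \<le> b k * (5 / 4 * amp (Suc k))"
    "b k * (160 * amp (Suc k)) \<le> b k * (160 * (2 * (\<Prod>j\<in>{Suc k..K}. 160 * b j)))"
    by (rule mult_left_mono[OF IH(2) bk], rule mult_left_mono[OF mult_left_mono[OF IH(3)] bk]) simp
  moreover have "{k..K} = insert k {Suc k..K}" using k by auto
  ultimately show ?case using st(1) by simp
qed

text \<open>The gain per window far exceeds 2. The ratio 2 is what balances lam(k) <= 2^(k - 1)
  lam(1), so that the X norm at intermediate times is controlled by the final amplitude.\<close>

lemma amp_decay: assumes "1 \<le> k" "k \<le> K" shows "2 ^ (k - 1) * amp k \<le> amp 1"
  using assms
proof (induction rule: nat_induct_at_least)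
  case (Suc k)
  have "2 \<le> Suc k" "636 \<le> b (Suc k)" using Suc b_large[of "Suc k"] by auto
  note st = ready_step(2)[OF this]
  have "ready (Suc k)" using cascade[of "Suc k"] Suc by auto
  from st[OF this] have "5 / 4 * amp (Suc k) \<le> cmod (th (tau k) k)" by (simp add: amp_def mult_ac)
  moreover have "636 * cmod (th (tau k) k) \<le> amp k" unfolding amp_def using b_large[of k] Suc by (intro mult_right_mono) auto
  moreover have "0 \<le> amp (Suc k)" by (simp add: amp_def b_nonneg)
  ultimately have "2 * amp (Suc k) \<le> amp k" by linarith
  then have "2 ^ (k - 1) * (2 * amp (Suc k)) \<le> 2 ^ (k - 1) * amp k" by (intro mult_left_mono) auto
  moreover have "2 ^ (Suc k - 1) * amp (Suc k) = 2 ^ (k - 1) * (2 * amp (Suc k))" using Suc by (cases k) auto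
  ultimately show ?case using Suc by linarith
qed simp

lemma amp_pos: assumes "1 \<le> k" "k \<le> K" shows "0 < amp k"
  using cascade[OF assms] b_large[OF assms] by (auto simp: amp_def ready_def)

lemma step_bound:
  assumes k: "1 \<le> k" "k \<le> K" and t: "tau k \<le> t" "2 \<le> k \<Longrightarrow> t \<le> tau (k - 1)" and l: "1 \<le> l"
  shows "cmod (th t l) \<le> 640 * amp k * dq k l" "cmod (H t l) \<le> 8 * amp k * dq k l"
proof -
  define p where "p = cmod (th (tau k) k)"
  have bk: "636 \<le> b k" by (rule b_large[OF k])
  have rdy: "ready k" using cascade[OF k] by simp
  note maj = step_majorant[OF k(1) bk _ rdy p_def l t(1) order.refl]
  have p0: "0 \<le> p" by (simp add: p_def)
  have a: "amp k = b k * p" by (simp add: amp_def p_def)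
  have ap: "636 * p \<le> amp k" unfolding a using bk p0 by (intro mult_right_mono) auto
  have dap: "dq k l * (636 * p) \<le> dq k l * amp k" using ap dq_pos[of k l] by (intro mult_left_mono) auto
  have dp: "0 \<le> dq k l * p" using p0 dq_pos[of k l] by simp
  have cm: "640 * amp k * dq k l = 640 * (dq k l * amp k)" "8 * amp k * dq k l = 8 * (dq k l * amp k)"
    "dq k l * (636 * p) = 636 * (dq k l * p)" by simp_all
  have "stepQ k p l t \<le> 640 * amp k * dq k l"
  proof -
    consider "l = k" | "l = k + 1 \<or> l + 1 = k" | "l \<noteq> k" "l \<noteq> k + 1" "l + 1 \<noteq> k" by blast
    then show ?thesis
    proof cases
      case 2
      then have e: "dq k l = 1 / 4" by auto
      have "stepQ k p l t = 160 * amp k" using 2 by (auto simp: stepQ_def a)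
      then show ?thesis unfolding e by simp
    next
      case 3
      then have "stepQ k p l t = 40 * (dq k l * p)" by (simp add: stepQ_def)
      then show ?thesis using dap dp unfolding cm by linarith
    qed (use ap p0 in \<open>auto simp: stepQ_def\<close>)
  qed
  then show "cmod (th t l) \<le> 640 * amp k * dq k l" using maj(1) t(2) by fastforce
  have "stepP k p l t \<le> 8 * amp k * dq k l"
  proof (cases "l = k")
    case False
    then have "stepP k p l t = dq k l * p" by (simp add: stepP_def)
    then show ?thesis using dap dp unfolding cm by linarith
  qed (use ap p0 in \<open>auto simp: stepP_def\<close>)
  then show "cmod (H t l) \<le> 8 * amp k * dq k l" using maj(2) t(2) by fastforce
qed

text \<open>Here k is the index of the current window, or K before the first one. This bound for all
  times provides the dominating function in the superposition.\<close>

lemma transient_bound: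
  assumes "0 \<le> t"
  shows "\<exists>k\<in>{1..K}. \<forall>l\<ge>1. cmod (th t l) \<le> 640 * amp 1 / 2 ^ (k - 1) * dq k l"
proof (cases "t < tau K")
  case True
  have a: "amp K \<le> amp 1 / 2 ^ (K - 1)" using amp_decay[of K] K by (simp add: field_simps)
  have "636 * (9 / 10) \<le> b K * cmod (th (tau K) K)" using initial_ready(1)[OF K init] K by (intro mult_mono) auto
  then have "6 \<le> 640 * (amp 1 / 2 ^ (K - 1))" using a by (simp add: amp_def)
  then have "6 * dq K l \<le> 640 * (amp 1 / 2 ^ (K - 1)) * dq K l" for l using dq_pos[of K l] by (intro mult_right_mono) auto
  then show ?thesis using initial_bound[OF K init _ assms] True K
    by (intro bexI[of _ K]) (auto intro: order.trans)
next
  case False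
  then have "\<exists>k. 1 \<le> k \<and> tau k \<le> t" using K by (intro exI[of _ K]) auto
  then obtain k where k: "1 \<le> k" "tau k \<le> t" and min: "\<And>j. j < k \<Longrightarrow> \<not> (1 \<le> j \<and> tau j \<le> t)"
    using exists_least_iff[of "\<lambda>k. 1 \<le> k \<and> tau k \<le> t"] by auto
  have kK: "k \<le> K" using min[of K] False K by (metis le_eq_less_or_eq linorder_not_less one_le_numeral order.trans)
  have "2 \<le> k \<Longrightarrow> t \<le> tau (k - 1)" using min[of "k - 1"] by auto
  note st = step_bound(1)[OF k(1) kK k(2) this]
  have "amp k \<le> amp 1 / 2 ^ (k - 1)" using amp_decay[of k] k kK by (simp add: field_simps)
  then have "640 * amp k * dq k l \<le> 640 * (amp 1 / 2 ^ (k - 1)) * dq k l" for l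
    using dq_pos[of k l] by (intro mult_right_mono mult_left_mono) auto
  then show ?thesis using st k kK by (intro bexI[of _ k]) (auto intro: order.trans)
qed

text \<open>Resonance 1 hands over to mode 2 as well, since mode 0 is excluded; it is complete at
  4/3 eta.\<close>

lemma final_lower: assumes "2 * eta \<le> t" shows "5 / 4 * amp 1 \<le> cmod (th t 2)"
proof -
  have K1: "1 \<le> K" using K by simp
  have "eta / real 1 + eta / (real 1 * (2 * real 1 + 1)) \<le> t" using assms eta_pos by simp
  from step_growth[OF _ b_large _ _ refl this order.refl, of 2] cascade[of 1] K1 show ?thesis by (simp add: amp_def mult.assoc)
qed

lemma final_upper: assumes "2 * eta \<le> t" "1 \<le> l"
  shows "cmod (th t l) \<le> 640 * amp 1 * dq 1 l" "cmod (H t l) \<le> 8 * amp 1 * dq 1 l"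
proof -
  have "tau 1 \<le> t" using assms eta_pos by (simp add: tau_def)
  then show "cmod (th t l) \<le> 640 * amp 1 * dq 1 l" "cmod (H t l) \<le> 8 * amp 1 * dq 1 l"
    using step_bound[of 1 t l] K assms by auto
qed

lemma final_limit: assumes "1 \<le> l" shows "\<exists>L. ((\<lambda>t. th t l) \<longlongrightarrow> L) at_top"
proof (rule th_convergent_of_bound[of "2 * eta" l "\<lambda>m. 640 * amp 1 * dq 1 m"])
  fix m :: nat and s assume m: "1 \<le> m" "2 * eta \<le> s"
  have "0 \<le> amp 1 * dq 1 m" using amp_pos[of 1] K dq_pos[of 1 m] by simp
  then show "cmod (th s m) \<le> 640 * amp 1 * dq 1 m \<and> cmod (H s m) \<le> 640 * amp 1 * dq 1 m"
    using final_upper[OF m(2,1)] by auto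
qed (use eta_pos assms in auto)

end

end

section \<open>Numerical bounds\<close>

lemma power_over_fact_le_exp:
  fixes u :: real assumes "0 \<le> u" shows "u ^ n / fact n \<le> exp u"
proof -
  have "(\<Sum>k\<in>{n}. u ^ k / fact k) \<le> (\<Sum>k. u ^ k / fact k)"
    using assms summable_exp[of u] by (intro sum_le_suminf) (auto simp: field_simps)
  also have "\<dots> = exp u" by (simp add: exp_def field_simps)
  finally show ?thesis by simp
qed

lemma fact_le_Stirling: "1 \<le> n \<Longrightarrow> fact n \<le> real n ^ (n + 1) * exp (1 - real n)"
proof (induction n rule: nat_induct_at_least)
  case (Suc n)
  have n: "0 < real n" using Suc by simp
  have "real n / (real n + 1) \<le> exp (- (1 / (real n + 1)))"
    using exp_ge_add_one_self[of "- (1 / (real n + 1))"] n by (simp add: field_simps)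
  then have "(real n / (real n + 1)) ^ (n + 1) \<le> exp (- (1 / (real n + 1))) ^ (n + 1)" using n by (intro power_mono) auto
  also have "\<dots> = exp (- 1)" using n by (simp add: exp_of_nat_mult[symmetric] field_simps del: power_Suc)
  finally have *: "real n ^ (n + 1) \<le> exp (- 1) * (real n + 1) ^ (n + 1)"
    unfolding power_divide using n by (subst (asm) pos_divide_le_eq) auto
  have "fact (Suc n) = real (Suc n) * fact n" by simp
  also have "\<dots> \<le> real (Suc n) * (real n ^ (n + 1) * exp (1 - real n))" using Suc by (intro mult_left_mono) auto
  also have "\<dots> \<le> real (Suc n) * (exp (- 1) * (real n + 1) ^ (n + 1) * exp (1 - real n))"
    using * by (intro mult_left_mono mult_right_mono) auto
  also have "\<dots> = real (Suc n) ^ (Suc n + 1) * (exp (- 1) * exp (1 - real n))" by (simp add: mult_ac add.commute)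
  also have "exp (- 1) * exp (1 - real n) = exp (1 - real (Suc n))" by (simp flip: exp_add)
  finally show ?case .
qed simp

text \<open>Absorbs the polynomial loss n^3 of the cubed factorial bound; at 116 it follows from
  2^23 > 116^3.\<close>

lemma cube_le_exp: "116 \<le> n \<Longrightarrow> real n ^ 3 \<le> exp (real n / 5)"
proof (induction n rule: nat_induct_at_least)
  case base
  have "(2::real) ^ 23 \<le> exp 1 ^ 23" using exp_ge_add_one_self[of 1] by (intro power_mono) auto
  also have "\<dots> = exp 23" by (simp flip: exp_of_nat_mult)
  also have "\<dots> \<le> exp (real 116 / 5)" by simp
  finally show ?case by simp
next
  case (Suc n)
  have n: "116 \<le> real n" using Suc by simp
  have "real (Suc n) ^ 3 \<le> (real n * (117 / 116)) ^ 3" using n by (intro power_mono) auto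
  also have "\<dots> = real n ^ 3 * (117 / 116) ^ 3" by (rule power_mult_distrib)
  also have "\<dots> \<le> exp (real n / 5) * exp (1 / 5)"
    using Suc exp_ge_add_one_self[of "1/5"] by (intro mult_mono) (auto simp: power3_eq_cube)
  also have "\<dots> = exp (real (Suc n) / 5)" by (simp add: add_divide_distrib flip: exp_add)
  finally show ?case .
qed

lemma prod_cubes: "(\<Prod>j\<in>{1..K}. A * (a / real j ^ 3)) = (A * a) ^ K / (fact K) ^ 3"
proof (induction K)
  case (Suc K)
  have "{1..Suc K} = insert (Suc K) {1..K}" by auto
  then have "(\<Prod>j\<in>{1..Suc K}. A * (a / real j ^ 3)) = A * (a / real (Suc K) ^ 3) * ((A * a) ^ K / (fact K) ^ 3)" using Suc by simp
  also have "\<dots> = (A * a * (A * a) ^ K) / (real (Suc K) ^ 3 * (fact K) ^ 3)" by simp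
  also have "\<dots> = (A * a) ^ Suc K / (fact (Suc K)) ^ 3" by (simp only: power_Suc fact_Suc power_mult_distrib of_nat_mult of_nat_fact)
  finally show ?case .
qed simp

text \<open>Compared through 20th powers, where the left side is e^119. The claim is 5.95 < ln(795 /
  2), with 795 = 5/4 * 636.\<close>

lemma exp_595: "exp (119 / 20 :: real) \<le> 795 / 2"
proof (rule power_le_imp_le_base[where n = 19])
  have "exp (119 / 20 :: real) ^ Suc 19 = exp 1 ^ 119" by (simp flip: exp_of_nat_mult)
  also have "\<dots> \<le> (272 / 100) ^ 119" using e_less_272 by (intro power_mono) auto
  also have "\<dots> \<le> (795 / 2) ^ Suc 19" unfolding power_divide by (rule mult_imp_div_pos_le) simp_all
  finally show "exp (119 / 20 :: real) ^ Suc 19 \<le> (795 / 2) ^ Suc 19" .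
qed simp

lemma cube_le_imp_le: "u \<le> v" if "u ^ 3 \<le> v ^ 3" "0 \<le> v" for u v :: real
  using power_le_imp_le_base[of u 2 v] that by (simp add: numeral_3_eq_3)

text \<open>All constants come from 10 K <= y < 10 (K + 1) with y^3 = a pi / 2: 636 is below 2000 /
  pi, 655 is above (117/116)^3 * 2000 / pi, and 8.61 is above 10 (2 / pi)^(1/3). The number 116
  comes from y >= 1162.\<close>

lemma floor_mode:
  fixes a :: real
  assumes x: "1000 < root 3 a" and K: "K = nat \<lfloor>(1/10) * root 3 (a * pi / 2)\<rfloor>"
  shows "116 \<le> K" "636 * real K ^ 3 \<le> a" "a \<le> 655 * real K ^ 3" "root 3 a \<le> 861 / 100 * (real K + 1)"
    "int K = \<lfloor>(1/10) * root 3 (a * pi / 2)\<rfloor>" "real K \<le> root 3 a"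
proof -
  define y where "y = root 3 (a * pi / 2)"
  have pi: "157 / 50 \<le> pi" "pi \<le> 31416 / 10000" using pi_approx by auto
  have "0 < root 3 a" using x by linarith
  then have a0: "0 < a" using real_root_gt_0_iff[of 3 a] by (metis zero_less_numeral)
  have x3: "root 3 a ^ 3 = a" using a0 by (simp add: real_root_pow_pos2)
  have "(1000::real) ^ 3 \<le> root 3 a ^ 3" using x by (intro power_mono) auto
  then have a9: "1000000000 \<le> a" using x3 by simp
  have y3: "y ^ 3 = a * pi / 2" unfolding y_def using a0 by (intro real_root_pow_pos2) auto
  have y0: "0 \<le> y" unfolding y_def using a0 by simp
  have "1000000000 * (157 / 50) \<le> a * pi" using a9 pi by (intro mult_mono) auto
  then have "(1162::real) ^ 3 \<le> y ^ 3" unfolding y3 by simp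
  then have y: "1162 \<le> y" using y0 by (rule cube_le_imp_le)
  show Ki: "int K = \<lfloor>(1/10) * root 3 (a * pi / 2)\<rfloor>" unfolding K using y a0 by (simp add: y_def)
  have Kr: "real K \<le> y / 10" "y / 10 < real K + 1" using Ki y_def by linarith+
  then show K116: "116 \<le> K" using y by linarith
  have "real K ^ 3 \<le> (y / 10) ^ 3" using Kr by (intro power_mono) auto
  then have "2000 * real K ^ 3 \<le> a * pi" unfolding power_divide y3 by simp
  also have "\<dots> \<le> a * (31416 / 10000)" using pi a0 by (intro mult_left_mono) auto
  finally show "636 * real K ^ 3 \<le> a" using zero_le_power[of "real K" 3] by linarith
  have "(y / 10) ^ 3 \<le> (real K + 1) ^ 3" using Kr y0 by (intro power_mono) auto
  then have "a * pi \<le> 2000 * (real K + 1) ^ 3" unfolding power_divide y3 by simp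
  moreover have "a * (157 / 50) \<le> a * pi" using pi a0 by (intro mult_left_mono) auto
  ultimately have up: "a * 157 \<le> 100000 * (real K + 1) ^ 3" by simp
  have "(real K + 1) ^ 3 \<le> (real K * (117 / 116)) ^ 3" using K116 by (intro power_mono) auto
  also have "\<dots> = real K ^ 3 * (117 / 116) ^ 3" by (rule power_mult_distrib)
  also have "\<dots> \<le> real K ^ 3 * (10262 / 10000)" by (intro mult_left_mono) (auto simp: power3_eq_cube)
  finally show "a \<le> 655 * real K ^ 3" using up zero_le_power[of "real K" 3] by linarith
  have e: "(861 / 100 * (real K + 1)) ^ 3 = 638277381 / 1000000 * (real K + 1) ^ 3" unfolding power_mult_distrib by (simp add: power_divide)
  have "root 3 a ^ 3 \<le> (861 / 100 * (real K + 1)) ^ 3" unfolding x3 e using up zero_le_power[of "real K + 1" 3] by linarith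
  then show "root 3 a \<le> 861 / 100 * (real K + 1)" by (rule cube_le_imp_le) simp
  have "real K ^ 3 \<le> root 3 a ^ 3" unfolding x3 using \<open>636 * real K ^ 3 \<le> a\<close> zero_le_power[of "real K" 3] by linarith
  then show "real K \<le> root 3 a" by (rule cube_le_imp_le) (use x in linarith)
qed

text \<open>By Stirling the product is at least (795 e^3)^K up to polynomial factors. The factor 2^K
  on the left pays for lam(K) against lam(2).\<close>

lemma lower_numeric:
  fixes a x :: real
  assumes K: "116 \<le> K" "636 * real K ^ 3 \<le> a" and x: "x \<le> 861 / 100 * (real K + 1)"
  shows "exp x * 2 ^ K \<le> 9 / 10 * ((5 / 4 * a) ^ K / (fact K) ^ 3)"
proof -
  have Kr: "116 \<le> real K" using K by simp
  have "(fact K :: real) ^ 3 \<le> (real K ^ (K + 1) * exp (1 - real K)) ^ 3" using fact_le_Stirling[of K] K by (intro power_mono) auto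
  also have "\<dots> = (real K ^ 3) ^ K * real K ^ 3 * exp (3 - 3 * real K)"
    by (simp add: power_mult_distrib power_add exp_of_nat_mult[symmetric] flip: power_mult) (simp add: mult.commute)
  also have "\<dots> \<le> (real K ^ 3) ^ K * exp (real K / 5) * exp (3 - 3 * real K)"
    using cube_le_exp[OF K(1)] by (intro mult_right_mono mult_left_mono) auto
  finally have f: "(fact K :: real) ^ 3 \<le> (real K ^ 3) ^ K * exp (real K / 5) * exp (3 - 3 * real K)" .
  have "exp x * 2 ^ K * (fact K) ^ 3 \<le> exp (861 / 100 * (real K + 1)) * 2 ^ K * ((real K ^ 3) ^ K * exp (real K / 5) * exp (3 - 3 * real K))"
    using x f by (intro mult_mono) auto
  also have "\<dots> = (2 * real K ^ 3) ^ K * exp (861 / 100 * (real K + 1) + real K / 5 + (3 - 3 * real K))"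
    by (simp only: power_mult_distrib exp_add mult.assoc mult.left_commute mult.commute)
  \<comment> \<open>Per unit of K the exponent is 8.61 + 0.2 - 3 = 5.81. The reserve 0.14 K up to
    5.95 covers the constants 8.61 + 3 + 1 because K >= 116.\<close>
  also have "\<dots> \<le> (2 * real K ^ 3) ^ K * (9 / 10 * exp (real K * (119 / 20)))"
  proof (intro mult_left_mono)
    have "exp (861 / 100 * (real K + 1) + real K / 5 + (3 - 3 * real K)) \<le> exp (real K * (119 / 20) + - 1)"
      using Kr by (simp add: field_simps)
    also have "\<dots> = exp (real K * (119 / 20)) * exp (- 1)" by (rule exp_add)
    also have "exp (- 1 :: real) \<le> 9 / 10" using exp_ge_add_one_self[of 1] by (simp add: exp_minus field_simps)
    finally show "exp (861 / 100 * (real K + 1) + real K / 5 + (3 - 3 * real K)) \<le> 9 / 10 * exp (real K * (119 / 20))" by simp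
  qed auto
  also have "exp (real K * (119 / 20)) = exp (119 / 20) ^ K" by (rule exp_of_nat_mult)
  also have "(2 * real K ^ 3) ^ K * (9 / 10 * exp (119 / 20) ^ K) \<le> (2 * real K ^ 3) ^ K * (9 / 10 * (795 / 2) ^ K)"
    using exp_595 by (intro mult_left_mono power_mono) auto
  also have "\<dots> = 9 / 10 * (795 * real K ^ 3) ^ K"
  proof -
    have "(2 * real K ^ 3) ^ K * (795 / 2) ^ K = (2 * real K ^ 3 * (795 / 2)) ^ K" by (rule power_mult_distrib[symmetric])
    also have "2 * real K ^ 3 * (795 / 2) = 795 * real K ^ 3" by simp
    finally show ?thesis by (simp only: mult.left_commute[of _ "9 / 10"])
  qed
  also have "\<dots> \<le> 9 / 10 * (5 / 4 * a) ^ K" using K by (intro mult_left_mono power_mono) auto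
  finally show ?thesis unfolding times_divide_eq_right by (subst pos_le_divide_eq) auto
qed

lemma upper_numeric:
  fixes a x :: real
  assumes x: "x ^ 3 = a" "1000 \<le> x" and K: "real K \<le> x"
  shows "10000 * (2 ^ K * (2 * ((160 * a) ^ K / (fact K) ^ 3))) \<le> exp (50 * x)"
proof -
  have "0 \<le> x ^ 3" using x(2) by (intro zero_le_power) linarith
  then have a0: "0 \<le> a" using x(1) by simp
  \<comment> \<open>160 <= 6^3 turns the product into the cube of a single term of the exponential
    series of 6 x. With 2^K <= e^x and 20000 <= e^x the total exponent is 20 x.\<close>
  have "(160 * a) ^ K \<le> ((6 * x) ^ 3) ^ K" unfolding power_mult_distrib[of 6 x 3] x(1) using a0 by (intro power_mono) auto
  then have "(160 * a) ^ K / (fact K) ^ 3 \<le> ((6 * x) ^ 3) ^ K / (fact K) ^ 3" by (intro divide_right_mono) auto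
  also have "\<dots> = ((6 * x) ^ K / fact K) ^ 3" by (simp only: power_divide power_mult[symmetric] mult.commute[of 3 K])
  also have "\<dots> \<le> exp (6 * x) ^ 3" using power_over_fact_le_exp[of "6 * x" K] x by (intro power_mono) auto
  also have "\<dots> = exp (18 * x)" by (simp flip: exp_of_nat_mult)
  finally have 1: "(160 * a) ^ K / (fact K) ^ 3 \<le> exp (18 * x)" .
  have "(2::real) ^ K \<le> exp 1 ^ K" using exp_ge_add_one_self[of 1] by (intro power_mono) auto
  also have "\<dots> = exp (real K)" by (simp flip: exp_of_nat_mult)
  also have "\<dots> \<le> exp x" using K by simp
  finally have 2: "(2::real) ^ K \<le> exp x" .
  have "(20000::real) \<le> 2 ^ 15" by simp
  also have "\<dots> \<le> exp 1 ^ 15" using exp_ge_add_one_self[of 1] by (intro power_mono) auto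
  also have "\<dots> = exp 15" by (simp flip: exp_of_nat_mult)
  also have "\<dots> \<le> exp x" using x by simp
  finally have 3: "(20000::real) \<le> exp x" .
  have "10000 * (2 ^ K * (2 * ((160 * a) ^ K / (fact K) ^ 3))) = 20000 * (2 ^ K * ((160 * a) ^ K / (fact K) ^ 3))" by simp
  also have "\<dots> \<le> exp x * (exp x * exp (18 * x))" using 1 2 3 a0 by (intro mult_mono) auto
  also have "\<dots> = exp (20 * x)" by (simp flip: exp_add)
  also have "\<dots> \<le> exp (50 * x)" using x by simp
  finally show ?thesis .
qed

section \<open>The weighted sequence space\<close>

lemma has_sum_int_nat:
  fixes g :: "int \<Rightarrow> real"
  assumes "\<And>l. 0 \<le> g l" "\<And>l. l < 0 \<Longrightarrow> g l = 0" "(\<lambda>n. g (int n)) sums S"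
  shows "(g has_sum S) UNIV"
proof -
  have "((g \<circ> int) has_sum S) UNIV" using sums_nonneg_imp_has_sum[OF assms(3)] assms(1) by (simp add: o_def)
  then have "(g has_sum S) (range int)" by (subst has_sum_reindex) auto
  moreover have "l \<in> range int" if "\<not> l < 0" for l :: int using that by (metis nonneg_int_cases not_less rangeI)
  ultimately show ?thesis using has_sum_cong_neutral[of UNIV "range int" g g S] assms(2) by blast
qed

lemma sum_dq: "(\<Sum>n<N. dq k n) \<le> 2"
proof -
  \<comment> \<open>Strengthened to the geometric sums on either side of k, whose limit is 1 +
    2/3.\<close>
  have "(\<Sum>n<N. dq k n) \<le> (if N \<le> k then 1 / (3 * 4 ^ (k - N)) else 5 / 3 - 1 / (3 * 4 ^ (N - k - 1)))"
  proof (induction N)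
    case (Suc N)
    consider "N < k" | "N = k" | "k < N" by linarith
    then show ?case
    proof cases
      case 1
      define X where "X = (4::real) ^ (k - Suc N)"
      have "k - N = Suc (k - Suc N)" using 1 by simp
      then have "dq k N = 1 / (4 * X)" "(4::real) ^ (k - N) = 4 * X" using 1 by (auto simp: dq_def X_def)
      moreover have "1 / (3 * (4 * X)) + 1 / (4 * X) = 1 / (3 * X)" by (simp add: X_def field_simps)
      ultimately show ?thesis using Suc 1 by (simp add: X_def[symmetric])
    next
      case 3
      define X where "X = (4::real) ^ (N - k - 1)"
      have "N - k = Suc (N - k - 1)" using 3 by simp
      then have e: "dq k N = 1 / (4 * X)" "(4::real) ^ (Suc N - k - 1) = 4 * X" using 3 by (auto simp: dq_def X_def)
      have "1 / (4 * X) - 1 / (3 * X) = - (1 / (3 * (4 * X)))" by (simp add: X_def field_simps)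
      moreover have "(\<Sum>n<N. dq k n) \<le> 5 / 3 - 1 / (3 * X)" using Suc 3 by (simp add: X_def)
      moreover have "(\<Sum>n<Suc N. dq k n) = (\<Sum>n<N. dq k n) + dq k N" by simp
      ultimately have "(\<Sum>n<Suc N. dq k n) \<le> 5 / 3 - 1 / (3 * 4 ^ (Suc N - k - 1))" unfolding e by linarith
      then show ?thesis using 3 by simp
    qed (use Suc in simp)
  qed simp
  also have "\<dots> \<le> 2"
  proof (cases "N \<le> k")
    case True
    have "1 \<le> 3 * (4::real) ^ (k - N)" using one_le_power[of "4::real" "k - N"] by linarith
    then have "1 / (3 * (4::real) ^ (k - N)) \<le> 1" by simp
    then have "1 / (3 * (4::real) ^ (k - N)) \<le> 2" by linarith
    then show ?thesis using True by (simp only: if_True)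
  next
    case False
    have "0 \<le> 1 / (3 * (4::real) ^ (N - k - 1))" by simp
    then have "5 / 3 - 1 / (3 * (4::real) ^ (N - k - 1)) \<le> 2" by linarith
    then show ?thesis using False by (simp only: if_False)
  qed
  finally show ?thesis .
qed

lemma summable_dq: "summable (dq k)"
proof (rule bounded_imp_summable[where B = 2])
  show "sum (dq k) {..n} \<le> 2" for n using sum_dq[of k "Suc n"] by (simp add: lessThan_Suc_atMost)
qed (simp add: dq_pos less_imp_le)

lemma suminf_dq: "(\<Sum>n. dq k n) \<le> 2"
  by (rule suminf_le_const[OF summable_dq]) (use sum_dq in auto)

locale weight =
  fixes lam :: "int \<Rightarrow> real"
  assumes lam_pos: "0 < lam l" and lam_step: "lam (l + 1) \<le> 2 * lam l" "lam (l - 1) \<le> 2 * lam l"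
begin

lemma lam_add: "lam (l + int n) \<le> 2 ^ n * lam l" "lam (l - int n) \<le> 2 ^ n * lam l"
proof (induction n)
  case (Suc n)
  { case 1
    have "lam (l + int n + 1) \<le> 2 * lam (l + int n)" by (rule lam_step)
    then show ?case using Suc(1) by (simp add: add.assoc add.commute[of 1]) }
  { case 2
    have "lam (l - int n - 1) \<le> 2 * lam (l - int n)" by (rule lam_step)
    then show ?case using Suc(2) by (simp add: algebra_simps) }
qed auto

lemma lam_dist: "lam (int l) \<le> 2 ^ ((l - k) + (k - l)) * lam (int k)"
proof (cases "k \<le> l")
  case True
  then show ?thesis using lam_add(1)[of "int k" "l - k"] by (simp add: of_nat_diff)
next
  case False
  then show ?thesis using lam_add(2)[of "int k" "k - l"] by (simp add: of_nat_diff)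
qed

text \<open>The weight grows at most like 2^e at distance e, so the square of 2^e / 4^e is again
  \<open>dq\<close>, which is summable.\<close>

lemma lam_dq: "(lam (int l) * dq k l)\<^sup>2 \<le> (lam (int k))\<^sup>2 * dq k l"
proof -
  define e where "e = (l - k) + (k - l)"
  have "lam (int l) * dq k l \<le> 2 ^ e * lam (int k) * dq k l"
    using lam_dist[of l k] dq_pos[of k l] by (intro mult_right_mono) (auto simp: e_def)
  also have "\<dots> = lam (int k) * (1 / 2 ^ e)" by (simp add: dq_def e_def field_simps flip: power_mult_distrib)
  finally have "(lam (int l) * dq k l)\<^sup>2 \<le> (lam (int k) * (1 / 2 ^ e))\<^sup>2"
    using lam_pos[of "int l"] dq_pos[of k l] by (intro power_mono) auto
  also have "\<dots> = (lam (int k))\<^sup>2 * dq k l"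
    by (simp add: dq_def e_def[symmetric] power_mult_distrib power_divide power_mult[symmetric] mult.commute[of e 2]) (simp add: power_mult)
  finally show ?thesis .
qed

lemma coord_le_Xnorm:
  assumes "in_X lam u" shows "lam l * cmod (u l) \<le> Xnorm lam u"
proof -
  have "(\<Sum>l\<in>{l}. (lam l * cmod (u l))\<^sup>2) \<le> (\<Sum>\<^sub>\<infinity>l. (lam l * cmod (u l))\<^sup>2)"
    using assms unfolding in_X_def by (intro finite_sum_le_infsum) auto
  then have "sqrt ((lam l * cmod (u l))\<^sup>2) \<le> Xnorm lam u" unfolding Xnorm_def by (intro real_sqrt_le_mono) simp
  then show ?thesis using lam_pos[of l] by simp
qed

lemma in_X_diff:
  assumes "in_X lam u" "in_X lam v" shows "in_X lam (\<lambda>l. u l - v l)"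
proof -
  have "(\<lambda>l. 2 * (lam l * cmod (u l))\<^sup>2 + 2 * (lam l * cmod (v l))\<^sup>2) summable_on UNIV"
    using assms unfolding in_X_def by (intro summable_on_add summable_on_cmult_right)
  then show ?thesis unfolding in_X_def
  proof (rule summable_on_comparison_test)
    fix l
    have "lam l * cmod (u l - v l) \<le> lam l * cmod (u l) + lam l * cmod (v l)"
      using lam_pos[of l] norm_triangle_ineq4[of "u l" "v l"] by (simp flip: distrib_left)
    then have "(lam l * cmod (u l - v l))\<^sup>2 \<le> (lam l * cmod (u l) + lam l * cmod (v l))\<^sup>2"
      using lam_pos[of l] by (intro power_mono) auto
    also have "\<dots> \<le> 2 * (lam l * cmod (u l))\<^sup>2 + 2 * (lam l * cmod (v l))\<^sup>2"
      using zero_le_power2[of "lam l * cmod (u l) - lam l * cmod (v l)"] by (simp add: power2_eq_square algebra_simps)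
    finally show "(lam l * cmod (u l - v l))\<^sup>2 \<le> 2 * (lam l * cmod (u l))\<^sup>2 + 2 * (lam l * cmod (v l))\<^sup>2" .
  qed auto
qed

lemma X_terms:
  assumes "\<And>l. 1 \<le> l \<Longrightarrow> cmod (u (int l)) \<le> C * dq k l" "u 0 = 0"
  shows "(lam (int n) * cmod (u (int n)))\<^sup>2 \<le> C\<^sup>2 * ((lam (int k))\<^sup>2 * dq k n)"
proof (cases "n = 0")
  case False
  have "lam (int n) * cmod (u (int n)) \<le> C * (lam (int n) * dq k n)"
    using mult_left_mono[OF assms(1)[of n], of "lam (int n)"] False lam_pos[of "int n"] by (simp add: mult_ac)
  then have "(lam (int n) * cmod (u (int n)))\<^sup>2 \<le> (C * (lam (int n) * dq k n))\<^sup>2"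
    using lam_pos[of "int n"] by (intro power_mono) auto
  also have "\<dots> = C\<^sup>2 * (lam (int n) * dq k n)\<^sup>2" by (simp add: power_mult_distrib)
  also have "\<dots> \<le> C\<^sup>2 * ((lam (int k))\<^sup>2 * dq k n)" using lam_dq[of n k] by (intro mult_left_mono) auto
  finally show ?thesis .
qed (use assms(2) dq_pos[of k 0] in simp)

lemma Xnorm_suminf:
  assumes "\<And>l. 1 \<le> l \<Longrightarrow> cmod (u (int l)) \<le> C * dq k l" "\<And>l. l \<le> 0 \<Longrightarrow> u l = 0"
  shows "in_X lam u" "Xnorm lam u = sqrt (\<Sum>n. (lam (int n) * cmod (u (int n)))\<^sup>2)"
    "summable (\<lambda>n. (lam (int n) * cmod (u (int n)))\<^sup>2)"
proof -
  show s: "summable (\<lambda>n. (lam (int n) * cmod (u (int n)))\<^sup>2)"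
  proof (rule summable_comparison_test')
    show "summable (\<lambda>n. C\<^sup>2 * ((lam (int k))\<^sup>2 * dq k n))" by (intro summable_mult summable_dq)
    show "norm ((lam (int n) * cmod (u (int n)))\<^sup>2) \<le> C\<^sup>2 * ((lam (int k))\<^sup>2 * dq k n)" for n
      using X_terms[OF assms(1) assms(2)[of 0], of n] by simp
  qed
  have "((\<lambda>l. (lam l * cmod (u l))\<^sup>2) has_sum (\<Sum>n. (lam (int n) * cmod (u (int n)))\<^sup>2)) UNIV"
    by (rule has_sum_int_nat) (use assms(2) s in \<open>auto simp: summable_sums\<close>)
  then show "in_X lam u" "Xnorm lam u = sqrt (\<Sum>n. (lam (int n) * cmod (u (int n)))\<^sup>2)"
    unfolding in_X_def Xnorm_def by (auto simp: summable_on_def infsumI)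
qed

lemma X_bound:
  assumes "\<And>l. 1 \<le> l \<Longrightarrow> cmod (u (int l)) \<le> C * dq k l" "\<And>l. l \<le> 0 \<Longrightarrow> u l = 0" "0 \<le> C"
  shows "Xnorm lam u \<le> 2 * C * lam (int k)"
proof -
  have eq: "Xnorm lam u = sqrt (\<Sum>n. (lam (int n) * cmod (u (int n)))\<^sup>2)"
    by (rule Xnorm_suminf(2)[of u C k]) (use assms in auto)
  have "(\<Sum>n. (lam (int n) * cmod (u (int n)))\<^sup>2) \<le> (\<Sum>n. C\<^sup>2 * ((lam (int k))\<^sup>2 * dq k n))"
    by (intro suminf_le X_terms[OF assms(1) assms(2)] Xnorm_suminf(3)[OF assms(1,2)] summable_mult summable_dq) auto
  also have "\<dots> = C\<^sup>2 * ((lam (int k))\<^sup>2 * (\<Sum>n. dq k n))" by (simp add: suminf_mult summable_dq summable_mult)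
  also have "\<dots> \<le> C\<^sup>2 * ((lam (int k))\<^sup>2 * 4)" using suminf_dq[of k] by (intro mult_left_mono) auto
  also have "\<dots> = (2 * C * lam (int k))\<^sup>2" by (simp add: power_mult_distrib)
  finally have "Xnorm lam u \<le> sqrt ((2 * C * lam (int k))\<^sup>2)"
    unfolding eq by (rule real_sqrt_le_mono)
  then show ?thesis using assms(3) lam_pos[of "int k"] by simp
qed

lemma Xnorm_delta: "in_X lam (\<lambda>l. if l = k then z else 0)" "Xnorm lam (\<lambda>l. if l = k then z else 0) = lam k * cmod z"
proof -
  let ?g = "\<lambda>l. (lam l * cmod (if l = k then z else 0))\<^sup>2"
  have "(?g has_sum (\<Sum>l\<in>{k}. ?g l)) {k}" by (rule has_sum_finite) simp
  then have "(?g has_sum (\<Sum>l\<in>{k}. ?g l)) UNIV" by (subst has_sum_cong_neutral[of "{k}" UNIV ?g ?g]) auto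
  then have "((\<lambda>l. (lam l * cmod (if l = k then z else 0))\<^sup>2) has_sum (lam k * cmod z)\<^sup>2) UNIV" by simp
  then show "in_X lam (\<lambda>l. if l = k then z else 0)" "Xnorm lam (\<lambda>l. if l = k then z else 0) = lam k * cmod z"
    unfolding in_X_def Xnorm_def using lam_pos[of k] by (auto simp: summable_on_def infsumI)
qed

text \<open>Dominated convergence for series: coordinatewise limits suffice under a common multiple
  of \<open>dq\<close>.\<close>

lemma X_tendsto:
  assumes F: "F \<noteq> bot" and lim: "\<And>l. 1 \<le> l \<Longrightarrow> ((\<lambda>t. u t (int l)) \<longlongrightarrow> 0) F"
    and bd: "\<forall>\<^sub>F t in F. (\<forall>l\<ge>1. cmod (u t (int l)) \<le> C * dq k l) \<and> (\<forall>l\<le>0. u t l = 0)"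
  shows "((\<lambda>t. Xnorm lam (u t)) \<longlongrightarrow> 0) F"
proof -
  have "((\<lambda>t. \<Sum>n. (lam (int n) * cmod (u t (int n)))\<^sup>2) \<longlongrightarrow> (\<Sum>n::nat. 0)) F"
  proof (rule tannerys_theorem[where M = "\<lambda>n. C\<^sup>2 * ((lam (int k))\<^sup>2 * dq k n)", THEN conjunct2, THEN conjunct2])
    show "((\<lambda>t. (lam (int n) * cmod (u t (int n)))\<^sup>2) \<longlongrightarrow> 0) F" for n
    proof (cases "n = 0")
      case True
      have "\<forall>\<^sub>F t in F. (lam (int n) * cmod (u t (int n)))\<^sup>2 = 0" using bd by (rule eventually_mono) (use True in auto)
      then show ?thesis by (rule tendsto_eventually)
    next
      case False
      have "((\<lambda>t. (lam (int n) * cmod (u t (int n)))\<^sup>2) \<longlongrightarrow> (lam (int n) * cmod 0)\<^sup>2) F"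
        by (intro tendsto_intros lim) (use False in auto)
      then show ?thesis by simp
    qed
    have "\<forall>\<^sub>F t in F. \<forall>n. norm ((lam (int n) * cmod (u t (int n)))\<^sup>2) \<le> C\<^sup>2 * ((lam (int k))\<^sup>2 * dq k n)"
      using bd by eventually_elim (use X_terms in auto)
    then show "\<forall>\<^sub>F (n, t) in sequentially \<times>\<^sub>F F. norm ((lam (int n) * cmod (u t (int n)))\<^sup>2) \<le> C\<^sup>2 * ((lam (int k))\<^sup>2 * dq k n)"
      unfolding eventually_prod_filter
      by (intro exI[of _ "\<lambda>_. True"] exI[of _ "\<lambda>t. \<forall>n. norm ((lam (int n) * cmod (u t (int n)))\<^sup>2) \<le> C\<^sup>2 * ((lam (int k))\<^sup>2 * dq k n)"]) auto
    show "summable (\<lambda>n. C\<^sup>2 * ((lam (int k))\<^sup>2 * dq k n))" by (intro summable_mult summable_dq)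
  qed (use F in auto)
  then have "((\<lambda>t. sqrt (\<Sum>n. (lam (int n) * cmod (u t (int n)))\<^sup>2)) \<longlongrightarrow> sqrt 0) F" by (intro tendsto_real_sqrt) simp
  moreover have "\<forall>\<^sub>F t in F. sqrt (\<Sum>n. (lam (int n) * cmod (u t (int n)))\<^sup>2) = Xnorm lam (u t)"
    using bd by eventually_elim (metis Xnorm_suminf(2))
  ultimately show ?thesis by (auto elim: Lim_transform_eventually)
qed

end

section \<open>Existence and uniqueness for the wave perturbation system\<close>

locale wave =
  fixes nu c :: real and f :: "real \<Rightarrow> real"
  assumes nu_pos: "0 < nu" and c_pos: "0 < c" and c_small: "c < 1 / 1000"
    and f_cont: "continuous_on {0..} f"
    and f_bound: "\<And>t. 0 \<le> t \<Longrightarrow> \<bar>f t\<bar> \<le> 2 * c / (1 + t\<^sup>2)"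
begin

text \<open>The index \<open>(l, False)\<close> stands for \<open>\<theta>\<^sub>l\<close> and \<open>(l, True)\<close> for \<open>G\<^sub>l\<close>.\<close>

definition lor :: "int \<Rightarrow> real \<Rightarrow> real \<Rightarrow> real" where "lor l \<eta> t = 1 / (1 + (\<eta> / real_of_int l - t)\<^sup>2)"

definition coef :: "int \<times> bool \<Rightarrow> real \<Rightarrow> real \<Rightarrow> real" where
  "coef j \<eta> t = (if snd j then dcoef c \<eta> (fst j) t else ccoef c \<eta> (fst j) t)"

definition nbr :: "int \<times> bool \<Rightarrow> (int \<times> bool) set" where
  "nbr i = {(fst i + 1, False), (fst i - 1, False), (fst i + 1, True), (fst i - 1, True), (fst i, False)}"

definition mat :: "int \<times> bool \<Rightarrow> int \<times> bool \<Rightarrow> real \<Rightarrow> real \<Rightarrow> complex" where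
  "mat i j \<eta> t = (if fst i = 0 then 0
     else if fst j = fst i then (if snd i \<and> \<not> snd j then of_real (2 * (\<eta> / real_of_int (fst i) - t) * (lor (fst i) \<eta> t)\<^sup>2) else 0)
     else (if snd i then of_real (f t / (2 * c)) * \<i> * of_int (fst i) + of_real (lor (fst i) \<eta> t) else 1) * of_real (coef j \<eta> t))"

definition damp :: "int \<times> bool \<Rightarrow> real \<Rightarrow> real \<Rightarrow> real" where
  "damp i \<eta> t = (if snd i then nu * ((real_of_int (fst i))\<^sup>2 + (\<eta> - real_of_int (fst i) * t)\<^sup>2) else 0)"

definition dampint :: "int \<times> bool \<Rightarrow> real \<Rightarrow> real \<Rightarrow> real" where
  "dampint i \<eta> t = (if snd i then nu * ((real_of_int (fst i))\<^sup>2 * t + (\<eta>\<^sup>2 * t - \<eta> * real_of_int (fst i) * t\<^sup>2 + (real_of_int (fst i))\<^sup>2 * t ^ 3 / 3)) else 0)"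

lemma one_plus_sq: "1 + (x::real)\<^sup>2 \<noteq> 0" "0 < 1 + x\<^sup>2" by (auto simp: add_pos_nonneg add_nonneg_eq_0_iff)

lemma continuous_lor: "continuous_on S (\<lambda>z. lor l (fst z) (snd z))"
  unfolding lor_def using one_plus_sq by (cases "l = 0") (auto intro!: continuous_intros)

lemma continuous_coef: "continuous_on S (\<lambda>z. coef j (fst z) (snd z))"
  unfolding coef_def ccoef_def dcoef_def using one_plus_sq
  by (cases "fst j = 0"; cases "snd j") (auto intro!: continuous_intros)

lemma continuous_mat: "continuous_on (UNIV \<times> {0..}) (\<lambda>(\<eta>, t). mat i j \<eta> t)"
proof -
  have f: "continuous_on (UNIV \<times> {0..}) (\<lambda>z::real \<times> real. f (snd z))"
    by (rule continuous_on_compose2[OF f_cont]) (auto intro!: continuous_intros)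
  show ?thesis
  proof (cases "fst i = 0")
    case False
    then show ?thesis unfolding split_beta mat_def
      by (cases "fst j = fst i"; cases "snd i"; cases "snd j")
         (auto intro!: continuous_intros f continuous_lor continuous_coef simp: c_pos[THEN less_imp_neq, symmetric])
  qed (simp add: mat_def)
qed

sublocale ls: lin_sys nbr mat damp dampint
proof
  show "finite (nbr i)" for i by (simp add: nbr_def)
  show "continuous_on (UNIV \<times> {0..}) (\<lambda>(\<eta>, t). mat i j \<eta> t)" for i j by (rule continuous_mat)
  show "continuous_on (UNIV \<times> {0..}) (\<lambda>(\<eta>, t). dampint i \<eta> t)" for i
    unfolding split_beta dampint_def by (cases "snd i") (auto intro!: continuous_intros)
  show "(dampint i \<eta> has_real_derivative damp i \<eta> t) (at t within {0..})" for i \<eta> t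
  proof (cases "snd i")
    case True
    have "((\<lambda>t. nu * (l\<^sup>2 * t + (\<eta>\<^sup>2 * t - \<eta> * l * t\<^sup>2 + l\<^sup>2 * t ^ 3 / 3))) has_real_derivative nu * (l\<^sup>2 + (\<eta> - l * t)\<^sup>2)) (at t within {0..})" for l
      by (auto intro!: derivative_eq_intros simp: power2_eq_square algebra_simps)
    then show ?thesis using True by (simp add: dampint_def[abs_def] damp_def)
  qed (simp add: dampint_def[abs_def] damp_def)
  show "0 \<le> damp i \<eta> t" for i \<eta> t using nu_pos by (simp add: damp_def)
qed

text \<open>The decay |j|^-3 of the coefficients pays for the factor l in the equation of G: the
  prefactor there is at most |l| + 1 <= |j| + 2.\<close>

lemma coef_bound: "\<bar>coef j \<eta> t\<bar> * (\<bar>real_of_int (fst j)\<bar> + 2) \<le> 3 * \<bar>c * \<eta>\<bar>"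
proof (cases "fst j = 0")
  case False
  define m where "m = \<bar>real_of_int (fst j)\<bar>"
  have m: "1 \<le> m" using False unfolding m_def by linarith
  have *: "\<bar>coef j \<eta> t\<bar> \<le> \<bar>c * \<eta>\<bar> / m ^ 3"
  proof -
    let ?x = "1 + (\<eta> / real_of_int (fst j) - t)\<^sup>2"
    have x: "1 \<le> ?x" "1 \<le> ?x\<^sup>2" by (auto intro: one_le_power)
    have "\<bar>c * \<eta>\<bar> / m ^ 3 / y \<le> \<bar>c * \<eta>\<bar> / m ^ 3 / 1" if "1 \<le> y" for y using that m by (intro divide_left_mono) auto
    from this[OF x(1)] this[OF x(2)] show ?thesis
      using False x by (auto simp: coef_def ccoef_def dcoef_def m_def abs_mult abs_divide power_abs)
  qed
  have "\<bar>coef j \<eta> t\<bar> * (m + 2) \<le> (\<bar>c * \<eta>\<bar> / m ^ 3) * (3 * m)" using * m by (intro mult_mono) auto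
  also have "\<dots> = 3 * \<bar>c * \<eta>\<bar> * (1 / m\<^sup>2)" using m by (simp add: field_simps power2_eq_square power3_eq_cube)
  also have "\<dots> \<le> 3 * \<bar>c * \<eta>\<bar> * 1" using m by (intro mult_left_mono) auto
  finally show ?thesis by (simp add: m_def)
qed (simp add: coef_def ccoef_def dcoef_def)

text \<open>Four neighbour entries of size at most 3 |c eta| |R| each, plus the entry of th_l in the
  equation of G_l, which is at most 1 since 2|x| <= (1 + x^2)^2.\<close>

lemma row_bound_wave:
  assumes v: "\<And>l. 0 \<le> v l" "\<And>l. v (l + 1) \<le> R * v l" "\<And>l. v (l - 1) \<le> R * v l"
  shows "ls.row_bound \<eta> (\<lambda>i. v (fst i)) (12 * \<bar>c * \<eta>\<bar> * \<bar>R\<bar> + 1)"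
  unfolding ls.row_bound_def
proof (intro conjI allI impI)
  fix i :: "int \<times> bool" and t :: real assume t: "0 \<le> t"
  obtain l g where i: "i = (l, g)" by (cases i)
  have nb: "cmod (mat i j \<eta> t) * v (fst j) \<le> 3 * \<bar>c * \<eta>\<bar> * \<bar>R\<bar> * v l" if "fst j = l + 1 \<or> fst j = l - 1" for j
  proof -
    have "cmod (mat i j \<eta> t) \<le> 3 * \<bar>c * \<eta>\<bar>"
    proof (cases "l = 0")
      case False
      have "\<bar>f t\<bar> / (2 * c) \<le> 1 / (1 + t\<^sup>2)" using f_bound[OF t] c_pos by (simp add: field_simps)
      also have "\<dots> \<le> 1" by (simp add: one_plus_sq)
      finally have ft: "\<bar>f t\<bar> / (2 * c) \<le> 1" .
      have "lor l \<eta> t \<le> 1" "0 \<le> lor l \<eta> t" by (auto simp: lor_def one_plus_sq less_imp_le)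
      then have "cmod (of_real (f t / (2 * c)) * \<i> * of_int l + of_real (lor l \<eta> t)) \<le> \<bar>f t\<bar> / (2 * c) * \<bar>real_of_int l\<bar> + 1"
        using c_pos by (intro order.trans[OF norm_triangle_ineq] add_mono) (auto simp: norm_mult norm_divide)
      also have "\<dots> \<le> 1 * \<bar>real_of_int l\<bar> + 1" using ft by (intro add_right_mono mult_right_mono) auto
      also have "\<dots> \<le> \<bar>real_of_int (fst j)\<bar> + 2" using that by auto
      finally have pre: "cmod (of_real (f t / (2 * c)) * \<i> * of_int l + of_real (lor l \<eta> t)) \<le> \<bar>real_of_int (fst j)\<bar> + 2" .
      have "cmod (mat i j \<eta> t) \<le> (\<bar>real_of_int (fst j)\<bar> + 2) * \<bar>coef j \<eta> t\<bar>"
      proof -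
        have "mat i j \<eta> t = (if g then of_real (f t / (2 * c)) * \<i> * of_int l + of_real (lor l \<eta> t) else 1) * of_real (coef j \<eta> t)"
          using False that by (auto simp: mat_def i)
        then have "cmod (mat i j \<eta> t) = cmod (if g then of_real (f t / (2 * c)) * \<i> * of_int l + of_real (lor l \<eta> t) else 1) * \<bar>coef j \<eta> t\<bar>"
          by (simp only: norm_mult norm_of_real)
        also have "\<dots> \<le> (\<bar>real_of_int (fst j)\<bar> + 2) * \<bar>coef j \<eta> t\<bar>" using pre by (intro mult_right_mono) auto
        finally show ?thesis .
      qed
      then show ?thesis using coef_bound[of j \<eta> t] by (simp add: mult.commute)
    qed (simp add: mat_def i)
    moreover have "v (fst j) \<le> \<bar>R\<bar> * v l"
      using that v(2)[of l] v(3)[of l] mult_right_mono[OF abs_ge_self[of R] v(1)[of l]] by auto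
    ultimately show ?thesis using v(1) by (metis abs_ge_zero mult.assoc mult_mono mult_nonneg_nonneg norm_ge_zero zero_le_numeral)
  qed
  have self: "cmod (mat i (l, False) \<eta> t) * v l \<le> 1 * v l"
  proof (rule mult_right_mono)
    define x where "x = \<eta> / real_of_int l - t"
    have "2 * \<bar>x\<bar> \<le> 1 + x\<^sup>2" using zero_le_power2[of "\<bar>x\<bar> - 1"] by (simp add: power2_eq_square algebra_simps)
    also have "\<dots> \<le> (1 + x\<^sup>2)\<^sup>2" using mult_left_mono[of 1 "1 + x\<^sup>2" "1 + x\<^sup>2"] by (simp add: power2_eq_square)
    finally have "2 * \<bar>x\<bar> * (1 / (1 + x\<^sup>2))\<^sup>2 \<le> 1" using one_plus_sq[of x] by (simp add: power_divide)
    moreover have "\<bar>2 * x * (1 / (1 + x\<^sup>2))\<^sup>2\<bar> = 2 * \<bar>x\<bar> * (1 / (1 + x\<^sup>2))\<^sup>2" by (simp add: abs_mult)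
    moreover have "mat i (l, False) \<eta> t = of_real (if l \<noteq> 0 \<and> g then 2 * x * (1 / (1 + x\<^sup>2))\<^sup>2 else 0)"
      by (simp add: mat_def i lor_def x_def)
    ultimately show "cmod (mat i (l, False) \<eta> t) \<le> 1" by (auto simp only: norm_of_real abs_zero zero_le_one split: if_splits)
  qed (rule v)
  have "(\<Sum>j\<in>nbr i. cmod (mat i j \<eta> t) * v (fst j)) \<le> 12 * \<bar>c * \<eta>\<bar> * \<bar>R\<bar> * v l + 1 * v l"
    unfolding nbr_def i using nb[of "(l + 1, False)"] nb[of "(l - 1, False)"] nb[of "(l + 1, True)"] nb[of "(l - 1, True)"] self
    by (simp add: i)
  then show "(\<Sum>j\<in>nbr i. cmod (mat i j \<eta> t) * v (fst j)) \<le> (12 * \<bar>c * \<eta>\<bar> * \<bar>R\<bar> + 1) * v (fst i)"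
    by (simp add: i algebra_simps)
qed (use v in auto)

definition pack :: "(real \<Rightarrow> int \<Rightarrow> complex) \<Rightarrow> (real \<Rightarrow> int \<Rightarrow> complex) \<Rightarrow> int \<times> bool \<Rightarrow> real \<Rightarrow> complex" where
  "pack th G i t = (if snd i then G t (fst i) else th t (fst i))"

lemma rhs_theta: "l \<noteq> 0 \<Longrightarrow> ls.rhs \<eta> y (l, False) t = coupling c \<eta> (\<lambda>m. y (m, False)) (\<lambda>m. y (m, True)) l t"
  by (simp add: ls.rhs_def nbr_def mat_def coef_def coupling_def)

lemma rhs_G: "l \<noteq> 0 \<Longrightarrow> ls.rhs \<eta> y (l, True) t - damp (l, True) \<eta> t *\<^sub>R y (l, True) =
    G_rhs nu c f \<eta> (\<lambda>m. y (m, False)) (\<lambda>m. y (m, True)) l t"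
  by (simp add: ls.rhs_def nbr_def mat_def coef_def coupling_def G_rhs_def damp_def lor_def scaleR_conv_of_real power_divide)
     (simp add: algebra_simps add_divide_distrib)

lemma rhs_zero: "ls.rhs \<eta> y (0, g) t = 0" by (simp add: ls.rhs_def mat_def)

lemma wave_ivp_solution:
  assumes "wave_ivp nu c f lam \<eta> th0 G0 th G"
  shows "ls.solution \<eta> (pack th G)"
  unfolding ls.solution_def
proof (intro allI impI)
  fix i :: "int \<times> bool" and t :: real assume t: "0 \<le> t"
  obtain l g where i: "i = (l, g)" by (cases i)
  show "(pack th G i has_vector_derivative ls.rhs \<eta> (\<lambda>j. pack th G j t) i t - damp i \<eta> t *\<^sub>R pack th G i t) (at t within {0..})"
  proof (cases "l = 0")
    case True
    have z: "pack th G i s = 0" if "0 \<le> s" for s using assms that True by (auto simp: wave_ivp_def pack_def i)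
    have "((\<lambda>_. 0) has_vector_derivative (0::complex)) (at t within {0..})" by simp
    then have "(pack th G i has_vector_derivative 0) (at t within {0..})"
      by (rule has_vector_derivative_transform[rotated 2]) (use t z in auto)
    then show ?thesis using True z[OF t] by (simp add: i rhs_zero)
  next
    case False
    have d: "((\<lambda>s. th s l) has_vector_derivative coupling c \<eta> (th t) (G t) l t) (at t within {0..})"
      "((\<lambda>s. G s l) has_vector_derivative G_rhs nu c f \<eta> (th t) (G t) l t) (at t within {0..})"
      using assms False t by (auto simp: wave_ivp_def)
    show ?thesis
    proof (cases g)
      case True
      then show ?thesis using d(2) rhs_G[OF False, of \<eta> "\<lambda>j. pack th G j t" t] by (simp add: i pack_def[abs_def])
    next
      case g: False
      then show ?thesis using d(1) rhs_theta[OF False, of \<eta> "\<lambda>j. pack th G j t" t] by (simp add: i pack_def[abs_def] damp_def)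
    qed
  qed
qed

lemma solution_diff:
  assumes "ls.solution \<eta> y" "ls.solution \<eta> z"
  shows "ls.solution \<eta> (\<lambda>i t. y i t - z i t)"
  unfolding ls.solution_def
proof (intro allI impI)
  fix i t assume "0 \<le> (t::real)"
  then have "(y i has_vector_derivative ls.rhs \<eta> (\<lambda>j. y j t) i t - damp i \<eta> t *\<^sub>R y i t) (at t within {0..})"
    "(z i has_vector_derivative ls.rhs \<eta> (\<lambda>j. z j t) i t - damp i \<eta> t *\<^sub>R z i t) (at t within {0..})"
    using assms unfolding ls.solution_def by blast+
  from has_vector_derivative_diff[OF this]
  show "((\<lambda>t. y i t - z i t) has_vector_derivative ls.rhs \<eta> (\<lambda>j. y j t - z j t) i t - damp i \<eta> t *\<^sub>R (y i t - z i t)) (at t within {0..})"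
    by (rule has_vector_derivative_eq_rhs) (simp add: ls.rhs_def sum_subtractf algebra_simps)
qed

end

locale wave_weight = wave + weight
begin

text \<open>Continuity in X gives local bounds in time, and compactness of [0, T] makes finitely
  many of them suffice.\<close>

lemma wave_ivp_bounded:
  assumes "wave_ivp nu c f lam \<eta> th0 G0 th G"
  shows "\<exists>C. \<forall>t l. 0 \<le> t \<longrightarrow> t \<le> T \<longrightarrow> lam l * cmod (th t l) \<le> C \<and> lam l * cmod (G t l) \<le> C"
proof -
  define P where "P = (\<lambda>C S. \<forall>t\<in>S. \<forall>l. lam l * cmod (th t l) \<le> C \<and> lam l * cmod (G t l) \<le> C)"
  have X: "in_X lam (th t)" "in_X lam (G t)" if "0 \<le> t" for t using assms that by (auto simp: wave_ivp_def)
  have loc: "\<exists>U. open U \<and> s \<in> U \<and> (\<exists>C. P C (U \<inter> {0..T}))" if s: "s \<in> {0..T}" for s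
  proof -
    have s0: "0 \<le> s" using s by simp
    have "((\<lambda>t. Xnorm lam (\<lambda>l. th t l - th s l)) \<longlongrightarrow> 0) (at s within {0..})"
      "((\<lambda>t. Xnorm lam (\<lambda>l. G t l - G s l)) \<longlongrightarrow> 0) (at s within {0..})"
      using assms s by (auto simp: wave_ivp_def)
    from order_tendstoD(2)[OF this(1), of 1] order_tendstoD(2)[OF this(2), of 1]
    have "\<forall>\<^sub>F t in at s within {0..}. Xnorm lam (\<lambda>l. th t l - th s l) < 1 \<and> Xnorm lam (\<lambda>l. G t l - G s l) < 1"
      by (auto intro: eventually_conj)
    then obtain U where U: "open U" "s \<in> U" and lt: "\<And>t. t \<in> U \<Longrightarrow> t \<noteq> s \<Longrightarrow> 0 \<le> t \<Longrightarrow>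
        Xnorm lam (\<lambda>l. th t l - th s l) < 1 \<and> Xnorm lam (\<lambda>l. G t l - G s l) < 1"
      unfolding eventually_at_topological by auto
    have one: "lam l * cmod (v t l) \<le> 1 + Xnorm lam (v s)"
      if "in_X lam (v t)" "in_X lam (v s)" "t = s \<or> Xnorm lam (\<lambda>l. v t l - v s l) < 1" for v :: "real \<Rightarrow> int \<Rightarrow> complex" and t l
    proof -
      have "lam l * cmod (v t l) \<le> lam l * cmod (v t l - v s l) + lam l * cmod (v s l)"
        using norm_triangle_sub[of "v t l" "v s l"] lam_pos[of l] by (simp flip: distrib_left add: add.commute)
      moreover have "lam l * cmod (v s l) \<le> Xnorm lam (v s)" by (rule coord_le_Xnorm[OF that(2)])
      moreover have "lam l * cmod (v t l - v s l) \<le> 1"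
        using coord_le_Xnorm[OF in_X_diff[OF that(1,2)], of l] that(3) by auto
      ultimately show ?thesis by linarith
    qed
    have "P (max (1 + Xnorm lam (th s)) (1 + Xnorm lam (G s))) (U \<inter> {0..T})"
      unfolding P_def
    proof (intro ballI allI conjI)
      fix t l assume t: "t \<in> U \<inter> {0..T}"
      show "lam l * cmod (th t l) \<le> max (1 + Xnorm lam (th s)) (1 + Xnorm lam (G s))"
        using one[of th t l] X[of t] X[OF s0] t lt[of t] by fastforce
      show "lam l * cmod (G t l) \<le> max (1 + Xnorm lam (th s)) (1 + Xnorm lam (G s))"
        using one[of G t l] X[of t] X[OF s0] t lt[of t] by fastforce
    qed
    then show ?thesis using U by blast
  qed
  define \<U> where "\<U> = {U. open U \<and> (\<exists>C. P C (U \<inter> {0..T}))}"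
  have cov: "{0..T} \<subseteq> \<Union>\<U>" using loc unfolding \<U>_def by blast
  obtain \<F> where F: "\<F> \<subseteq> \<U>" "finite \<F>" "{0..T} \<subseteq> \<Union>\<F>"
    by (rule compactE[OF compact_Icc cov]) (auto simp: \<U>_def)
  have "\<forall>U\<in>\<F>. \<exists>C. P C (U \<inter> {0..T})" using F(1) unfolding \<U>_def by blast
  then obtain Cf where Cf: "\<forall>U\<in>\<F>. P (Cf U) (U \<inter> {0..T})" by (rule bchoice[THEN exE])
  have "lam l * cmod (th t l) \<le> (\<Sum>U\<in>\<F>. \<bar>Cf U\<bar>) \<and> lam l * cmod (G t l) \<le> (\<Sum>U\<in>\<F>. \<bar>Cf U\<bar>)" if t: "0 \<le> t" "t \<le> T" for t l
  proof -
    have "t \<in> \<Union>\<F>" using F(3) t by (meson atLeastAtMost_iff subsetD)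
    then obtain U where U: "U \<in> \<F>" "t \<in> U" by blast
    have "\<bar>Cf U\<bar> \<le> (\<Sum>U\<in>\<F>. \<bar>Cf U\<bar>)" using U F(2) by (intro member_le_sum) auto
    moreover have "t \<in> U \<inter> {0..T}" using U t by simp
    then have "lam l * cmod (th t l) \<le> Cf U" "lam l * cmod (G t l) \<le> Cf U" using Cf U(1) unfolding P_def by blast+
    ultimately show ?thesis by linarith
  qed
  then show ?thesis by blast
qed

text \<open>Membership in X bounds a coordinate by a multiple of 1 / lam(l), and this weight has
  neighbour ratios at most 2, so \<open>solution_zero\<close> applies to the difference.\<close>

lemma wave_ivp_unique:
  assumes "wave_ivp nu c f lam \<eta> th0 G0 th G" "wave_ivp nu c f lam \<eta> th0 G0 th' G'" and t: "0 \<le> t"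
  shows "th t l = th' t l" "G t l = G' t l"
proof -
  define y where "y = (\<lambda>i s. pack th G i s - pack th' G' i s)"
  have sol: "ls.solution \<eta> y" unfolding y_def
    by (rule solution_diff[OF wave_ivp_solution[OF assms(1)] wave_ivp_solution[OF assms(2)]])
  have rb: "ls.row_bound \<eta> (\<lambda>i. 1 / lam (fst i)) (12 * \<bar>c * \<eta>\<bar> * \<bar>2\<bar> + 1)"
  proof (rule row_bound_wave)
    fix l
    show "0 \<le> 1 / lam l" using lam_pos[of l] by simp
    show "1 / lam (l + 1) \<le> 2 * (1 / lam l)" using lam_step(2)[of "l + 1"] lam_pos[of l] lam_pos[of "l + 1"] by (simp add: field_simps)
    show "1 / lam (l - 1) \<le> 2 * (1 / lam l)" using lam_step(1)[of "l - 1"] lam_pos[of l] lam_pos[of "l - 1"] by (simp add: field_simps)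
  qed
  obtain C C' where C: "\<And>s l. 0 \<le> s \<Longrightarrow> s \<le> t \<Longrightarrow> lam l * cmod (th s l) \<le> C \<and> lam l * cmod (G s l) \<le> C"
    "\<And>s l. 0 \<le> s \<Longrightarrow> s \<le> t \<Longrightarrow> lam l * cmod (th' s l) \<le> C' \<and> lam l * cmod (G' s l) \<le> C'"
    using wave_ivp_bounded[OF assms(1), of t] wave_ivp_bounded[OF assms(2), of t] by metis
  have bd: "cmod (y i s) \<le> (C + C') * (1 / lam (fst i))" if "0 \<le> s" "s \<le> t" for i s
  proof -
    have "lam (fst i) * cmod (y i s) \<le> lam (fst i) * cmod (pack th G i s) + lam (fst i) * cmod (pack th' G' i s)"
      unfolding y_def using norm_triangle_ineq4[of "pack th G i s" "pack th' G' i s"] lam_pos[of "fst i"] by (simp flip: distrib_left)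
    also have "\<dots> \<le> C + C'" using C(1)[OF that, of "fst i"] C(2)[OF that, of "fst i"] by (auto simp: pack_def)
    finally show ?thesis using lam_pos[of "fst i"] by (simp add: field_simps)
  qed
  have "y i 0 = 0" for i using assms by (auto simp: y_def pack_def wave_ivp_def)
  then have "y i t = 0" for i by (intro ls.solution_zero[OF rb sol _ bd t order.refl])
  from this[of "(l, False)"] this[of "(l, True)"] show "th t l = th' t l" "G t l = G' t l" by (auto simp: y_def pack_def)
qed

end

section \<open>The solution starting from a single mode\<close>

context wave begin

definition y0 :: "nat \<Rightarrow> int \<times> bool \<Rightarrow> complex" where "y0 k i = (if i = (int k, False) then 1 else 0)"
definition Th :: "nat \<Rightarrow> real \<Rightarrow> real \<Rightarrow> int \<Rightarrow> complex" where "Th k \<eta> t l = ls.sol (y0 k) (l, False) \<eta> t"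
definition Gs :: "nat \<Rightarrow> real \<Rightarrow> real \<Rightarrow> int \<Rightarrow> complex" where "Gs k \<eta> t l = ls.sol (y0 k) (l, True) \<eta> t"

text \<open>The row of mode 0 vanishes, so nothing passes from positive to negative modes. This
  justifies natural indices for the resonance analysis.\<close>

lemma pic_support:
  assumes "1 \<le> k" "l \<le> 0" shows "ls.pic (y0 k) n (l, g) \<eta> t = 0"
  using assms(2)
proof (induction n arbitrary: l g t)
  case 0
  then show ?case using assms(1) by (auto simp: y0_def)
next
  case (Suc n)
  have "ls.rhs \<eta> (\<lambda>j. ls.pic (y0 k) n j \<eta> s) (l, g) s = 0" for s
  proof (cases "l = 0")
    case False
    then have "l + 1 \<le> 0" "l - 1 \<le> 0" using Suc by auto
    then have "ls.pic (y0 k) n (l + 1, h) \<eta> s = 0" "ls.pic (y0 k) n (l - 1, h) \<eta> s = 0" "ls.pic (y0 k) n (l, h) \<eta> s = 0" for h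
      using Suc by blast+
    then show ?thesis by (simp add: ls.rhs_def nbr_def)
  qed (simp add: rhs_zero)
  then show ?case by simp
qed

lemma Th_support: assumes "1 \<le> k" "l \<le> 0" shows "Th k \<eta> t l = 0" "Gs k \<eta> t l = 0"
  using pic_support[OF assms] by (auto simp: Th_def Gs_def ls.sol_def)

definition geo :: "real \<Rightarrow> int \<times> bool \<Rightarrow> real" where "geo R i = 1 / R ^ nat \<bar>fst i\<bar>"

lemma geo_row: assumes "1 \<le> R" shows "ls.row_bound \<eta> (geo R) (12 * \<bar>c * \<eta>\<bar> * \<bar>R\<bar> + 1)"
proof -
  have "1 / R ^ nat \<bar>m\<bar> \<le> R * (1 / R ^ nat \<bar>l\<bar>)" if "\<bar>l\<bar> \<le> \<bar>m\<bar> + 1" for l m :: int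
  proof -
    have "R ^ nat \<bar>l\<bar> \<le> R ^ Suc (nat \<bar>m\<bar>)" using that assms by (intro power_increasing) auto
    then show ?thesis using assms by (simp add: field_simps)
  qed
  then show ?thesis unfolding geo_def using row_bound_wave[of "\<lambda>l. 1 / R ^ nat \<bar>l\<bar>" R \<eta>] assms by auto
qed

lemma y0_geo: assumes "1 \<le> R" shows "cmod (y0 k i) \<le> R ^ k * geo R i"
  using assms by (auto simp: y0_def geo_def)

lemma sol_facts:
  shows "ls.solution \<eta> (\<lambda>i. ls.sol (y0 k) i \<eta>)" "ls.sol (y0 k) i \<eta> 0 = y0 k i"
    and "1 \<le> R \<Longrightarrow> 0 \<le> t \<Longrightarrow> cmod (ls.sol (y0 k) i \<eta> t) \<le> R ^ k * exp ((12 * \<bar>c * \<eta>\<bar> * \<bar>R\<bar> + 1) * t) * geo R i"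
proof -
  show "ls.solution \<eta> (\<lambda>i. ls.sol (y0 k) i \<eta>)" by (rule ls.solution_sol[OF geo_row[OF order.refl] y0_geo[OF order.refl]]) simp
  show "ls.sol (y0 k) i \<eta> 0 = y0 k i" by (rule ls.sol_initial[OF geo_row[OF order.refl] y0_geo[OF order.refl]]) simp
  assume R: "1 \<le> R" "0 \<le> t"
  show "cmod (ls.sol (y0 k) i \<eta> t) \<le> R ^ k * exp ((12 * \<bar>c * \<eta>\<bar> * \<bar>R\<bar> + 1) * t) * geo R i"
    by (rule ls.sol_bound[OF geo_row[OF R(1)] y0_geo[OF R(1)]]) (use R in auto)
qed

lemma Th_geometric:
  assumes "1 \<le> R"
  shows "\<exists>C\<ge>0. \<forall>l t. 0 \<le> t \<longrightarrow> t \<le> T \<longrightarrow> cmod (Th k \<eta> t (int l)) \<le> C / R ^ l \<and> cmod (Gs k \<eta> t (int l)) \<le> C / R ^ l"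
proof (intro exI[of _ "R ^ k * exp ((12 * \<bar>c * \<eta>\<bar> * \<bar>R\<bar> + 1) * T)"] conjI allI impI)
  fix l and t :: real assume t: "0 \<le> t" "t \<le> T"
  have "R ^ k * exp ((12 * \<bar>c * \<eta>\<bar> * \<bar>R\<bar> + 1) * t) * geo R (int l, g) \<le> R ^ k * exp ((12 * \<bar>c * \<eta>\<bar> * \<bar>R\<bar> + 1) * T) / R ^ l" for g
  proof -
    have "(12 * \<bar>c * \<eta>\<bar> * \<bar>R\<bar> + 1) * t \<le> (12 * \<bar>c * \<eta>\<bar> * \<bar>R\<bar> + 1) * T" using t by (intro mult_left_mono) auto
    then show ?thesis using assms by (simp add: geo_def divide_right_mono mult_left_mono)
  qed
  from order.trans[OF sol_facts(3)[OF assms t(1)] this]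
  show "cmod (Th k \<eta> t (int l)) \<le> R ^ k * exp ((12 * \<bar>c * \<eta>\<bar> * \<bar>R\<bar> + 1) * T) / R ^ l"
    "cmod (Gs k \<eta> t (int l)) \<le> R ^ k * exp ((12 * \<bar>c * \<eta>\<bar> * \<bar>R\<bar> + 1) * T) / R ^ l"
    by (simp_all add: Th_def Gs_def)
qed (use assms in auto)

lemma Th_deriv:
  assumes "l \<noteq> 0" "0 \<le> t"
  shows "((\<lambda>s. Th k \<eta> s l) has_vector_derivative coupling c \<eta> (Th k \<eta> t) (Gs k \<eta> t) l t) (at t within {0..})"
    "((\<lambda>s. Gs k \<eta> s l) has_vector_derivative G_rhs nu c f \<eta> (Th k \<eta> t) (Gs k \<eta> t) l t) (at t within {0..})"
proof -
  have d: "(ls.sol (y0 k) i \<eta> has_vector_derivative ls.rhs \<eta> (\<lambda>j. ls.sol (y0 k) j \<eta> t) i t - damp i \<eta> t *\<^sub>R ls.sol (y0 k) i \<eta> t) (at t within {0..})" for i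
    using sol_facts(1)[of \<eta> k] assms unfolding ls.solution_def by blast
  show "((\<lambda>s. Th k \<eta> s l) has_vector_derivative coupling c \<eta> (Th k \<eta> t) (Gs k \<eta> t) l t) (at t within {0..})"
    using d[of "(l, False)"] rhs_theta[OF assms(1), of \<eta> "\<lambda>j. ls.sol (y0 k) j \<eta> t" t] by (simp add: Th_def[abs_def] Gs_def[abs_def] damp_def)
  show "((\<lambda>s. Gs k \<eta> s l) has_vector_derivative G_rhs nu c f \<eta> (Th k \<eta> t) (Gs k \<eta> t) l t) (at t within {0..})"
    using d[of "(l, True)"] rhs_G[OF assms(1), of \<eta> "\<lambda>j. ls.sol (y0 k) j \<eta> t" t] by (simp add: Th_def[abs_def] Gs_def[abs_def])
qed

lemma Th_init: "Th k \<eta> 0 = (\<lambda>l. if l = int k then 1 else 0)" "Gs k \<eta> 0 = (\<lambda>l. 0)"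
  by (auto simp: Th_def Gs_def sol_facts y0_def)

lemma Th_modes:
  assumes eta: "0 < \<eta>" and k: "1 \<le> k"
  shows "modes_sol_ap nu c \<eta> f (\<lambda>t l. Th k \<eta> t (int l)) (\<lambda>t l. Gs k \<eta> t (int l) - (1 / (1 + (t - \<eta> / real l)\<^sup>2)) *\<^sub>R Th k \<eta> t (int l))"
proof -
  interpret modes nu c \<eta> f by unfold_locales (use nu_pos c_pos c_small eta f_bound in auto)
  define th where "th = (\<lambda>t l. Th k \<eta> t (int l))"
  define H where "H = (\<lambda>t l. Gs k \<eta> t (int l) - (1 / (1 + (t - \<eta> / real l)\<^sup>2)) *\<^sub>R Th k \<eta> t (int l))"
  have H_w: "H t l = Gs k \<eta> t (int l) - w l t *\<^sub>R th t l" for t l by (simp add: H_def th_def w_def)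
  have cc: "ccoef c \<eta> (int m) t = b m * (w m t)\<^sup>2" "dcoef c \<eta> (int m) t = b m * w m t" for m t
    by (auto simp: ccoef_def dcoef_def b_def w_def power_divide power2_commute[of t])
  have infl: "inflow (th t) (H t) m t = of_real (ccoef c \<eta> (int m) t) * Th k \<eta> t (int m) + of_real (dcoef c \<eta> (int m) t) * Gs k \<eta> t (int m)" for m t
    unfolding inflow_def H_w cc by (simp add: th_def scaleR_conv_of_real algebra_simps power2_eq_square)
  have cp: "coupling c \<eta> (Th k \<eta> t) (Gs k \<eta> t) (int l) t = cpl (th t) (H t) l t" if "1 \<le> l" for l t
  proof -
    have "int l + 1 = int (l + 1)" "int l - 1 = int (l - 1)" using that by auto
    then show ?thesis unfolding coupling_def cpl_def infl by (simp only: add_ac)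
  qed
  have thd: "((\<lambda>s. th s l) has_vector_derivative cpl (th t) (H t) l t) (at t within {0..})" if "1 \<le> l" "0 \<le> t" for l t
    using Th_deriv(1)[of "int l" t k \<eta>] that cp[OF that(1)] by (simp add: th_def)
  have "modes_sol_ap nu c \<eta> f th H"
  proof unfold_locales
    show "((\<lambda>s. th s l) has_vector_derivative cpl (th t) (H t) l t) (at t within {0..})" if "1 \<le> l" "0 \<le> t" for l t by (rule thd[OF that])
    show "((\<lambda>s. H s l) has_vector_derivative Hrhs (th t) (H t) l t - D l t *\<^sub>R H t l) (at t within {0..})" if l: "1 \<le> l" and t: "0 \<le> t" for l t
    proof -
      define w' where "w' = 2 * (\<eta> / real l - t) * (w l t)\<^sup>2"
      have nz: "1 + (t - \<eta> / real l)\<^sup>2 \<noteq> 0" by (rule one_plus_sq)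
      have wd: "(w l has_real_derivative w') (at t within {0..})"
      proof -
        have "((\<lambda>t. 1 / (1 + (t - x)\<^sup>2)) has_real_derivative 2 * (x - t) * (1 / (1 + (t - x)\<^sup>2))\<^sup>2) (at t within {0..})" for x
          using one_plus_sq(1)[of "t - x"] by (auto intro!: derivative_eq_intros simp: power2_eq_square field_simps)
        from this[of "\<eta> / real l"] show ?thesis unfolding w'_def w_def[abs_def] .
      qed
      have Gd: "((\<lambda>s. Gs k \<eta> s (int l)) has_vector_derivative G_rhs nu c f \<eta> (Th k \<eta> t) (Gs k \<eta> t) (int l) t) (at t within {0..})"
        using Th_deriv(2)[of "int l" t k \<eta>] l t by simp
      have "((\<lambda>s. Gs k \<eta> s (int l) - w l s *\<^sub>R th s l) has_vector_derivative
          G_rhs nu c f \<eta> (Th k \<eta> t) (Gs k \<eta> t) (int l) t - (w l t *\<^sub>R cpl (th t) (H t) l t + w' *\<^sub>R th t l)) (at t within {0..})"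
        by (intro has_vector_derivative_diff Gd has_vector_derivative_scaleR wd thd l t)
      \<comment> \<open>The product rule for w th removes both the explicit forcing w' th and the
        coupling weighted by w, and D w = nu l^2 turns the damping of w th into the source of
        \<open>Hrhs\<close>.\<close>
      moreover have "G_rhs nu c f \<eta> (Th k \<eta> t) (Gs k \<eta> t) (int l) t - (w l t *\<^sub>R cpl (th t) (H t) l t + w' *\<^sub>R th t l) = Hrhs (th t) (H t) l t - D l t *\<^sub>R H t l"
      proof -
        have sq: "(\<eta> / real l - t)\<^sup>2 = (t - \<eta> / real l)\<^sup>2" by (rule power2_commute)
        have w1: "2 * (\<eta> / real l - t) / (1 + (\<eta> / real l - t)\<^sup>2)\<^sup>2 = w'" by (simp add: w'_def w_def sq power_divide)
        have w2: "X / of_real (1 + (\<eta> / real l - t)\<^sup>2) = w l t *\<^sub>R X" for X :: complex by (simp add: w_def sq scaleR_conv_of_real)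
        have lr: "0 < real l" using l by simp
        have Dd: "nu * ((real l)\<^sup>2 + (\<eta> - real l * t)\<^sup>2) = D l t"
        proof -
          have "(\<eta> - real l * t)\<^sup>2 = (real l)\<^sup>2 * (t - \<eta> / real l)\<^sup>2" using lr by (simp add: power2_eq_square field_simps)
          then show ?thesis by (simp add: D_def algebra_simps)
        qed
        have "G_rhs nu c f \<eta> (Th k \<eta> t) (Gs k \<eta> t) (int l) t = - of_real (D l t) * Gs k \<eta> t (int l)
            + of_real (f t / (2 * c)) * \<i> * of_nat l * cpl (th t) (H t) l t + of_real w' * th t l + w l t *\<^sub>R cpl (th t) (H t) l t"
          unfolding G_rhs_def cp[OF l] by (simp only: of_int_of_nat_eq w1 w2 Dd th_def)
        moreover have "D l t *\<^sub>R H t l = of_real (D l t) * Gs k \<eta> t (int l) - (nu * (real l)\<^sup>2) *\<^sub>R th t l"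
          unfolding H_w D_w[symmetric, of l t] by (simp add: scaleR_conv_of_real algebra_simps)
        ultimately show ?thesis by (simp add: Hrhs_def scaleR_conv_of_real)
      qed
      ultimately show ?thesis unfolding H_w[abs_def] by simp
    qed
    show "\<exists>C. \<forall>l\<ge>1. \<forall>t. 0 \<le> t \<longrightarrow> t \<le> T \<longrightarrow> cmod (th t l) \<le> C / R ^ l \<and> cmod (H t l) \<le> C / R ^ l" if R: "1 \<le> R" for R T
    proof -
      obtain C where C: "0 \<le> C" "\<And>l t. 0 \<le> t \<Longrightarrow> t \<le> T \<Longrightarrow> cmod (Th k \<eta> t (int l)) \<le> C / R ^ l \<and> cmod (Gs k \<eta> t (int l)) \<le> C / R ^ l"
        using Th_geometric[OF R, of T k \<eta>] by blast
      have "cmod (th t l) \<le> 2 * C / R ^ l \<and> cmod (H t l) \<le> 2 * C / R ^ l" if t: "0 \<le> t" "t \<le> T" for t l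
      proof -
        have "w l t * cmod (th t l) \<le> 1 * cmod (th t l)" using w_le_1[of l t] by (intro mult_right_mono) auto
        then have "cmod (H t l) \<le> cmod (Gs k \<eta> t (int l)) + cmod (th t l)"
          using norm_triangle_ineq4[of "Gs k \<eta> t (int l)" "w l t *\<^sub>R th t l"] w_pos[of l t] by (simp add: H_w)
        moreover have "0 \<le> C / R ^ l" using C(1) R by simp
        ultimately show ?thesis using C(2)[OF t, of l] by (simp add: th_def)
      qed
      then show ?thesis by blast
    qed
  qed
  then show ?thesis by (simp add: th_def H_def)
qed

lemma Th_main:
  assumes eta: "0 < \<eta>" and x: "1000 < root 3 (c * \<eta>)" and K: "K = nat \<lfloor>(1/10) * root 3 (c * \<eta> * pi / 2)\<rfloor>"
  obtains A where "0 < A" "\<And>t. 2 * \<eta> \<le> t \<Longrightarrow> 5 / 4 * A \<le> cmod (Th K \<eta> t 2)"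
    "\<And>t l. 2 * \<eta> \<le> t \<Longrightarrow> 1 \<le> l \<Longrightarrow> cmod (Th K \<eta> t (int l)) \<le> 640 * A * dq 1 l \<and> cmod (Gs K \<eta> t (int l)) \<le> 648 * A * dq 1 l"
    "\<And>t. 0 \<le> t \<Longrightarrow> \<exists>k\<in>{1..K}. \<forall>l\<ge>1. cmod (Th K \<eta> t (int l)) \<le> 640 * A / 2 ^ (k - 1) * dq k l"
    "\<And>l. 1 \<le> l \<Longrightarrow> \<exists>L. ((\<lambda>t. Th K \<eta> t (int l)) \<longlongrightarrow> L) at_top"
    "exp (root 3 (c * \<eta>)) * 2 ^ K \<le> 5 / 4 * A" "10000 * (2 ^ K * A) \<le> exp (50 * root 3 (c * \<eta>))"
proof -
  note fm = floor_mode[OF x K]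
  have K1: "1 \<le> K" using fm(1) by simp
  interpret ms: modes_sol_ap nu c \<eta> f "\<lambda>t l. Th K \<eta> t (int l)" "\<lambda>t l. Gs K \<eta> t (int l) - (1 / (1 + (t - \<eta> / real l)\<^sup>2)) *\<^sub>R Th K \<eta> t (int l)"
    by (rule Th_modes[OF eta K1])
  have K3: "0 < real K ^ 3" using K1 by simp
  have b: "116 \<le> K" "636 \<le> ms.b K" "ms.b K \<le> 655" using fm K3 by (auto simp: ms.b_def field_simps)
  have i1: "Th K \<eta> 0 (int l) = (if l = K then 1 else 0)" for l by (simp add: Th_init)
  have i2: "Gs K \<eta> 0 (int l) - (1 / (1 + (0 - \<eta> / real l)\<^sup>2)) *\<^sub>R Th K \<eta> 0 (int l) = (if l = K then - of_real (ms.w K 0) else 0)" for l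
    by (simp add: Th_init ms.w_def scaleR_conv_of_real)
  note res = b i1 i2
  define A where "A = ms.amp 1"
  have cas: "9 / 10 * (\<Prod>j\<in>{1..K}. 5 / 4 * ms.b j) \<le> 5 / 4 * A" "A \<le> 2 * (\<Prod>j\<in>{1..K}. 160 * ms.b j)"
    using ms.cascade[OF res order.refl K1] by (auto simp: A_def)
  have A0: "0 < A" unfolding A_def by (rule ms.amp_pos[OF res order.refl K1])
  show thesis
  proof (rule that[OF A0])
    show "5 / 4 * A \<le> cmod (Th K \<eta> t 2)" if "2 * \<eta> \<le> t" for t
      using ms.final_lower[OF res that] by (simp add: A_def)
    show "cmod (Th K \<eta> t (int l)) \<le> 640 * A * dq 1 l \<and> cmod (Gs K \<eta> t (int l)) \<le> 648 * A * dq 1 l" if "2 * \<eta> \<le> t" "1 \<le> l" for t l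
    proof -
      note up = ms.final_upper[OF res that]
      have "(1 / (1 + (t - \<eta> / real l)\<^sup>2)) * cmod (Th K \<eta> t (int l)) \<le> 1 * cmod (Th K \<eta> t (int l))"
        using ms.w_le_1[of l t] unfolding ms.w_def by (intro mult_right_mono) auto
      then have "cmod ((1 / (1 + (t - \<eta> / real l)\<^sup>2)) *\<^sub>R Th K \<eta> t (int l)) \<le> cmod (Th K \<eta> t (int l))"
        using one_plus_sq(2)[of "t - \<eta> / real l"] by simp
      then have "cmod (Gs K \<eta> t (int l)) \<le> 8 * ms.amp 1 * dq 1 l + 640 * ms.amp 1 * dq 1 l"
        using up norm_triangle_sub[of "Gs K \<eta> t (int l)" "(1 / (1 + (t - \<eta> / real l)\<^sup>2)) *\<^sub>R Th K \<eta> t (int l)"] by linarith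
      then show ?thesis using up(1) unfolding A_def by (intro conjI; linarith)
    qed
    show "\<exists>k\<in>{1..K}. \<forall>l\<ge>1. cmod (Th K \<eta> t (int l)) \<le> 640 * A / 2 ^ (k - 1) * dq k l" if "0 \<le> t" for t
      using ms.transient_bound[OF res that] by (simp add: A_def)
    show "\<exists>L. ((\<lambda>t. Th K \<eta> t (int l)) \<longlongrightarrow> L) at_top" if "1 \<le> l" for l
      by (rule ms.final_limit[OF res that])
    have "(\<Prod>j\<in>{1..K}. a * ms.b j) = (a * (c * \<eta>)) ^ K / (fact K) ^ 3" for a
      using prod_cubes[where A = a and a = "c * \<eta>" and K = K] by (simp add: ms.b_def)
    note pr = this
    show "exp (root 3 (c * \<eta>)) * 2 ^ K \<le> 5 / 4 * A"
      using lower_numeric[OF fm(1,2,4)] cas(1) unfolding pr by linarith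
    have x3: "root 3 (c * \<eta>) ^ 3 = c * \<eta>" using c_pos eta by (intro real_root_pow_pos2) auto
    have "2 ^ K * A \<le> 2 ^ K * (2 * ((160 * (c * \<eta>)) ^ K / (fact K) ^ 3))" using cas(2) unfolding pr by (intro mult_left_mono) auto
    then show "10000 * (2 ^ K * A) \<le> exp (50 * root 3 (c * \<eta>))"
      using upper_numeric[OF x3 _ fm(6)] x by linarith
  qed
qed

end

section \<open>Growth and convergence in X\<close>

context wave_weight begin

lemma Th_wave_ivp:
  assumes k: "1 \<le> k"
  shows "wave_ivp nu c f lam \<eta> (\<lambda>l. if l = int k then 1 else 0) (\<lambda>l. 0) (Th k \<eta>) (Gs k \<eta>)"
proof -
  have bd: "\<exists>C. \<forall>t. 0 \<le> t \<longrightarrow> t \<le> T \<longrightarrow> (\<forall>l\<ge>1. cmod (Th k \<eta> t (int l)) \<le> C * dq 1 l \<and> cmod (Gs k \<eta> t (int l)) \<le> C * dq 1 l)" for T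
  proof -
    obtain C where C: "\<And>l t. 0 \<le> t \<Longrightarrow> t \<le> T \<Longrightarrow> cmod (Th k \<eta> t (int l)) \<le> C / 4 ^ l \<and> cmod (Gs k \<eta> t (int l)) \<le> C / 4 ^ l"
      using Th_geometric[of 4 T k \<eta>] by auto
    have e: "C / 4 ^ l = C / 4 * dq 1 l" if "1 \<le> l" for l using that by (cases l) (auto simp: dq_def)
    show ?thesis
    proof (intro exI[of _ "C / 4"] allI impI)
      fix t and l :: nat assume "0 \<le> t" "t \<le> T" "1 \<le> l"
      then show "cmod (Th k \<eta> t (int l)) \<le> C / 4 * dq 1 l \<and> cmod (Gs k \<eta> t (int l)) \<le> C / 4 * dq 1 l"
        using C[of t l] e[of l] by (simp only:)
    qed
  qed
  have cont: "((\<lambda>t. Xnorm lam (\<lambda>l. u t l - u s l)) \<longlongrightarrow> 0) (at s within {0..})"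
    if s: "0 \<le> s" and sup: "\<And>t l. l \<le> 0 \<Longrightarrow> u t l = 0"
      and d: "\<And>l. 1 \<le> l \<Longrightarrow> \<exists>D. ((\<lambda>t. u t (int l)) has_vector_derivative D) (at s within {0..})"
      and C: "\<And>t l. 0 \<le> t \<Longrightarrow> t \<le> s + 1 \<Longrightarrow> 1 \<le> l \<Longrightarrow> cmod (u t (int l)) \<le> C * dq 1 l" for u :: "real \<Rightarrow> int \<Rightarrow> complex" and s C
  proof (rule X_tendsto[where C = "2 * C" and k = 1])
    have "s islimpt {0..}" by (rule islimpt_subset[of _ "{s..s + 1}"]) (use s in auto)
    then show "at s within {0..} \<noteq> bot" by (simp add: trivial_limit_within)
    show "((\<lambda>t. u t (int l) - u s (int l)) \<longlongrightarrow> 0) (at s within {0..})" if "1 \<le> l" for l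
    proof -
      have "continuous (at s within {0..}) (\<lambda>t. u t (int l))" using d[OF that] has_vector_derivative_continuous by blast
      then show ?thesis by (simp add: continuous_within LIM_zero_iff)
    qed
    have "\<forall>\<^sub>F t in at s within {0..}. t \<in> {0..}" by (simp add: eventually_at_filter)
    moreover have "\<forall>\<^sub>F t in at s within {0..}. t < s + 1" by (rule order_tendstoD(2)[OF tendsto_ident_at]) simp
    ultimately show "\<forall>\<^sub>F t in at s within {0..}. (\<forall>l\<ge>1. cmod (u t (int l) - u s (int l)) \<le> 2 * C * dq 1 l) \<and> (\<forall>l\<le>0. u t l - u s l = 0)"
    proof eventually_elim
      case (elim t)
      have "cmod (u t (int l) - u s (int l)) \<le> 2 * C * dq 1 l" if "1 \<le> l" for l
        using norm_triangle_ineq4[of "u t (int l)" "u s (int l)"] C[of t l] C[of s l] elim s that by auto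
      then show ?case using sup by simp
    qed
  qed
  show ?thesis unfolding wave_ivp_def
  proof (intro conjI allI impI)
    fix t :: real assume t: "0 \<le> t"
    obtain C where C: "\<And>l. 1 \<le> l \<Longrightarrow> cmod (Th k \<eta> t (int l)) \<le> C * dq 1 l \<and> cmod (Gs k \<eta> t (int l)) \<le> C * dq 1 l"
      using bd[of t] t by blast
    show "in_X lam (Th k \<eta> t)" by (rule Xnorm_suminf(1)[where C = C and k = 1]) (use C Th_support[OF k] in auto)
    show "in_X lam (Gs k \<eta> t)" by (rule Xnorm_suminf(1)[where C = C and k = 1]) (use C Th_support[OF k] in auto)
    obtain C' where C': "\<And>s l. 0 \<le> s \<Longrightarrow> s \<le> t + 1 \<Longrightarrow> 1 \<le> l \<Longrightarrow> cmod (Th k \<eta> s (int l)) \<le> C' * dq 1 l \<and> cmod (Gs k \<eta> s (int l)) \<le> C' * dq 1 l"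
      using bd[of "t + 1"] by blast
    show "((\<lambda>s. Xnorm lam (\<lambda>l. Th k \<eta> s l - Th k \<eta> t l)) \<longlongrightarrow> 0) (at t within {0..})"
    proof (rule cont[OF t, where C = C'])
      show "\<exists>D. ((\<lambda>t. Th k \<eta> t (int l)) has_vector_derivative D) (at t within {0..})" if "1 \<le> l" for l
        using Th_deriv(1)[of "int l" t k \<eta>] t that by auto
    qed (use C' Th_support[OF k] in auto)
    show "((\<lambda>s. Xnorm lam (\<lambda>l. Gs k \<eta> s l - Gs k \<eta> t l)) \<longlongrightarrow> 0) (at t within {0..})"
    proof (rule cont[OF t, where C = C'])
      show "\<exists>D. ((\<lambda>t. Gs k \<eta> t (int l)) has_vector_derivative D) (at t within {0..})" if "1 \<le> l" for l
        using Th_deriv(2)[of "int l" t k \<eta>] t that by auto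
    qed (use C' Th_support[OF k] in auto)
  qed (use Th_init Th_support[OF k] Th_deriv in auto)
qed

text \<open>By uniqueness the given solution is the constructed one. The lower bound tests mode 2
  only, the upper one sums the final majorant, and both compare weights at distance less than K at
  the price 2^K.\<close>

lemma single_mode_growth:
  assumes eta: "0 < \<eta>" and x: "1000 < root 3 (c * \<eta>)" and K: "K = nat \<lfloor>(1/10) * root 3 (c * \<eta> * pi / 2)\<rfloor>"
    and ivp: "wave_ivp nu c f lam \<eta> (\<lambda>l. if l = int K then 1 else 0) (\<lambda>l. 0) th G"
  shows "2 * \<eta> < t \<Longrightarrow> exp (root 3 (c * \<eta>)) * Xnorm lam (th 0) \<le> Xnorm lam (th t)"
    "2 * \<eta> < t \<Longrightarrow> Xnorm lam (th t) + Xnorm lam (G t) \<le> exp (50 * root 3 (c * \<eta>)) * Xnorm lam (th 0)"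
    "X_convergent lam th"
proof -
  note fm = floor_mode[OF x K]
  have K1: "1 \<le> K" using fm(1) by simp
  have eq: "th t = Th K \<eta> t" "G t = Gs K \<eta> t" if "0 \<le> t" for t
    using wave_ivp_unique[OF ivp Th_wave_ivp[OF K1] that] by auto
  obtain A where A: "0 < A" "\<And>t. 2 * \<eta> \<le> t \<Longrightarrow> 5 / 4 * A \<le> cmod (Th K \<eta> t 2)"
    "\<And>t l. 2 * \<eta> \<le> t \<Longrightarrow> 1 \<le> l \<Longrightarrow> cmod (Th K \<eta> t (int l)) \<le> 640 * A * dq 1 l \<and> cmod (Gs K \<eta> t (int l)) \<le> 648 * A * dq 1 l"
    "\<And>l. 1 \<le> l \<Longrightarrow> \<exists>L. ((\<lambda>t. Th K \<eta> t (int l)) \<longlongrightarrow> L) at_top"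
    "exp (root 3 (c * \<eta>)) * 2 ^ K \<le> 5 / 4 * A" "10000 * (2 ^ K * A) \<le> exp (50 * root 3 (c * \<eta>))"
    using Th_main[OF eta x K] by metis
  have n0: "Xnorm lam (th 0) = lam (int K)" unfolding eq[OF order.refl] Th_init using Xnorm_delta(2)[of "int K" 1] by simp
  { assume t: "2 * \<eta> < t"
    then have t0: "0 \<le> t" using eta by simp
    have "lam (int K) \<le> 2 ^ ((K - 2) + (2 - K)) * lam (int 2)" by (rule lam_dist)
    also have "\<dots> \<le> 2 ^ K * lam 2" using fm(1) lam_pos[of 2] by (auto intro!: mult_right_mono power_increasing)
    finally have "exp (root 3 (c * \<eta>)) * lam (int K) \<le> exp (root 3 (c * \<eta>)) * (2 ^ K * lam 2)" by (intro mult_left_mono) auto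
    also have "\<dots> = lam 2 * (exp (root 3 (c * \<eta>)) * 2 ^ K)" by simp
    also have "\<dots> \<le> lam 2 * cmod (Th K \<eta> t 2)" using A(5) A(2)[of t] t lam_pos[of 2] by (intro mult_left_mono) auto
    also have "\<dots> \<le> Xnorm lam (Th K \<eta> t)"
      by (rule coord_le_Xnorm) (use Th_wave_ivp[OF K1, of \<eta>] t0 in \<open>auto simp: wave_ivp_def\<close>)
    finally show "exp (root 3 (c * \<eta>)) * Xnorm lam (th 0) \<le> Xnorm lam (th t)" using n0 eq[OF t0] by simp
    \<comment> \<open>The two norms together give 2 * 640 + 2 * 648 = 2576, below the reserve
      10000.\<close>
    have "Xnorm lam (Th K \<eta> t) \<le> 2 * (640 * A) * lam (int 1)"
      by (rule X_bound) (use A(1) A(3)[of t] t Th_support[OF K1] in auto)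
    moreover have "Xnorm lam (Gs K \<eta> t) \<le> 2 * (648 * A) * lam (int 1)"
      by (rule X_bound) (use A(1) A(3)[of t] t Th_support[OF K1] in auto)
    moreover have "lam (int 1) \<le> 2 ^ K * lam (int K)"
    proof -
      have "lam (int 1) \<le> 2 ^ ((1 - K) + (K - 1)) * lam (int K)" by (rule lam_dist)
      also have "\<dots> \<le> 2 ^ K * lam (int K)" using lam_pos[of "int K"] K1 by (auto intro!: mult_right_mono power_increasing)
      finally show ?thesis .
    qed
    from mult_left_mono[OF this, of "2576 * A"]
    have "2576 * A * lam (int 1) \<le> 2576 * A * (2 ^ K * lam (int K))" using A(1) by simp
    ultimately have "Xnorm lam (Th K \<eta> t) + Xnorm lam (Gs K \<eta> t) \<le> 2576 * A * (2 ^ K * lam (int K))" by linarith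
    also have "\<dots> = 2576 * (2 ^ K * A) * lam (int K)" by simp
    also have "\<dots> \<le> 10000 * (2 ^ K * A) * lam (int K)" using A(1) lam_pos[of "int K"] by (intro mult_right_mono) auto
    also have "\<dots> \<le> exp (50 * root 3 (c * \<eta>)) * lam (int K)" using A(6) lam_pos[of "int K"] by (intro mult_right_mono) auto
    finally show "Xnorm lam (th t) + Xnorm lam (G t) \<le> exp (50 * root 3 (c * \<eta>)) * Xnorm lam (th 0)" using n0 eq[OF t0] by simp }
  obtain L0 where L0: "\<And>l. 1 \<le> l \<Longrightarrow> ((\<lambda>t. Th K \<eta> t (int l)) \<longlongrightarrow> L0 l) at_top" using A(4) by metis
  define L where "L = (\<lambda>l. if 1 \<le> l then L0 (nat l) else 0)"
  have Lb: "cmod (L (int l)) \<le> 640 * A * dq 1 l" if "1 \<le> l" for l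
  proof -
    have "((\<lambda>t. cmod (Th K \<eta> t (int l))) \<longlongrightarrow> cmod (L0 l)) at_top" by (intro tendsto_norm L0 that)
    then have "cmod (L0 l) \<le> 640 * A * dq 1 l"
    proof (rule tendsto_upperbound)
      show "\<forall>\<^sub>F t in at_top. cmod (Th K \<eta> t (int l)) \<le> 640 * A * dq 1 l"
        using eventually_ge_at_top[of "2 * \<eta>"] by eventually_elim (use A(3)[OF _ that] in blast)
    qed simp
    then show ?thesis using that by (simp add: L_def)
  qed
  show "X_convergent lam th" unfolding X_convergent_def
  proof (intro exI[of _ L] conjI)
    show "in_X lam L" by (rule Xnorm_suminf(1)[OF Lb]) (auto simp: L_def)
    have "((\<lambda>t. Xnorm lam (\<lambda>l. Th K \<eta> t l - L l)) \<longlongrightarrow> 0) at_top"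
    proof (rule X_tendsto[where C = "1280 * A" and k = 1])
      show "((\<lambda>t. Th K \<eta> t (int l) - L (int l)) \<longlongrightarrow> 0) at_top" if "1 \<le> l" for l
        using L0[OF that] that by (simp add: L_def LIM_zero_iff)
      show "\<forall>\<^sub>F t in at_top. (\<forall>l\<ge>1. cmod (Th K \<eta> t (int l) - L (int l)) \<le> 1280 * A * dq 1 l) \<and> (\<forall>l\<le>0. Th K \<eta> t l - L l = 0)"
        using eventually_ge_at_top[of "2 * \<eta>"]
      proof eventually_elim
        case (elim t)
        have "cmod (Th K \<eta> t (int l) - L (int l)) \<le> 1280 * A * dq 1 l" if "1 \<le> l" for l
          using norm_triangle_ineq4[of "Th K \<eta> t (int l)" "L (int l)"] A(3)[OF elim that] Lb[OF that] by linarith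
        then show ?case using Th_support[OF K1] by (simp add: L_def)
      qed
    qed simp
    then show "((\<lambda>t. Xnorm lam (\<lambda>l. th t l - L l)) \<longlongrightarrow> 0) at_top"
      by (rule Lim_transform_eventually) (auto intro!: eventually_mono[OF eventually_ge_at_top[of 0]] simp: eq)
  qed
qed

end

section \<open>Superposition over the frequencies\<close>

context wave_weight begin

lemma Xnorm_scale:
  assumes "in_X lam u"
  shows "in_X lam (\<lambda>l. z * u l)" "Xnorm lam (\<lambda>l. z * u l) = cmod z * Xnorm lam u"
proof -
  have e: "(\<lambda>l. (lam l * cmod (z * u l))\<^sup>2) = (\<lambda>l. (cmod z)\<^sup>2 * (lam l * cmod (u l))\<^sup>2)"
    by (auto simp: norm_mult power_mult_distrib mult_ac)
  show "in_X lam (\<lambda>l. z * u l)" using assms unfolding in_X_def e by (rule summable_on_cmult_right)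
  show "Xnorm lam (\<lambda>l. z * u l) = cmod z * Xnorm lam u" unfolding Xnorm_def e by (simp add: infsum_cmult_right' real_sqrt_mult)
qed

lemma Xnorm_sq: "(Xnorm lam u)\<^sup>2 = (\<Sum>\<^sub>\<infinity>l. (lam l * cmod (u l))\<^sup>2)"
  unfolding Xnorm_def by (simp add: infsum_nonneg)

lemma Xnorm_nonneg: "0 \<le> Xnorm lam u" unfolding Xnorm_def by (simp add: infsum_nonneg)

lemma Xnorm_diff_sq:
  assumes u: "in_X lam u" and v: "in_X lam v"
  shows "(Xnorm lam (\<lambda>l. u l - v l))\<^sup>2 \<le> 2 * (Xnorm lam u)\<^sup>2 + 2 * (Xnorm lam v)\<^sup>2"
proof -
  have s: "(\<lambda>l. 2 * (lam l * cmod (u l))\<^sup>2) summable_on UNIV" "(\<lambda>l. 2 * (lam l * cmod (v l))\<^sup>2) summable_on UNIV"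
    using u v unfolding in_X_def by (auto intro: summable_on_cmult_right)
  have "(\<Sum>\<^sub>\<infinity>l. (lam l * cmod (u l - v l))\<^sup>2) \<le> (\<Sum>\<^sub>\<infinity>l. 2 * (lam l * cmod (u l))\<^sup>2 + 2 * (lam l * cmod (v l))\<^sup>2)"
  proof (rule infsum_mono)
    show "(\<lambda>l. (lam l * cmod (u l - v l))\<^sup>2) summable_on UNIV" using in_X_diff[OF u v] by (simp add: in_X_def)
    show "(\<lambda>l. 2 * (lam l * cmod (u l))\<^sup>2 + 2 * (lam l * cmod (v l))\<^sup>2) summable_on UNIV" by (intro summable_on_add s)
    fix l
    have "lam l * cmod (u l - v l) \<le> lam l * cmod (u l) + lam l * cmod (v l)"
      using lam_pos[of l] norm_triangle_ineq4[of "u l" "v l"] by (simp flip: distrib_left)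
    then have "(lam l * cmod (u l - v l))\<^sup>2 \<le> (lam l * cmod (u l) + lam l * cmod (v l))\<^sup>2"
      using lam_pos[of l] by (intro power_mono) auto
    also have "\<dots> \<le> 2 * (lam l * cmod (u l))\<^sup>2 + 2 * (lam l * cmod (v l))\<^sup>2"
      using zero_le_power2[of "lam l * cmod (u l) - lam l * cmod (v l)"] by (simp add: power2_eq_square algebra_simps)
    finally show "(lam l * cmod (u l - v l))\<^sup>2 \<le> 2 * (lam l * cmod (u l))\<^sup>2 + 2 * (lam l * cmod (v l))\<^sup>2" .
  qed
  also have "\<dots> = 2 * (\<Sum>\<^sub>\<infinity>l. (lam l * cmod (u l))\<^sup>2) + 2 * (\<Sum>\<^sub>\<infinity>l. (lam l * cmod (v l))\<^sup>2)"
    by (simp add: infsum_add[OF s] infsum_cmult_right')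
  finally show ?thesis unfolding Xnorm_sq .
qed

lemma wave_ivp_scale:
  assumes "wave_ivp nu c f lam \<eta> th0 G0 th G"
  shows "wave_ivp nu c f lam \<eta> (\<lambda>l. z * th0 l) (\<lambda>l. z * G0 l) (\<lambda>t l. z * th t l) (\<lambda>t l. z * G t l)"
proof -
  have X: "in_X lam (th t)" "in_X lam (G t)" "th t 0 = 0" "G t 0 = 0" if "0 \<le> t" for t using assms that by (auto simp: wave_ivp_def)
  have lim: "((\<lambda>t. Xnorm lam (\<lambda>l. z * u t l - z * u s l)) \<longlongrightarrow> 0) (at s within {0..})"
    if s: "0 \<le> s" and u: "\<And>t. 0 \<le> t \<Longrightarrow> in_X lam (u t)" and l: "((\<lambda>t. Xnorm lam (\<lambda>l. u t l - u s l)) \<longlongrightarrow> 0) (at s within {0..})" for u s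
  proof (rule Lim_transform_eventually)
    show "((\<lambda>t. cmod z * Xnorm lam (\<lambda>l. u t l - u s l)) \<longlongrightarrow> 0) (at s within {0..})" using tendsto_mult_right_zero[OF l] by simp
    have "\<forall>\<^sub>F t in at s within {0..}. t \<in> {0..}" by (simp add: eventually_at_filter)
    then show "\<forall>\<^sub>F t in at s within {0..}. cmod z * Xnorm lam (\<lambda>l. u t l - u s l) = Xnorm lam (\<lambda>l. z * u t l - z * u s l)"
    proof eventually_elim
      case (elim t)
      then have "in_X lam (\<lambda>l. u t l - u s l)" using u s by (intro in_X_diff) auto
      from Xnorm_scale(2)[OF this, of z] show ?case by (simp add: right_diff_distrib)
    qed
  qed
  have cz: "coupling c \<eta> (\<lambda>l. z * a l) (\<lambda>l. z * b l) l t = z * coupling c \<eta> a b l t" for a b l t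
    by (simp add: coupling_def algebra_simps)
  have gz: "G_rhs nu c f \<eta> (\<lambda>l. z * a l) (\<lambda>l. z * b l) l t = z * G_rhs nu c f \<eta> a b l t" for a b l t
    unfolding G_rhs_def cz by (simp add: algebra_simps)
  show ?thesis unfolding wave_ivp_def cz gz
  proof (intro conjI allI impI)
    fix t :: real assume t: "0 \<le> t"
    show "in_X lam (\<lambda>l. z * th t l)" "in_X lam (\<lambda>l. z * G t l)" using Xnorm_scale(1) X(1,2)[OF t] by auto
    show "((\<lambda>s. Xnorm lam (\<lambda>l. z * th s l - z * th t l)) \<longlongrightarrow> 0) (at t within {0..})"
      by (rule lim[OF t X(1)]) (use assms t in \<open>auto simp: wave_ivp_def\<close>)
    show "((\<lambda>s. Xnorm lam (\<lambda>l. z * G s l - z * G t l)) \<longlongrightarrow> 0) (at t within {0..})"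
      by (rule lim[OF t X(2)]) (use assms t in \<open>auto simp: wave_ivp_def\<close>)
    fix l :: int assume l: "l \<noteq> 0"
    show "((\<lambda>s. z * th s l) has_vector_derivative z * coupling c \<eta> (th t) (G t) l t) (at t within {0..})"
      "((\<lambda>s. z * G s l) has_vector_derivative z * G_rhs nu c f \<eta> (th t) (G t) l t) (at t within {0..})"
      using assms l t by (auto simp: wave_ivp_def intro!: has_vector_derivative_mult_right)
  qed (use assms X in \<open>auto simp: wave_ivp_def\<close>)
qed

text \<open>The maximum with 1 keeps the starting mode positive at every frequency, also where the
  amplitude will be 0.\<close>

definition Km :: "real \<Rightarrow> nat" where "Km \<eta> = max 1 (nat \<lfloor>(1/10) * root 3 (c * \<eta> * pi / 2)\<rfloor>)"
text \<open>The limit is taken along integer times so that it is measurable in eta.\<close>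

definition LL :: "real \<Rightarrow> int \<Rightarrow> complex" where "LL \<eta> l = lim (\<lambda>n. Th (Km \<eta>) \<eta> (real n) l)"

lemma Km_ge: "1 \<le> Km \<eta>" by (simp add: Km_def)

lemma LL_support: "l \<le> 0 \<Longrightarrow> LL \<eta> l = 0"
  using Th_support[OF Km_ge] by (simp add: LL_def)

lemma measurable_Km: "Km \<in> measurable lborel (count_space UNIV)"
proof -
  have [measurable]: "(\<lambda>\<eta>. \<lfloor>(1/10) * root 3 (c * \<eta> * pi / 2)\<rfloor>) \<in> measurable borel (count_space UNIV)" by measurable
  have "(\<lambda>\<eta>. max 1 (nat \<lfloor>(1/10) * root 3 (c * \<eta> * pi / 2)\<rfloor>)) \<in> measurable borel (count_space UNIV)" by measurable
  then show ?thesis unfolding Km_def[abs_def] by simp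
qed

lemma measurable_Th: assumes "0 \<le> t" shows "(\<lambda>\<eta>. Th (Km \<eta>) \<eta> t l) \<in> borel_measurable lborel"
  by (rule measurable_compose_countable[OF _ measurable_Km]) (unfold Th_def, rule ls.measurable_sol[OF assms])

lemma measurable_LL: "(\<lambda>\<eta>. LL \<eta> l) \<in> borel_measurable lborel"
  unfolding LL_def by (intro borel_measurable_lim_metric measurable_Th) simp

text \<open>Everything is expressed through mode 2 of the limit, which lies between 5/4 A and 160 A;
  this gives 128 as the quotient, and 2048 * 5/4 = 2 * 640 * 2 with lam(1) <= 2 lam(2).\<close>

lemma limit_profile:
  assumes eta: "0 < \<eta>" and x: "1000 < root 3 (c * \<eta>)"
  shows "0 < cmod (LL \<eta> 2)"
    "2 * \<eta> \<le> t \<Longrightarrow> cmod (LL \<eta> 2) / 128 \<le> cmod (Th (Km \<eta>) \<eta> t 2)"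
    "0 \<le> t \<Longrightarrow> Xnorm lam (Th (Km \<eta>) \<eta> t) \<le> 2048 * (lam 2 * cmod (LL \<eta> 2))"
    "in_X lam (LL \<eta>)" "Xnorm lam (LL \<eta>) \<le> 2048 * (lam 2 * cmod (LL \<eta> 2))"
    "lam (int (Km \<eta>)) * exp (root 3 (c * \<eta>)) \<le> lam 2 * cmod (LL \<eta> 2)"
    "((\<lambda>t. Xnorm lam (\<lambda>l. Th (Km \<eta>) \<eta> t l - LL \<eta> l)) \<longlongrightarrow> 0) at_top"
proof -
  define K where "K = nat \<lfloor>(1/10) * root 3 (c * \<eta> * pi / 2)\<rfloor>"
  note fm = floor_mode[OF x K_def]
  have KK: "Km \<eta> = K" using fm(1) by (simp add: Km_def K_def)
  have K1: "1 \<le> K" using fm(1) by simp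
  obtain A where A: "0 < A" "\<And>t. 2 * \<eta> \<le> t \<Longrightarrow> 5 / 4 * A \<le> cmod (Th K \<eta> t 2)"
    "\<And>t l. 2 * \<eta> \<le> t \<Longrightarrow> 1 \<le> l \<Longrightarrow> cmod (Th K \<eta> t (int l)) \<le> 640 * A * dq 1 l \<and> cmod (Gs K \<eta> t (int l)) \<le> 648 * A * dq 1 l"
    "\<And>t. 0 \<le> t \<Longrightarrow> \<exists>k\<in>{1..K}. \<forall>l\<ge>1. cmod (Th K \<eta> t (int l)) \<le> 640 * A / 2 ^ (k - 1) * dq k l"
    "\<And>l. 1 \<le> l \<Longrightarrow> \<exists>L. ((\<lambda>t. Th K \<eta> t (int l)) \<longlongrightarrow> L) at_top"
    "exp (root 3 (c * \<eta>)) * 2 ^ K \<le> 5 / 4 * A"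
    using Th_main[OF eta x K_def] by metis
  have lim: "((\<lambda>t. Th K \<eta> t (int l)) \<longlongrightarrow> LL \<eta> (int l)) at_top" if "1 \<le> l" for l
  proof -
    obtain L where L: "((\<lambda>t. Th K \<eta> t (int l)) \<longlongrightarrow> L) at_top" using A(5)[OF \<open>1 \<le> l\<close>] by blast
    then have "(\<lambda>n. Th K \<eta> (real n) (int l)) \<longlonglongrightarrow> L" by (rule filterlim_compose[OF _ filterlim_real_sequentially])
    then show ?thesis using L limI by (auto simp: LL_def KK)
  qed
  have Lb: "cmod (LL \<eta> (int l)) \<le> 640 * A * dq 1 l" if "1 \<le> l" for l
  proof (rule tendsto_upperbound[OF tendsto_norm[OF lim[OF that]]])
    show "\<forall>\<^sub>F t in at_top. cmod (Th K \<eta> t (int l)) \<le> 640 * A * dq 1 l"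
      using eventually_ge_at_top[of "2 * \<eta>"] by eventually_elim (use A(3)[OF _ that] in blast)
  qed simp
  have L2: "cmod (LL \<eta> 2) \<le> 160 * A" using Lb[of 2] by (simp add: dq_def)
  have L2': "5 / 4 * A \<le> cmod (LL \<eta> 2)"
  proof (rule tendsto_lowerbound)
    show "((\<lambda>t. cmod (Th K \<eta> t 2)) \<longlongrightarrow> cmod (LL \<eta> 2)) at_top" using tendsto_norm[OF lim[of 2]] by simp
    show "\<forall>\<^sub>F t in at_top. 5 / 4 * A \<le> cmod (Th K \<eta> t 2)"
      using eventually_ge_at_top[of "2 * \<eta>"] by eventually_elim (rule A(2))
  qed simp
  show "0 < cmod (LL \<eta> 2)" using L2' A(1) by linarith
  show "2 * \<eta> \<le> t \<Longrightarrow> cmod (LL \<eta> 2) / 128 \<le> cmod (Th (Km \<eta>) \<eta> t 2)" using A(2)[of t] L2 unfolding KK by linarith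
  have lam12: "lam (int 1) \<le> 2 * lam 2" using lam_dist[of 1 2] by simp
  have fin: "2 * (640 * A) * lam (int 1) \<le> 2048 * (lam 2 * cmod (LL \<eta> 2))"
  proof -
    have "2 * (640 * A) * lam (int 1) \<le> 2 * (640 * A) * (2 * lam 2)" using lam12 A(1) by (intro mult_left_mono) auto
    also have "\<dots> = 2048 * (lam 2 * (5 / 4 * A))" by simp
    also have "\<dots> \<le> 2048 * (lam 2 * cmod (LL \<eta> 2))" using L2' lam_pos[of 2] by (intro mult_left_mono) auto
    finally show ?thesis .
  qed
  show "Xnorm lam (Th (Km \<eta>) \<eta> t) \<le> 2048 * (lam 2 * cmod (LL \<eta> 2))" if t: "0 \<le> t"
  proof -
    obtain k where k: "1 \<le> k" "\<And>l. 1 \<le> l \<Longrightarrow> cmod (Th K \<eta> t (int l)) \<le> 640 * A / 2 ^ (k - 1) * dq k l" using A(4)[OF t] by auto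
    have "Xnorm lam (Th K \<eta> t) \<le> 2 * (640 * A / 2 ^ (k - 1)) * lam (int k)"
      by (rule X_bound) (use k A(1) Th_support[OF K1] in auto)
    also have "\<dots> \<le> 2 * (640 * A / 2 ^ (k - 1)) * (2 ^ (k - 1) * lam (int 1))"
      using lam_dist[of k 1] k(1) A(1) by (intro mult_left_mono) auto
    also have "\<dots> = 2 * (640 * A) * lam (int 1)" by simp
    finally show ?thesis using fin unfolding KK by linarith
  qed
  show "in_X lam (LL \<eta>)" by (rule Xnorm_suminf(1)[OF Lb]) (auto simp: LL_support)
  have "Xnorm lam (LL \<eta>) \<le> 2 * (640 * A) * lam (int 1)" by (rule X_bound) (use Lb A(1) in \<open>auto simp: LL_support\<close>)
  then show "Xnorm lam (LL \<eta>) \<le> 2048 * (lam 2 * cmod (LL \<eta> 2))" using fin by linarith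
  have "lam (int K) \<le> 2 ^ ((K - 2) + (2 - K)) * lam (int 2)" by (rule lam_dist)
  also have "\<dots> \<le> 2 ^ K * lam 2" using fm(1) lam_pos[of 2] by (auto intro!: mult_right_mono power_increasing)
  finally have "lam (int K) * exp (root 3 (c * \<eta>)) \<le> 2 ^ K * lam 2 * exp (root 3 (c * \<eta>))" by (intro mult_right_mono) auto
  also have "\<dots> = lam 2 * (exp (root 3 (c * \<eta>)) * 2 ^ K)" by simp
  also have "\<dots> \<le> lam 2 * cmod (LL \<eta> 2)" using A(6) L2' lam_pos[of 2] by (intro mult_left_mono) auto
  finally show "lam (int (Km \<eta>)) * exp (root 3 (c * \<eta>)) \<le> lam 2 * cmod (LL \<eta> 2)" unfolding KK .
  show "((\<lambda>t. Xnorm lam (\<lambda>l. Th (Km \<eta>) \<eta> t l - LL \<eta> l)) \<longlongrightarrow> 0) at_top" unfolding KK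
  proof (rule X_tendsto[where C = "1280 * A" and k = 1])
    show "((\<lambda>t. Th K \<eta> t (int l) - LL \<eta> (int l)) \<longlongrightarrow> 0) at_top" if "1 \<le> l" for l using lim[OF that] by (simp add: LIM_zero_iff)
    show "\<forall>\<^sub>F t in at_top. (\<forall>l\<ge>1. cmod (Th K \<eta> t (int l) - LL \<eta> (int l)) \<le> 1280 * A * dq 1 l) \<and> (\<forall>l\<le>0. Th K \<eta> t l - LL \<eta> l = 0)"
      using eventually_ge_at_top[of "2 * \<eta>"]
    proof eventually_elim
      case (elim t)
      have "cmod (Th K \<eta> t (int l) - LL \<eta> (int l)) \<le> 1280 * A * dq 1 l" if "1 \<le> l" for l
        using norm_triangle_ineq4[of "Th K \<eta> t (int l)" "LL \<eta> (int l)"] A(3)[OF elim that] Lb[OF that] by linarith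
      then show ?case using Th_support[OF K1] by (simp add: LL_support)
    qed
  qed simp
qed

end

lemma tail_integral_finite:
  fixes a E C :: real
  assumes a: "a < - 1 / 2" and E: "1 \<le> E" and h: "\<And>x. h x \<le> (if E \<le> x then C * (1 + x\<^sup>2) powr a else 0)"
  shows "(\<integral>\<^sup>+ x. ennreal (h x) \<partial>lborel) < \<infinity>"
proof -
  have b: "2 * a + 1 < 0" using a by simp
  have fin: "(\<integral>\<^sup>+ x. ennreal (x powr (2 * a)) * indicator {E..} x \<partial>lborel) = ennreal (0 - E powr (2 * a + 1) / (2 * a + 1))"
  proof (rule nn_integral_FTC_atLeast)
    show "((\<lambda>x. x powr (2 * a + 1) / (2 * a + 1)) has_real_derivative x powr (2 * a)) (at x)" if "E \<le> x" for x
      using DERIV_cdivide[OF has_real_derivative_powr[of x "2 * a + 1"], of "2 * a + 1"] that E b by simp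
    have "((\<lambda>x. x powr (2 * a + 1)) \<longlongrightarrow> 0) at_top" by (rule tendsto_neg_powr[OF b filterlim_ident])
    from tendsto_divide[OF this tendsto_const, of "2 * a + 1"] b
    show "((\<lambda>x. x powr (2 * a + 1) / (2 * a + 1)) \<longlongrightarrow> 0) at_top" by simp
  qed auto
  have "(\<integral>\<^sup>+ x. ennreal (h x) \<partial>lborel) \<le> (\<integral>\<^sup>+ x. ennreal \<bar>C\<bar> * (ennreal (x powr (2 * a)) * indicator {E..} x) \<partial>lborel)"
  proof (rule nn_integral_mono)
    fix x
    show "ennreal (h x) \<le> ennreal \<bar>C\<bar> * (ennreal (x powr (2 * a)) * indicator {E..} x)"
    proof (cases "E \<le> x")
      case True
      have "(1 + x\<^sup>2) powr a \<le> (x\<^sup>2) powr a" using True E a by (intro powr_mono2') auto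
      also have "(x\<^sup>2) powr a = x powr (2 * a)" using True E powr_powr[of x 2 a] by (simp add: powr_numeral)
      finally have "\<bar>C\<bar> * (1 + x\<^sup>2) powr a \<le> \<bar>C\<bar> * x powr (2 * a)" by (intro mult_left_mono) auto
      moreover have "C * (1 + x\<^sup>2) powr a \<le> \<bar>C\<bar> * (1 + x\<^sup>2) powr a" by (intro mult_right_mono) auto
      ultimately have "h x \<le> \<bar>C\<bar> * x powr (2 * a)" using h[of x] True by simp
      then show ?thesis using True by (simp add: ennreal_mult'[symmetric] ennreal_leI)
    next
      case False
      then show ?thesis using h[of x] by (simp add: ennreal_neg)
    qed
  qed
  also have "\<dots> = ennreal \<bar>C\<bar> * ennreal (0 - E powr (2 * a + 1) / (2 * a + 1))" unfolding fin[symmetric] by (rule nn_integral_cmult) measurable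
  also have "\<dots> < \<infinity>" by (simp add: ennreal_mult_less_top)
  finally show ?thesis .
qed

section \<open>Data on the borderline of the Sobolev scale\<close>

context wave_weight begin

lemma measurable_Xnorm:
  assumes m: "\<And>l. (\<lambda>\<eta>. u \<eta> l) \<in> borel_measurable lborel" and X: "\<And>\<eta>. in_X lam (u \<eta>)" and s: "\<And>\<eta> l. l < 0 \<Longrightarrow> u \<eta> l = 0"
  shows "(\<lambda>\<eta>. Xnorm lam (u \<eta>)) \<in> borel_measurable lborel"
proof -
  have "Xnorm lam (u \<eta>) = sqrt (\<Sum>n. (lam (int n) * cmod (u \<eta> (int n)))\<^sup>2)" for \<eta>
  proof -
    let ?g = "\<lambda>l. (lam l * cmod (u \<eta> l))\<^sup>2"
    have g: "?g summable_on UNIV" using X[of \<eta>] by (simp add: in_X_def)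
    then have "?g summable_on range int" by (rule summable_on_subset_banach) simp
    then have "(?g \<circ> int) summable_on UNIV" by (subst (asm) summable_on_reindex) auto
    then have "(?g \<circ> int) sums (infsum (?g \<circ> int) UNIV)" by (intro has_sum_imp_sums has_sum_infsum)
    then have "(\<Sum>n. ?g (int n)) = infsum (?g \<circ> int) UNIV" by (simp add: sums_iff o_def)
    also have "\<dots> = infsum ?g (range int)" by (subst infsum_reindex) auto
    also have "\<dots> = infsum ?g UNIV"
    proof (rule infsum_cong_neutral)
      show "?g l = 0" if "l \<in> UNIV - range int" for l
      proof -
        have "l < 0" using that by (metis DiffD2 nonneg_int_cases not_less rangeI)
        then show ?thesis using s by simp
      qed
    qed auto
    finally show ?thesis by (simp add: Xnorm_def)
  qed
  moreover have "(\<lambda>\<eta>. sqrt (\<Sum>n. (lam (int n) * cmod (u \<eta> (int n)))\<^sup>2)) \<in> borel_measurable lborel"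
    using m by measurable
  ultimately show ?thesis by simp
qed

text \<open>Normalised so that the weighted mode 2 of the limit has square (1 + eta^2)^(-sigma -
  1/2). In H^s this leaves the power s - sigma - 1/2 of 1 + eta^2, integrable at infinity exactly
  for s < sigma.\<close>

definition ampl :: "real \<Rightarrow> real \<Rightarrow> real \<Rightarrow> real" where
  "ampl \<sigma> E \<eta> = (if E \<le> \<eta> then (1 + \<eta>\<^sup>2) powr (- \<sigma> / 2 - 1 / 4) / (lam 2 * cmod (LL \<eta> 2)) else 0)"

lemma ampl_nonneg: "0 \<le> ampl \<sigma> E \<eta>"
  using lam_pos[of 2] by (auto simp: ampl_def)

lemma measurable_ampl: "ampl \<sigma> E \<in> borel_measurable lborel"
  unfolding ampl_def[abs_def] using measurable_LL[of 2] by measurable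

context
  fixes \<sigma> E :: real
  assumes E1: "1 \<le> E" and E2: "\<And>\<eta>. E \<le> \<eta> \<Longrightarrow> 1000 < root 3 (c * \<eta>)"
begin

lemma E_pos: "E \<le> \<eta> \<Longrightarrow> 0 < \<eta>" using E1 by linarith

lemma ampl_sq:
  assumes "E \<le> \<eta>"
  shows "(ampl \<sigma> E \<eta> * (lam 2 * cmod (LL \<eta> 2)))\<^sup>2 = (1 + \<eta>\<^sup>2) powr (- \<sigma> - 1 / 2)"
proof -
  have "ampl \<sigma> E \<eta> * (lam 2 * cmod (LL \<eta> 2)) = (1 + \<eta>\<^sup>2) powr (- \<sigma> / 2 - 1 / 4)"
    using assms lam_pos[of 2] limit_profile(1)[OF E_pos[OF assms] E2[OF assms]] by (simp add: ampl_def)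
  then show ?thesis by (simp add: power2_eq_square powr_add[symmetric])
qed

lemma ampl_bound:
  assumes u: "E \<le> \<eta> \<Longrightarrow> Xnorm lam u \<le> 2048 * (lam 2 * cmod (LL \<eta> 2))"
  shows "(1 + \<eta>\<^sup>2) powr s * (ampl \<sigma> E \<eta> * Xnorm lam u)\<^sup>2 \<le> (if E \<le> \<eta> then 4194304 * (1 + \<eta>\<^sup>2) powr (s - \<sigma> - 1 / 2) else 0)"
proof (cases "E \<le> \<eta>")
  case True
  have "(ampl \<sigma> E \<eta> * Xnorm lam u)\<^sup>2 \<le> (ampl \<sigma> E \<eta> * (2048 * (lam 2 * cmod (LL \<eta> 2))))\<^sup>2"
    using u[OF True] ampl_nonneg[of \<sigma> E \<eta>] Xnorm_nonneg[of u] by (intro power_mono mult_left_mono) auto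
  also have "\<dots> = 2048\<^sup>2 * (ampl \<sigma> E \<eta> * (lam 2 * cmod (LL \<eta> 2)))\<^sup>2" unfolding power_mult_distrib[symmetric] by (simp add: mult_ac)
  also have "\<dots> = 4194304 * (1 + \<eta>\<^sup>2) powr (- \<sigma> - 1 / 2)" unfolding ampl_sq[OF True] by simp
  finally have "(1 + \<eta>\<^sup>2) powr s * (ampl \<sigma> E \<eta> * Xnorm lam u)\<^sup>2 \<le> (1 + \<eta>\<^sup>2) powr s * (4194304 * (1 + \<eta>\<^sup>2) powr (- \<sigma> - 1 / 2))"
    by (intro mult_left_mono) auto
  also have "\<dots> = 4194304 * ((1 + \<eta>\<^sup>2) powr s * (1 + \<eta>\<^sup>2) powr (- \<sigma> - 1 / 2))" by (simp only: mult_ac)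
  also have "\<dots> = 4194304 * (1 + \<eta>\<^sup>2) powr (s - \<sigma> - 1 / 2)" unfolding powr_add[symmetric] by (simp add: algebra_simps)
  finally show ?thesis using True by simp
qed (simp add: ampl_def)

definition UU :: "real \<Rightarrow> real \<Rightarrow> int \<Rightarrow> complex" where "UU t \<eta> l = of_real (ampl \<sigma> E \<eta>) * Th (Km \<eta>) \<eta> t l"
definition VV :: "real \<Rightarrow> int \<Rightarrow> complex" where "VV \<eta> l = of_real (ampl \<sigma> E \<eta>) * LL \<eta> l"

lemma Th_in_X: "0 \<le> t \<Longrightarrow> in_X lam (Th (Km \<eta>) \<eta> t)"
  using Th_wave_ivp[OF Km_ge, of \<eta>] by (auto simp: wave_ivp_def)

lemma UU_in_X: "0 \<le> t \<Longrightarrow> in_X lam (UU t \<eta>)" "0 \<le> t \<Longrightarrow> Xnorm lam (UU t \<eta>) = ampl \<sigma> E \<eta> * Xnorm lam (Th (Km \<eta>) \<eta> t)"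
  unfolding UU_def[abs_def] using Xnorm_scale[OF Th_in_X, of t "of_real (ampl \<sigma> E \<eta>)" \<eta>] ampl_nonneg by auto

lemma VV_in_X: "in_X lam (VV \<eta>)"
proof (cases "E \<le> \<eta>")
  case True
  then show ?thesis unfolding VV_def[abs_def] using Xnorm_scale(1)[OF limit_profile(4)[OF E_pos E2]] by blast
next
  case False
  then show ?thesis by (simp add: VV_def[abs_def] ampl_def in_X_def)
qed

lemma UU_bound:
  assumes "0 \<le> t"
  shows "(1 + \<eta>\<^sup>2) powr s * (Xnorm lam (UU t \<eta>))\<^sup>2 \<le> (if E \<le> \<eta> then 4194304 * (1 + \<eta>\<^sup>2) powr (s - \<sigma> - 1 / 2) else 0)"
  unfolding UU_in_X(2)[OF assms] by (rule ampl_bound) (use limit_profile(3)[OF E_pos E2] assms in blast)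

lemma VV_bound:
  "(1 + \<eta>\<^sup>2) powr s * (Xnorm lam (VV \<eta>))\<^sup>2 \<le> (if E \<le> \<eta> then 4194304 * (1 + \<eta>\<^sup>2) powr (s - \<sigma> - 1 / 2) else 0)"
proof (cases "E \<le> \<eta>")
  case True
  have "Xnorm lam (VV \<eta>) = ampl \<sigma> E \<eta> * Xnorm lam (LL \<eta>)" unfolding VV_def[abs_def]
    using Xnorm_scale(2)[OF limit_profile(4)[OF E_pos[OF True] E2[OF True]]] ampl_nonneg by simp
  then show ?thesis using ampl_bound[of \<eta> "LL \<eta>" s] limit_profile(5)[OF E_pos E2] by simp
next
  case False
  then show ?thesis by (simp add: VV_def[abs_def] ampl_def Xnorm_def)
qed

lemma measurable_UU: "0 \<le> t \<Longrightarrow> (\<lambda>\<eta>. UU t \<eta> l) \<in> borel_measurable lborel"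
  unfolding UU_def using measurable_ampl[of \<sigma> E] measurable_Th[of t l] by measurable

lemma measurable_VV: "(\<lambda>\<eta>. VV \<eta> l) \<in> borel_measurable lborel"
  unfolding VV_def using measurable_ampl[of \<sigma> E] measurable_LL[of l] by measurable

text \<open>Dominated convergence in eta: the bound valid at all times dominates, and at each
  frequency the solution converges in X.\<close>

lemma superposition_converges:
  assumes s: "s < \<sigma>" and th: "\<And>t \<eta>. 0 \<le> t \<Longrightarrow> th t \<eta> = UU t \<eta>"
  shows "HsX_convergent lam s th"
proof -
  have a: "s - \<sigma> - 1 / 2 < - 1 / 2" using s by simp
  \<comment> \<open>16777216 = (2 + 2) * 2048^2, from the square of a difference and the two profile
    bounds.\<close>
  define w where "w \<eta> = (if E \<le> \<eta> then 16777216 * (1 + \<eta>\<^sup>2) powr (s - \<sigma> - 1 / 2) else 0)" for \<eta>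
  \<comment> \<open>The time is cut off at 0 so that membership in X and measurability hold for
    every real t.\<close>
  define D where "D t \<eta> = (1 + \<eta>\<^sup>2) powr s * (Xnorm lam (\<lambda>l. UU (max t 0) \<eta> l - VV \<eta> l))\<^sup>2" for t \<eta>
  have Xd: "in_X lam (\<lambda>l. UU (max t 0) \<eta> l - VV \<eta> l)" for t \<eta> by (intro in_X_diff UU_in_X VV_in_X) simp
  have Dw: "D t \<eta> \<le> w \<eta>" for t \<eta>
  proof -
    have "D t \<eta> \<le> (1 + \<eta>\<^sup>2) powr s * (2 * (Xnorm lam (UU (max t 0) \<eta>))\<^sup>2 + 2 * (Xnorm lam (VV \<eta>))\<^sup>2)"
      unfolding D_def by (intro mult_left_mono Xnorm_diff_sq UU_in_X VV_in_X) auto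
    then show ?thesis using UU_bound[of "max t 0" \<eta> s] VV_bound[of \<eta> s] by (simp add: w_def algebra_simps split: if_splits)
  qed
  have Dm: "(\<lambda>\<eta>. ennreal (D t \<eta>)) \<in> borel_measurable lborel" for t
  proof -
    have "(\<lambda>\<eta>. Xnorm lam (\<lambda>l. UU (max t 0) \<eta> l - VV \<eta> l)) \<in> borel_measurable lborel"
    proof (rule measurable_Xnorm[OF _ Xd])
      show "(\<lambda>\<eta>. UU (max t 0) \<eta> l - VV \<eta> l) \<in> borel_measurable lborel" for l
        using measurable_UU[of "max t 0" l] measurable_VV[of l] by measurable
      show "UU (max t 0) \<eta> l - VV \<eta> l = 0" if "l < 0" for \<eta> l
        using that Th_support(1)[OF Km_ge, of l] by (simp add: UU_def VV_def LL_support)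
    qed
    then show ?thesis unfolding D_def by measurable
  qed
  have Dlim: "((\<lambda>t. D t \<eta>) \<longlongrightarrow> 0) at_top" for \<eta>
  proof (cases "E \<le> \<eta>")
    case True
    have "((\<lambda>t. (1 + \<eta>\<^sup>2) powr s * (ampl \<sigma> E \<eta> * Xnorm lam (\<lambda>l. Th (Km \<eta>) \<eta> t l - LL \<eta> l))\<^sup>2) \<longlongrightarrow> (1 + \<eta>\<^sup>2) powr s * (ampl \<sigma> E \<eta> * 0)\<^sup>2) at_top"
      by (intro tendsto_intros limit_profile(7)[OF E_pos[OF True] E2[OF True]])
    moreover have "\<forall>\<^sub>F t in at_top. (1 + \<eta>\<^sup>2) powr s * (ampl \<sigma> E \<eta> * Xnorm lam (\<lambda>l. Th (Km \<eta>) \<eta> t l - LL \<eta> l))\<^sup>2 = D t \<eta>"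
      using eventually_ge_at_top[of 0]
    proof eventually_elim
      case (elim t)
      have "in_X lam (\<lambda>l. Th (Km \<eta>) \<eta> t l - LL \<eta> l)"
        by (rule in_X_diff[OF Th_in_X[OF elim] limit_profile(4)[OF E_pos[OF True] E2[OF True]]])
      from Xnorm_scale(2)[OF this, of "of_real (ampl \<sigma> E \<eta>)"]
      have "Xnorm lam (\<lambda>l. UU t \<eta> l - VV \<eta> l) = ampl \<sigma> E \<eta> * Xnorm lam (\<lambda>l. Th (Km \<eta>) \<eta> t l - LL \<eta> l)"
        using ampl_nonneg by (simp add: UU_def VV_def right_diff_distrib)
      then show ?case using elim by (simp add: D_def max_def)
    qed
    ultimately show ?thesis by (auto elim: Lim_transform_eventually)
  next
    case False
    have "0 \<le> D t \<eta>" for t by (simp add: D_def)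
    then have "D t \<eta> = 0" for t using Dw[of t \<eta>] False by (simp add: w_def order_antisym)
    then show ?thesis by simp
  qed
  have lim: "((\<lambda>t. \<integral>\<^sup>+ \<eta>. ennreal (D t \<eta>) \<partial>lborel) \<longlongrightarrow> 0) at_top"
  proof (rule tendsto_at_topI_sequentially)
    fix X :: "nat \<Rightarrow> real" assume X: "filterlim X at_top sequentially"
    have "(\<lambda>n. \<integral>\<^sup>+ \<eta>. ennreal (D (X n) \<eta>) \<partial>lborel) \<longlonglongrightarrow> (\<integral>\<^sup>+ \<eta>. 0 \<partial>(lborel :: real measure))"
    proof (rule nn_integral_dominated_convergence[where w = "\<lambda>\<eta>. ennreal (w \<eta>)"])
      show "(\<lambda>\<eta>. ennreal (w \<eta>)) \<in> borel_measurable lborel" unfolding w_def by measurable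
      show "AE \<eta> in lborel. ennreal (D (X n) \<eta>) \<le> ennreal (w \<eta>)" for n using Dw by (simp add: ennreal_leI)
      show "(\<integral>\<^sup>+ \<eta>. ennreal (w \<eta>) \<partial>lborel) < \<infinity>"
        by (rule tail_integral_finite[OF a E1, of _ 16777216]) (simp add: w_def)
      have "(\<lambda>n. ennreal (D (X n) \<eta>)) \<longlonglongrightarrow> ennreal 0" for \<eta>
        by (intro tendsto_ennrealI filterlim_compose[OF Dlim X])
      then show "AE \<eta> in lborel. (\<lambda>n. ennreal (D (X n) \<eta>)) \<longlonglongrightarrow> 0" by simp
    qed (use Dm in auto)
    then show "(\<lambda>n. \<integral>\<^sup>+ \<eta>. ennreal (D (X n) \<eta>) \<partial>lborel) \<longlonglongrightarrow> 0" by simp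
  qed
  show ?thesis unfolding HsX_convergent_def
  proof (intro exI[of _ VV] conjI allI)
    show "HsX_sq lam s VV < \<infinity>" unfolding HsX_sq_def by (rule tail_integral_finite[OF a E1 VV_bound])
    show "((\<lambda>t. HsX_sq lam s (\<lambda>\<eta> l. th t \<eta> l - VV \<eta> l)) \<longlongrightarrow> 0) at_top"
      by (rule Lim_transform_eventually[OF lim])
        (auto intro!: eventually_mono[OF eventually_ge_at_top[of 0]] simp: th HsX_sq_def D_def max_def)
  qed (use measurable_VV VV_in_X in auto)
qed

text \<open>At time t all frequencies up to t / 2 are past their last resonance and carry a fixed
  portion of the limit. Their contribution is at least a multiple of the integral of 1 / eta over
  [E, t / 2], which grows like ln t; 32768 is 2 * 128^2.\<close>

lemma superposition_diverges:
  assumes s: "\<sigma> < s" and th: "\<And>t \<eta>. 0 \<le> t \<Longrightarrow> th t \<eta> = UU t \<eta>"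
  shows "((\<lambda>t. HsX_sq lam s (th t)) \<longlongrightarrow> \<infinity>) at_top"
proof -
  have low: "ennreal ((ln (t / 2) - ln E) / 32768) \<le> HsX_sq lam s (th t)" if t: "2 * E \<le> t" for t
  proof -
    have t0: "0 \<le> t" using t E1 by linarith
    have "(\<integral>\<^sup>+ \<eta>. ennreal (1 / 32768 * inverse \<eta>) * indicator {E..t / 2} \<eta> \<partial>lborel) = ennreal (1 / 32768 * ln (t / 2) - 1 / 32768 * ln E)"
    proof (rule nn_integral_FTC_Icc[where F = "\<lambda>\<eta>. 1 / 32768 * ln \<eta>"])
      show "((\<lambda>\<eta>. 1 / 32768 * ln \<eta>) has_real_derivative 1 / 32768 * inverse \<eta>) (at \<eta>)" if "\<eta> \<in> {E..t / 2}" for \<eta>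
        using that by (intro DERIV_cmult DERIV_ln E_pos) simp
      show "0 \<le> 1 / 32768 * inverse \<eta>" if "\<eta> \<in> {E..t / 2}" for \<eta> using E_pos[of \<eta>] that by simp
    qed (use t in auto)
    also have "1 / 32768 * ln (t / 2) - 1 / 32768 * ln E = (ln (t / 2) - ln E) / 32768" by (simp add: diff_divide_distrib)
    finally have "ennreal ((ln (t / 2) - ln E) / 32768) = (\<integral>\<^sup>+ \<eta>. ennreal (1 / 32768 * inverse \<eta>) * indicator {E..t / 2} \<eta> \<partial>lborel)" by simp
    also have "\<dots> \<le> HsX_sq lam s (th t)" unfolding HsX_sq_def
    proof (rule nn_integral_mono)
      fix \<eta>
      show "ennreal (1 / 32768 * inverse \<eta>) * indicator {E..t / 2} \<eta> \<le> ennreal ((1 + \<eta>\<^sup>2) powr s * (Xnorm lam (th t \<eta>))\<^sup>2)"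
      proof (cases "\<eta> \<in> {E..t / 2}")
        case True
        then have e: "E \<le> \<eta>" "2 * \<eta> \<le> t" "1 \<le> \<eta>" using E1 by auto
        have "lam 2 * cmod (LL \<eta> 2) / 128 \<le> lam 2 * cmod (Th (Km \<eta>) \<eta> t 2)"
          using limit_profile(2)[OF E_pos[OF e(1)] E2[OF e(1)] e(2)] lam_pos[of 2] by (simp flip: times_divide_eq_right)
        also have "\<dots> \<le> Xnorm lam (Th (Km \<eta>) \<eta> t)" by (rule coord_le_Xnorm[OF Th_in_X[OF t0]])
        finally have "ampl \<sigma> E \<eta> * (lam 2 * cmod (LL \<eta> 2) / 128) \<le> Xnorm lam (th t \<eta>)"
          unfolding th[OF t0] UU_in_X(2)[OF t0] by (intro mult_left_mono ampl_nonneg)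
        then have "(ampl \<sigma> E \<eta> * (lam 2 * cmod (LL \<eta> 2) / 128))\<^sup>2 \<le> (Xnorm lam (th t \<eta>))\<^sup>2"
          using ampl_nonneg[of \<sigma> E \<eta>] lam_pos[of 2] by (intro power_mono) auto
        moreover have "(ampl \<sigma> E \<eta> * (lam 2 * cmod (LL \<eta> 2) / 128))\<^sup>2 = (1 + \<eta>\<^sup>2) powr (- \<sigma> - 1 / 2) / 16384"
          using ampl_sq[OF e(1)] by (simp add: power_divide)
        ultimately have "(1 + \<eta>\<^sup>2) powr s * ((1 + \<eta>\<^sup>2) powr (- \<sigma> - 1 / 2) / 16384) \<le> (1 + \<eta>\<^sup>2) powr s * (Xnorm lam (th t \<eta>))\<^sup>2"
          by (intro mult_left_mono) auto
        moreover have "(1 + \<eta>\<^sup>2) powr s * (1 + \<eta>\<^sup>2) powr (- \<sigma> - 1 / 2) = (1 + \<eta>\<^sup>2) powr (s - \<sigma> - 1 / 2)"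
          unfolding powr_add[symmetric] by (simp add: algebra_simps)
        moreover have "1 / 2 * inverse \<eta> \<le> (1 + \<eta>\<^sup>2) powr (s - \<sigma> - 1 / 2)"
        proof -
          have "1 + \<eta>\<^sup>2 \<le> (2 * \<eta>)\<^sup>2" using one_le_power[OF e(3), of 2] by (simp only: power_mult_distrib) simp
          then have "((2 * \<eta>)\<^sup>2) powr (- 1 / 2) \<le> (1 + \<eta>\<^sup>2) powr (- 1 / 2)" by (intro powr_mono2') (auto simp: add_pos_nonneg)
          also have "\<dots> \<le> (1 + \<eta>\<^sup>2) powr (s - \<sigma> - 1 / 2)" using s by (intro powr_mono) auto
          also have "((2 * \<eta>)\<^sup>2) powr (- 1 / 2) = inverse (2 * \<eta>)"
            using e(3) powr_powr[of "2 * \<eta>" 2 "- 1 / 2"] by (simp add: powr_numeral powr_minus)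
          finally show ?thesis by simp
        qed
        ultimately have "1 / 32768 * inverse \<eta> \<le> (1 + \<eta>\<^sup>2) powr s * (Xnorm lam (th t \<eta>))\<^sup>2"
          unfolding times_divide_eq_right by linarith
        then show ?thesis using True by (simp add: ennreal_leI)
      qed simp
    qed
    finally show ?thesis .
  qed
  have "filterlim (\<lambda>t. (ln (t / 2) - ln E) / 32768) at_top at_top" by real_asymp
  then have "((\<lambda>t. ennreal ((ln (t / 2) - ln E) / 32768)) \<longlongrightarrow> \<infinity>) at_top" by (simp add: ennreal_tendsto_top_eq_at_top)
  then show ?thesis
    by (rule tendsto_sandwich[OF eventually_mono[OF eventually_ge_at_top[of "2 * E"] low], rotated 2, where h = "\<lambda>_. \<infinity>"]) auto
qed

text \<open>With x the cube root of c eta, the growth bound gives ||th0||^2 <= e^(-2x) (1 +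
  eta^2)^(-sigma - 1/2). One factor e^(-x) is the Gevrey weight, so C' = c^(1/3).\<close>

lemma superposition_solution:
  assumes C: "C = c powr (1 / 3)" and E3: "\<And>\<eta>. E \<le> \<eta> \<Longrightarrow> (1 / 2 - \<sigma>) * ln (1 + \<eta>\<^sup>2) \<le> C * \<eta> powr (1 / 3)"
  defines "th0 \<equiv> \<lambda>\<eta> l. if l = int (Km \<eta>) then complex_of_real (ampl \<sigma> E \<eta>) else 0"
  shows "in_X lam (th0 \<eta>)" "(\<lambda>\<eta>. th0 \<eta> l) \<in> borel_measurable lborel"
    "(\<integral>\<^sup>+ \<eta>. ennreal (exp (C * \<bar>\<eta>\<bar> powr (1 / 3)) * (Xnorm lam (th0 \<eta>))\<^sup>2) \<partial>lborel) < \<infinity>"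
    "\<exists>G. wave_ivp nu c f lam \<eta> (th0 \<eta>) (\<lambda>l. 0) (\<lambda>t. UU t \<eta>) G"
proof -
  show "in_X lam (th0 \<eta>)" unfolding th0_def by (rule Xnorm_delta)
  have "(\<lambda>\<eta>. if l = int (Km \<eta>) then complex_of_real (ampl \<sigma> E \<eta>) else 0) \<in> borel_measurable lborel"
  proof (rule measurable_compose_countable[OF _ measurable_Km])
    show "(\<lambda>\<eta>. if l = int k then complex_of_real (ampl \<sigma> E \<eta>) else 0) \<in> borel_measurable lborel" for k
      using measurable_ampl[of \<sigma> E] by measurable
  qed
  then show "(\<lambda>\<eta>. th0 \<eta> l) \<in> borel_measurable lborel" by (simp add: th0_def)
  show "(\<integral>\<^sup>+ \<eta>. ennreal (exp (C * \<bar>\<eta>\<bar> powr (1 / 3)) * (Xnorm lam (th0 \<eta>))\<^sup>2) \<partial>lborel) < \<infinity>"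
  proof (rule tail_integral_finite[of "-1" E _ 1])
    fix \<eta>
    have n: "Xnorm lam (th0 \<eta>) = lam (int (Km \<eta>)) * ampl \<sigma> E \<eta>" unfolding th0_def Xnorm_delta(2) using ampl_nonneg by simp
    show "exp (C * \<bar>\<eta>\<bar> powr (1 / 3)) * (Xnorm lam (th0 \<eta>))\<^sup>2 \<le> (if E \<le> \<eta> then 1 * (1 + \<eta>\<^sup>2) powr - 1 else 0)"
    proof (cases "E \<le> \<eta>")
      case True
      note e = E_pos[OF True]
      define x where "x = C * \<eta> powr (1 / 3)"
      have x: "root 3 (c * \<eta>) = x" using e c_pos by (simp add: x_def C root_powr_inverse powr_mult)
      have "lam (int (Km \<eta>)) * exp x * ampl \<sigma> E \<eta> \<le> lam 2 * cmod (LL \<eta> 2) * ampl \<sigma> E \<eta>"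
        using limit_profile(6)[OF e E2[OF True]] unfolding x by (intro mult_right_mono ampl_nonneg)
      then have "(lam (int (Km \<eta>)) * exp x * ampl \<sigma> E \<eta>)\<^sup>2 \<le> (lam 2 * cmod (LL \<eta> 2) * ampl \<sigma> E \<eta>)\<^sup>2"
        using lam_pos[of "int (Km \<eta>)"] ampl_nonneg[of \<sigma> E \<eta>] by (intro power_mono) auto
      also have "\<dots> = (1 + \<eta>\<^sup>2) powr (- \<sigma> - 1 / 2)" using ampl_sq[OF True] by (simp only: mult_ac)
      finally have 1: "(Xnorm lam (th0 \<eta>))\<^sup>2 * (exp x)\<^sup>2 \<le> (1 + \<eta>\<^sup>2) powr (- \<sigma> - 1 / 2)"
        unfolding n by (simp add: power_mult_distrib mult_ac)
      \<comment> \<open>The other factor e^(-x) absorbs (1 + eta^2)^(1/2 - sigma) by the choice of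
        E, leaving the integrable (1 + eta^2)^(-1).\<close>
      have "exp x * (Xnorm lam (th0 \<eta>))\<^sup>2 = exp (- x) * ((Xnorm lam (th0 \<eta>))\<^sup>2 * (exp x)\<^sup>2)"
        by (simp add: power2_eq_square exp_minus field_simps)
      also have "\<dots> \<le> exp (- x) * (1 + \<eta>\<^sup>2) powr (- \<sigma> - 1 / 2)" using 1 by (intro mult_left_mono) auto
      also have "\<dots> = exp (- x + (1 / 2 - \<sigma>) * ln (1 + \<eta>\<^sup>2) - ln (1 + \<eta>\<^sup>2))"
        using one_plus_sq(1)[of \<eta>] by (simp add: powr_def mult_exp_exp algebra_simps)
      also have "\<dots> \<le> exp (- 1 * ln (1 + \<eta>\<^sup>2))" using E3[OF True] by (simp add: x_def)
      also have "\<dots> = (1 + \<eta>\<^sup>2) powr - 1" using one_plus_sq(1)[of \<eta>] by (simp add: powr_def)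
      finally show ?thesis using True e by (simp add: x_def)
    next
      case False
      then have "ampl \<sigma> E \<eta> = 0" by (simp add: ampl_def)
      then show ?thesis using False n by simp
    qed
  qed (use E1 in auto)
  have i: "(\<lambda>l. complex_of_real (ampl \<sigma> E \<eta>) * (if l = int (Km \<eta>) then 1 else 0)) = th0 \<eta>" by (auto simp: th0_def)
  show "\<exists>G. wave_ivp nu c f lam \<eta> (th0 \<eta>) (\<lambda>l. 0) (\<lambda>t. UU t \<eta>) G"
    using wave_ivp_scale[OF Th_wave_ivp[OF Km_ge], of \<eta> "of_real (ampl \<sigma> E \<eta>)" \<eta>] unfolding i UU_def[abs_def] by auto
qed

end

text \<open>A logarithm grows more slowly than a cube root, whatever the sign of q.\<close>

lemma cutoff_exists:
  assumes C: "0 < C"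
  shows "\<exists>E\<ge>1. \<forall>\<eta>\<ge>E. 1000 < root 3 (c * \<eta>) \<and> q * ln (1 + \<eta>\<^sup>2) \<le> C * \<eta> powr (1 / 3)"
proof -
  have "((\<lambda>\<eta>::real. ln (1 + \<eta>\<^sup>2) / \<eta> powr (1 / 3)) \<longlongrightarrow> 0) at_top" by real_asymp
  moreover have "0 < C / (\<bar>q\<bar> + 1)" using C by simp
  ultimately have "\<forall>\<^sub>F \<eta> in at_top. ln (1 + \<eta>\<^sup>2) / \<eta> powr (1 / 3) < C / (\<bar>q\<bar> + 1)" by (rule order_tendstoD)
  then have "\<forall>\<^sub>F \<eta> in at_top. 1000 < root 3 (c * \<eta>) \<and> q * ln (1 + \<eta>\<^sup>2) \<le> C * \<eta> powr (1 / 3)"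
    using eventually_gt_at_top[of "1000 ^ 3 / c"] eventually_gt_at_top[of 0]
  proof eventually_elim
    case (elim \<eta>)
    have "root 3 (1000 ^ 3) < root 3 (c * \<eta>)" using elim(2) c_pos by (intro real_root_less_mono) (auto simp: field_simps)
    moreover have "root 3 (1000 ^ 3) = (1000::real)" by (rule real_root_power_cancel) auto
    moreover have "q * ln (1 + \<eta>\<^sup>2) \<le> (\<bar>q\<bar> + 1) * ln (1 + \<eta>\<^sup>2)" by (intro mult_right_mono) auto
    moreover have "(\<bar>q\<bar> + 1) * ln (1 + \<eta>\<^sup>2) < C * \<eta> powr (1 / 3)" using elim(1,3) by (simp add: field_simps)
    ultimately show ?case by linarith
  qed
  then obtain E where "\<And>\<eta>. E \<le> \<eta> \<Longrightarrow> 1000 < root 3 (c * \<eta>) \<and> q * ln (1 + \<eta>\<^sup>2) \<le> C * \<eta> powr (1 / 3)"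
    unfolding eventually_at_top_linorder by blast
  then show ?thesis by (intro exI[of _ "max E 1"]) auto
qed

lemma sharp_Sobolev_blowup:
  "\<exists>C'>0. \<exists>th0 :: real \<Rightarrow> int \<Rightarrow> complex.
      (\<forall>\<eta>. in_X lam (th0 \<eta>)) \<and> (\<forall>l. (\<lambda>\<eta>. th0 \<eta> l) \<in> borel_measurable lborel) \<and>
      (\<integral>\<^sup>+ \<eta>. ennreal (exp (C' * \<bar>\<eta>\<bar> powr (1/3)) * (Xnorm lam (th0 \<eta>))\<^sup>2) \<partial>lborel) < \<infinity> \<and>
      (\<forall>\<eta>. \<exists>th G. wave_ivp nu c f lam \<eta> (th0 \<eta>) (\<lambda>l. 0) th G) \<and>
      (\<forall>th G :: real \<Rightarrow> real \<Rightarrow> int \<Rightarrow> complex.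
         (\<forall>\<eta>. wave_ivp nu c f lam \<eta> (th0 \<eta>) (\<lambda>l. 0) (\<lambda>t. th t \<eta>) (\<lambda>t. G t \<eta>)) \<longrightarrow>
         (\<forall>s<\<sigma>. HsX_convergent lam s th) \<and> (\<forall>s>\<sigma>. ((\<lambda>t. HsX_sq lam s (th t)) \<longlongrightarrow> \<infinity>) at_top))"
proof -
  define C where "C = c powr (1 / 3)"
  have C: "0 < C" using c_pos by (simp add: C_def)
  obtain E where E1: "1 \<le> E" and E2: "\<And>\<eta>. E \<le> \<eta> \<Longrightarrow> 1000 < root 3 (c * \<eta>)"
    and E3: "\<And>\<eta>. E \<le> \<eta> \<Longrightarrow> (1 / 2 - \<sigma>) * ln (1 + \<eta>\<^sup>2) \<le> C * \<eta> powr (1 / 3)"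
    using cutoff_exists[OF C, of "1 / 2 - \<sigma>"] by blast
  note sol = superposition_solution[OF E1 E2 C_def E3]
  let ?th0 = "\<lambda>\<eta> l. if l = int (Km \<eta>) then complex_of_real (ampl \<sigma> E \<eta>) else 0"
  have "(\<forall>s<\<sigma>. HsX_convergent lam s th) \<and> (\<forall>s>\<sigma>. ((\<lambda>t. HsX_sq lam s (th t)) \<longlongrightarrow> \<infinity>) at_top)"
    if ivp: "\<And>\<eta>. wave_ivp nu c f lam \<eta> (?th0 \<eta>) (\<lambda>l. 0) (\<lambda>t. th t \<eta>) (\<lambda>t. G t \<eta>)" for th G
  proof -
    have "th t \<eta> = UU \<sigma> E t \<eta>" if "0 \<le> t" for t \<eta>
      using sol(4)[of \<eta>] wave_ivp_unique[OF ivp[of \<eta>] _ that] by blast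
    then show ?thesis using superposition_converges[OF E1 E2] superposition_diverges[OF E1 E2] by blast
  qed
  then show ?thesis using C sol by (intro exI[of _ C] conjI exI[of _ ?th0]) blast+
qed

end

theorem theorem4p1:
  fixes nu c :: real and f :: "real \<Rightarrow> real" and lam :: "int \<Rightarrow> real"
  assumes nu_pos: "nu > 0"
    and c_pos: "0 < c" and c_small: "c < 0.001"
    and f_cont: "continuous_on {0..} f"
    and f_bound: "\<forall>t\<ge>0. \<bar>f t\<bar> \<le> 2 * c / (1 + t\<^sup>2)"
    and lam_pos: "\<forall>l. lam l > 0"
    and lam_ratio: "\<exists>M<2. \<forall>l. lam (l + 1) \<le> M * lam l \<and> lam (l - 1) \<le> M * lam l"
  shows
  "(\<forall>eta>0. root 3 (c * eta) > 1000 * max (nu powr (-1/2)) 1 \<longrightarrow>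
      (let k2 = \<lfloor>(1/10) * root 3 (c * eta * pi / 2)\<rfloor>;
           th0 = (\<lambda>l. if l = k2 then 1 else 0 :: complex)
       in (\<exists>th G. wave_ivp nu c f lam eta th0 (\<lambda>l. 0) th G) \<and>
          (\<forall>th G. wave_ivp nu c f lam eta th0 (\<lambda>l. 0) th G \<longrightarrow>
             (\<forall>t>2 * eta.
                exp (root 3 (c * eta)) * Xnorm lam (th 0) \<le> Xnorm lam (th t) \<and>
                Xnorm lam (th t) \<le> Xnorm lam (th t) + Xnorm lam (G t) \<and>
                Xnorm lam (th t) + Xnorm lam (G t) \<le> exp (50 * root 3 (c * eta)) * Xnorm lam (th 0)) \<and>
             X_convergent lam th)))
   \<and>
   (\<forall>\<sigma>::real. \<exists>C'>0. \<exists>th0 :: real \<Rightarrow> int \<Rightarrow> complex.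
      (\<forall>eta. in_X lam (th0 eta)) \<and>
      (\<forall>l. (\<lambda>eta. th0 eta l) \<in> borel_measurable lborel) \<and>
      (\<integral>\<^sup>+ eta. ennreal (exp (C' * \<bar>eta\<bar> powr (1/3)) * (Xnorm lam (th0 eta))\<^sup>2) \<partial>lborel) < \<infinity> \<and>
      (\<forall>eta. \<exists>th G. wave_ivp nu c f lam eta (th0 eta) (\<lambda>l. 0) th G) \<and>
      (\<forall>th G :: real \<Rightarrow> real \<Rightarrow> int \<Rightarrow> complex.
         (\<forall>eta. wave_ivp nu c f lam eta (th0 eta) (\<lambda>l. 0) (\<lambda>t. th t eta) (\<lambda>t. G t eta)) \<longrightarrow>
         (\<forall>s<\<sigma>. HsX_convergent lam s th) \<and>
         (\<forall>s>\<sigma>. ((\<lambda>t. HsX_sq lam s (th t)) \<longlongrightarrow> \<infinity>) at_top)))"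
proof -
  obtain M where M: "M < 2" "\<And>l. lam (l + 1) \<le> M * lam l" "\<And>l. lam (l - 1) \<le> M * lam l" using lam_ratio by blast
  have M2: "M * lam l \<le> 2 * lam l" for l using M(1) lam_pos by (intro mult_right_mono) (auto simp: less_imp_le)
  interpret wave_weight nu c f lam
  proof
    show "lam (l + 1) \<le> 2 * lam l" "lam (l - 1) \<le> 2 * lam l" for l using M(2,3)[of l] M2[of l] by linarith+
  qed (use nu_pos c_pos c_small f_cont f_bound lam_pos in auto)
  have "let k2 = \<lfloor>(1/10) * root 3 (c * eta * pi / 2)\<rfloor>;
           th0 = (\<lambda>l. if l = k2 then 1 else 0 :: complex)
       in (\<exists>th G. wave_ivp nu c f lam eta th0 (\<lambda>l. 0) th G) \<and>
          (\<forall>th G. wave_ivp nu c f lam eta th0 (\<lambda>l. 0) th G \<longrightarrow>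
             (\<forall>t>2 * eta.
                exp (root 3 (c * eta)) * Xnorm lam (th 0) \<le> Xnorm lam (th t) \<and>
                Xnorm lam (th t) \<le> Xnorm lam (th t) + Xnorm lam (G t) \<and>
                Xnorm lam (th t) + Xnorm lam (G t) \<le> exp (50 * root 3 (c * eta)) * Xnorm lam (th 0)) \<and>
             X_convergent lam th)"
    if eta: "0 < eta" and x: "1000 * max (nu powr (-1/2)) 1 < root 3 (c * eta)" for eta
  proof -
    have x': "1000 < root 3 (c * eta)" using x max.cobounded2[of 1 "nu powr (-1/2)"] by linarith
    define K where "K = nat \<lfloor>(1/10) * root 3 (c * eta * pi / 2)\<rfloor>"
    note fm = floor_mode[OF x' K_def]
    have K1: "1 \<le> K" using fm(1) by simp
    show ?thesis unfolding Let_def fm(5)[symmetric]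
      using Th_wave_ivp[OF K1] single_mode_growth[OF eta x' K_def] Xnorm_nonneg by auto
  qed
  then show ?thesis using sharp_Sobolev_blowup by blast
qed



end
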